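(* Let $\ell$ be an odd prime. Let $\mathcal{M}_\ell$ be the collection of isomorphism classes of metacyclic fields of degree $\ell(\ell-1)$, and for $X>0$ let $N_\ell(X)=\#\{K\in\mathcal{M}_\ell : |\Delta_K|\leq X\}$, where $\Delta_K$ denotes the discriminant of $K$. Then, as $X\to\infty$, $$N_\ell(X)\sim A_\ell\, X^{\frac{1}{(\ell-1)^2}}(\log X)^{\ell-2},$$ where $$A_\ell=a_\ell\prod_{p}\left[\left(1+\frac{\ell-1}{p}\right)\left(1-\frac1p\right)^{\ell-1}\right]$$ (the product being over all primes $p$) and $$a_\ell=\frac{(\ell-1)^{-2(\ell-2)}}{(2\ell-1)(\ell-2)!}\left(2\,\ell^{-\frac{\ell^2-2}{(\ell-1)^2}}+\ell^{-\frac{\ell(\ell-2)}{(\ell-1)^2}}(\ell-1)^{-1}\right).$$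
   Context: For an odd prime $\ell$, a metacyclic field (of degree $\ell(\ell-1)$) is a number field $K$ that is the Galois closure over $\mathbb{Q}$ of a pure field $\mathbb{Q}(\sqrt[\ell]{D})$ of degree $\ell$ over $\mathbb{Q}$, with $D\in\mathbb{Z}$; thus $K=\mathbb{Q}(\sqrt[\ell]{D},\zeta_\ell)$ with $\zeta_\ell$ a primitive $\ell$-th root of unity, and $[K:\mathbb{Q}]=\ell(\ell-1)$. Fields are counted up to isomorphism. The notation $f(X)\sim g(X)$ means $f(X)/g(X)\to 1$ as $X\to\infty$. *)

theory Defs
  imports
    "HOL-Analysis.Infinite_Products"
    "HOL-Library.FuncSet"
    "HOL-Library.Landau_Symbols"
    "HOL-Algebra.Generated_Fields"
    "HOL-Algebra.Embedded_Algebras"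
    "HOL-Algebra.Algebraic_Closure_Type"
    "Jordan_Normal_Form.Determinant"
begin

text \<open>
  Number fields are realised as subfields of the complex numbers; every number field is isomorphic
  to such a subfield, so passing to isomorphism classes below loses nothing.
\<close>

abbreviation complex_ring :: "complex ring"
  where "complex_ring \<equiv> ring_of_type_algebra"

abbreviation field_ring :: "complex set \<Rightarrow> complex ring"
  where "field_ring K \<equiv> complex_ring \<lparr>carrier := K\<rparr>"

definition number_field :: "complex set \<Rightarrow> bool"
  where "number_field K \<longleftrightarrow>
    subfield K complex_ring \<and> ring.finite_dimension complex_ring \<rat> K"

definition field_degree :: "complex set \<Rightarrow> nat"
  where "field_degree K = ring.dim complex_ring \<rat> K"

definition number_field_iso :: "(complex set \<times> complex set) set"
  where "number_field_iso =
    {(K, L). number_field K \<and> number_field L \<and> field_ring K \<simeq> field_ring L}"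


text \<open>
  Embeddings are made extensional so that two of them that agree on \<open>K\<close> are equal; otherwise
  the sum in the trace would range over infinitely many functions.
\<close>

definition embeddings :: "complex set \<Rightarrow> (complex \<Rightarrow> complex) set"
  where "embeddings K = Ring.ring_hom (field_ring K) complex_ring \<inter> extensional K"

definition field_trace :: "complex set \<Rightarrow> complex \<Rightarrow> complex"
  where "field_trace K x = (\<Sum>\<sigma>\<in>embeddings K. \<sigma> x)"

definition ring_of_integers :: "complex set \<Rightarrow> complex set"
  where "ring_of_integers K = {x \<in> K. algebraic_int x}"

definition integral_basis :: "complex set \<Rightarrow> complex list \<Rightarrow> bool"
  where "integral_basis K bs \<longleftrightarrow>
    set bs \<subseteq> ring_of_integers K \<and>
    (\<forall>x\<in>ring_of_integers K. \<exists>!cs :: int list.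
       length cs = length bs \<and> x = (\<Sum>i<length bs. of_int (cs ! i) * bs ! i))"

definition discriminant :: "complex set \<Rightarrow> int"
  where "discriminant K = (THE d. \<exists>bs. integral_basis K bs \<and>
    of_int d = Determinant.det
      (mat (length bs) (length bs) (\<lambda>(i, j). field_trace K (bs ! i * bs ! j))))"


text \<open>
  Separability is automatic in characteristic 0, so a Galois extension of \<open>\<rat>\<close> is an algebraic
  normal one. The complex numbers are algebraically closed, so an irreducible polynomial splits
  over \<open>K\<close> iff all its complex roots lie in \<open>K\<close>.
\<close>

definition galois_over_rat :: "complex set \<Rightarrow> bool"
  where "galois_over_rat K \<longleftrightarrow>
    subfield K complex_ring \<and>
    (\<forall>x\<in>K. Polynomial.algebraic x) \<and>
    (\<forall>p :: rat poly. Factorial_Ring.irreducible p \<longrightarrow>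
       (\<exists>x\<in>K. poly (map_poly of_rat p) x = 0) \<longrightarrow>
       (\<forall>z. poly (map_poly of_rat p) z = 0 \<longrightarrow> z \<in> K))"

definition is_galois_closure :: "complex set \<Rightarrow> complex set \<Rightarrow> bool"
  where "is_galois_closure L K \<longleftrightarrow>
    galois_over_rat K \<and> L \<subseteq> K \<and>
    (\<forall>M. galois_over_rat M \<and> L \<subseteq> M \<longrightarrow> K \<subseteq> M)"

text \<open>The root \<open>\<alpha>\<close> may be any complex \<open>l\<close>-th root of \<open>D\<close>.\<close>

definition pure_field :: "nat \<Rightarrow> complex set \<Rightarrow> bool"
  where "pure_field l L \<longleftrightarrow>
    (\<exists>(D :: int) \<alpha>. \<alpha> ^ l = of_int D \<and> L = generate_field complex_ring {\<alpha>}) \<and>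
    field_degree L = l"

text \<open>
  For an odd prime \<open>l\<close> such a field is \<open>\<rat>(\<alpha>, \<zeta>)\<close> with \<open>\<alpha> ^ l = D\<close> and \<open>\<zeta>\<close> a primitive \<open>l\<close>-th
  root of unity, and its degree over \<open>\<rat>\<close> is \<open>l * (l - 1)\<close>.
\<close>

definition metacyclic_field :: "nat \<Rightarrow> complex set \<Rightarrow> bool"
  where "metacyclic_field l K \<longleftrightarrow>
    number_field K \<and> (\<exists>L. pure_field l L \<and> is_galois_closure L K)"

definition metacyclic_count :: "nat \<Rightarrow> real \<Rightarrow> nat"
  where "metacyclic_count l x =
    card ({K. metacyclic_field l K \<and> real_of_int \<bar>discriminant K\<bar> \<le> x} // number_field_iso)"

definition small_a :: "nat \<Rightarrow> real"
  where "small_a l =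
    (real l - 1) powr (- 2 * (real l - 2)) / ((2 * real l - 1) * fact (l - 2)) *
    (2 * real l powr (- ((real l)\<^sup>2 - 2) / (real l - 1)\<^sup>2) +
     real l powr (- (real l * (real l - 2)) / (real l - 1)\<^sup>2) * inverse (real l - 1))"

definition big_A :: "nat \<Rightarrow> real"
  where "big_A l = small_a l *
    (\<Prod>p. if Factorial_Ring.prime p
          then (1 + (real l - 1) / real p) * (1 - 1 / real p) ^ (l - 1) else 1)"

end

(* Proof idea.  Every metacyclic field is K = Q(n^(1/l), zeta) for an l-th-power-free n > 1, and by
  Kummer theory exactly l - 1 such n give the same field, so it suffices to count radicands.  The
  discriminant is found one prime p at a time: K is spanned over Q(zeta) by the powers of a suitable
  element, and these powers times a basis of the integers of Q(zeta) form a basis of the p-integral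
  elements; their determinant is a twisted Kronecker product of a Vandermonde (Fourier) matrix over
  the Kummer conjugates and one over the conjugates of zeta.  For p = l the generators are the powers
  of (1 - zeta) / (alpha - D) when l^2 does not divide D^l - D, and the means
  (1/l) sum_j (zeta^k alpha / D)^j when D^(l-1) = 1 mod l^2.  This gives |disc K| = l^e r^((l-1)^2),
  where r is the product of the primes p dividing n with p <> l, and e takes one of three values.

  An l-th-power-free n prime to l corresponds to a tuple t_1, ..., t_(l-1) of positive integers with
  squarefree product r via n = prod_j t_j^j.  Tuples with product at most Y, with entries prime to l
  and with n in a fixed unit class mod l^2, are equidistributed among the unit classes because t_1
  alone can be solved for.  Squarefreeness is imposed one prime at a time, which multiplies the
  density by (1 + (l-1)/p) (1 - 1/p)^(l-1); the primes p > z change the count by a relative O(1/z). *)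

theory Submission
  imports
    Defs
    "Jordan_Normal_Form.Char_Poly"
    "HOL-Number_Theory.Number_Theory"
    "HOL-Real_Asymp.Real_Asymp"
begin

hide_const (open) Divisibility.prime

text \<open>Integrality at p is expressed without ideals or valuations: x is p-integral if t x is an
  algebraic integer for some integer t prime to p. The ramification statements rest on one
  Eisenstein-type descent for powers of an element \<pi> whose N-th power is p times a unit. The
  same descent yields the degrees of Q(zeta) and of K, so irreducibility of the cyclotomic
  polynomial and of x^l - D is never proved separately. The descent needs a radicand divisible by p
  exactly once. In general no single radicand has this property at every prime factor of n, so the
  generator is changed with the prime: n^k divided by the l-th power of some p^m generates the same
  field, because k is prime to l. The absolute discriminant is determined by its multiplicities, and
  each of them can be read off from any basis of the p-integral elements, whose determinant differs
  from that of an integral basis by a p-unit factor. In the count, multiplying one entry of a tuple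
  by p moves the unit class of n modulo l^2; the sieve becomes inductive by carrying its statement
  for all unit classes at once.\<close>

abbreviation mdet :: "nat \<Rightarrow> (nat \<Rightarrow> nat \<Rightarrow> complex) \<Rightarrow> complex"
  where "mdet n f \<equiv> det (mat n n (\<lambda>(i, j). f i j))"

section \<open>Algebraic integers through finitely generated stable modules\<close>

definition zspan :: "complex set \<Rightarrow> complex set"
 where "zspan G = {x. \<exists>c :: complex \<Rightarrow> int. x = (\<Sum>g\<in>G. of_int (c g) * g)}"

lemma zspan_add: "x \<in> zspan G \<Longrightarrow> y \<in> zspan G \<Longrightarrow> x + y \<in> zspan G"
proof -
 assume "x \<in> zspan G" "y \<in> zspan G"
 then obtain c d where "x = (\<Sum>g\<in>G. of_int (c g) * g)" "y = (\<Sum>g\<in>G. of_int (d g) * g)"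
  unfolding zspan_def by blast
 hence "x + y = (\<Sum>g\<in>G. of_int (c g + d g) * g)"
  by (simp add: sum.distrib distrib_right)
 thus ?thesis unfolding zspan_def mem_Collect_eq by (rule exI[of _ "\<lambda>g. c g + d g"])
qed

lemma zspan_0: "0 \<in> zspan G"
 unfolding zspan_def mem_Collect_eq by (rule exI[of _ "\<lambda>_. 0"]) simp

lemma zspan_scale: "x \<in> zspan G \<Longrightarrow> of_int k * x \<in> zspan G"
proof -
 assume "x \<in> zspan G"
 then obtain c where "x = (\<Sum>g\<in>G. of_int (c g) * g)"
  unfolding zspan_def by blast
 hence "of_int k * x = (\<Sum>g\<in>G. of_int (k * c g) * g)"
  by (simp add: sum_distrib_left mult.assoc)
 thus ?thesis unfolding zspan_def mem_Collect_eq by (rule exI[of _ "\<lambda>g. k * c g"])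
qed

lemma zspan_sum: "(\<And>i. i \<in> I \<Longrightarrow> f i \<in> zspan G) \<Longrightarrow> (\<Sum>i\<in>I. f i) \<in> zspan G"
 by (induction I rule: infinite_finite_induct) (auto intro: zspan_add zspan_0)

lemma zspan_base: assumes "finite G" "g \<in> G" shows "g \<in> zspan G"
proof -
 have "g = (\<Sum>h\<in>G. of_int (if h = g then 1 else 0) * h)"
  using assms by (simp add: if_distrib[of of_int] if_distrib[of "\<lambda>x. x * _"] sum.delta cong: if_cong)
 thus ?thesis unfolding zspan_def mem_Collect_eq by (rule exI[of _ "\<lambda>h. if h = g then 1 else 0"])
qed

lemma zspan_mult:
 assumes "\<And>g. g \<in> G \<Longrightarrow> z * g \<in> zspan G" "x \<in> zspan G"
 shows "z * x \<in> zspan G"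
proof -
 obtain c where c: "x = (\<Sum>g\<in>G. of_int (c g) * g)"
  using assms(2) unfolding zspan_def by blast
 have "z * x = (\<Sum>g\<in>G. of_int (c g) * (z * g))"
  unfolding c sum_distrib_left by (intro sum.cong) auto
 also have "\<dots> \<in> zspan G" using assms(1) by (intro zspan_sum zspan_scale)
 finally show ?thesis .
qed

text \<open>The integer matrix describing multiplication by \<open>z\<close> on generators of a module has \<open>z\<close> as an
 eigenvalue, so \<open>z\<close> is a root of its characteristic polynomial.\<close>

lemma algebraic_int_if_stable:
 assumes "finite G" "1 \<in> G" "\<And>g. g \<in> G \<Longrightarrow> z * g \<in> zspan G"
 shows "algebraic_int z"
proof -
 obtain gs where gs: "set gs = G" "distinct gs" using finite_distinct_list[OF assms(1)] by blast
 define n where "n = length gs"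
 have "\<forall>g\<in>G. \<exists>c :: complex \<Rightarrow> int. z * g = (\<Sum>h\<in>G. of_int (c h) * h)"
  using assms(3) unfolding zspan_def by blast
 then obtain c :: "complex \<Rightarrow> complex \<Rightarrow> int"
  where c: "\<And>g. g \<in> G \<Longrightarrow> z * g = (\<Sum>h\<in>G. of_int (c g h) * h)"
  by metis
 define A where "A = mat n n (\<lambda>(i, j). c (gs ! i) (gs ! j))"
 have A: "A \<in> carrier_mat n n" by (simp add: A_def)
 define B where "B = map_mat (of_int :: int \<Rightarrow> complex) A"
 have B: "B \<in> carrier_mat n n" using A by (simp add: B_def)
 define v where "v = vec n (\<lambda>i. gs ! i)"
 \<comment> \<open>An eigenvector must be nonzero; the entry 1 of the generating set guarantees
   it.\<close>
 have "v \<noteq> 0\<^sub>v n"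
 proof
  assume "v = 0\<^sub>v n"
  obtain i where i: "i < n" "gs ! i = 1" using assms(2) gs by (metis in_set_conv_nth n_def)
  have "v $ i = 1" using i by (simp add: v_def)
  with \<open>v = 0\<^sub>v n\<close> i show False by simp
 qed
 have "B *\<^sub>v v = z \<cdot>\<^sub>v v"
 proof (rule eq_vecI)
  fix i assume i: "i < dim_vec (z \<cdot>\<^sub>v v)"
  hence i: "i < n" by (simp add: v_def)
  have "(B *\<^sub>v v) $ i = (\<Sum>j<n. of_int (c (gs ! i) (gs ! j)) * gs ! j)"
   using i by (simp add: B_def A_def v_def scalar_prod_def atLeast0LessThan)
  also have "\<dots> = (\<Sum>h\<in>G. of_int (c (gs ! i) h) * h)"
   using sum.reindex_bij_betw[OF bij_betw_nth[OF gs(2) _ gs(1)[symmetric]], of "{..<n}" "\<lambda>h. of_int (c (gs ! i) h) * h"]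
   by (simp add: n_def)
  also have "\<dots> = z * gs ! i" using c[OF nth_mem[of i gs, unfolded gs(1)]] i n_def by simp
  finally show "(B *\<^sub>v v) $ i = (z \<cdot>\<^sub>v v) $ i" using i by (simp add: v_def)
 qed (simp add: B_def A_def v_def)
 hence "eigenvalue B z"
  unfolding eigenvalue_def eigenvector_def using B \<open>v \<noteq> 0\<^sub>v n\<close> by (intro exI[of _ v]) (auto simp: v_def)
 hence "poly (char_poly B) z = 0" using eigenvalue_root_char_poly[OF B] by simp
 moreover have "char_poly B = map_poly of_int (char_poly A)"
  unfolding B_def by (rule of_int_hom.char_poly_hom[OF A])
 moreover have "lead_coeff (char_poly A) = 1" using degree_monic_char_poly[OF A] by simp
 ultimately show ?thesis
  by (intro algebraic_int.intros[of "map_poly of_int (char_poly A)"]) auto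
qed

lemma algebraic_int_power_reduce:
 assumes "algebraic_int (x :: complex)"
 obtains n where "n > 0" "x ^ n \<in> zspan ((\<lambda>i. x ^ i) ` {..<n})"
  "\<exists>c :: nat \<Rightarrow> int. x ^ n = (\<Sum>i<n. of_int (c i) * x ^ i)"
proof -
 from assms obtain p where p: "lead_coeff p = 1" "\<And>i. poly.coeff p i \<in> \<int>" "poly p x = 0"
  by (auto elim: algebraic_int.cases)
 define n where "n = Polynomial.degree p"
 have n: "n > 0"
 proof (rule ccontr)
  assume "\<not> n > 0"
  hence "p = [:1:]" using p(1) unfolding n_def
   by (metis degree_0_id gr0I)
  thus False using p(3) by simp
 qed
 have "\<forall>i. \<exists>k. poly.coeff p i = of_int k" using p(2) by (meson Ints_cases)
 then obtain c where c: "\<And>i. poly.coeff p i = of_int (c i)" by (auto dest: choice)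
 have "0 = (\<Sum>i\<le>n. poly.coeff p i * x ^ i)"
  unfolding n_def poly_altdef[symmetric] by (rule p(3)[symmetric])
 also have "\<dots> = x ^ n + (\<Sum>i<n. of_int (c i) * x ^ i)"
  using p(1) by (simp add: lessThan_Suc_atMost[symmetric] n_def c)
 finally have e: "x ^ n = (\<Sum>i<n. of_int (- c i) * x ^ i)"
  by (simp add: sum_negf add_eq_0_iff)
 moreover have "(\<Sum>i<n. of_int (- c i) * x ^ i) \<in> zspan ((\<lambda>i. x ^ i) ` {..<n})"
  by (intro zspan_sum zspan_scale zspan_base) auto
 ultimately show ?thesis using n by (intro that[of n]) (auto intro: exI[of _ "\<lambda>i. - c i"])
qed

text \<open>The monomials x^i y^j with exponents below the degrees of the two monic relations
  generate Z[x, y]. A single module stable under both multiplications is what lets sum and product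
  follow from \<open>algebraic_int_if_stable\<close>.\<close>

lemma algebraic_int_pair_module:
 assumes "algebraic_int x" "algebraic_int y"
 obtains G where "finite G" "(1 :: complex) \<in> G"
  "\<And>g. g \<in> G \<Longrightarrow> x * g \<in> zspan G" "\<And>g. g \<in> G \<Longrightarrow> y * g \<in> zspan G"
proof -
 obtain m c where m: "m > 0" "x ^ m = (\<Sum>i<m. of_int (c i) * x ^ i)"
  using algebraic_int_power_reduce[OF assms(1)] by metis
 obtain n d where n: "n > 0" "y ^ n = (\<Sum>i<n. of_int (d i) * y ^ i)"
  using algebraic_int_power_reduce[OF assms(2)] by metis
 define G where "G = (\<lambda>(i, j). x ^ i * y ^ j) ` ({..<m} \<times> {..<n})"
 have fin: "finite G" by (simp add: G_def)
 have mem: "x ^ i * y ^ j \<in> zspan G" if "i < m" "j < n" for i j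
  by (intro zspan_base[OF fin]) (use that in \<open>auto simp: G_def\<close>)
 have "1 \<in> G" unfolding G_def using m n by (intro image_eqI[of _ _ "(0,0)"]) auto
 moreover have "x * g \<in> zspan G" if g: "g \<in> G" for g
 proof -
  obtain i j where ij: "i < m" "j < n" "g = x ^ i * y ^ j" using g by (auto simp: G_def)
  show ?thesis
  proof (cases "Suc i < m")
   case True
   thus ?thesis using mem[of "Suc i" j] ij by (simp add: mult.assoc)
  next
   case False
   hence "Suc i = m" using ij by simp
   hence "x * g = x ^ m * y ^ j" using ij by auto
   also have "\<dots> = (\<Sum>i<m. of_int (c i) * (x ^ i * y ^ j))"
    unfolding m(2) by (simp add: sum_distrib_right mult.assoc)
   also have "\<dots> \<in> zspan G" using mem ij by (intro zspan_sum zspan_scale) auto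
   finally show ?thesis .
  qed
 qed
 moreover have "y * g \<in> zspan G" if g: "g \<in> G" for g
 proof -
  obtain i j where ij: "i < m" "j < n" "g = x ^ i * y ^ j" using g by (auto simp: G_def)
  show ?thesis
  proof (cases "Suc j < n")
   case True
   thus ?thesis using mem[of i "Suc j"] ij by (simp add: mult_ac)
  next
   case False
   hence "Suc j = n" using ij by simp
   hence "y * g = y ^ n * x ^ i" using ij by (auto simp: mult_ac)
   also have "\<dots> = (\<Sum>j<n. of_int (d j) * (x ^ i * y ^ j))"
    unfolding n(2) by (simp add: sum_distrib_left mult_ac)
   also have "\<dots> \<in> zspan G" using mem ij by (intro zspan_sum zspan_scale) auto
   finally show ?thesis .
  qed
 qed
 ultimately show ?thesis using fin that by blast
qed

lemma algebraic_int_plus_complex: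
 assumes "algebraic_int x" "algebraic_int (y :: complex)"
 shows "algebraic_int (x + y)"
proof -
 obtain G where "finite G" "1 \<in> G" "\<And>g. g \<in> G \<Longrightarrow> x * g \<in> zspan G"
  "\<And>g. g \<in> G \<Longrightarrow> y * g \<in> zspan G"
  using algebraic_int_pair_module[OF assms] by blast
 thus ?thesis by (intro algebraic_int_if_stable[of G]) (simp_all add: distrib_right zspan_add)
qed

lemma algebraic_int_times_complex:
 assumes "algebraic_int x" "algebraic_int (y :: complex)"
 shows "algebraic_int (x * y)"
proof -
 obtain G where G: "finite G" "1 \<in> G" "\<And>g. g \<in> G \<Longrightarrow> x * g \<in> zspan G"
  "\<And>g. g \<in> G \<Longrightarrow> y * g \<in> zspan G"
  using algebraic_int_pair_module[OF assms] by blast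
 have "x * y * g \<in> zspan G" if "g \<in> G" for g
  unfolding mult.assoc by (rule zspan_mult[OF G(3) G(4)[OF that]])
 with G show ?thesis by (intro algebraic_int_if_stable[of G])
qed

lemma algebraic_int_power_complex: "algebraic_int (x :: complex) \<Longrightarrow> algebraic_int (x ^ n)"
 by (induction n) (auto intro: algebraic_int_times_complex)

lemma algebraic_int_sum_complex:
 "(\<And>i. i \<in> I \<Longrightarrow> algebraic_int (f i :: complex)) \<Longrightarrow> algebraic_int (\<Sum>i\<in>I. f i)"
 by (induction I rule: infinite_finite_induct) (auto intro: algebraic_int_plus_complex)

subsection \<open>Integrality at a prime\<close>

text \<open>The integral closure in the complex numbers of the localisation of the integers at \<open>p\<close>.\<close>

definition pint :: "nat \<Rightarrow> complex set"
 where "pint p = {x. \<exists>t :: int. \<not> int p dvd t \<and> algebraic_int (of_int t * x)}"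

text \<open>The rational counterpart of \<open>pint p\<close>: \<open>zloc_if_pint\<close> and
  \<open>pint_if_zloc\<close> identify it with the p-integral rationals. Coordinates of p-integral
  elements are shown to lie in it.\<close>

definition zloc :: "nat \<Rightarrow> rat set"
 where "zloc p = {q. \<exists>m t :: int. \<not> int p dvd t \<and> q = of_int m / of_int t}"

definition punit :: "nat \<Rightarrow> complex \<Rightarrow> bool"
 where "punit p x \<longleftrightarrow> x \<noteq> 0 \<and> x \<in> pint p \<and> inverse x \<in> pint p"

locale prime_place =
 fixes p :: nat
 assumes prime_p: "prime p"
begin

lemma not_dvd_one: "\<not> int p dvd 1"
 using prime_p by (metis int_dvd_int_iff not_prime_unit of_nat_1)

lemma not_dvd_mult: "\<not> int p dvd s \<Longrightarrow> \<not> int p dvd t \<Longrightarrow> \<not> int p dvd s * t"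
 using prime_p by (meson prime_dvd_mult_iff prime_int_nat_transfer[THEN iffD2] prime_nat_int_transfer)

lemma pint_algebraic_int: "algebraic_int x \<Longrightarrow> x \<in> pint p"
 unfolding pint_def mem_Collect_eq using not_dvd_one by (intro exI[of _ 1]) auto

lemma pint_of_int: "of_int n \<in> pint p"
 by (intro pint_algebraic_int) auto

lemma pint_of_nat: "of_nat n \<in> pint p"
 using pint_of_int[of "int n"] by simp

lemma pint_1: "1 \<in> pint p" using pint_of_int[of 1] by simp

lemma pint_0: "0 \<in> pint p" using pint_of_int[of 0] by simp

lemma pint_add: assumes "x \<in> pint p" "y \<in> pint p" shows "x + y \<in> pint p"
proof -
 obtain s t :: int where st: "\<not> int p dvd s" "algebraic_int (of_int s * x)"
   "\<not> int p dvd t" "algebraic_int (of_int t * y)"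
  using assms unfolding pint_def by auto
 have "algebraic_int (of_int t * (of_int s * x) + of_int s * (of_int t * y))"
  by (intro algebraic_int_plus_complex algebraic_int_times_complex st) auto
 also have "of_int t * (of_int s * x) + of_int s * (of_int t * y) = of_int (s * t) * (x + y)"
  by (simp add: algebra_simps)
 finally show ?thesis unfolding pint_def using not_dvd_mult st by blast
qed

lemma pint_mult: assumes "x \<in> pint p" "y \<in> pint p" shows "x * y \<in> pint p"
proof -
 obtain s t :: int where st: "\<not> int p dvd s" "algebraic_int (of_int s * x)"
   "\<not> int p dvd t" "algebraic_int (of_int t * y)"
  using assms unfolding pint_def by auto
 have "algebraic_int ((of_int s * x) * (of_int t * y))"
  by (intro algebraic_int_times_complex st)
 also have "(of_int s * x) * (of_int t * y) = of_int (s * t) * (x * y)"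
  by (simp add: algebra_simps)
 finally show ?thesis unfolding pint_def using not_dvd_mult st by blast
qed

lemma pint_minus: "x \<in> pint p \<Longrightarrow> - x \<in> pint p"
 using pint_mult[of "-1" x] pint_of_int[of "-1"] by simp

lemma pint_diff: "x \<in> pint p \<Longrightarrow> y \<in> pint p \<Longrightarrow> x - y \<in> pint p"
 using pint_add[of x "-y"] pint_minus by simp

lemma pint_power: "x \<in> pint p \<Longrightarrow> x ^ n \<in> pint p"
 by (induction n) (auto intro: pint_mult pint_1)

lemma pint_sum: "(\<And>i. i \<in> I \<Longrightarrow> f i \<in> pint p) \<Longrightarrow> (\<Sum>i\<in>I. f i) \<in> pint p"
 by (induction I rule: infinite_finite_induct) (auto intro: pint_add pint_0)

text \<open>If t x^n is an algebraic integer, so is t^(n-1) (t x^n) = (t x)^n, and an n-th root of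
  an algebraic integer is again one.\<close>

lemma pint_root: assumes "x ^ n \<in> pint p" "n > 0" shows "x \<in> pint p"
proof -
 obtain t :: int where t: "\<not> int p dvd t" "algebraic_int (of_int t * x ^ n)"
  using assms unfolding pint_def by auto
 have "algebraic_int (of_int t ^ (n - 1) * (of_int t * x ^ n))"
  by (intro algebraic_int_times_complex t algebraic_int_power_complex) auto
 also have "of_int t ^ (n - 1) * (of_int t * x ^ n) = (of_int t * x) ^ n"
  using assms(2) by (cases n) (auto simp: power_mult_distrib)
 finally have "algebraic_int (of_int t * x)"
  using algebraic_int_root[of "(of_int t * x) ^ n" "Polynomial.monom 1 n" "of_int t * x"] assms(2)
  by (auto simp: poly_monom degree_monom_eq)
 thus ?thesis unfolding pint_def using t by blast
qed

lemma pint_inverse_int: "\<not> int p dvd t \<Longrightarrow> inverse (of_int t) \<in> pint p"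
 unfolding pint_def mem_Collect_eq by (intro exI[of _ t]) (cases "t = 0", auto)

lemma punit_of_int: "\<not> int p dvd t \<Longrightarrow> punit p (of_int t)"
 unfolding punit_def using pint_of_int pint_inverse_int by auto

lemma punit_mult: "punit p x \<Longrightarrow> punit p y \<Longrightarrow> punit p (x * y)"
 unfolding punit_def by (auto intro: pint_mult)

lemma punit_1: "punit p 1" unfolding punit_def using pint_1 by simp

lemma punit_inverse: "punit p x \<Longrightarrow> punit p (inverse x)"
 unfolding punit_def by auto

lemma punit_divide: "punit p x \<Longrightarrow> punit p y \<Longrightarrow> punit p (x / y)"
 unfolding divide_inverse by (intro punit_mult punit_inverse)

lemma punit_power: "punit p x \<Longrightarrow> punit p (x ^ n)"
 by (induction n) (auto intro: punit_mult punit_1)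

lemma punit_prod: "(\<And>i. i \<in> I \<Longrightarrow> punit p (f i)) \<Longrightarrow> punit p (\<Prod>i\<in>I. f i)"
 by (induction I rule: infinite_finite_induct) (auto intro: punit_mult punit_1)

lemma zloc_if_pint: assumes "of_rat q \<in> pint p" shows "q \<in> zloc p"
proof -
 obtain t :: int where t: "\<not> int p dvd t" "algebraic_int (of_int t * of_rat q :: complex)"
  using assms unfolding pint_def by auto
 have "(of_int t * of_rat q :: complex) \<in> \<rat>" by (metis Rats_mult Rats_of_int Rats_of_rat)
 hence "(of_int t * of_rat q :: complex) \<in> \<int>"
  using rational_algebraic_int_is_int t(2) by blast
 then obtain m where "(of_int t * of_rat q :: complex) = of_int m" by (auto elim: Ints_cases)
 hence "(of_rat (of_int t * q) :: complex) = of_rat (of_int m)" by (simp add: of_rat_mult)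
 hence "of_int t * q = of_int m" by (simp only: of_rat_eq_iff)
 moreover have "t \<noteq> 0" using t by auto
 ultimately have "q = of_int m / of_int t" by (simp add: field_simps)
 thus ?thesis unfolding zloc_def using t by blast
qed

lemma pint_if_zloc: "q \<in> zloc p \<Longrightarrow> of_rat q \<in> pint p"
proof -
 assume "q \<in> zloc p"
 then obtain m t :: int where mt: "\<not> int p dvd t" "q = of_int m / of_int t" unfolding zloc_def by blast
 hence "of_rat q = of_int m * inverse (of_int t :: complex)" by (simp add: of_rat_divide divide_inverse of_rat_mult of_rat_inverse)
 thus ?thesis using pint_mult[OF pint_of_int pint_inverse_int[OF mt(1)]] by simp
qed

lemma int_dvd_if_pint: assumes "of_int c / of_nat p \<in> pint p" shows "int p dvd c"
proof -
 have "(of_rat (of_int c / of_nat p) :: complex) \<in> pint p" using assms by (simp add: of_rat_divide)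
 hence "of_int c / of_nat p \<in> zloc p" using zloc_if_pint by blast
 then obtain m t :: int where mt: "\<not> int p dvd t" "of_int c / of_nat p = (of_int m / of_int t :: rat)"
  unfolding zloc_def by blast
 have "p > 0" using prime_p prime_gt_0_nat by blast
 moreover have "t \<noteq> 0" using mt by auto
 ultimately have "of_int c * of_int t = (of_int m * of_nat p :: rat)" using mt by (simp add: field_simps)
 hence "of_int (c * t) = (of_int (m * int p) :: rat)" by simp
 hence "c * t = m * int p" by (simp only: of_int_eq_iff)
 hence "int p dvd c * t" by simp
 thus ?thesis using not_dvd_mult mt(1) by blast
qed

lemma sum_split_at:
 fixes f :: "nat \<Rightarrow> complex"
 assumes "v < N"
 shows "(\<Sum>w<N. f w) = (\<Sum>w<v. f w) + f v + (\<Sum>w\<in>{v<..<N}. f w)"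
proof -
 have "{..<N} = insert v ({..<v} \<union> {v<..<N})" using assms by auto
 thus ?thesis by (simp add: sum.union_disjoint disjoint_iff)
qed

text \<open>Eisenstein descent. Once the coefficients below v are known to be divisible by p, their
  terms can be removed; the remaining sum is p times an integral number, and dividing by \<pi>^v
  leaves c v times a unit plus a multiple of \<pi>. Assumption \<open>c\<close> turns divisibility
  of c v by \<pi> into divisibility by p; it reflects that p does not ramify in the ring from which
  the coefficients come.\<close>

lemma ramified_dvd_general:
 assumes pi: "\<pi> ^ N = of_nat p * u" "punit p u" "N > 0"
  and e: "\<And>v. v < N \<Longrightarrow> punit p (e v)"
  and cp: "\<And>v. v < N \<Longrightarrow> c v \<in> pint p"
  and c: "\<And>v z. v < N \<Longrightarrow> z \<in> pint p \<Longrightarrow> c v = \<pi> * z \<Longrightarrow> c v / of_nat p \<in> pint p"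
  and s: "(\<Sum>v<N. c v * (\<pi> ^ v * e v)) / of_nat p \<in> pint p"
 shows "v < N \<Longrightarrow> c v / of_nat p \<in> pint p"
proof (induction v rule: less_induct)
 case (less v)
 have p0: "(of_nat p :: complex) \<noteq> 0" using prime_p by auto
 have pi0: "\<pi> \<noteq> 0"
 proof
  assume "\<pi> = 0" thus False using pi p0 by (auto simp: punit_def power_0_left)
 qed
 have "\<pi> ^ N \<in> pint p"
  unfolding pi(1) using pi(2) by (intro pint_mult pint_of_nat) (simp add: punit_def)
 hence pip: "\<pi> \<in> pint p" by (rule pint_root) fact
 define y where "y = (\<Sum>v<N. c v * (\<pi> ^ v * e v)) / of_nat p"
 define y1 where "y1 = y - (\<Sum>w<v. c w / of_nat p * (\<pi> ^ w * e w))"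
 have y1: "y1 \<in> pint p" unfolding y1_def y_def
  using e less.prems by (intro pint_diff pint_sum pint_mult pint_power pip s less.IH) (auto simp: punit_def)
 have "of_nat p * y = (\<Sum>w<v. c w * (\<pi> ^ w * e w)) + c v * (\<pi> ^ v * e v)
     + (\<Sum>w\<in>{v<..<N}. c w * (\<pi> ^ w * e w))"
  unfolding y_def sum_split_at[OF less.prems] using p0 by simp
 also have "(\<Sum>w<v. c w * (\<pi> ^ w * e w)) = of_nat p * (\<Sum>w<v. c w / of_nat p * (\<pi> ^ w * e w))"
  unfolding sum_distrib_left using p0 by (intro sum.cong) auto
 also have "(\<Sum>w\<in>{v<..<N}. c w * (\<pi> ^ w * e w))
   = \<pi> ^ v * (\<pi> * (\<Sum>w\<in>{v<..<N}. c w * (\<pi> ^ (w - Suc v) * e w)))"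
  unfolding sum_distrib_left
 proof (intro sum.cong refl)
  fix w assume "w \<in> {v<..<N}"
  hence "w = v + Suc (w - Suc v)" by auto
  hence "\<pi> ^ w = \<pi> ^ (v + Suc (w - Suc v))" by (rule arg_cong)
  hence "\<pi> ^ w = \<pi> ^ v * (\<pi> * \<pi> ^ (w - Suc v))" unfolding power_add power_Suc .
  thus "c w * (\<pi> ^ w * e w) = \<pi> ^ v * (\<pi> * (c w * (\<pi> ^ (w - Suc v) * e w)))"
   by (simp add: mult_ac)
 qed
 finally have "of_nat p * y1 = \<pi> ^ v * (c v * e v + \<pi> * (\<Sum>w\<in>{v<..<N}. c w * (\<pi> ^ (w - Suc v) * e w)))"
  unfolding y1_def by (simp add: algebra_simps)
 \<comment> \<open>Since v < N, the number p contains a further factor \<pi> beyond \<pi>^v; after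
   cancelling \<pi>^v the left-hand side is still a multiple of \<pi>.\<close>
 moreover have "of_nat p = \<pi> ^ v * (\<pi> * (\<pi> ^ (N - Suc v) * inverse u))"
 proof -
  have "N = v + Suc (N - Suc v)" using less.prems by auto
  hence "\<pi> ^ N = \<pi> ^ (v + Suc (N - Suc v))" by (rule arg_cong)
  hence "\<pi> ^ N = \<pi> ^ v * (\<pi> * \<pi> ^ (N - Suc v))" unfolding power_add power_Suc .
  moreover have "of_nat p = \<pi> ^ N * inverse u" using pi by (simp add: punit_def)
  ultimately show ?thesis by (simp add: mult_ac)
 qed
 ultimately have "\<pi> ^ v * (\<pi> * (\<pi> ^ (N - Suc v) * inverse u)) * y1
   = \<pi> ^ v * (c v * e v + \<pi> * (\<Sum>w\<in>{v<..<N}. c w * (\<pi> ^ (w - Suc v) * e w)))"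
  by (simp only:)
 hence "\<pi> ^ v * (\<pi> * (\<pi> ^ (N - Suc v) * inverse u) * y1)
   = \<pi> ^ v * (c v * e v + \<pi> * (\<Sum>w\<in>{v<..<N}. c w * (\<pi> ^ (w - Suc v) * e w)))"
  by (simp only: mult.assoc)
 hence "\<pi> * (\<pi> ^ (N - Suc v) * inverse u) * y1
   = c v * e v + \<pi> * (\<Sum>w\<in>{v<..<N}. c w * (\<pi> ^ (w - Suc v) * e w))"
  using pi0 by simp
 hence "c v * e v = \<pi> * (\<pi> ^ (N - Suc v) * inverse u * y1 - (\<Sum>w\<in>{v<..<N}. c w * (\<pi> ^ (w - Suc v) * e w)))"
  (is "_ = \<pi> * ?z") by (simp add: algebra_simps)
 moreover have "?z \<in> pint p" using pi(2) e
  by (intro pint_diff pint_mult pint_sum pint_power pip y1 cp) (auto simp: punit_def)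
 ultimately obtain z0 where z0: "c v * e v = \<pi> * z0" "z0 \<in> pint p" by blast
 have ev: "e v \<noteq> 0" "inverse (e v) \<in> pint p" using e[OF less.prems] by (simp_all add: punit_def)
 have "c v = (c v * e v) * inverse (e v)" using ev by simp
 also have "\<dots> = \<pi> * (z0 * inverse (e v))" unfolding z0(1) by (simp only: mult.assoc)
 finally show ?case using c[OF less.prems pint_mult[OF z0(2) ev(2)]] by blast
qed

text \<open>Raising to the N-th power replaces \<pi> by p: c^N = p u z^N, and p is prime.\<close>

lemma int_dvd_if_ramified:
 assumes pi: "\<pi> ^ N = of_nat p * u" "punit p u" and z: "z \<in> pint p" "of_int c = \<pi> * z"
 shows "int p dvd c"
proof -
 have p0: "(of_nat p :: complex) \<noteq> 0" using prime_p by auto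
 have "of_int c ^ N = of_nat p * (u * z ^ N)"
  unfolding z(2) power_mult_distrib pi(1) by (simp only: mult.assoc)
 hence "of_int (c ^ N) / of_nat p = u * z ^ N" using p0 by simp
 moreover have "u * z ^ N \<in> pint p" using z(1) pi(2) by (auto simp: punit_def intro: pint_mult pint_power)
 ultimately have "int p dvd c ^ N" by (intro int_dvd_if_pint) auto
 thus ?thesis using prime_p prime_dvd_power[of "int p"] by auto
qed

lemma ramified_dvd:
 assumes pi: "\<pi> ^ N = of_nat p * u" "punit p u" "N > 0"
  and e: "\<And>v. v < N \<Longrightarrow> punit p (e v)"
  and s: "(\<Sum>v<N. of_int (c v) * (\<pi> ^ v * e v)) / of_nat p \<in> pint p"
  and v: "v < N"
 shows "int p dvd c v"
proof (rule int_dvd_if_pint)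
 have p0: "(of_nat p :: complex) \<noteq> 0" using prime_p by auto
 have *: "of_int (c v) / of_nat p \<in> pint p" if z: "z \<in> pint p" "of_int (c v) = \<pi> * z" for v z
 proof -
  obtain d where "c v = int p * d" using int_dvd_if_ramified[OF pi(1,2) z] by (auto simp: dvd_def)
  thus ?thesis using p0 pint_of_int by simp
 qed
 show "of_int (c v) / of_nat p \<in> pint p"
  using * by (intro ramified_dvd_general[where c = "\<lambda>v. of_int (c v)", OF pi e pint_of_int _ s v]) auto
qed

text \<open>Assumption \<open>pure\<close> says that the lattice of the b i is saturated at p. A
  common denominator p^m t of the rational coefficients is lowered one factor p at a time:
  multiplied by it, the sum has integer coefficients and is p times an integral number, so each of
  these coefficients is divisible by p.\<close>

lemma pure_zloc:
 fixes b :: "'i \<Rightarrow> complex"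
 assumes I: "finite I"
  and pure: "\<And>c :: 'i \<Rightarrow> int. (\<Sum>i\<in>I. of_int (c i) * b i) / of_nat p \<in> pint p \<Longrightarrow> \<forall>i\<in>I. int p dvd c i"
  and S: "(\<Sum>i\<in>I. of_rat (q i) * b i) \<in> pint p"
 shows "\<forall>i\<in>I. q i \<in> zloc p"
proof -
 define S where "S = (\<Sum>i\<in>I. of_rat (q i) * b i)"
 have p0: "p \<noteq> 0" using prime_p by auto
 have main: "\<forall>v\<in>I. q v \<in> zloc p"
  if "\<forall>v\<in>I. of_int (int p ^ m * t) * q v \<in> \<int>" "\<not> int p dvd t" for m t
  using that
 proof (induction m)
  case 0
  show ?case
  proof
   fix v assume "v \<in> I"
   then obtain k where "of_int t * q v = of_int k" using 0 by (auto elim!: Ints_cases)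
   moreover have "t \<noteq> 0" using 0 by auto
   ultimately have "q v = of_int k / of_int t" by (simp add: field_simps)
   thus "q v \<in> zloc p" unfolding zloc_def using 0 by blast
  qed
 next
  case (Suc m)
  have "\<forall>v\<in>I. \<exists>k. of_int (int p ^ Suc m * t) * q v = of_int k"
   using Suc.prems(1) by (meson Ints_cases)
  then obtain c where c: "\<And>v. v \<in> I \<Longrightarrow> of_int (int p ^ Suc m * t) * q v = of_int (c v)"
   by (auto dest!: bchoice)
  have cc: "of_int (c v) = of_int (int p ^ Suc m * t) * (of_rat (q v) :: complex)" if "v \<in> I" for v
   using arg_cong[OF c[OF that], of "of_rat :: rat \<Rightarrow> complex"] by (simp add: of_rat_mult of_rat_power)
  have "(\<Sum>v\<in>I. of_int (c v) * b v) = (\<Sum>v\<in>I. of_int (int p ^ Suc m * t) * (of_rat (q v) * b v))"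
   by (intro sum.cong refl) (simp only: cc mult.assoc)
  also have "\<dots> = of_nat p * (of_int (int p ^ m * t) * S)"
   unfolding S_def sum_distrib_left by (intro sum.cong) (auto simp: mult_ac)
  finally have "(\<Sum>v\<in>I. of_int (c v) * b v) / of_nat p = of_int (int p ^ m * t) * S" using p0 by simp
  moreover have "of_int (int p ^ m * t) * S \<in> pint p" using S unfolding S_def by (intro pint_mult pint_of_int)
  ultimately have "\<forall>i\<in>I. int p dvd c i" using pure by simp
  moreover have "of_int (int p ^ m * t) * q v \<in> \<int>" if "v \<in> I" "int p dvd c v" for v
  proof -
   from that obtain d where "c v = int p * d" by (auto simp: dvd_def)
   with c[OF that(1)] have "of_nat p * (of_int (int p ^ m * t) * q v) = of_nat p * of_int d"
    by (simp add: mult_ac)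
   hence "of_int (int p ^ m * t) * q v = of_int d" using p0 by (metis mult_left_cancel of_nat_eq_0_iff)
   thus ?thesis by simp
  qed
  ultimately show ?case using Suc by blast
 qed
 define d where "d = (\<Prod>v\<in>I. snd (quotient_of (q v)))"
 have d0: "d \<noteq> 0" unfolding d_def using quotient_of_denom_pos' I by (auto simp: less_le prod_zero_iff)
 have "of_int d * q v \<in> \<int>" if "v \<in> I" for v
 proof -
  have "d = snd (quotient_of (q v)) * (\<Prod>v\<in>I-{v}. snd (quotient_of (q v)))"
   unfolding d_def using that I by (subst prod.remove[of _ v]) auto
  moreover have "of_int (snd (quotient_of (q v))) * q v = of_int (fst (quotient_of (q v)))"
   using quotient_of_div[of "q v" "fst (quotient_of (q v))" "snd (quotient_of (q v))"]
    quotient_of_denom_pos'[of "q v"] by (simp add: field_simps)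
  ultimately have "of_int d * q v = of_int ((\<Prod>v\<in>I-{v}. snd (quotient_of (q v))) * fst (quotient_of (q v)))"
   by (simp add: mult_ac)
  thus ?thesis by (metis Ints_of_int)
 qed
 moreover obtain m t where "d = int p ^ m * t" "\<not> int p dvd t"
  using multiplicity_decompose'[of d "int p"] d0 prime_p
  by (metis not_prime_unit prime_nat_int_transfer)
 ultimately show ?thesis using main[of m t] by blast
qed

text \<open>The numerator of q would be divisible by every power of p.\<close>

lemma zloc_all_powers: assumes "\<And>k. q / of_nat p ^ k \<in> zloc p" shows "q = 0"
proof (rule ccontr)
 assume q0: "q \<noteq> 0"
 obtain a b where ab: "quotient_of q = (a, b)" by fastforce
 have b: "b > 0" "q = of_int a / of_int b" using quotient_of_denom_pos[OF ab] quotient_of_div[OF ab] by auto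
 have a0: "a \<noteq> 0" using q0 b by auto
 have p0: "p \<noteq> 0" using prime_p by auto
 have "int p ^ k dvd a" for k
 proof -
  obtain m t where mt: "\<not> int p dvd t" "q / of_nat p ^ k = of_int m / of_int t"
   using assms[of k] unfolding zloc_def by blast
  have "t \<noteq> 0" using mt by auto
  hence "of_int (a * t) = (of_int (m * b * int p ^ k) :: rat)"
   using mt(2) b p0 by (simp add: field_simps)
  hence "a * t = m * b * int p ^ k" by (simp only: of_int_eq_iff)
  hence "int p ^ k dvd a * t" by simp
  moreover have "coprime (int p ^ k) t"
   using mt(1) prime_p by (simp add: prime_imp_coprime)
  ultimately show ?thesis by (simp add: coprime_dvd_mult_left_iff)
 qed
 moreover have "\<not> is_unit (int p)" using not_dvd_one by simp
 ultimately show False using a0 finite_divisor_powers[of a "int p"]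
  by (simp)
qed

text \<open>A vanishing combination stays p-integral after division by any power of p, so its
  coefficients are divisible by all powers of p. Linear independence over the rationals is thus a
  by-product of integrality.\<close>

lemma independent_if_zloc:
 fixes b :: "'i \<Rightarrow> complex"
 assumes z: "\<And>q i. (\<Sum>i\<in>I. of_rat (q i) * b i) \<in> pint p \<Longrightarrow> i \<in> I \<Longrightarrow> q i \<in> zloc p"
  and s: "(\<Sum>i\<in>I. of_rat (q i) * b i) = 0" and i: "i \<in> I"
 shows "q i = 0"
proof (rule zloc_all_powers)
 fix k
 have p0: "p \<noteq> 0" using prime_p by auto
 have "(\<Sum>i\<in>I. of_rat (q i / of_nat p ^ k) * b i) = (\<Sum>i\<in>I. of_rat (q i) * b i) / of_nat p ^ k"
  unfolding sum_divide_distrib by (intro sum.cong refl) (simp add: of_rat_divide of_rat_power)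
 also have "\<dots> \<in> pint p" using s pint_0 by simp
 finally show "q i / of_nat p ^ k \<in> zloc p" using z[of "\<lambda>i. q i / of_nat p ^ k"] i by blast
qed

lemma ramified_zloc:
 assumes pi: "\<pi> ^ N = of_nat p * u" "punit p u" "N > 0"
  and e: "\<And>v. v < N \<Longrightarrow> punit p (e v)"
  and s: "(\<Sum>v<N. of_rat (q v) * (\<pi> ^ v * e v)) \<in> pint p"
  and v: "v < N"
 shows "q v \<in> zloc p"
 using pure_zloc[of "{..<N}" "\<lambda>v. \<pi> ^ v * e v" q] ramified_dvd[where e = e, OF pi e] s v by auto

subsection \<open>Congruences modulo a prime\<close>

definition pcong :: "complex \<Rightarrow> complex \<Rightarrow> bool"
 where "pcong x y \<longleftrightarrow> (x - y) / of_nat p \<in> pint p"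

lemma pcong_refl: "pcong x x"
 using pint_0 by (simp add: pcong_def)

lemma pcong_trans: "pcong x y \<Longrightarrow> pcong y z \<Longrightarrow> pcong x z"
 using pint_add[of "(x - y) / of_nat p" "(y - z) / of_nat p"]
 by (simp add: pcong_def add_divide_distrib[symmetric])

lemma pcong_add: "pcong x y \<Longrightarrow> pcong x' y' \<Longrightarrow> pcong (x + x') (y + y')"
 using pint_add[of "(x - y) / of_nat p" "(x' - y') / of_nat p"]
 by (simp add: pcong_def add_divide_distrib[symmetric] add_diff_add)

lemma pcong_mult:
 assumes "pcong x y" "pcong x' y'" "x \<in> pint p" "y' \<in> pint p"
 shows "pcong (x * x') (y * y')"
proof -
 have "(x * x' - y * y') / of_nat p = x * ((x' - y') / of_nat p) + y' * ((x - y) / of_nat p)"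
  by (simp add: diff_divide_distrib algebra_simps)
 thus ?thesis using assms unfolding pcong_def by (metis pint_add pint_mult)
qed

lemma pcong_power: "pcong x y \<Longrightarrow> x \<in> pint p \<Longrightarrow> y \<in> pint p \<Longrightarrow> pcong (x ^ n) (y ^ n)"
 by (induction n) (simp_all add: pcong_refl pcong_mult pint_power)

lemma pcong_sum: "(\<And>i. i \<in> I \<Longrightarrow> pcong (f i) (g i)) \<Longrightarrow> pcong (\<Sum>i\<in>I. f i) (\<Sum>i\<in>I. g i)"
 by (induction I rule: infinite_finite_induct) (simp_all add: pcong_refl pcong_add)

lemma pcong_frobenius_add:
 assumes "x \<in> pint p" "y \<in> pint p"
 shows "pcong ((x + y) ^ p) (x ^ p + y ^ p)"
proof -
 have p: "p > 1" using prime_p prime_gt_1_nat by blast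
 have "{..p} = insert 0 (insert p {1..<p})" using p by auto
 hence "(x + y) ^ p = x ^ p + y ^ p + (\<Sum>k\<in>{1..<p}. of_nat (p choose k) * x ^ k * y ^ (p - k))"
  unfolding binomial_ring using p by simp
 hence "((x + y) ^ p - (x ^ p + y ^ p)) / of_nat p
   = (\<Sum>k\<in>{1..<p}. of_nat (p choose k) * x ^ k * y ^ (p - k)) / of_nat p" by simp
 also have "\<dots> = (\<Sum>k\<in>{1..<p}. of_nat ((p choose k) div p) * (x ^ k * y ^ (p - k)))"
  unfolding sum_divide_distrib
 proof (intro sum.cong refl)
  fix k assume k: "k \<in> {1..<p}"
  have "p dvd (p choose k)" using k prime_p by (intro dvd_choose_prime) auto
  then obtain d where "p choose k = p * d" by (auto simp: dvd_def)
  thus "of_nat (p choose k) * x ^ k * y ^ (p - k) / of_nat p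
    = of_nat ((p choose k) div p) * (x ^ k * y ^ (p - k))" using p by simp
 qed
 also have "\<dots> \<in> pint p" using assms by (intro pint_sum pint_mult pint_of_nat pint_power)
 finally show ?thesis by (simp add: pcong_def)
qed

lemma pcong_frobenius_sum:
 assumes "\<And>i. i \<in> I \<Longrightarrow> f i \<in> pint p"
 shows "pcong ((\<Sum>i\<in>I. f i) ^ p) (\<Sum>i\<in>I. f i ^ p)"
 using assms
proof (induction I rule: infinite_finite_induct)
 case (insert i I)
 have "pcong ((f i + (\<Sum>i\<in>I. f i)) ^ p) (f i ^ p + (\<Sum>i\<in>I. f i) ^ p)"
  using insert by (intro pcong_frobenius_add pint_sum) auto
 moreover have "pcong (f i ^ p + (\<Sum>i\<in>I. f i) ^ p) (f i ^ p + (\<Sum>i\<in>I. f i ^ p))"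
  using insert by (intro pcong_add pcong_refl) auto
 ultimately have "pcong ((f i + (\<Sum>i\<in>I. f i)) ^ p) (f i ^ p + (\<Sum>i\<in>I. f i ^ p))"
  by (rule pcong_trans)
 thus ?case using insert by simp
qed (use prime_gt_0_nat[OF prime_p] in \<open>simp_all add: pcong_refl power_0_left\<close>)

lemma pcong_of_int_power: "pcong (of_int c ^ p) (of_int c)"
proof -
 have "int p dvd c ^ p - c"
 proof (cases "int p dvd c")
  case True
  moreover have "c dvd c ^ p" using prime_gt_0_nat[OF prime_p] by (intro dvd_power) auto
  ultimately show ?thesis by (meson dvd_diff dvd_trans)
 next
  case False
  have "[(nat (c mod int p)) ^ (p - 1) = 1] (mod p)"
  proof (rule fermat_theorem[OF prime_p])
   show "\<not> p dvd nat (c mod int p)"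
    using False prime_p by (metis dvd_mod_iff dvd_refl int_dvd_int_iff nat_0_le of_nat_0_le_iff
      pos_mod_sign prime_gt_0_nat of_nat_0_less_iff)
  qed
  hence "[int (nat (c mod int p)) ^ (p - 1) = 1] (mod int p)"
   by (metis cong_int_iff of_nat_1 of_nat_power)
  hence "[(c mod int p) ^ (p - 1) = 1] (mod int p)" using prime_p by (simp add: prime_gt_0_nat)
  hence "[c ^ (p - 1) = 1] (mod int p)" by (simp add: Cong.cong_def power_mod)
  hence "[c ^ (p - 1) * c = 1 * c] (mod int p)" by (rule cong_scalar_right)
  hence "[c ^ p = c] (mod int p)" using prime_p
   by (metis mult_1 power_minus_mult prime_gt_0_nat)
  thus ?thesis by (simp add: cong_iff_dvd_diff)
 qed
 then obtain d where "c ^ p - c = int p * d" by (auto simp: dvd_def)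
 hence "of_int c ^ p - of_int c = (of_nat p * of_int d :: complex)"
  by (metis of_int_diff of_int_mult of_int_of_nat_eq of_int_power)
 thus ?thesis using prime_p pint_of_int by (simp add: pcong_def)
qed

end

subsection \<open>Conjugation as a relation\<close>

definition bsum :: "nat \<Rightarrow> nat \<Rightarrow> (nat \<Rightarrow> nat \<Rightarrow> rat) \<Rightarrow> complex \<Rightarrow> complex \<Rightarrow> complex"
 where "bsum m n q z w = (\<Sum>i<m. \<Sum>j<n. of_rat (q i j) * z ^ i * w ^ j)"

lemma bsum_add: "bsum m n (\<lambda>i j. q i j + r i j) z w = bsum m n q z w + bsum m n r z w"
 by (simp add: bsum_def of_rat_add distrib_right sum.distrib)

lemma bsum_scale: "bsum m n (\<lambda>i j. c * q i j) z w = of_rat c * bsum m n q z w"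
 by (simp add: bsum_def of_rat_mult sum_distrib_left mult.assoc)

locale conj_pair =
 fixes m n :: nat and D :: rat and z w z' w' :: complex
 assumes mn: "m > 0" "n > 0"
  and zm: "z ^ m = 1" "z' ^ m = 1" and wn: "w ^ n = of_rat D" "w' ^ n = of_rat D"
begin

text \<open>A relation rather than a map, because an element has many representations as a
  \<open>bsum\<close>: the exponents of z run up to m - 1 although the powers of a root of unity sum
  to zero. Sums and products are respected in any case; single-valuedness is added in
  \<open>conj_pair_indep\<close>.\<close>

definition conjrel :: "complex \<Rightarrow> complex \<Rightarrow> bool"
 where "conjrel x x' \<longleftrightarrow> (\<exists>q. x = bsum m n q z w \<and> x' = bsum m n q z' w')"

lemma conjrelI: "conjrel (bsum m n q z w) (bsum m n q z' w')"
 unfolding conjrel_def by blast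

lemma conjrelE: assumes "conjrel x x'" obtains q where "x = bsum m n q z w" "x' = bsum m n q z' w'"
 using assms unfolding conjrel_def by blast

lemma conjrel_add: assumes "conjrel x x'" "conjrel y y'" shows "conjrel (x + y) (x' + y')"
proof -
 obtain q where q: "x = bsum m n q z w" "x' = bsum m n q z' w'" using assms(1) by (rule conjrelE)
 obtain r where r: "y = bsum m n r z w" "y' = bsum m n r z' w'" using assms(2) by (rule conjrelE)
 show ?thesis unfolding q r bsum_add[symmetric] by (rule conjrelI)
qed

lemma conjrel_scale: assumes "conjrel x x'" shows "conjrel (of_rat c * x) (of_rat c * x')"
proof -
 obtain q where q: "x = bsum m n q z w" "x' = bsum m n q z' w'" using assms by (rule conjrelE)
 show ?thesis unfolding q bsum_scale[symmetric] by (rule conjrelI)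
qed

lemma conjrel_0: "conjrel 0 0"
 unfolding conjrel_def by (intro exI[of _ "\<lambda>_ _. 0"]) (simp add: bsum_def)

lemma conjrel_sum: "(\<And>i. i \<in> I \<Longrightarrow> conjrel (f i) (g i)) \<Longrightarrow> conjrel (\<Sum>i\<in>I. f i) (\<Sum>i\<in>I. g i)"
 by (induction I rule: infinite_finite_induct) (simp_all add: conjrel_0 conjrel_add)

text \<open>Exponents are reduced by z^m = 1 and w^n = D, and the coefficient D^(j div n) pays for
  the second reduction. The coefficients depend only on i and j, so the same ones serve both pairs
  of generators.\<close>

lemma bsum_monom:
 assumes "z0 ^ m = 1" "w0 ^ n = of_rat D"
 shows "bsum m n (\<lambda>a b. if a = i mod m \<and> b = j mod n then D ^ (j div n) else 0) z0 w0 = z0 ^ i * w0 ^ j"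
proof -
 have "bsum m n (\<lambda>a b. if a = i mod m \<and> b = j mod n then D ^ (j div n) else 0) z0 w0
  = (\<Sum>a<m. \<Sum>b<n. if a = i mod m then (if b = j mod n then of_rat (D ^ (j div n)) * z0 ^ a * w0 ^ b else 0) else 0)"
  unfolding bsum_def by (intro sum.cong refl) auto
 also have "\<dots> = (\<Sum>a<m. if a = i mod m then (\<Sum>b<n. if b = j mod n then of_rat (D ^ (j div n)) * z0 ^ a * w0 ^ b else 0) else 0)"
  by (intro sum.cong refl) auto
 also have "\<dots> = of_rat (D ^ (j div n)) * z0 ^ (i mod m) * w0 ^ (j mod n)"
  using mn by (simp add: sum.delta)
 finally have 1: "bsum m n (\<lambda>a b. if a = i mod m \<and> b = j mod n then D ^ (j div n) else 0) z0 w0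
   = of_rat (D ^ (j div n)) * z0 ^ (i mod m) * w0 ^ (j mod n)" .
 have "w0 ^ j = w0 ^ (n * (j div n) + j mod n)" by simp
 also have "\<dots> = of_rat (D ^ (j div n)) * w0 ^ (j mod n)"
  by (simp only: power_add power_mult assms(2) of_rat_power)
 finally have 2: "w0 ^ j = of_rat (D ^ (j div n)) * w0 ^ (j mod n)" .
 have "z0 ^ i = z0 ^ (m * (i div m) + i mod m)" by simp
 also have "\<dots> = z0 ^ (i mod m)" by (simp only: power_add power_mult assms(1) power_one mult_1)
 finally have 3: "z0 ^ i = z0 ^ (i mod m)" .
 show ?thesis unfolding 1 by (subst 2, subst 3) (simp only: mult_ac)
qed

lemma conjrel_monom: "conjrel (z ^ i * w ^ j) (z' ^ i * w' ^ j)"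
 unfolding conjrel_def
 using bsum_monom[OF zm(1) wn(1)] bsum_monom[OF zm(2) wn(2)] by metis

lemma conjrel_bsum: "conjrel (bsum m' n' q z w) (bsum m' n' q z' w')"
 unfolding bsum_def mult.assoc by (intro conjrel_sum conjrel_scale conjrel_monom)

lemma conjrel_mult: assumes "conjrel x x'" "conjrel y y'" shows "conjrel (x * y) (x' * y')"
proof -
 obtain q r where q: "x = bsum m n q z w" "x' = bsum m n q z' w'"
  and r: "y = bsum m n r z w" "y' = bsum m n r z' w'"
  using assms unfolding conjrel_def by blast
 have e: "bsum m n q u v * bsum m n r u v
  = (\<Sum>i<m. \<Sum>j<n. \<Sum>a<m. \<Sum>b<n. of_rat (q i j) * (of_rat (r a b) * (u ^ (i + a) * v ^ (j + b))))" for u v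
  unfolding bsum_def by (unfold sum_distrib_right, unfold sum_distrib_left)
   (intro sum.cong refl, simp only: power_add mult_ac)
 show ?thesis unfolding q r e
  by (intro conjrel_sum conjrel_scale conjrel_monom)
qed

lemma conjrel_rat: "conjrel (of_rat c) (of_rat c)"
 using conjrel_scale[OF conjrel_monom[of 0 0], of c] by simp

lemma conjrel_poly:
 assumes "conjrel x x'"
 shows "conjrel (poly (map_poly of_rat P) x) (poly (map_poly of_rat P) x')"
proof (induction P)
 case 0
 show ?case by (simp add: conjrel_0)
next
 case (pCons a P)
 have "map_poly of_rat (pCons a P) = pCons (of_rat a :: complex) (map_poly of_rat P)"
  by (intro poly_eqI) (simp add: coeff_map_poly coeff_pCons split: nat.splits)
 thus ?case using conjrel_add[OF conjrel_rat[of a] conjrel_mult[OF assms pCons(2)]] by simp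
qed

end

text \<open>Independence is required for i < m - 1 only: the vanishing power sum expresses z^(m-1)
  by the lower powers, and it does so in the same way for z'.\<close>

locale conj_pair_indep = conj_pair +
 assumes indep: "\<And>q i j. (\<Sum>i<m-1. \<Sum>j<n. of_rat (q i j) * z ^ i * w ^ j) = 0 \<Longrightarrow> i < m - 1 \<Longrightarrow> j < n \<Longrightarrow> q i j = 0"
  and sumz: "(\<Sum>i<m. z ^ i) = 0" "(\<Sum>i<m. z' ^ i) = 0"
begin

lemma bsum_reduce:
 assumes "(\<Sum>i<m. z0 ^ i) = (0 :: complex)"
 shows "bsum m n q z0 w0 = (\<Sum>i<m-1. \<Sum>j<n. of_rat (q i j - q (m - 1) j) * z0 ^ i * w0 ^ j)"
proof -
 obtain k where k: "m = Suc k" using mn by (cases m) auto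
 have e: "z0 ^ k = - (\<Sum>i<k. z0 ^ i)" using assms unfolding k by (simp add: add_eq_0_iff2)
 have "bsum m n q z0 w0 = (\<Sum>i<k. \<Sum>j<n. of_rat (q i j) * z0 ^ i * w0 ^ j)
   + (\<Sum>j<n. of_rat (q k j) * z0 ^ k * w0 ^ j)" by (simp add: bsum_def k)
 also have "(\<Sum>j<n. of_rat (q k j) * z0 ^ k * w0 ^ j) = - (\<Sum>j<n. \<Sum>i<k. of_rat (q k j) * z0 ^ i * w0 ^ j)"
  unfolding e by (simp add: sum_distrib_left sum_distrib_right sum_negf)
 also have "(\<Sum>j<n. \<Sum>i<k. of_rat (q k j) * z0 ^ i * w0 ^ j) = (\<Sum>i<k. \<Sum>j<n. of_rat (q k j) * z0 ^ i * w0 ^ j)"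
  by (rule sum.swap)
 finally show ?thesis by (simp add: k of_rat_diff left_diff_distrib sum_subtractf)
qed

lemma conjrel_zero: assumes "conjrel 0 x'" shows "x' = 0"
proof -
 obtain q where q: "0 = bsum m n q z w" "x' = bsum m n q z' w'"
  using assms unfolding conjrel_def by blast
 have "q i j - q (m - 1) j = 0" if "i < m - 1" "j < n" for i j
  using indep[of "\<lambda>i j. q i j - q (m - 1) j" i j] q(1) that unfolding bsum_reduce[OF sumz(1)] by simp
 thus ?thesis unfolding q(2) bsum_reduce[OF sumz(2)] by simp
qed

lemma conjrel_unique: assumes "conjrel x x'" "conjrel x x''" shows "x' = x''"
 using conjrel_zero[of "x' - x''"] conjrel_add[OF assms(1) conjrel_scale[OF assms(2), of "-1"]] by simp

lemma conjrel_root: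
 assumes "conjrel x x'" "poly (map_poly of_rat P) x = 0"
 shows "poly (map_poly of_rat P) x' = 0"
 using conjrel_zero conjrel_poly[OF assms(1), of P] assms(2) by simp

lemma conjrel_algebraic_int:
 assumes "conjrel x x'" "algebraic_int x"
 shows "algebraic_int x'"
proof -
 obtain p :: "int poly" where p: "poly (of_int_poly p) x = 0" "lead_coeff p = 1"
  using assms(2) unfolding algebraic_int_altdef_ipoly by blast
 have e: "of_int_poly p = (map_poly of_rat (of_int_poly p) :: complex poly)"
  by (simp add: map_poly_map_poly o_def)
 have "poly (of_int_poly p) x' = 0"
  using conjrel_root[OF assms(1), of "of_int_poly p"] p(1) unfolding e by simp
 thus ?thesis unfolding algebraic_int_altdef_ipoly using p(2) by blast
qed

lemma conjrel_pint:
 assumes "conjrel x x'" "x \<in> pint p"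
 shows "x' \<in> pint p"
proof -
 obtain t :: int where t: "\<not> int p dvd t" "algebraic_int (of_int t * x)"
  using assms(2) unfolding pint_def by auto
 have "conjrel (of_int t * x) (of_int t * x')" using conjrel_scale[OF assms(1), of "of_int t"] by simp
 thus ?thesis unfolding pint_def using conjrel_algebraic_int t by blast
qed

end

subsection \<open>The cyclotomic field\<close>

locale cyclotomic =
 fixes l :: nat and \<zeta> :: complex
 assumes prime_l: "prime l" and odd_l: "odd l"
  and zeta: "\<zeta> = cis (2 * pi / real l)"
begin

sublocale L: prime_place l by standard (rule prime_l)

lemma l_ge_3: "l \<ge> 3"
proof -
 have "l \<ge> 2" using prime_l prime_ge_2_nat by blast
 moreover have "l \<noteq> 2" using odd_l by auto
 ultimately show ?thesis by simp
qed

lemma l_pos: "l > 0" using l_ge_3 by simp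

lemma zeta_power: "\<zeta> ^ k = cis (2 * pi * real k / real l)"
 unfolding zeta Complex.DeMoivre by (rule arg_cong[of _ _ cis]) simp

lemma zeta_l: "\<zeta> ^ l = 1"
 using l_pos by (simp add: zeta_power)

lemma zeta_power_mod: "\<zeta> ^ (k mod l) = \<zeta> ^ k"
proof -
 have "\<zeta> ^ k = \<zeta> ^ (l * (k div l) + k mod l)" by simp
 also have "\<dots> = \<zeta> ^ (k mod l)" unfolding power_add power_mult zeta_l by simp
 finally show ?thesis by simp
qed

lemma zeta_bij: "bij_betw (\<lambda>k. \<zeta> ^ k) {..<l} {z. z ^ l = 1}"
 using Complex.bij_betw_roots_unity[OF l_pos] by (simp add: zeta_power)

lemma zeta_power_eq_1: "\<zeta> ^ k = 1 \<longleftrightarrow> l dvd k"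
proof -
 have "\<zeta> ^ k = 1 \<longleftrightarrow> \<zeta> ^ (k mod l) = \<zeta> ^ 0" by (simp add: zeta_power_mod)
 also have "\<dots> \<longleftrightarrow> k mod l = 0"
  using inj_on_eq_iff[OF bij_betw_imp_inj_on[OF zeta_bij], of "k mod l" 0] l_pos by simp
 finally show ?thesis by auto
qed

lemma zeta_power_eq: "\<zeta> ^ i = \<zeta> ^ j \<longleftrightarrow> i mod l = j mod l"
proof -
 have "\<zeta> ^ i = \<zeta> ^ j \<longleftrightarrow> \<zeta> ^ (i mod l) = \<zeta> ^ (j mod l)" by (simp add: zeta_power_mod)
 also have "\<dots> \<longleftrightarrow> i mod l = j mod l"
  using inj_on_eq_iff[OF bij_betw_imp_inj_on[OF zeta_bij], of "i mod l" "j mod l"] l_pos by simp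
 finally show ?thesis .
qed

lemma zeta_nz: "\<zeta> \<noteq> 0" using zeta_l l_pos by (metis power_0_left zero_neq_one less_irrefl)

lemma root_of_unity_cases: assumes "z ^ l = 1" obtains a where "a < l" "z = \<zeta> ^ a"
 using assms zeta_bij unfolding bij_betw_def by (auto simp: image_iff set_eq_iff)

lemma root_cases: assumes "x ^ l = y ^ l" "y \<noteq> 0" obtains b where "b < l" "x = \<zeta> ^ b * y"
proof -
 have "(x / y) ^ l = 1" using assms by (simp add: power_divide)
 then obtain b where "b < l" "x / y = \<zeta> ^ b" by (rule root_of_unity_cases)
 thus ?thesis using that assms by (simp add: field_simps)
qed

lemma sum_root_of_unity: assumes "z ^ l = 1" "z \<noteq> (1 :: complex)" shows "(\<Sum>i<l. z ^ i) = 0"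
proof -
 have "(z - 1) * (\<Sum>i<l. z ^ i) = z ^ l - 1" by (rule power_diff_1_eq[symmetric])
 thus ?thesis using assms by simp
qed

lemma sum_zeta_power: "(\<Sum>i<l. (\<zeta> ^ k) ^ i) = (if l dvd k then of_nat l else 0)"
proof (cases "l dvd k")
 case True
 hence "\<zeta> ^ k = 1" by (simp add: zeta_power_eq_1)
 thus ?thesis using True by simp
next
 case False
 hence "\<zeta> ^ k \<noteq> 1" by (simp add: zeta_power_eq_1)
 moreover have "(\<zeta> ^ k) ^ l = 1" by (metis power_mult mult.commute zeta_l power_one)
 ultimately show ?thesis using False sum_root_of_unity by simp
qed

lemma algebraic_int_zeta: "algebraic_int \<zeta>"
 using algebraic_int_root[of 1 "Polynomial.monom 1 l" \<zeta>] l_pos zeta_l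
 by (auto simp: poly_monom degree_monom_eq)

text \<open>As polynomials in x both sides are monic of degree l and agree at the l distinct points
  \<zeta>^b y.\<close>

lemma prod_zeta: "(\<Prod>b<l. (x - \<zeta> ^ b * y)) = x ^ l - y ^ l"
proof (cases "y = 0")
 case True
 thus ?thesis using l_pos by (simp add: power_0_left)
next
 case False
 define p where "p = (\<Prod>b<l. [:- (\<zeta> ^ b * y), 1:])"
 define q where "q = Polynomial.monom 1 l - [:y ^ l:]"
 have dp: "Polynomial.degree p = l" unfolding p_def by (subst degree_prod_sum_eq) auto
 have "lead_coeff p = 1" unfolding p_def lead_coeff_prod by simp
 hence cp: "poly.coeff p l = 1" using dp by simp
 have dq: "Polynomial.degree q \<le> l" unfolding q_def
  by (intro degree_diff_le) (auto simp: degree_monom_le)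
 have cq: "poly.coeff q l = 1" unfolding q_def using l_pos by (cases l) auto
 have inj: "inj_on (\<lambda>b. \<zeta> ^ b * y) {..<l}"
  using False bij_betw_imp_inj_on[OF zeta_bij] by (auto simp: inj_on_def)
 have "p = q"
 proof (rule poly_eqI_degree_lead_coeff[where n = l and A = "(\<lambda>b. \<zeta> ^ b * y) ` {..<l}"])
  show "card ((\<lambda>b. \<zeta> ^ b * y) ` {..<l}) \<ge> l" using card_image[OF inj] by simp
  fix v assume "v \<in> (\<lambda>b. \<zeta> ^ b * y) ` {..<l}"
  then obtain b where b: "b < l" "v = \<zeta> ^ b * y" by auto
  have "poly p v = 0" unfolding p_def poly_prod using b by (auto simp: prod_zero_iff)
  moreover have "v ^ l = y ^ l"
   unfolding b power_mult_distrib by (metis mult_1 power_mult mult.commute zeta_l power_one)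
  hence "poly q v = 0" unfolding q_def by (simp add: poly_monom)
  ultimately show "poly p v = poly q v" by simp
 qed (simp_all add: dp dq cp cq)
 hence "poly p x = poly q x" by simp
 thus ?thesis unfolding p_def q_def by (simp add: poly_prod poly_monom)
qed

text \<open>The value at 1 of 1 + x + ... + x^(l-1). The factor x - 1 has to be cancelled between
  polynomials, because after evaluation at 1 it would be zero.\<close>

lemma prod_one_minus_zeta: "(\<Prod>a\<in>{1..<l}. (1 - \<zeta> ^ a)) = of_nat l"
proof -
 define p where "p = (\<Prod>b\<in>{1..<l}. [:- (\<zeta> ^ b), 1:])"
 define q :: "complex poly" where "q = (\<Sum>i<l. Polynomial.monom 1 i)"
 have "[:-1, 1:] * p = [:-1, 1:] * q"
 proof (rule poly_eq_poly_eq_iff[THEN iffD1], rule ext)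
  fix x :: complex
  have "{..<l} = insert 0 {1..<l}" using l_pos by auto
  hence "(x - 1) * (\<Prod>b\<in>{1..<l}. (x - \<zeta> ^ b)) = x ^ l - 1"
   using prod_zeta[of x 1] by simp
  also have "\<dots> = (x - 1) * (\<Sum>i<l. x ^ i)" by (rule power_diff_1_eq)
  finally have *: "(x - 1) * (\<Prod>b\<in>{1..<l}. (x - \<zeta> ^ b)) = (x - 1) * (\<Sum>i<l. x ^ i)" .
  have "poly [:-1, 1:] x = x - 1" "poly p x = (\<Prod>b\<in>{1..<l}. (x - \<zeta> ^ b))" "poly q x = (\<Sum>i<l. x ^ i)"
   by (simp_all add: p_def q_def poly_prod poly_sum poly_monom)
  thus "poly ([:-1, 1:] * p) x = poly ([:-1, 1:] * q) x"
   unfolding poly_mult using * by (simp only:)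
 qed
 hence "p = q" by (subst (asm) mult_cancel_left) auto
 hence "poly p 1 = poly q 1" by simp
 thus ?thesis by (simp add: p_def q_def poly_prod poly_sum poly_monom)
qed

lemma one_minus_zeta_nz: "0 < a \<Longrightarrow> a < l \<Longrightarrow> 1 - \<zeta> ^ a \<noteq> 0"
 using zeta_power_eq_1[of a] nat_dvd_not_less[of a l] by auto

lemma inverse_mod_l: assumes "\<not> l dvd a" obtains b where "[a * b = 1] (mod l)"
proof -
 have "coprime a l" using assms prime_l by (metis coprime_commute prime_imp_coprime)
 thus ?thesis using that cong_solve_coprime_nat[of a l] by auto
qed

text \<open>A cyclotomic unit: with a b = 1 modulo l, \<zeta> is the b-th power of \<zeta>^a, so the
  quotient and its inverse are both geometric sums in powers of \<zeta>.\<close>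

lemma punit_zeta_quotient:
 assumes a: "0 < a" "a < l"
 shows "punit l ((1 - \<zeta> ^ a) / (1 - \<zeta>))"
proof -
 have n: "1 - \<zeta> \<noteq> 0" "1 - \<zeta> ^ a \<noteq> 0" using one_minus_zeta_nz[of 1] one_minus_zeta_nz[of a] a l_ge_3 by auto
 have "(1 - \<zeta>) * (\<Sum>i<a. \<zeta> ^ i) = 1 - \<zeta> ^ a" by (rule one_diff_power_eq[symmetric])
 hence 1: "(1 - \<zeta> ^ a) / (1 - \<zeta>) = (\<Sum>i<a. \<zeta> ^ i)" using n by (simp add: field_simps)
 have "\<not> l dvd a" using a by (auto dest: dvd_imp_le)
 then obtain b where b: "[a * b = 1] (mod l)" by (rule inverse_mod_l)
 hence "(\<zeta> ^ a) ^ b = \<zeta>"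
  using zeta_power_eq[of "a * b" 1] by (simp add: Cong.cong_def power_mult)
 moreover have "(1 - \<zeta> ^ a) * (\<Sum>i<b. (\<zeta> ^ a) ^ i) = 1 - (\<zeta> ^ a) ^ b" by (rule one_diff_power_eq[symmetric])
 ultimately have 2: "inverse ((1 - \<zeta> ^ a) / (1 - \<zeta>)) = (\<Sum>i<b. (\<zeta> ^ a) ^ i)" using n by (simp add: field_simps)
 have "(1 - \<zeta> ^ a) / (1 - \<zeta>) \<in> pint l" unfolding 1
  by (intro L.pint_algebraic_int algebraic_int_sum_complex algebraic_int_power_complex algebraic_int_zeta)
 moreover have "inverse ((1 - \<zeta> ^ a) / (1 - \<zeta>)) \<in> pint l" unfolding 2
  by (intro L.pint_algebraic_int algebraic_int_sum_complex algebraic_int_power_complex algebraic_int_zeta)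
 ultimately show ?thesis unfolding punit_def using n by simp
qed

text \<open>A prime element above l: by \<open>lam_power\<close> its (l-1)-th power is l times an
  l-unit.\<close>

definition lam :: complex where "lam = 1 - \<zeta>"

lemma lam_nz: "lam \<noteq> 0" using one_minus_zeta_nz[of 1] l_ge_3 by (auto simp: lam_def)

lemma lam_power: obtains u where "lam ^ (l - 1) = of_nat l * u" "punit l u"
proof -
 define v where "v = (\<Prod>a\<in>{1..<l}. (1 - \<zeta> ^ a) / (1 - \<zeta>))"
 have v: "punit l v" unfolding v_def using punit_zeta_quotient by (intro L.punit_prod) auto
 have "v = of_nat l / lam ^ (l - 1)"
  unfolding v_def prod_dividef prod_one_minus_zeta by (simp add: lam_def)
 moreover have "v \<noteq> 0" using v by (simp add: punit_def)
 ultimately have "lam ^ (l - 1) = of_nat l * inverse v" using lam_nz by (simp add: field_simps)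
 thus ?thesis using that L.punit_inverse[OF v] by blast
qed

lemma lam_zloc:
 assumes "(\<Sum>i<l-1. of_rat (q i) * lam ^ i) \<in> pint l" "i < l - 1"
 shows "q i \<in> zloc l"
proof -
 obtain u where u: "lam ^ (l - 1) = of_nat l * u" "punit l u" by (rule lam_power)
 show ?thesis using L.ramified_zloc[where e = "\<lambda>_. 1" and q = q, OF u] assms L.punit_1 l_ge_3 by auto
qed

text \<open>Obtained from the descent at l alone. The degree l - 1 of the cyclotomic field rests on
  it.\<close>

lemma lam_independent:
 assumes "(\<Sum>i<l-1. of_rat (q i) * lam ^ i) = 0" "i < l - 1"
 shows "q i = 0"
 using L.independent_if_zloc[where I = "{..<l-1}" and b = "\<lambda>i. lam ^ i"] lam_zloc assms by auto

end

text \<open>Passing between the bases \<open>(1 - x) ^ i\<close> and \<open>x ^ i\<close> is a triangular integral transformation.\<close>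

lemma binomial_basis_change:
 fixes x :: complex
 shows "(\<Sum>i<n. of_rat (q i) * x ^ i)
   = (\<Sum>k<n. of_rat (\<Sum>i<n. q i * of_int ((-1) ^ k * int (i choose k))) * (1 - x) ^ k)"
proof -
 have b: "x ^ i = (\<Sum>k<n. of_int ((-1) ^ k * int (i choose k)) * (1 - x) ^ k)" if "i < n" for i
 proof -
  have "x ^ i = (- (1 - x) + 1) ^ i" by simp
  also have "\<dots> = (\<Sum>k\<le>i. of_nat (i choose k) * (- (1 - x)) ^ k)" unfolding binomial_ring by simp
  also have "\<dots> = (\<Sum>k\<le>i. of_int ((-1) ^ k * int (i choose k)) * (1 - x) ^ k)"
   by (intro sum.cong refl) (subst power_minus, simp)
  also have "\<dots> = (\<Sum>k<n. of_int ((-1) ^ k * int (i choose k)) * (1 - x) ^ k)"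
   using that by (intro sum.mono_neutral_left) auto
  finally show ?thesis .
 qed
 have "(\<Sum>i<n. of_rat (q i) * x ^ i) = (\<Sum>i<n. \<Sum>k<n. of_rat (q i) * (of_int ((-1) ^ k * int (i choose k)) * (1 - x) ^ k))"
  unfolding sum_distrib_left[symmetric] using b by (intro sum.cong refl) (simp only: lessThan_iff)
 also have "\<dots> = (\<Sum>k<n. \<Sum>i<n. of_rat (q i) * (of_int ((-1) ^ k * int (i choose k)) * (1 - x) ^ k))"
  by (rule sum.swap)
 also have "\<dots> = (\<Sum>k<n. of_rat (\<Sum>i<n. q i * of_int ((-1) ^ k * int (i choose k))) * (1 - x) ^ k)"
  by (simp add: of_rat_sum of_rat_mult of_rat_power of_rat_minus sum_distrib_right mult.assoc)
 finally show ?thesis .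
qed

text \<open>The matrix is triangular with diagonal entries (-1)^k, so the coefficients vanish one
  after the other from the top index down.\<close>

lemma binomial_basis_change_zero:
 fixes q :: "nat \<Rightarrow> rat"
 assumes "\<And>k. k < n \<Longrightarrow> (\<Sum>i<n. q i * of_int ((-1) ^ k * int (i choose k))) = 0"
 shows "k < n \<Longrightarrow> q k = 0"
proof (induction "n - k" arbitrary: k rule: less_induct)
 case less
 have "0 = (\<Sum>i<n. q i * of_int ((-1) ^ k * int (i choose k)))" using assms less by simp
 also have "\<dots> = (\<Sum>i\<in>{k}. q i * of_int ((-1) ^ k * int (i choose k)))"
 proof (rule sum.mono_neutral_right)
  show "\<forall>i\<in>{..<n} - {k}. q i * of_int ((-1) ^ k * int (i choose k)) = 0"
  proof
   fix i assume i: "i \<in> {..<n} - {k}"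
   show "q i * of_int ((-1) ^ k * int (i choose k)) = 0"
   proof (cases "i < k")
    case False
    hence "q i = 0" using i less.prems by (intro less.hyps) auto
    thus ?thesis by simp
   qed (simp add: binomial_eq_0)
  qed
 qed (use less.prems in simp_all)
 finally show ?case by simp
qed

context cyclotomic
begin

lemma zeta_independent:
 assumes "(\<Sum>i<l-1. of_rat (q i) * \<zeta> ^ i) = 0" "i < l - 1"
 shows "q i = 0"
proof (rule binomial_basis_change_zero[where q = q and n = "l - 1"])
 fix k assume k: "k < l - 1"
 show "(\<Sum>i<l-1. q i * of_int ((-1) ^ k * int (i choose k))) = 0"
  using lam_independent[where q = "\<lambda>k. \<Sum>i<l-1. q i * of_int ((-1) ^ k * int (i choose k))", OF _ k]
   assms(1) unfolding binomial_basis_change[where x = \<zeta> and q = q and n = "l - 1"] lam_def[symmetric] by blast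
qed (rule assms(2))

end

section \<open>Algebraic numbers, inverses and common denominators\<close>

lemma algebraic_ipoly:
 fixes x :: complex
 shows "algebraic x \<longleftrightarrow> (\<exists>p :: int poly. p \<noteq> 0 \<and> poly (of_int_poly p) x = 0)"
proof
 assume "algebraic x"
 then obtain p where p: "\<And>i. poly.coeff p i \<in> \<int>" "p \<noteq> 0" "poly p x = 0"
  unfolding Polynomial.algebraic_def by blast
 define r where "r = map_poly (\<lambda>z. \<lfloor>Re z\<rfloor>) p"
 have "of_int_poly r = p"
 proof (rule poly_eqI)
  fix i
  obtain k where "poly.coeff p i = of_int k" using p(1)[of i] by (rule Ints_cases)
  thus "poly.coeff (of_int_poly r) i = poly.coeff p i" by (simp add: r_def coeff_map_poly)
 qed
 thus "\<exists>p :: int poly. p \<noteq> 0 \<and> poly (of_int_poly p) x = 0" using p by (intro exI[of _ r]) auto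
next
 assume "\<exists>p :: int poly. p \<noteq> 0 \<and> poly (of_int_poly p) x = 0"
 then obtain p :: "int poly" where "p \<noteq> 0" "poly (of_int_poly p) x = 0" by blast
 thus "algebraic x" by (intro algebraicI[of "of_int_poly p"]) auto
qed

lemma subring_inverse_closed:
 fixes S :: "complex set"
 assumes add: "\<And>x y. x \<in> S \<Longrightarrow> y \<in> S \<Longrightarrow> x + y \<in> S"
  and mult: "\<And>x y. x \<in> S \<Longrightarrow> y \<in> S \<Longrightarrow> x * y \<in> S"
  and rat: "\<And>q. of_rat q \<in> S"
  and x: "x \<in> S" "algebraic x"
 shows "inverse x \<in> S"
proof (cases "x = 0")
 case True
 thus ?thesis using rat[of 0] by simp
next
 case False
 have int: "of_int k \<in> S" for k using rat[of "of_int k"] by simp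
 have poly: "poly (of_int_poly p) x \<in> S" for p
 proof (induction p)
  case 0 show ?case using int[of 0] by simp
 next
  case (pCons a p)
  thus ?case using add[OF int[of a] mult[OF x(1) pCons(2)]] by simp
 qed
 have "inverse x \<in> S" if "p \<noteq> 0" "poly (of_int_poly p) x = 0" for p
  using that
 proof (induction p)
  case (pCons a p)
  show ?case
  proof (cases "a = 0")
   case True
   thus ?thesis using pCons False by simp
  next
   case a: False
   have "of_int a = - (x * poly (of_int_poly p) x)" using pCons.prems by (simp add: eq_neg_iff_add_eq_0)
   have "x * (of_rat (- inverse (of_int a)) * poly (of_int_poly p) x)
     = - inverse (of_int a) * (x * poly (of_int_poly p) x)" by (simp add: of_rat_minus of_rat_inverse)
   also have "x * poly (of_int_poly p) x = - of_int a" using \<open>of_int a = _\<close> by simp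
   finally have "x * (of_rat (- inverse (of_int a)) * poly (of_int_poly p) x) = 1" using a by simp
   hence "inverse x = of_rat (- inverse (of_int a)) * poly (of_int_poly p) x" by (rule inverse_unique)
   thus ?thesis using mult[OF rat poly] by simp
  qed
 qed simp
 thus ?thesis using x(2) unfolding algebraic_ipoly by blast
qed

lemma algebraic_if_multiple:
 assumes "algebraic_int (of_int d * x)" "d \<noteq> 0"
 shows "algebraic (x :: complex)"
proof -
 obtain p :: "int poly" where p: "p \<noteq> 0" "poly (of_int_poly p) (of_int d * x) = 0"
  using algebraic_int_imp_algebraic[OF assms(1)] unfolding algebraic_ipoly by blast
 define r where "r = pcompose p [:0, d:]"
 have "r \<noteq> 0" unfolding r_def using p(1) assms(2)
  by (metis degree_pCons_eq_if gr0I pCons_eq_0_iff pcompose_eq_0 zero_less_Suc)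
 moreover have "of_int_poly [:0, d:] = ([:0, of_int d:] :: complex poly)"
  by (intro poly_eqI) (simp add: coeff_map_poly coeff_pCons split: nat.splits)
 hence "poly (of_int_poly r) x = 0"
  unfolding r_def using p(2) by (simp add: of_int_hom.map_poly_pcompose poly_pcompose mult.commute)
 ultimately show ?thesis unfolding algebraic_ipoly by blast
qed

lemma common_denominator:
 fixes q :: "'i \<Rightarrow> rat"
 assumes "finite I"
 obtains d :: int and c :: "'i \<Rightarrow> int" where "d > 0" "\<And>i. i \<in> I \<Longrightarrow> of_int d * q i = of_int (c i)"
proof -
 have "\<exists>d c. d > (0::int) \<and> (\<forall>i\<in>I. of_int d * q i = of_int (c i))"
  using assms
 proof (induction I rule: finite_induct)
  case empty show ?case by (rule exI[of _ 1]) simp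
 next
  case (insert i I)
  then obtain d c where dc: "d > (0::int)" "\<forall>i\<in>I. of_int d * q i = of_int (c i)" by blast
  obtain a b where ab: "quotient_of (q i) = (a, b)" by fastforce
  have b: "b > 0" "q i = of_int a / of_int b" using quotient_of_denom_pos[OF ab] quotient_of_div[OF ab] by auto
  have "\<forall>j\<in>insert i I. of_int (b * d) * q j = of_int (if j = i then d * a else b * c j)"
   using dc b insert(2) by (auto simp: mult.assoc)
  moreover have "b * d > 0" using dc b by simp
  ultimately show ?case by (intro exI[of _ "b * d"] exI[of _ "\<lambda>j. if j = i then d * a else b * c j"]) simp
 qed
 thus ?thesis using that by blast
qed

context conj_pair
begin

lemma conjrel_multiple_algebraic_int:
 assumes "conjrel x x'" "algebraic_int z" "algebraic_int w"
 obtains d where "d \<noteq> 0" "algebraic_int (of_int d * x)"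
proof -
 obtain q where q: "x = bsum m n q z w" using assms(1) by (rule conjrelE)
 obtain d c where d: "d > (0::int)" "\<And>i. i \<in> {..<m} \<times> {..<n} \<Longrightarrow> of_int d * (case i of (a, b) \<Rightarrow> q a b) = of_int (c i)"
  using common_denominator[of "{..<m} \<times> {..<n}" "\<lambda>(a, b). q a b"] by (metis finite_cartesian_product finite_lessThan)
 have "of_int d * x = (\<Sum>i<m. \<Sum>j<n. of_rat (of_int d * q i j) * z ^ i * w ^ j)"
  unfolding q bsum_def by (simp add: sum_distrib_left of_rat_mult mult.assoc)
 also have "\<dots> = (\<Sum>i<m. \<Sum>j<n. of_int (c (i, j)) * z ^ i * w ^ j)"
  using d(2) by (intro sum.cong refl) force
 also have "algebraic_int \<dots>"
  by (intro algebraic_int_sum_complex algebraic_int_times_complex algebraic_int_power_complex assms) auto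
 finally show ?thesis using that[of d] d(1) by auto
qed

lemma conjrel_algebraic:
 assumes "conjrel x x'" "algebraic_int z" "algebraic_int w"
 shows "algebraic x"
 using conjrel_multiple_algebraic_int[OF assms] algebraic_if_multiple by metis

end

section \<open>The cyclotomic field, its conjugations and its p-integral elements\<close>

context cyclotomic
begin

definition cycF :: "complex set"
 where "cycF = {x. \<exists>q. x = (\<Sum>i<l-1. of_rat (q i) * \<zeta> ^ i)}"

text \<open>The cyclotomic field is the case of a trivial second generator: n = 1, D = 1 and w =
  1.\<close>

lemma conj_F: assumes "\<not> l dvd k" shows "conj_pair_indep l 1 1 \<zeta> 1 (\<zeta> ^ k) 1"
proof
 show "l > 0" by (rule l_pos)
 show "\<zeta> ^ l = 1" by (rule zeta_l)
 show "(\<zeta> ^ k) ^ l = 1" by (metis power_mult mult.commute zeta_l power_one)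
 show "(\<Sum>i<l. \<zeta> ^ i) = 0" using sum_zeta_power[of 1] l_ge_3 by simp
 show "(\<Sum>i<l. (\<zeta> ^ k) ^ i) = 0" using sum_zeta_power[of k] assms by simp
 fix q i j assume *: "(\<Sum>i<l-1. \<Sum>j<1. of_rat (q i j) * \<zeta> ^ i * 1 ^ j) = 0" "i < l - 1" "j < (1::nat)"
 show "q i j = 0" using zeta_independent[of "\<lambda>i. q i 0" i] * by simp
qed simp_all

lemma not_dvd_1: "\<not> l dvd 1" using l_ge_3 by simp

sublocale F: conj_pair_indep l 1 1 \<zeta> 1 \<zeta> 1
 using conj_F[OF not_dvd_1] by simp

text \<open>Being related to itself under the identity conjugation is another way of having
  coordinates. It turns the closure properties of \<open>conjrel\<close> into those of the
  field.\<close>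

lemma F_conjrel: "x \<in> cycF \<longleftrightarrow> F.conjrel x x"
proof
 assume "x \<in> cycF"
 then obtain q where q: "x = (\<Sum>i<l-1. of_rat (q i) * \<zeta> ^ i)" unfolding cycF_def by blast
 have "x = bsum (l - 1) 1 (\<lambda>i _. q i) \<zeta> 1" by (simp add: q bsum_def)
 thus "F.conjrel x x" using F.conjrel_bsum by simp
next
 assume "F.conjrel x x"
 then obtain q where "x = bsum l 1 q \<zeta> 1" by (rule F.conjrelE)
 hence "x = (\<Sum>i<l-1. of_rat (q i 0 - q (l - 1) 0) * \<zeta> ^ i)"
  unfolding F.bsum_reduce[OF F.sumz(1)] by simp
 thus "x \<in> cycF" unfolding cycF_def mem_Collect_eq
  by (intro exI[of _ "\<lambda>i. q i 0 - q (l - 1) 0"])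
qed

lemma F_add: "x \<in> cycF \<Longrightarrow> y \<in> cycF \<Longrightarrow> x + y \<in> cycF"
 unfolding F_conjrel by (rule F.conjrel_add)
lemma F_mult: "x \<in> cycF \<Longrightarrow> y \<in> cycF \<Longrightarrow> x * y \<in> cycF"
 unfolding F_conjrel by (rule F.conjrel_mult)
lemma F_rat: "of_rat q \<in> cycF"
 unfolding F_conjrel by (rule F.conjrel_rat)
lemma F_int: "of_int q \<in> cycF" using F_rat[of "of_int q"] by simp
lemma F_0: "0 \<in> cycF" using F_int[of 0] by simp
lemma F_1: "1 \<in> cycF" using F_int[of 1] by simp
lemma F_minus: "x \<in> cycF \<Longrightarrow> - x \<in> cycF" using F_mult[OF F_int[of "-1"], of x] by simp
lemma F_diff: "x \<in> cycF \<Longrightarrow> y \<in> cycF \<Longrightarrow> x - y \<in> cycF" using F_add[OF _ F_minus, of x y] by simp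
lemma F_zeta: "\<zeta> ^ k \<in> cycF"
 unfolding F_conjrel using F.conjrel_monom[of k 0] by simp
lemma F_power: "x \<in> cycF \<Longrightarrow> x ^ n \<in> cycF"
 by (induction n) (simp_all add: F_1 F_mult)
lemma F_sum: "(\<And>i. i \<in> I \<Longrightarrow> f i \<in> cycF) \<Longrightarrow> (\<Sum>i\<in>I. f i) \<in> cycF"
 by (induction I rule: infinite_finite_induct) (simp_all add: F_0 F_add)
lemma F_algebraic: "x \<in> cycF \<Longrightarrow> algebraic x"
 unfolding F_conjrel using F.conjrel_algebraic algebraic_int_zeta by auto
lemma F_inverse: assumes "x \<in> cycF" shows "inverse x \<in> cycF"
 by (rule subring_inverse_closed[OF _ _ _ assms F_algebraic[OF assms]]) (simp_all add: F_add F_mult F_rat)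
lemma F_divide: "x \<in> cycF \<Longrightarrow> y \<in> cycF \<Longrightarrow> x / y \<in> cycF"
 unfolding divide_inverse by (intro F_mult F_inverse)
lemma F_lam: "lam \<in> cycF" unfolding lam_def using F_diff[OF F_1 F_zeta[of 1]] by simp

lemma zeta_conj_pint:
 assumes "(\<Sum>i<l-1. of_rat (q i) * \<zeta> ^ i) \<in> pint p" "\<not> l dvd k"
 shows "(\<Sum>i<l-1. of_rat (q i) * (\<zeta> ^ k) ^ i) \<in> pint p"
proof -
 interpret c: conj_pair_indep l 1 1 \<zeta> 1 "\<zeta> ^ k" 1 by (rule conj_F[OF assms(2)])
 show ?thesis using c.conjrel_pint[OF c.conjrel_bsum[of "l-1" 1 "\<lambda>i _. q i"]] assms(1)
  by (simp add: bsum_def)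
qed

text \<open>Fourier inversion on the cyclic group of order \<open>l\<close>, taken against \<open>\<zeta>\<^bsup>-m\<^esup> - \<zeta>\<close> to avoid the
 value at the trivial character, which is not a conjugate.\<close>

lemma zeta_zloc:
 assumes p: "prime p" "p \<noteq> l"
  and y: "(\<Sum>i<l-1. of_rat (q i) * \<zeta> ^ i) \<in> pint p" and m: "m < l - 1"
 shows "q m \<in> zloc p"
proof -
 interpret P: prime_place p by standard (rule p(1))
 define Y where "Y k = (\<Sum>i<l-1. of_rat (q i) * (\<zeta> ^ k) ^ i)" for k
 have Y: "Y k \<in> pint p" if "k \<in> {..<l} - {0}" for k
 proof -
  have "\<not> l dvd k" using that by (auto dest: dvd_imp_le)
  thus ?thesis unfolding Y_def using zeta_conj_pint[OF y] by blast
 qed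
 have T: "(\<Sum>k<l. Y k * (\<zeta> ^ (l - r)) ^ k) = (if r < l - 1 then of_nat l * of_rat (q r) else 0)" if r: "r < l" for r
 proof -
  have "(\<Sum>k<l. Y k * (\<zeta> ^ (l - r)) ^ k) = (\<Sum>k<l. \<Sum>i<l-1. of_rat (q i) * (\<zeta> ^ (i + (l - r))) ^ k)"
   unfolding Y_def sum_distrib_right
   by (intro sum.cong refl) (simp add: power_add power_mult_distrib power_mult[symmetric] mult_ac)
  also have "\<dots> = (\<Sum>i<l-1. of_rat (q i) * (\<Sum>k<l. (\<zeta> ^ (i + (l - r))) ^ k))"
   by (subst sum.swap) (simp add: sum_distrib_left)
  also have "\<dots> = (\<Sum>i<l-1. if i = r then of_nat l * of_rat (q r) else 0)"
  proof (intro sum.cong refl)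
   fix i assume i: "i \<in> {..<l-1}"
   have "l dvd i + (l - r) \<longleftrightarrow> i = r"
   proof
    assume "l dvd i + (l - r)"
    then obtain t where t: "i + (l - r) = l * t" by (auto simp: dvd_def)
    have "0 < i + (l - r)" "i + (l - r) < l * 2" using i r by auto
    hence "0 < l * t" "l * t < l * 2" unfolding t by auto
    hence "t = 1" by auto
    thus "i = r" using t r by simp
   qed (use r in auto)
   thus "of_rat (q i) * (\<Sum>k<l. (\<zeta> ^ (i + (l - r))) ^ k) = (if i = r then of_nat l * of_rat (q r) else 0)"
    unfolding sum_zeta_power by auto
  qed
  finally show ?thesis by (simp add: sum.delta)
 qed
 have "of_nat l * of_rat (q m) = (\<Sum>k<l. Y k * (\<zeta> ^ (l - m)) ^ k) - (\<Sum>k<l. Y k * (\<zeta> ^ (l - (l - 1))) ^ k)"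
  using T[of m] T[of "l - 1"] m l_pos by simp
 also have "\<dots> = (\<Sum>k<l. Y k * ((\<zeta> ^ (l - m)) ^ k - (\<zeta> ^ (l - (l - 1))) ^ k))"
  by (simp add: sum_subtractf right_diff_distrib)
 \<comment> \<open>At k = 0 both powers are 1 and the term vanishes. \<open>Y 0\<close> is not a
   conjugate of the given element, so its integrality is not known.\<close>
 also have "\<dots> = (\<Sum>k\<in>{..<l} - {0}. Y k * ((\<zeta> ^ (l - m)) ^ k - (\<zeta> ^ (l - (l - 1))) ^ k))"
  by (rule sum.mono_neutral_right) auto
 also have "\<dots> \<in> pint p"
  by (intro P.pint_sum P.pint_mult P.pint_diff Y P.pint_power P.pint_algebraic_int algebraic_int_zeta)
 finally have lq: "of_nat l * of_rat (q m) \<in> pint p" .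
 have "\<not> int p dvd int l" using p prime_l primes_dvd_imp_eq by auto
 hence "inverse (of_int (int l)) * (of_nat l * of_rat (q m)) \<in> pint p"
  using P.pint_mult[OF P.pint_inverse_int lq] by blast
 also have "inverse (of_int (int l)) * (of_nat l * of_rat (q m)) = (of_rat (q m) :: complex)"
  using l_pos by (simp add: mult.assoc[symmetric])
 finally have "of_rat (q m) \<in> pint p" .
 thus ?thesis by (rule P.zloc_if_pint)
qed

text \<open>The powers of \<open>lam\<close> serve at every prime: at l by the descent, elsewhere
  because the integral triangular passage from the powers of \<zeta> preserves p-integral
  coordinates.\<close>

lemma F_coords:
 assumes p: "prime p" and x: "x \<in> cycF" "x \<in> pint p"
 obtains q where "x = (\<Sum>i<l-1. of_rat (q i) * lam ^ i)" "\<And>i. i < l - 1 \<Longrightarrow> q i \<in> zloc p"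
proof -
 obtain r where r: "x = (\<Sum>i<l-1. of_rat (r i) * \<zeta> ^ i)" using x(1) unfolding cycF_def by blast
 define q where "q k = (\<Sum>i<l-1. r i * of_int ((-1) ^ k * int (i choose k)))" for k
 have q: "x = (\<Sum>i<l-1. of_rat (q i) * lam ^ i)"
  unfolding r q_def lam_def by (rule binomial_basis_change)
 moreover have "q k \<in> zloc p" if k: "k < l - 1" for k
 proof (cases "p = l")
  case True
  thus ?thesis using lam_zloc[of q k] q x k by simp
 next
  case False
  interpret P: prime_place p by standard (rule p(1))
  have "r i \<in> zloc p" if "i < l - 1" for i using zeta_zloc[OF p False _ that] r x by simp
  hence "of_rat (r i) \<in> pint p" if "i < l - 1" for i using that P.pint_if_zloc by blast
  hence "(\<Sum>i<l-1. of_rat (r i) * of_int ((-1) ^ k * int (i choose k))) \<in> pint p"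
   by (intro P.pint_sum P.pint_mult P.pint_of_int) auto
  also have "(\<Sum>i<l-1. of_rat (r i) * of_int ((-1) ^ k * int (i choose k))) = of_rat (q k)"
   unfolding q_def of_rat_sum of_rat_mult of_rat_of_int_eq by (rule refl)
  finally show ?thesis by (rule P.zloc_if_pint)
 qed
 ultimately show ?thesis by (rule that)
qed

text \<open>\<open>p\<close> is unramified in the cyclotomic field, so \<open>\<int>[\<zeta>]\<close> modulo \<open>p\<close> is reduced: a power of
 Frobenius is the identity.\<close>

lemma zeta_frobenius:
 fixes c :: "nat \<Rightarrow> int"
 assumes p: "prime p" "p \<noteq> l"
 defines "y \<equiv> \<lambda>k. (\<Sum>i<l-1. of_int (c i) * \<zeta> ^ (k * i))"
 shows "prime_place.pcong p (y 1 ^ (p ^ f)) (y (p ^ f))"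
proof -
 interpret P: prime_place p by standard (rule p(1))
 have yp: "y k \<in> pint p" for k unfolding y_def
  by (intro P.pint_sum P.pint_mult P.pint_of_int P.pint_power P.pint_algebraic_int algebraic_int_zeta)
 have step: "P.pcong (y k ^ p) (y (k * p))" for k
 proof -
  have "P.pcong (y k ^ p) (\<Sum>i<l-1. (of_int (c i) * \<zeta> ^ (k * i)) ^ p)" unfolding y_def
   by (intro P.pcong_frobenius_sum P.pint_mult P.pint_of_int P.pint_power P.pint_algebraic_int algebraic_int_zeta)
  moreover have "P.pcong (\<Sum>i<l-1. (of_int (c i) * \<zeta> ^ (k * i)) ^ p) (y (k * p))" unfolding y_def
  proof (intro P.pcong_sum)
   fix i
   have "(of_int (c i) * \<zeta> ^ (k * i)) ^ p = of_int (c i) ^ p * \<zeta> ^ (k * p * i)"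
    by (simp add: power_mult_distrib power_mult[symmetric] mult_ac)
   thus "P.pcong ((of_int (c i) * \<zeta> ^ (k * i)) ^ p) (of_int (c i) * \<zeta> ^ (k * p * i))"
    by (simp only:, intro P.pcong_mult P.pcong_of_int_power P.pcong_refl P.pint_power P.pint_of_int
      P.pint_algebraic_int algebraic_int_zeta)
  qed
  ultimately show ?thesis by (rule P.pcong_trans)
 qed
 show ?thesis
 proof (induction f)
  case 0 show ?case by (simp add: P.pcong_refl)
 next
  case (Suc f)
  have "P.pcong ((y 1 ^ (p ^ f)) ^ p) (y (p ^ f) ^ p)"
   by (intro P.pcong_power Suc P.pint_power yp)
  moreover have "P.pcong (y (p ^ f) ^ p) (y (p ^ f * p))" by (rule step)
  ultimately have "P.pcong ((y 1 ^ (p ^ f)) ^ p) (y (p ^ f * p))" by (rule P.pcong_trans)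
  thus ?case by (simp only: power_Suc2 power_mult)
 qed
qed

text \<open>If Y is a multiple of \<pi>, then Y^(p^f) is a multiple of p, because p^f \<ge> l. When
  p^f = 1 modulo l, the f-th power of Frobenius fixes Y modulo p, so Y itself is a multiple of
  p.\<close>

lemma zeta_reduced:
 assumes p: "prime p" "p \<noteq> l"
  and pi: "\<pi> ^ l = of_nat p * u" "punit p u"
  and y: "(\<Sum>i<l-1. of_int (c i) * \<zeta> ^ i) = \<pi> * z" "z \<in> pint p"
 shows "(\<Sum>i<l-1. of_int (c i) * \<zeta> ^ i) / of_nat p \<in> pint p"
proof -
 interpret P: prime_place p by standard (rule p(1))
 define Y where "Y = (\<Sum>i<l-1. of_int (c i) * \<zeta> ^ i)"
 \<comment> \<open>The factor l - 1 gives p^f = 1 modulo l by Fermat; the factor l makes p^f at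
   least l.\<close>
 define f where "f = (l - 1) * l"
 have "coprime p l" using p prime_l by (simp add: primes_coprime)
 hence "[p ^ (l - 1) = 1] (mod l)"
  using fermat_theorem[OF prime_l] by (metis coprime_commute coprime_absorb_left not_prime_unit prime_l)
 hence "[(p ^ (l - 1)) ^ l = 1 ^ l] (mod l)" by (rule cong_pow)
 hence pf: "[p ^ f = 1] (mod l)" by (simp add: f_def power_mult)
 have "\<zeta> ^ (p ^ f * i) = \<zeta> ^ (1 * i)" for i
 proof -
  have "[p ^ f * i = 1 * i] (mod l)" using pf by (rule cong_scalar_right)
  thus ?thesis unfolding zeta_power_eq Cong.cong_def .
 qed
 hence c: "P.pcong (Y ^ (p ^ f)) Y"
  using zeta_frobenius[OF p, of c f] unfolding Y_def by simp
 have "l < 2 ^ l" by (rule less_exp)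
 also have "\<dots> \<le> p ^ l" using prime_ge_2_nat[OF p(1)] by (intro power_mono) auto
 also have "\<dots> \<le> p ^ f" using prime_gt_0_nat[OF p(1)] l_ge_3 unfolding f_def by (intro power_increasing) auto
 finally have "p ^ f = l + (p ^ f - l)" by simp
 hence "\<pi> ^ (p ^ f) = \<pi> ^ (l + (p ^ f - l))" by (rule arg_cong)
 hence "\<pi> ^ (p ^ f) = of_nat p * u * \<pi> ^ (p ^ f - l)" unfolding power_add pi(1) .
 hence "Y ^ (p ^ f) = of_nat p * (u * \<pi> ^ (p ^ f - l) * z ^ (p ^ f))"
  unfolding Y_def y(1) power_mult_distrib by (simp only: mult.assoc)
 hence "Y ^ (p ^ f) / of_nat p = u * \<pi> ^ (p ^ f - l) * z ^ (p ^ f)" using prime_gt_0_nat[OF p(1)] by simp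
 moreover have "\<pi> \<in> pint p"
 proof (rule P.pint_root)
  show "\<pi> ^ l \<in> pint p" unfolding pi(1) using pi(2) by (intro P.pint_mult P.pint_of_nat) (simp add: punit_def)
 qed (rule l_pos)
 hence "u * \<pi> ^ (p ^ f - l) * z ^ (p ^ f) \<in> pint p"
  using pi(2) y(2) by (intro P.pint_mult P.pint_power) (auto simp: punit_def)
 ultimately have "Y ^ (p ^ f) / of_nat p \<in> pint p" by simp
 moreover have "(Y ^ (p ^ f) - Y) / of_nat p \<in> pint p" using c by (simp add: P.pcong_def)
 ultimately have "Y ^ (p ^ f) / of_nat p - (Y ^ (p ^ f) - Y) / of_nat p \<in> pint p" by (rule P.pint_diff)
 thus ?thesis unfolding Y_def by (simp add: diff_divide_distrib)
qed

text \<open>The part of being a relative integral basis over \<open>cycF\<close> that depends on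
  ramification. Spanning and the integrality of the \<open>g j\<close> enter separately in
  \<open>p_basis_if_F_integral\<close>.\<close>

definition F_integral :: "nat \<Rightarrow> (nat \<Rightarrow> complex) \<Rightarrow> bool"
 where "F_integral p g \<longleftrightarrow> (\<forall>y. (\<forall>j<l. y j \<in> cycF) \<longrightarrow> (\<Sum>j<l. y j * g j) \<in> pint p \<longrightarrow> (\<forall>j<l. y j \<in> pint p))"

text \<open>Purity is tested on the l (l-1) products \<zeta>^i \<pi>^j. The descent runs with
  coefficients in Z[\<zeta>], where \<open>zeta_reduced\<close> supplies the passage from \<pi> to
  p, and \<open>zeta_zloc\<close> then splits each coefficient into integers.\<close>

lemma F_integral_unramified:
 assumes p: "prime p" "p \<noteq> l"
  and pi: "\<pi> ^ l = of_nat p * u" "punit p u"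
 shows "F_integral p (\<lambda>j. \<pi> ^ j)"
 unfolding F_integral_def
proof (intro allI impI)
 interpret P: prime_place p by standard (rule p(1))
 fix y k assume y: "\<forall>j<l. y j \<in> cycF" "(\<Sum>j<l. y j * \<pi> ^ j) \<in> pint p" and k: "k < l"
 have "\<forall>j\<in>{..<l}. \<exists>q. y j = (\<Sum>i<l-1. of_rat (q i) * \<zeta> ^ i)" using y(1) unfolding cycF_def by blast
 then obtain q where q: "\<And>j. j < l \<Longrightarrow> y j = (\<Sum>i<l-1. of_rat (q j i) * \<zeta> ^ i)" by (auto dest!: bchoice)
 have "(\<Sum>j<l. y j * \<pi> ^ j) = (\<Sum>j<l. \<Sum>i<l-1. of_rat (q j i) * (\<zeta> ^ i * \<pi> ^ j))"
  by (intro sum.cong refl) (simp add: q sum_distrib_right mult.assoc)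
 also have "\<dots> = (\<Sum>x\<in>{..<l}\<times>{..<l-1}. of_rat (case x of (j, i) \<Rightarrow> q j i) * (case x of (j, i) \<Rightarrow> \<zeta> ^ i * \<pi> ^ j))"
  by (simp add: sum.cartesian_product case_prod_unfold)
 finally have S: "(\<Sum>x\<in>{..<l}\<times>{..<l-1}. of_rat (case x of (j, i) \<Rightarrow> q j i) * (case x of (j, i) \<Rightarrow> \<zeta> ^ i * \<pi> ^ j)) \<in> pint p"
  using y(2) by simp
 have pure: "\<forall>x\<in>{..<l}\<times>{..<l-1}. int p dvd c x"
  if c: "(\<Sum>x\<in>{..<l}\<times>{..<l-1}. of_int (c x) * (case x of (j, i) \<Rightarrow> \<zeta> ^ i * \<pi> ^ j)) / of_nat p \<in> pint p"
  for c :: "nat \<times> nat \<Rightarrow> int"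
 proof -
  define w where "w j = (\<Sum>i<l-1. of_int (c (j, i)) * \<zeta> ^ i)" for j
  have "(\<Sum>j<l. w j * (\<pi> ^ j * 1)) = (\<Sum>j<l. \<Sum>i<l-1. of_int (c (j, i)) * (\<zeta> ^ i * \<pi> ^ j))"
   by (intro sum.cong refl) (simp add: w_def sum_distrib_right mult.assoc)
  also have "\<dots> = (\<Sum>x\<in>{..<l}\<times>{..<l-1}. of_int (c x) * (case x of (j, i) \<Rightarrow> \<zeta> ^ i * \<pi> ^ j))"
   by (simp add: sum.cartesian_product case_prod_unfold)
  finally have S: "(\<Sum>j<l. w j * (\<pi> ^ j * 1)) / of_nat p \<in> pint p" using c by simp
  have wp: "w j / of_nat p \<in> pint p" if "j < l" for j
  proof (rule P.ramified_dvd_general[where c = w and e = "\<lambda>_. 1", OF pi l_pos P.punit_1 _ _ S that])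
   show "w v \<in> pint p" for v unfolding w_def
    by (intro P.pint_sum P.pint_mult P.pint_of_int P.pint_power P.pint_algebraic_int algebraic_int_zeta)
   show "w v / of_nat p \<in> pint p" if "z \<in> pint p" "w v = \<pi> * z" for v z
    using zeta_reduced[OF p pi, of "\<lambda>i. c (v, i)" z] that unfolding w_def by blast
  qed
  have "int p dvd c (j, i)" if ji: "j < l" "i < l - 1" for j i
  proof -
   have "(\<Sum>i<l-1. of_rat (of_int (c (j, i)) / of_nat p) * \<zeta> ^ i) = w j / of_nat p"
    unfolding w_def sum_divide_distrib by (simp add: of_rat_divide)
   hence "(\<Sum>i<l-1. of_rat (of_int (c (j, i)) / of_nat p) * \<zeta> ^ i) \<in> pint p" using wp ji by simp
   hence "of_int (c (j, i)) / of_nat p \<in> zloc p" using zeta_zloc[where q = "\<lambda>i. of_int (c (j, i)) / of_nat p", OF p _ ji(2)] by blast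
   hence "of_rat (of_int (c (j, i)) / of_nat p) \<in> pint p" by (rule P.pint_if_zloc)
   thus ?thesis by (intro P.int_dvd_if_pint) (simp add: of_rat_divide)
  qed
  thus ?thesis by auto
 qed
 have "\<forall>x\<in>{..<l}\<times>{..<l-1}. (case x of (j, i) \<Rightarrow> q j i) \<in> zloc p"
  by (rule P.pure_zloc[OF _ pure S]) auto
 hence "q k i \<in> zloc p" if "i < l - 1" for i using k that by auto
 thus "y k \<in> pint p" unfolding q[OF k]
  by (intro P.pint_sum P.pint_mult P.pint_if_zloc P.pint_power P.pint_algebraic_int algebraic_int_zeta) auto
qed

text \<open>Up to a unit, lam^i \<pi>^j equals \<pi>^(i l + j). So \<pi> is a prime element for
  total ramification of l in degree l (l-1), and the descent over the integers treats all
  coordinates at once.\<close>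

lemma F_integral_ramified:
 assumes pi: "\<pi> ^ l = lam * e" "punit l e"
 shows "F_integral l (\<lambda>j. \<pi> ^ j)"
 unfolding F_integral_def
proof (intro allI impI)
 fix y k assume y: "\<forall>j<l. y j \<in> cycF" "(\<Sum>j<l. y j * \<pi> ^ j) \<in> pint l" and k: "k < l"
 have F: "\<exists>q. x = (\<Sum>i<l-1. of_rat (q i) * lam ^ i)" if x: "x \<in> cycF" for x
 proof -
  obtain r where r: "x = (\<Sum>i<l-1. of_rat (r i) * \<zeta> ^ i)" using x unfolding cycF_def by blast
  show ?thesis unfolding r lam_def
   by (rule exI[where x = "\<lambda>k. \<Sum>i<l-1. r i * of_int ((-1) ^ k * int (i choose k))"], rule binomial_basis_change)
 qed
 have "\<forall>j\<in>{..<l}. \<exists>q. y j = (\<Sum>i<l-1. of_rat (q i) * lam ^ i)" using y(1) F by blast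
 then obtain q where q: "\<And>j. j < l \<Longrightarrow> y j = (\<Sum>i<l-1. of_rat (q j i) * lam ^ i)" by (auto dest!: bchoice)
 obtain u where u: "lam ^ (l - 1) = of_nat l * u" "punit l u" by (rule lam_power)
 have e0: "e \<noteq> 0" using pi by (simp add: punit_def)
 have lam: "lam ^ i * \<pi> ^ j = \<pi> ^ (i * l + j) * inverse e ^ i" for i j
 proof -
  have "\<pi> ^ (i * l + j) = (lam * e) ^ i * \<pi> ^ j"
   unfolding power_add pi(1)[symmetric] by (simp add: power_mult[symmetric] mult.commute)
  thus ?thesis using e0 by (simp add: power_mult_distrib power_inverse)
 qed
 have N: "\<pi> ^ ((l - 1) * l) = of_nat l * (u * e ^ (l - 1))"
 proof -
  have "\<pi> ^ ((l - 1) * l) = (lam * e) ^ (l - 1)"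
   unfolding pi(1)[symmetric] by (simp add: power_mult[symmetric] mult.commute)
  thus ?thesis using u by (simp add: power_mult_distrib mult.assoc)
 qed
 have "(\<Sum>j<l. y j * \<pi> ^ j) = (\<Sum>j<l. \<Sum>i<l-1. of_rat (q j i) * (lam ^ i * \<pi> ^ j))"
  by (intro sum.cong refl) (simp add: q sum_distrib_right mult.assoc)
 also have "\<dots> = (\<Sum>i<l-1. \<Sum>j<l. of_rat (q j i) * (\<pi> ^ (i * l + j) * inverse e ^ i))"
  unfolding lam by (rule sum.swap)
 also have "\<dots> = (\<Sum>i<l-1. \<Sum>v\<in>{i*l..<i*l+l}. of_rat (q (v mod l) (v div l)) * (\<pi> ^ v * inverse e ^ (v div l)))"
 proof (rule sum.cong[OF refl])
  fix i
  show "(\<Sum>j<l. of_rat (q j i) * (\<pi> ^ (i * l + j) * inverse e ^ i))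
    = (\<Sum>v\<in>{i*l..<i*l+l}. of_rat (q (v mod l) (v div l)) * (\<pi> ^ v * inverse e ^ (v div l)))"
   by (rule sum.reindex_bij_witness[where i = "\<lambda>v. v - i * l" and j = "\<lambda>j. i * l + j"])
    (use l_pos in auto)
 qed
 also have "\<dots> = (\<Sum>v<(l-1)*l. of_rat (q (v mod l) (v div l)) * (\<pi> ^ v * inverse e ^ (v div l)))"
  by (rule sum.nat_group)
 finally have S: "(\<Sum>v<(l-1)*l. of_rat (q (v mod l) (v div l)) * (\<pi> ^ v * inverse e ^ (v div l))) \<in> pint l"
  using y(2) by simp
 have "q k i \<in> zloc l" if i: "i < l - 1" for i
 proof -
  have v: "i * l + k < (l - 1) * l"
  proof -
   have "i * l + k < (i + 1) * l" using k by simp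
   also have "\<dots> \<le> (l - 1) * l" using i by (intro mult_le_mono) auto
   finally show ?thesis .
  qed
  have "q ((i * l + k) mod l) ((i * l + k) div l) \<in> zloc l"
  proof (rule L.ramified_zloc[where e = "\<lambda>v. inverse e ^ (v div l)" and q = "\<lambda>v. q (v mod l) (v div l)", OF N _ _ _ S v])
   show "punit l (u * e ^ (l - 1))" by (intro L.punit_mult u L.punit_power pi)
   show "0 < (l - 1) * l" using l_ge_3 by simp
   show "punit l (inverse e ^ (v div l))" for v by (intro L.punit_power L.punit_inverse pi)
  qed
  thus ?thesis using k by simp
 qed
 hence "of_rat (q k i) \<in> pint l" if "i < l - 1" for i using that L.pint_if_zloc by blast
 moreover have "lam \<in> pint l" unfolding lam_def
  by (intro L.pint_diff L.pint_1 L.pint_algebraic_int algebraic_int_zeta)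
 ultimately show "y k \<in> pint l" unfolding q[OF k]
  by (intro L.pint_sum L.pint_mult L.pint_power) auto
qed

text \<open>Scaling a relation so that its j-th coefficient becomes 1/p contradicts integrality,
  since the sum is still 0.\<close>

lemma F_integral_independent:
 assumes g: "F_integral p g" and p: "prime p"
  and y: "\<And>j. j < l \<Longrightarrow> y j \<in> cycF" "(\<Sum>j<l. y j * g j) = 0" and j: "j < l"
 shows "y j = 0"
proof (rule ccontr)
 interpret P: prime_place p by standard (rule p(1))
 assume n: "y j \<noteq> 0"
 define w where "w i = y i * (inverse (y j) / of_nat p)" for i
 have "w i \<in> cycF" if "i < l" for i unfolding w_def
  using F_divide[OF F_inverse[OF y(1)[OF j]] F_int[of "int p"]] y(1)[OF that] by (intro F_mult) auto
 moreover have "(\<Sum>i<l. w i * g i) = (\<Sum>i<l. y i * g i) * (inverse (y j) / of_nat p)"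
  unfolding w_def sum_distrib_right by (intro sum.cong refl) (simp only: mult_ac)
 hence "(\<Sum>i<l. w i * g i) \<in> pint p" using y(2) P.pint_0 by simp
 ultimately have "w j \<in> pint p" using g j unfolding F_integral_def by blast
 hence "of_int 1 / of_nat p \<in> pint p" unfolding w_def using n by (simp add: field_simps)
 hence "int p dvd 1" by (rule P.int_dvd_if_pint)
 thus False using P.not_dvd_one by simp
qed

end

subsection \<open>Subfields of the complex numbers\<close>

lemma complex_ring_simps [simp]:
 "carrier complex_ring = UNIV"
 "mult complex_ring x y = x * y" "ring.add complex_ring x y = x + y"
 "one complex_ring = 1" "ring.zero complex_ring = 0"
 by (simp_all add: ring_of_type_algebra_def)

lemma field_C: "field complex_ring"
 by (rule field_from_type_algebra)

interpretation C: ring complex_ring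
 by (rule ring_from_type_algebra)

lemma C_a_inv: "a_inv complex_ring x = - x"
 by (rule C.minus_equality) simp_all

lemma C_m_inv: "x \<noteq> 0 \<Longrightarrow> m_inv complex_ring x = inverse x"
 by (rule C.inv_char) simp_all

lemma subfield_complexI:
 assumes "1 \<in> K" "\<And>x y. x \<in> K \<Longrightarrow> y \<in> K \<Longrightarrow> x + y \<in> K" "\<And>x y. x \<in> K \<Longrightarrow> y \<in> K \<Longrightarrow> x * y \<in> K"
  "\<And>x. x \<in> K \<Longrightarrow> - x \<in> K" "\<And>x. x \<in> K \<Longrightarrow> inverse x \<in> K"
 shows "subfield K complex_ring"
proof (rule field.subfieldI'[OF field_C])
 show "subring K complex_ring" by (rule C.subringI) (simp_all add: assms C_a_inv)
 show "m_inv complex_ring k \<in> K" if "k \<in> K - {ring.zero complex_ring}" for k using that assms(5)[of k] C_m_inv[of k] by simp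
qed

lemma subfield_complexD:
 assumes "subfield K complex_ring"
 shows "1 \<in> K" "x \<in> K \<Longrightarrow> y \<in> K \<Longrightarrow> x + y \<in> K" "x \<in> K \<Longrightarrow> y \<in> K \<Longrightarrow> x * y \<in> K"
  "x \<in> K \<Longrightarrow> - x \<in> K" "x \<in> K \<Longrightarrow> inverse x \<in> K"
proof -
 interpret subring K complex_ring by (rule subfieldE(1)[OF assms])
 show "1 \<in> K" "x \<in> K \<Longrightarrow> y \<in> K \<Longrightarrow> x + y \<in> K" "x \<in> K \<Longrightarrow> y \<in> K \<Longrightarrow> x * y \<in> K"
  using one_closed m_closed[of x y] subringE(7)[OF subfieldE(1)[OF assms], of x y] by simp_all
 show "x \<in> K \<Longrightarrow> - x \<in> K" using subringE(5)[OF subfieldE(1)[OF assms], of x] by (simp add: C_a_inv)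
 have "0 \<in> K" using subringE(2)[OF subfieldE(1)[OF assms]] by simp
 thus "x \<in> K \<Longrightarrow> inverse x \<in> K"
  using C.subfield_m_inv(1)[OF assms, of x] C_m_inv[of x] by (cases "x = 0") auto
qed

lemma subfield_complex_of_rat:
 assumes "subfield K complex_ring"
 shows "of_rat q \<in> K"
proof -
 note * = subfield_complexD[OF assms]
 have nat: "of_nat n \<in> K" for n
  by (induction n) (use *(1,2) *(2)[OF *(1) *(4)[OF *(1)]] in auto)
 have int: "of_int k \<in> K" for k
  using nat *(4) by (cases k rule: int_cases2) auto
 obtain a b where ab: "quotient_of q = (a, b)" by fastforce
 have "q = of_int a / of_int b" using quotient_of_div[OF ab] .
 hence "of_rat q = of_int a / (of_int b :: complex)" by (simp add: of_rat_divide)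
 hence "of_rat q = of_int a * inverse (of_int b :: complex)" by (simp only: divide_inverse)
 thus ?thesis using *(3)[OF int *(5)[OF int]] by simp
qed

lemma subfield_Rats: "subfield \<rat> complex_ring"
 by (rule subfield_complexI) auto

definition ratspan :: "'i set \<Rightarrow> ('i \<Rightarrow> complex) \<Rightarrow> complex set"
 where "ratspan I b = {x. \<exists>q. x = (\<Sum>i\<in>I. of_rat (q i) * b i)}"

lemma ratspan_insert:
 assumes "finite I" "i \<notin> I"
 shows "x \<in> ratspan (insert i I) b \<longleftrightarrow> (\<exists>r. \<exists>y\<in>ratspan I b. x = of_rat r * b i + y)"
proof
 assume "x \<in> ratspan (insert i I) b"
 then obtain q where "x = (\<Sum>i\<in>insert i I. of_rat (q i) * b i)" unfolding ratspan_def by blast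
 hence "x = of_rat (q i) * b i + (\<Sum>i\<in>I. of_rat (q i) * b i)" using assms by simp
 thus "\<exists>r. \<exists>y\<in>ratspan I b. x = of_rat r * b i + y" unfolding ratspan_def by blast
next
 assume "\<exists>r. \<exists>y\<in>ratspan I b. x = of_rat r * b i + y"
 then obtain r q where "x = of_rat r * b i + (\<Sum>i\<in>I. of_rat (q i) * b i)" unfolding ratspan_def by blast
 also have "\<dots> = (\<Sum>j\<in>insert i I. of_rat (if j = i then r else q j) * b j)"
  using assms by (subst sum.insert) (auto intro!: sum.cong)
 finally show "x \<in> ratspan (insert i I) b" unfolding ratspan_def mem_Collect_eq
  by (intro exI[of _ "\<lambda>j. if j = i then r else q j"])
qed

lemma Span_Rats:
 assumes "distinct xs"
 shows "C.Span \<rat> (map b xs) = ratspan (set xs) b"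
 using assms
proof (induction xs)
 case Nil
 show ?case by (auto simp: ratspan_def)
next
 case (Cons i xs)
 show ?case
 proof (rule Set.set_eqI)
  fix x
  have e: "C.Span \<rat> (map b (i # xs)) = C.line_extension \<rat> (b i) (C.Span \<rat> (map b xs))" by simp
  have "x \<in> C.Span \<rat> (map b (i # xs)) \<longleftrightarrow> (\<exists>k\<in>\<rat>. \<exists>y\<in>C.Span \<rat> (map b xs). x = k * b i + y)"
   unfolding e C.line_extension_mem_iff by simp
  also have "\<dots> \<longleftrightarrow> x \<in> ratspan (set (i # xs)) b"
   using Cons ratspan_insert[of "set xs" i x b] by (auto simp: Rats_def simp del: C.Span.simps)
  finally show "x \<in> C.Span \<rat> (map b (i # xs)) \<longleftrightarrow> x \<in> ratspan (set (i # xs)) b" .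
 qed
qed

lemma independent_Rats:
 assumes "distinct xs" "\<And>q i. (\<Sum>i\<in>set xs. of_rat (q i) * b i) = 0 \<Longrightarrow> i \<in> set xs \<Longrightarrow> q i = 0"
 shows "C.independent \<rat> (map b xs)"
 using assms
proof (induction xs)
 case (Cons i xs)
 have "C.independent \<rat> (map b xs)"
 proof (rule Cons.IH)
  show "distinct xs" using Cons.prems by simp
  fix q j assume *: "(\<Sum>i\<in>set xs. of_rat (q i) * b i) = 0" "j \<in> set xs"
  have "(\<Sum>k\<in>set (i # xs). of_rat (if k = i then 0 else q k) * b k) = (\<Sum>i\<in>set xs. of_rat (q i) * b i)"
   using Cons.prems(1) by (subst list.set) (subst sum.insert, auto intro!: sum.cong)
  hence "(if j = i then 0 else q j) = 0" using Cons.prems(2)[of "\<lambda>k. if k = i then 0 else q k" j] * by simp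
  thus "q j = 0" using * Cons.prems(1) by (auto split: if_splits)
 qed
 moreover have "b i \<notin> C.Span \<rat> (map b xs)"
 proof
  assume "b i \<in> C.Span \<rat> (map b xs)"
  hence "b i \<in> ratspan (set xs) b" using Span_Rats[of xs b] Cons.prems(1) by (simp del: C.Span.simps)
  then obtain q where q: "b i = (\<Sum>i\<in>set xs. of_rat (q i) * b i)" unfolding ratspan_def by blast
  have "(\<Sum>k\<in>set (i # xs). of_rat (if k = i then -1 else q k) * b k) = - b i + (\<Sum>i\<in>set xs. of_rat (q i) * b i)"
   using Cons.prems(1) by (subst list.set) (subst sum.insert, auto intro!: sum.cong)
  hence "(if i = i then -1 else q i) = (0 :: rat)"
   using Cons.prems(2)[of "\<lambda>k. if k = i then -1 else q k" i] q by simp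
  thus False by simp
 qed
 ultimately show ?case using C.li_Cons[of "b i" "\<rat>" "map b xs"] by simp
qed simp

lemma finite_dimension_ratspan:
 assumes "finite I"
 shows "C.finite_dimension \<rat> (ratspan I b)"
proof -
 obtain xs where "distinct xs" "set xs = I" using finite_distinct_list[OF assms] by blast
 thus ?thesis using C.Span_finite_dimension[OF subfield_Rats, of "map b xs"] Span_Rats[of xs b] by simp
qed

lemma dim_ratspan:
 assumes "finite I" "\<And>q i. (\<Sum>i\<in>I. of_rat (q i) * b i) = 0 \<Longrightarrow> i \<in> I \<Longrightarrow> q i = 0"
 shows "C.dim \<rat> (ratspan I b) = card I"
proof -
 obtain xs where xs: "distinct xs" "set xs = I" using finite_distinct_list[OF assms(1)] by blast
 have "C.independent \<rat> (map b xs)" using independent_Rats[of xs b] xs assms(2) by simp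
 hence "C.dimension (length (map b xs)) \<rat> (C.Span \<rat> (map b xs))" by (rule C.dimension_independent)
 hence "C.dimension (card I) \<rat> (ratspan I b)"
  using xs Span_Rats[of xs b] distinct_card[of xs] by simp
 thus ?thesis using C.dimI[OF subfield_Rats] by (simp add: over_def)
qed

subsection \<open>The splitting field of \<open>x ^ l - D\<close>\<close>

text \<open>The radicand is normalised at \<open>p0\<close>; every pure field has such a generator.\<close>

locale kummer = cyclotomic +
 fixes D :: int and \<alpha> :: complex and p0 :: nat
 assumes alpha: "\<alpha> ^ l = of_int D" and prime_p0: "prime p0"
  and mult_p0: "multiplicity (int p0) D = 1"
begin

sublocale P0: prime_place p0 by standard (rule prime_p0)

lemma D_nz: "D \<noteq> 0" using mult_p0 by (intro notI) simp

lemma alpha_nz: "\<alpha> \<noteq> 0" using alpha D_nz l_pos by (intro notI) (simp add: power_0_left)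

lemma algebraic_int_alpha: "algebraic_int \<alpha>"
 using algebraic_int_root[of "of_int D" "Polynomial.monom 1 l" \<alpha>] l_pos alpha
 by (auto simp: poly_monom degree_monom_eq)

lemma D_decomp:
 assumes "prime p" "multiplicity (int p) D = 1"
 obtains d where "D = int p * d" "\<not> int p dvd d"
proof -
 have "\<not> is_unit (int p)" using assms(1) by (metis not_prime_unit prime_nat_int_transfer)
 then obtain d where "D = int p ^ multiplicity (int p) D * d" "\<not> int p dvd d"
  using multiplicity_decompose'[OF D_nz, of "int p"] by blast
 hence "D = int p * d" "\<not> int p dvd d" using assms(2) by simp_all
 thus ?thesis by (rule that)
qed

lemma F_integral_alpha:
 assumes p: "prime p" "p \<noteq> l" "multiplicity (int p) D = 1"
 shows "F_integral p (\<lambda>j. \<alpha> ^ j)"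
proof -
 interpret P: prime_place p by standard (rule p(1))
 obtain d where d: "D = int p * d" "\<not> int p dvd d" using D_decomp p by blast
 show ?thesis
  by (rule F_integral_unramified[OF p(1,2), of \<alpha> "of_int d"]) (use d alpha P.punit_of_int in auto)
qed

text \<open>At p0 different from l the number \<alpha> itself serves as \<pi>. If p0 = l, valuations
  with v(l) = 1 give v(lam) = 1/(l-1) and v(\<alpha>) = 1/l, so lam/\<alpha> has value 1/(l(l-1))
  and satisfies the totally ramified criterion.\<close>

lemma alpha_F_independent:
 assumes y: "\<And>j. j < l \<Longrightarrow> y j \<in> cycF" "(\<Sum>j<l. y j * \<alpha> ^ j) = 0" and j: "j < l"
 shows "y j = 0"
proof (cases "p0 = l")
 case False
 show ?thesis using F_integral_independent[OF F_integral_alpha[OF prime_p0 False mult_p0] prime_p0 y j] by simp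
next
 case True
 obtain d where d: "D = int l * d" "\<not> int l dvd d" using D_decomp prime_p0 mult_p0 True by blast
 obtain u where u: "lam ^ (l - 1) = of_nat l * u" "punit l u" by (rule lam_power)
 define \<pi> where "\<pi> = lam / \<alpha>"
 have "lam ^ l = lam * lam ^ (l - 1)" using l_pos by (cases l) auto
 moreover have "\<pi> ^ l = lam ^ l / of_int D" unfolding \<pi>_def power_divide alpha ..
 ultimately have "\<pi> ^ l = lam * (u * inverse (of_int d))"
  using l_pos by (simp only: u(1) d(1)) (simp add: divide_inverse)
 moreover have "punit l (u * inverse (of_int d))"
  using u d L.punit_of_int by (intro L.punit_mult L.punit_inverse)
 ultimately have I: "F_integral l (\<lambda>j. \<pi> ^ j)" by (rule F_integral_ramified)
 \<comment> \<open>Dividing by \<alpha>^(l-1) turns a combination of powers of \<alpha> into one of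
   powers of lam/\<alpha>, with the order of the coefficients reversed.\<close>
 define w where "w i = y (l - 1 - i) * inverse lam ^ i" for i
 have wF: "w i \<in> cycF" if "i < l" for i
  unfolding w_def using that by (intro F_mult y(1) F_power F_inverse F_lam) auto
 have "(\<Sum>i<l. w i * \<pi> ^ i) = (\<Sum>i<l. y (l - Suc i) * \<alpha> ^ (l - Suc i)) * inverse \<alpha> ^ (l - 1)"
  unfolding sum_distrib_right
 proof (intro sum.cong refl)
  fix i assume i: "i \<in> {..<l}"
  have "\<alpha> ^ (l - 1) = \<alpha> ^ (l - Suc i + i)" using i by simp
  hence "\<alpha> ^ (l - 1) = \<alpha> ^ (l - Suc i) * \<alpha> ^ i" by (simp only: power_add)
  thus "w i * \<pi> ^ i = y (l - Suc i) * \<alpha> ^ (l - Suc i) * inverse \<alpha> ^ (l - 1)"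
   using lam_nz alpha_nz by (simp add: w_def \<pi>_def power_inverse power_divide field_simps)
 qed
 also have "(\<Sum>i<l. y (l - Suc i) * \<alpha> ^ (l - Suc i)) = (\<Sum>i<l. y i * \<alpha> ^ i)"
  by (rule sum.nat_diff_reindex)
 finally have "(\<Sum>i<l. w i * \<pi> ^ i) = 0" using y(2) by simp
 hence "w (l - 1 - j) = 0"
  using F_integral_independent[where j = "l - 1 - j", OF I prime_l wF] l_pos by simp
 thus ?thesis using lam_nz j by (simp add: w_def)
qed

lemma conj_K:
 assumes "\<not> l dvd a"
 shows "conj_pair_indep l l (of_int D) \<zeta> \<alpha> (\<zeta> ^ a) (\<zeta> ^ b * \<alpha>)"
proof -
 interpret c: conj_pair_indep l 1 1 \<zeta> 1 "\<zeta> ^ a" 1 by (rule conj_F[OF assms])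
 show ?thesis
 proof
  show "(\<zeta> ^ b * \<alpha>) ^ l = of_rat (of_int D)"
   unfolding power_mult_distrib alpha by (metis mult_1 power_mult mult.commute zeta_l power_one of_rat_of_int_eq)
  fix q i j assume *: "(\<Sum>i<l-1. \<Sum>j<l. of_rat (q i j) * \<zeta> ^ i * \<alpha> ^ j) = 0" "i < l - 1" "j < l"
  have "(\<Sum>j<l. (\<Sum>i<l-1. of_rat (q i j) * \<zeta> ^ i) * \<alpha> ^ j) = (\<Sum>j<l. \<Sum>i<l-1. of_rat (q i j) * \<zeta> ^ i * \<alpha> ^ j)"
   by (simp add: sum_distrib_right)
  also have "\<dots> = 0" using *(1) by (subst sum.swap) simp
  finally have 0: "(\<Sum>j<l. (\<Sum>i<l-1. of_rat (q i j) * \<zeta> ^ i) * \<alpha> ^ j) = 0" .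
  have "(\<Sum>i<l-1. of_rat (q i j) * \<zeta> ^ i) \<in> cycF" for j
   by (intro F_sum F_mult F_rat F_zeta)
  hence "(\<Sum>i<l-1. of_rat (q i j) * \<zeta> ^ i) = 0"
   using alpha_F_independent[where y = "\<lambda>j. \<Sum>i<l-1. of_rat (q i j) * \<zeta> ^ i", OF _ 0 *(3)] by blast
  thus "q i j = 0" using zeta_independent[where q = "\<lambda>i. q i j", OF _ *(2)] by blast
 qed (use c.zm c.sumz l_pos alpha in simp_all)
qed

sublocale K: conj_pair_indep l l "of_int D" \<zeta> \<alpha> \<zeta> \<alpha>
 using conj_K[OF not_dvd_1, of 0] by simp

definition kumK :: "complex set"
 where "kumK = {x. \<exists>y. (\<forall>j<l. y j \<in> cycF) \<and> x = (\<Sum>j<l. y j * \<alpha> ^ j)}"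

lemma K_conjrel: "x \<in> kumK \<longleftrightarrow> K.conjrel x x"
proof
 assume "x \<in> kumK"
 then obtain y where y: "\<forall>j<l. y j \<in> cycF" "x = (\<Sum>j<l. y j * \<alpha> ^ j)" unfolding kumK_def by blast
 have "\<forall>j\<in>{..<l}. \<exists>q. y j = (\<Sum>i<l-1. of_rat (q i) * \<zeta> ^ i)" using y(1) unfolding cycF_def by blast
 then obtain q where q: "\<And>j. j < l \<Longrightarrow> y j = (\<Sum>i<l-1. of_rat (q j i) * \<zeta> ^ i)" by (auto dest!: bchoice)
 have "x = (\<Sum>j<l. \<Sum>i<l-1. of_rat (q j i) * \<zeta> ^ i * \<alpha> ^ j)"
  unfolding y(2) by (intro sum.cong refl) (simp add: q sum_distrib_right)
 also have "\<dots> = bsum (l - 1) l (\<lambda>i j. q j i) \<zeta> \<alpha>" unfolding bsum_def by (rule sum.swap)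
 finally show "K.conjrel x x" using K.conjrel_bsum by simp
next
 assume "K.conjrel x x"
 then obtain q where q: "x = bsum l l q \<zeta> \<alpha>" by (rule K.conjrelE)
 have "x = (\<Sum>j<l. (\<Sum>i<l. of_rat (q i j) * \<zeta> ^ i) * \<alpha> ^ j)"
  unfolding q bsum_def by (subst sum.swap) (simp add: sum_distrib_right)
 moreover have "(\<Sum>i<l. of_rat (q i j) * \<zeta> ^ i) \<in> cycF" for j by (intro F_sum F_mult F_rat F_zeta)
 ultimately show "x \<in> kumK" unfolding kumK_def mem_Collect_eq
  by (intro exI[of _ "\<lambda>j. \<Sum>i<l. of_rat (q i j) * \<zeta> ^ i"]) simp
qed

lemma K_add: "x \<in> kumK \<Longrightarrow> y \<in> kumK \<Longrightarrow> x + y \<in> kumK"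
 unfolding K_conjrel by (rule K.conjrel_add)
lemma K_mult: "x \<in> kumK \<Longrightarrow> y \<in> kumK \<Longrightarrow> x * y \<in> kumK"
 unfolding K_conjrel by (rule K.conjrel_mult)
lemma K_rat: "of_rat q \<in> kumK"
 unfolding K_conjrel by (rule K.conjrel_rat)
lemma K_int: "of_int q \<in> kumK" using K_rat[of "of_int q"] by simp
lemma K_0: "0 \<in> kumK" using K_int[of 0] by simp
lemma K_1: "1 \<in> kumK" using K_int[of 1] by simp
lemma K_minus: "x \<in> kumK \<Longrightarrow> - x \<in> kumK" using K_mult[OF K_int[of "-1"], of x] by simp
lemma K_diff: "x \<in> kumK \<Longrightarrow> y \<in> kumK \<Longrightarrow> x - y \<in> kumK" using K_add[OF _ K_minus, of x y] by simp
lemma K_zeta: "\<zeta> ^ k \<in> kumK" unfolding K_conjrel using K.conjrel_monom[of k 0] by simp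
lemma K_alpha: "\<alpha> \<in> kumK" unfolding K_conjrel using K.conjrel_monom[of 0 1] by simp
lemma K_power: "x \<in> kumK \<Longrightarrow> x ^ n \<in> kumK"
 by (induction n) (simp_all add: K_1 K_mult)
lemma K_sum: "(\<And>i. i \<in> I \<Longrightarrow> f i \<in> kumK) \<Longrightarrow> (\<Sum>i\<in>I. f i) \<in> kumK"
 by (induction I rule: infinite_finite_induct) (simp_all add: K_0 K_add)
lemma K_algebraic: "x \<in> kumK \<Longrightarrow> algebraic x"
 unfolding K_conjrel using K.conjrel_algebraic algebraic_int_zeta algebraic_int_alpha by auto
lemma K_inverse: assumes "x \<in> kumK" shows "inverse x \<in> kumK"
 by (rule subring_inverse_closed[OF _ _ _ assms K_algebraic[OF assms]]) (simp_all add: K_add K_mult K_rat)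
lemma K_divide: "x \<in> kumK \<Longrightarrow> y \<in> kumK \<Longrightarrow> x / y \<in> kumK"
 unfolding divide_inverse by (intro K_mult K_inverse)
lemma K_F: "x \<in> cycF \<Longrightarrow> x \<in> kumK"
 unfolding cycF_def by (auto intro!: K_sum K_mult K_rat K_zeta)

lemma subfield_K: "subfield kumK complex_ring"
 by (rule subfield_complexI) (simp_all add: K_1 K_add K_mult K_minus K_inverse)

text \<open>Meaningful on \<open>kumK\<close> and for a prime to l, where independence makes the
  relation single-valued. Elsewhere the value is unspecified, so embeddings are obtained as
  restrictions.\<close>

definition sig :: "nat \<Rightarrow> nat \<Rightarrow> complex \<Rightarrow> complex"
 where "sig a b x = (THE x'. conj_pair.conjrel l l \<zeta> \<alpha> (\<zeta> ^ a) (\<zeta> ^ b * \<alpha>) x x')"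

lemma sig_eqI:
 assumes "\<not> l dvd a" "conj_pair.conjrel l l \<zeta> \<alpha> (\<zeta> ^ a) (\<zeta> ^ b * \<alpha>) x x'"
 shows "sig a b x = x'"
proof -
 interpret c: conj_pair_indep l l "of_int D" \<zeta> \<alpha> "\<zeta> ^ a" "\<zeta> ^ b * \<alpha>" by (rule conj_K[OF assms(1)])
 show ?thesis unfolding sig_def using assms(2) c.conjrel_unique by blast
qed

lemma sig_conjrel:
 assumes "\<not> l dvd a" "x \<in> kumK"
 shows "conj_pair.conjrel l l \<zeta> \<alpha> (\<zeta> ^ a) (\<zeta> ^ b * \<alpha>) x (sig a b x)"
proof -
 interpret c: conj_pair_indep l l "of_int D" \<zeta> \<alpha> "\<zeta> ^ a" "\<zeta> ^ b * \<alpha>" by (rule conj_K[OF assms(1)])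
 obtain q where "x = bsum l l q \<zeta> \<alpha>" using assms(2) unfolding K_conjrel by (rule K.conjrelE)
 hence "c.conjrel x (bsum l l q (\<zeta> ^ a) (\<zeta> ^ b * \<alpha>))" using c.conjrelI by simp
 thus ?thesis using sig_eqI[OF assms(1)] by metis
qed

context
 fixes a b :: nat assumes a: "\<not> l dvd a"
begin

interpretation c: conj_pair_indep l l "of_int D" \<zeta> \<alpha> "\<zeta> ^ a" "\<zeta> ^ b * \<alpha>" by (rule conj_K[OF a])

lemma sig_add: "x \<in> kumK \<Longrightarrow> y \<in> kumK \<Longrightarrow> sig a b (x + y) = sig a b x + sig a b y"
 by (intro sig_eqI[OF a] c.conjrel_add sig_conjrel[OF a])
lemma sig_mult: "x \<in> kumK \<Longrightarrow> y \<in> kumK \<Longrightarrow> sig a b (x * y) = sig a b x * sig a b y"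
 by (intro sig_eqI[OF a] c.conjrel_mult sig_conjrel[OF a])
lemma sig_rat: "sig a b (of_rat q) = of_rat q"
 by (intro sig_eqI[OF a] c.conjrel_rat)
lemma sig_int: "sig a b (of_int q) = of_int q"
 using sig_rat[of "of_int q"] by simp
lemma sig_zeta: "sig a b (\<zeta> ^ k) = (\<zeta> ^ a) ^ k"
 using sig_eqI[OF a c.conjrel_monom[of k 0]] by simp
lemma sig_alpha: "sig a b \<alpha> = \<zeta> ^ b * \<alpha>"
 using sig_eqI[OF a c.conjrel_monom[of 0 1]] by simp
lemma sig_bsum: "sig a b (bsum m n q \<zeta> \<alpha>) = bsum m n q (\<zeta> ^ a) (\<zeta> ^ b * \<alpha>)"
 by (intro sig_eqI[OF a] c.conjrel_bsum)
lemma sig_power: "x \<in> kumK \<Longrightarrow> sig a b (x ^ n) = sig a b x ^ n"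
 using sig_int[of 1] by (induction n) (simp_all add: sig_mult K_power)
lemma sig_sum: "(\<And>i. i \<in> I \<Longrightarrow> f i \<in> kumK) \<Longrightarrow> sig a b (\<Sum>i\<in>I. f i) = (\<Sum>i\<in>I. sig a b (f i))"
 using sig_int[of 0] by (induction I rule: infinite_finite_induct) (simp_all add: sig_add K_sum)
lemma sig_diff: "x \<in> kumK \<Longrightarrow> y \<in> kumK \<Longrightarrow> sig a b (x - y) = sig a b x - sig a b y"
 using sig_add[of "x - y" y] by (simp add: K_diff)
lemma sig_inverse: assumes "x \<in> kumK" shows "sig a b (inverse x) = inverse (sig a b x)"
proof (cases "x = 0")
 case True thus ?thesis using sig_int[of 0] by simp
next
 case False
 have "sig a b x * sig a b (inverse x) = sig a b (x * inverse x)" using assms K_inverse sig_mult by simp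
 also have "\<dots> = 1" using False sig_int[of 1] by simp
 finally show ?thesis by (metis inverse_unique)
qed
lemma sig_K: "x \<in> kumK \<Longrightarrow> sig a b x \<in> kumK"
proof -
 assume "x \<in> kumK"
 then obtain q where "x = bsum l l q \<zeta> \<alpha>" unfolding K_conjrel by (rule K.conjrelE)
 hence "sig a b x = bsum l l q (\<zeta> ^ a) (\<zeta> ^ b * \<alpha>)" by (simp add: sig_bsum)
 thus ?thesis unfolding bsum_def
  by (auto intro!: K_sum K_mult K_rat K_power K_zeta K_alpha)
qed
lemma sig_pint: "x \<in> kumK \<Longrightarrow> x \<in> pint p \<Longrightarrow> sig a b x \<in> pint p"
 using c.conjrel_pint[OF sig_conjrel[OF a]] .
lemma sig_root: "x \<in> kumK \<Longrightarrow> poly (map_poly of_rat P) x = 0 \<Longrightarrow> poly (map_poly of_rat P) (sig a b x) = 0"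
 using c.conjrel_root[OF sig_conjrel[OF a]] .
lemma sig_algebraic_int: "x \<in> kumK \<Longrightarrow> algebraic_int x \<Longrightarrow> algebraic_int (sig a b x)"
 using c.conjrel_algebraic_int[OF sig_conjrel[OF a]] .

end

lemma hom_bsum:
 assumes add: "\<And>x y. x \<in> kumK \<Longrightarrow> y \<in> kumK \<Longrightarrow> \<phi> (x + y) = \<phi> x + \<phi> y"
  and mult: "\<And>x y. x \<in> kumK \<Longrightarrow> y \<in> kumK \<Longrightarrow> \<phi> (x * y) = \<phi> x * (\<phi> y :: complex)"
  and one: "\<phi> 1 = 1"
 shows "\<phi> (bsum m n q \<zeta> \<alpha>) = bsum m n q (\<phi> \<zeta>) (\<phi> \<alpha>)" "\<phi> (of_rat r) = of_rat r"
proof -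
 have zero: "\<phi> 0 = 0" using add[OF K_0 K_0] by simp
 have nat: "\<phi> (of_nat k) = of_nat k" for k
 proof (induction k)
  case (Suc k)
  have "of_nat k \<in> kumK" using K_int[of "int k"] by simp
  thus ?case using add[OF K_1] Suc one by simp
 qed (simp add: zero)
 have neg: "\<phi> (- x) = - \<phi> x" if "x \<in> kumK" for x
  using add[OF that K_minus[OF that]] zero by (simp add: eq_neg_iff_add_eq_0 add.commute)
 have int: "\<phi> (of_int k) = of_int k" for k
 proof (cases k rule: int_cases2)
  case (nonpos n)
  have "of_nat n \<in> kumK" using K_int[of "int n"] by simp
  thus ?thesis using neg nat nonpos by simp
 qed (simp add: nat)
 have rat: "\<phi> (of_rat r) = of_rat r" for r
 proof -
  obtain u v where uv: "quotient_of r = (u, v)" by fastforce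
  have v: "v > 0" "r = of_int u / of_int v" using quotient_of_div[OF uv] quotient_of_denom_pos[OF uv] by auto
  hence e: "of_int v * of_rat r = (of_int u :: complex)" by (simp add: of_rat_divide)
  have "of_int v * \<phi> (of_rat r) = \<phi> (of_int v * of_rat r)" using mult[OF K_int K_rat] int by simp
  also have "\<dots> = of_int v * of_rat r" unfolding e by (simp add: int)
  finally show ?thesis using v by simp
 qed
 show "\<phi> (of_rat r) = of_rat r" by (rule rat)
 have pow: "\<phi> (x ^ k) = \<phi> x ^ k" if "x \<in> kumK" for x k
  by (induction k) (use that one mult K_power in simp_all)
 have sum: "\<phi> (\<Sum>i<k. f i) = (\<Sum>i<k. \<phi> (f i))" if "\<And>i. f i \<in> kumK" for f and k :: nat
 proof (induction k)
  case (Suc k)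
  have "(\<Sum>i<k. f i) \<in> kumK" by (intro K_sum that)
  thus ?case using add[OF _ that[of k]] Suc by simp
 qed (simp add: zero)
 have z1: "\<zeta> \<in> kumK" using K_zeta[of 1] by simp
 have tm: "of_rat (q i j) * \<zeta> ^ i * \<alpha> ^ j \<in> kumK" for i j
  by (intro K_mult K_rat K_power K_alpha z1)
 have "\<phi> (of_rat (q i j) * \<zeta> ^ i * \<alpha> ^ j) = of_rat (q i j) * \<phi> \<zeta> ^ i * \<phi> \<alpha> ^ j" for i j
  by (simp add: mult rat pow K_mult K_rat K_power K_alpha z1)
 thus "\<phi> (bsum m n q \<zeta> \<alpha>) = bsum m n q (\<phi> \<zeta>) (\<phi> \<alpha>)"
  unfolding bsum_def by (simp add: sum tm K_sum)
qed

text \<open>The images of \<zeta> and \<alpha> satisfy x^l = 1 and x^l = D, which determines a and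
  b. The value a = 0 is excluded because it would send the vanishing sum of the powers of \<zeta> to
  l.\<close>

lemma hom_is_sig:
 assumes add: "\<And>x y. x \<in> kumK \<Longrightarrow> y \<in> kumK \<Longrightarrow> \<phi> (x + y) = \<phi> x + \<phi> y"
  and mult: "\<And>x y. x \<in> kumK \<Longrightarrow> y \<in> kumK \<Longrightarrow> \<phi> (x * y) = \<phi> x * (\<phi> y :: complex)"
  and one: "\<phi> 1 = 1"
 obtains a b where "0 < a" "a < l" "b < l" "\<And>x. x \<in> kumK \<Longrightarrow> \<phi> x = sig a b x"
proof -
 note hb = hom_bsum[of \<phi>, OF add mult one]
 have z1: "\<zeta> \<in> kumK" using K_zeta[of 1] by simp
 have pow: "\<phi> (x ^ k) = \<phi> x ^ k" if "x \<in> kumK" for x k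
  by (induction k) (use that one mult K_power in simp_all)
 have "\<phi> \<zeta> ^ l = 1" using pow[OF z1, of l] zeta_l one by simp
 then obtain a where a: "a < l" "\<phi> \<zeta> = \<zeta> ^ a" by (rule root_of_unity_cases)
 have "\<phi> \<alpha> ^ l = \<phi> (of_rat (of_int D))" using pow[OF K_alpha, of l] alpha by simp
 hence "\<phi> \<alpha> ^ l = \<alpha> ^ l" using hb(2)[of "of_int D"] alpha by simp
 then obtain b where b: "b < l" "\<phi> \<alpha> = \<zeta> ^ b * \<alpha>" by (rule root_cases) (rule alpha_nz)
 have "a \<noteq> 0"
 proof
  assume "a = 0"
  hence z: "\<phi> \<zeta> = 1" using a by simp
  have "bsum l 1 (\<lambda>_ _. 1) \<zeta> \<alpha> = (\<Sum>i<l. \<zeta> ^ i)" by (simp add: bsum_def)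
  also have "\<dots> = 0" by (rule K.sumz(1))
  finally have "\<phi> 0 = bsum l 1 (\<lambda>_ _. 1) (\<phi> \<zeta>) (\<phi> \<alpha>)" using hb(1)[of l 1 "\<lambda>_ _. 1"] by simp
  also have "\<dots> = of_nat l" unfolding z by (simp add: bsum_def)
  finally show False using hb(2)[of 0] l_pos by simp
 qed
 moreover from this a have "\<not> l dvd a" by (auto dest: dvd_imp_le)
 hence "\<phi> x = sig a b x" if x: "x \<in> kumK" for x
 proof -
  obtain q where q: "x = bsum l l q \<zeta> \<alpha>" using x unfolding K_conjrel by (rule K.conjrelE)
  have "\<phi> x = bsum l l q (\<phi> \<zeta>) (\<phi> \<alpha>)" unfolding q by (rule hb(1))
  thus ?thesis unfolding q sig_bsum[OF \<open>\<not> l dvd a\<close>] a(2) b(2) .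
 qed
 ultimately show ?thesis using that[of a b] a(1) b(1) by simp
qed

lemma embeddings_K:
 "bij_betw (\<lambda>(a, b). restrict (sig a b) kumK) ({1..<l} \<times> {..<l}) (embeddings kumK)"
proof (rule bij_betw_imageI)
 have nd: "\<not> l dvd a" if "a \<in> {1..<l}" for a using that by (auto dest: dvd_imp_le)
 show "inj_on (\<lambda>(a, b). restrict (sig a b) kumK) ({1..<l} \<times> {..<l})"
 proof (intro inj_onI, clarify)
  fix a b a' b' assume *: "a \<in> {1..<l}" "b < l" "a' \<in> {1..<l}" "b' < l"
   and e: "restrict (sig a b) kumK = restrict (sig a' b') kumK"
  have "sig a b (\<zeta> ^ 1) = sig a' b' (\<zeta> ^ 1)" using fun_cong[OF e, of "\<zeta> ^ 1"] K_zeta[of 1] by simp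
  hence "\<zeta> ^ a = \<zeta> ^ a'" using sig_zeta[OF nd, of _ _ 1] * by simp
  hence a: "a = a'" using * by (simp add: zeta_power_eq)
  have "sig a b \<alpha> = sig a' b' \<alpha>" using fun_cong[OF e, of \<alpha>] K_alpha by simp
  hence "\<zeta> ^ b = \<zeta> ^ b'" using sig_alpha[OF nd] * alpha_nz by simp
  hence "b = b'" using * by (simp add: zeta_power_eq)
  with a show "a = a' \<and> b = b'" by simp
 qed
 show "(\<lambda>(a, b). restrict (sig a b) kumK) ` ({1..<l} \<times> {..<l}) = embeddings kumK"
 proof (intro equalityI subsetI)
  fix \<phi> assume "\<phi> \<in> (\<lambda>(a, b). restrict (sig a b) kumK) ` ({1..<l} \<times> {..<l})"
  then obtain a b where ab: "a \<in> {1..<l}" "\<phi> = restrict (sig a b) kumK" by auto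
  note n = nd[OF ab(1)]
  have "\<phi> \<in> Ring.ring_hom (field_ring kumK) complex_ring"
   by (rule ring_hom_memI)
    (use sig_add[OF n] sig_mult[OF n] sig_int[OF n, of _ 1] K_add K_mult K_1 in \<open>auto simp: ab(2)\<close>)
  thus "\<phi> \<in> embeddings kumK" unfolding embeddings_def ab(2) by simp
 next
  fix \<phi> assume "\<phi> \<in> embeddings kumK"
  hence h: "\<phi> \<in> Ring.ring_hom (field_ring kumK) complex_ring" and ex: "\<phi> \<in> extensional kumK"
   unfolding embeddings_def by auto
  obtain a b where ab: "0 < a" "a < l" "b < l" "\<And>x. x \<in> kumK \<Longrightarrow> \<phi> x = sig a b x"
   by (rule hom_is_sig[of \<phi>]) (use ring_hom_memE[OF h] in auto)
  have "\<phi> = restrict (sig a b) kumK" using ab(4) ex by (intro extensionalityI[of _ kumK]) auto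
  thus "\<phi> \<in> (\<lambda>(a, b). restrict (sig a b) kumK) ` ({1..<l} \<times> {..<l})" using ab by force
 qed
qed

lemma field_trace_K:
 assumes "x \<in> kumK"
 shows "field_trace kumK x = (\<Sum>a\<in>{1..<l}. \<Sum>b<l. sig a b x)"
proof -
 have "field_trace kumK x = (\<Sum>(a, b)\<in>{1..<l} \<times> {..<l}. restrict (sig a b) kumK x)"
  unfolding field_trace_def
  using sum.reindex_bij_betw[OF embeddings_K, of "\<lambda>\<sigma>. \<sigma> x"] by (simp add: case_prod_unfold)
 thus ?thesis using assms by (simp add: sum.cartesian_product)
qed

end

section \<open>Rational irreducible polynomials, traces and the Galois property\<close>

lemma of_rat_poly_add: "map_poly of_rat (p + q) = (map_poly of_rat p + map_poly of_rat q :: complex poly)"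
 by (intro poly_eqI) (simp add: coeff_map_poly of_rat_add)

lemma of_rat_poly_mult: "map_poly of_rat (p * q) = (map_poly of_rat p * map_poly of_rat q :: complex poly)"
 by (intro poly_eqI) (simp add: coeff_map_poly coeff_mult of_rat_sum of_rat_mult)

lemma irreducible_rat_dvd:
 fixes p r :: "rat poly" and x :: complex
 assumes p: "Factorial_Ring.irreducible p" "poly (map_poly of_rat p) x = 0"
  and r: "poly (map_poly of_rat r) x = 0"
 shows "p dvd r"
proof (rule ccontr)
 assume n: "\<not> p dvd r"
 have "prime_elem p" using p(1) by (rule irreducible_imp_prime_elem)
 hence "Rings.coprime p r" using n prime_elem_imp_coprime by blast
 then obtain u v where "u * p + v * r = 1" using bezout_coefficients_fst_snd[of p r] by (metis coprime_iff_gcd_eq_1)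
 hence "poly (map_poly of_rat (u * p + v * r)) x = 1" by (simp add: map_poly_1)
 thus False using p(2) r by (simp add: of_rat_poly_add of_rat_poly_mult)
qed

lemma irreducible_rat_poly_exists:
 fixes x :: complex
 assumes "algebraic x"
 obtains p :: "rat poly" where "Factorial_Ring.irreducible p" "poly (map_poly of_rat p) x = 0"
proof -
 define P where "P p \<longleftrightarrow> p \<noteq> 0 \<and> poly (map_poly of_rat p) x = 0" for p :: "rat poly"
 obtain q :: "int poly" where q: "q \<noteq> 0" "poly (of_int_poly q) x = 0" using assms unfolding algebraic_ipoly by blast
 have "of_int_poly q = (map_poly of_rat (of_int_poly q) :: complex poly)"
  by (simp add: map_poly_map_poly o_def)
 hence "P (of_int_poly q)" unfolding P_def using q by simp
 then obtain p where p: "P p" "\<And>r. P r \<Longrightarrow> Polynomial.degree p \<le> Polynomial.degree r"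
  using ex_has_least_nat[of P _ Polynomial.degree] by blast
 have "Factorial_Ring.irreducible p"
 proof (rule Factorial_Ring.irreducibleI)
  show "p \<noteq> 0" using p(1) by (simp add: P_def)
  show "\<not> is_unit p"
  proof
   assume "is_unit p"
   hence "Polynomial.degree p = 0" using p(1) by (simp add: P_def is_unit_iff_degree)
   then obtain c where "p = [:c:]" by (rule degree_eq_zeroE)
   moreover have "map_poly of_rat [:c:] = [:of_rat c :: complex:]"
    by (intro poly_eqI) (simp add: coeff_map_poly coeff_pCons split: nat.splits)
   ultimately show False using p(1) by (simp add: P_def)
  qed
  fix a b assume ab: "p = a * b"
  have "poly (map_poly of_rat a) x * poly (map_poly of_rat b) x = 0"
   using p(1) unfolding P_def ab by (simp add: of_rat_poly_mult)
  moreover have n: "a \<noteq> 0" "b \<noteq> 0" using p(1) ab by (auto simp: P_def)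
  ultimately have "P a \<or> P b" by (auto simp: P_def)
  hence "Polynomial.degree p \<le> Polynomial.degree a \<or> Polynomial.degree p \<le> Polynomial.degree b" using p(2) by blast
  moreover have "Polynomial.degree p = Polynomial.degree a + Polynomial.degree b"
   unfolding ab using n by (rule degree_mult_eq)
  ultimately have "Polynomial.degree a = 0 \<or> Polynomial.degree b = 0" by auto
  thus "is_unit a \<or> is_unit b" using n by (metis is_unit_iff_degree)
 qed
 thus ?thesis using that p(1) unfolding P_def by blast
qed

lemma sum_swap4:
 "(\<Sum>a\<in>A. \<Sum>b\<in>B. \<Sum>i\<in>I. \<Sum>j\<in>J. f a b i j) = (\<Sum>i\<in>I. \<Sum>j\<in>J. \<Sum>a\<in>A. \<Sum>b\<in>B. f a b i j)"
proof -
 have "(\<Sum>a\<in>A. \<Sum>b\<in>B. \<Sum>i\<in>I. \<Sum>j\<in>J. f a b i j) = (\<Sum>a\<in>A. \<Sum>i\<in>I. \<Sum>b\<in>B. \<Sum>j\<in>J. f a b i j)"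
  by (rule sum.cong[OF refl sum.swap])
 also have "\<dots> = (\<Sum>i\<in>I. \<Sum>a\<in>A. \<Sum>b\<in>B. \<Sum>j\<in>J. f a b i j)" by (rule sum.swap)
 also have "\<dots> = (\<Sum>i\<in>I. \<Sum>a\<in>A. \<Sum>j\<in>J. \<Sum>b\<in>B. f a b i j)"
  by (rule sum.cong[OF refl sum.cong[OF refl sum.swap]])
 also have "\<dots> = (\<Sum>i\<in>I. \<Sum>j\<in>J. \<Sum>a\<in>A. \<Sum>b\<in>B. f a b i j)"
  by (rule sum.cong[OF refl sum.swap])
 finally show ?thesis .
qed

context kummer
begin

lemma K_ratspan: "kumK = ratspan ({..<l} \<times> {..<l}) (\<lambda>(i, j). \<zeta> ^ i * \<alpha> ^ j)"
proof (rule Set.set_eqI)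
 fix x
 have e: "bsum l l q \<zeta> \<alpha> = (\<Sum>(i, j)\<in>{..<l} \<times> {..<l}. of_rat (q i j) * (\<zeta> ^ i * \<alpha> ^ j))" for q
  unfolding bsum_def by (simp add: sum.cartesian_product mult.assoc)
 show "x \<in> kumK \<longleftrightarrow> x \<in> ratspan ({..<l} \<times> {..<l}) (\<lambda>(i, j). \<zeta> ^ i * \<alpha> ^ j)"
 proof
  assume "x \<in> kumK"
  then obtain q where "x = bsum l l q \<zeta> \<alpha>" unfolding K_conjrel by (rule K.conjrelE)
  thus "x \<in> ratspan ({..<l} \<times> {..<l}) (\<lambda>(i, j). \<zeta> ^ i * \<alpha> ^ j)"
   unfolding e ratspan_def mem_Collect_eq by (intro exI[of _ "\<lambda>(i, j). q i j"]) (simp add: case_prod_unfold)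
 next
  assume "x \<in> ratspan ({..<l} \<times> {..<l}) (\<lambda>(i, j). \<zeta> ^ i * \<alpha> ^ j)"
  then obtain q where q: "x = (\<Sum>ij\<in>{..<l} \<times> {..<l}. of_rat (q ij) * (case ij of (i, j) \<Rightarrow> \<zeta> ^ i * \<alpha> ^ j))"
   unfolding ratspan_def by blast
  have "(case ij of (i, j) \<Rightarrow> \<zeta> ^ i * \<alpha> ^ j) \<in> kumK" for ij
   by (cases ij) (simp add: K_mult K_zeta K_power K_alpha)
  thus "x \<in> kumK" unfolding q by (intro K_sum K_mult K_rat)
 qed
qed

lemma number_field_K: "number_field kumK"
 unfolding number_field_def using subfield_K finite_dimension_ratspan[of "{..<l} \<times> {..<l}"] K_ratspan by simp

text \<open>On a monomial the sum over b vanishes unless the exponent of \<alpha> is 0, and the sum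
  over a is l - 1 or -1.\<close>

lemma trace_rational:
 assumes x: "x \<in> kumK"
 shows "(\<Sum>a\<in>{1..<l}. \<Sum>b<l. sig a b x) \<in> \<rat>"
proof -
 obtain q where q: "x = bsum l l q \<zeta> \<alpha>" using x unfolding K_conjrel by (rule K.conjrelE)
 have nd: "\<not> l dvd a" if "a \<in> {1..<l}" for a using that by (auto dest: dvd_imp_le)
 have "(\<Sum>a\<in>{1..<l}. \<Sum>b<l. sig a b x) = (\<Sum>a\<in>{1..<l}. \<Sum>b<l. \<Sum>i<l. \<Sum>j<l. of_rat (q i j) * (\<zeta> ^ a) ^ i * (\<zeta> ^ b * \<alpha>) ^ j)"
  unfolding q using sig_bsum[OF nd] by (intro sum.cong refl) (simp add: bsum_def)
 also have "\<dots> = (\<Sum>i<l. \<Sum>j<l. \<Sum>a\<in>{1..<l}. \<Sum>b<l. of_rat (q i j) * (\<zeta> ^ a) ^ i * (\<zeta> ^ b * \<alpha>) ^ j)"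
  by (rule sum_swap4)
 also have "\<dots> \<in> \<rat>"
 proof (rule Rats_sum, rule Rats_sum)
  fix i j assume ij: "i \<in> {..<l}" "j \<in> {..<l}"
  have "(\<Sum>a\<in>{1..<l}. \<Sum>b<l. of_rat (q i j) * (\<zeta> ^ a) ^ i * (\<zeta> ^ b * \<alpha>) ^ j)
   = of_rat (q i j) * (\<Sum>a\<in>{1..<l}. (\<zeta> ^ i) ^ a) * ((\<Sum>b<l. (\<zeta> ^ j) ^ b) * \<alpha> ^ j)"
   by (simp add: sum_distrib_left sum_distrib_right power_mult_distrib power_mult[symmetric] mult_ac)
  also have "(\<Sum>b<l. (\<zeta> ^ j) ^ b) * \<alpha> ^ j = (if j = 0 then of_nat l else 0)"
   unfolding sum_zeta_power using ij by (auto dest: dvd_imp_le)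
  also have "(\<Sum>a\<in>{1..<l}. (\<zeta> ^ i) ^ a) = (\<Sum>a<l. (\<zeta> ^ i) ^ a) - 1"
  proof -
   have "{..<l} = insert 0 {1..<l}" using l_pos by auto
   thus ?thesis by simp
  qed
  finally show "(\<Sum>a\<in>{1..<l}. \<Sum>b<l. of_rat (q i j) * (\<zeta> ^ a) ^ i * (\<zeta> ^ b * \<alpha>) ^ j) \<in> \<rat>"
   unfolding sum_zeta_power by (auto intro!: Rats_mult Rats_diff)
 qed
 finally show ?thesis .
qed

lemma fixed_rational:
 assumes x: "x \<in> kumK" and fixed: "\<And>a b. a \<in> {1..<l} \<Longrightarrow> b < l \<Longrightarrow> sig a b x = x"
 shows "x \<in> \<rat>"
proof -
 have "of_nat ((l - 1) * l) * x = (\<Sum>a\<in>{1..<l}. \<Sum>b<l. sig a b x)"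
  using fixed by (simp add: mult.assoc)
 also have "\<dots> \<in> \<rat>" by (rule trace_rational[OF x])
 finally have r: "of_nat ((l - 1) * l) * x \<in> \<rat>" .
 have "x = of_nat ((l - 1) * l) * x / of_nat ((l - 1) * l)" using l_ge_3 by simp
 also have "\<dots> \<in> \<rat>" using r by (intro Rats_divide) auto
 finally show ?thesis .
qed

lemma sig_inj:
 assumes "\<not> l dvd a"
 shows "inj_on (sig a b) kumK"
proof (rule inj_onI)
 fix x y assume xy: "x \<in> kumK" "y \<in> kumK" "sig a b x = sig a b y"
 show "x = y"
 proof (rule ccontr)
  assume "x \<noteq> y"
  have d: "x - y \<in> kumK" using xy by (simp add: K_diff)
  have "sig a b ((x - y) * inverse (x - y)) = 0"
   using sig_mult[OF assms d K_inverse[OF d]] sig_diff[OF assms xy(1,2)] xy(3) by simp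
  moreover have "(x - y) * inverse (x - y) = of_int 1" using \<open>x \<noteq> y\<close> by simp
  ultimately show False using sig_int[OF assms, of b 1] by simp
 qed
qed

lemma prod_linear_coeff:
 assumes "finite Y" "Y \<subseteq> kumK" "\<not> l dvd a"
 shows "poly.coeff (\<Prod>y\<in>Y. [:- y, 1:]) i \<in> kumK \<and>
  sig a b (poly.coeff (\<Prod>y\<in>Y. [:- y, 1:]) i) = poly.coeff (\<Prod>y\<in>Y. [:- sig a b y, 1:]) i"
 using assms(1,2)
proof (induction Y arbitrary: i rule: finite_induct)
 case empty
 show ?case using K_1 K_0 sig_int[OF assms(3), of b 0] sig_int[OF assms(3), of b 1] by (cases i) auto
next
 case (insert y Y)
 have c: "poly.coeff ([:- u, 1:] * P) i = (if i = 0 then 0 else poly.coeff P (i - 1)) - u * poly.coeff P i" for u :: complex and P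
  by (cases i) simp_all
 define P where "P = (\<Prod>y\<in>Y. [:- y, 1:])"
 define Q where "Q = (\<Prod>y\<in>Y. [:- sig a b y, 1:])"
 have IH: "poly.coeff P i \<in> kumK" "sig a b (poly.coeff P i) = poly.coeff Q i" for i
  using insert unfolding P_def Q_def by auto
 have y: "y \<in> kumK" using insert by simp
 have e: "(if i = 0 then 0 else poly.coeff P (i - 1)) \<in> kumK"
  "sig a b (if i = 0 then 0 else poly.coeff P (i - 1)) = (if i = 0 then 0 else poly.coeff Q (i - 1))"
  using IH K_0 sig_int[OF assms(3), of b 0] by auto
 have "(\<Prod>y\<in>insert y Y. [:- y, 1:]) = [:- y, 1:] * P" "(\<Prod>y\<in>insert y Y. [:- sig a b y, 1:]) = [:- sig a b y, 1:] * Q"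
  using insert unfolding P_def Q_def by simp_all
 thus ?case unfolding c using e IH y by (simp only: c sig_diff[OF assms(3)] sig_mult[OF assms(3)] K_diff K_mult simp_thms)
qed

text \<open>The polynomial whose roots are the conjugates of x is invariant under all
  \<open>sig a b\<close>, hence rational. An irreducible p with root x divides it, so every root of
  p is a conjugate of x and lies in \<open>kumK\<close>.\<close>

lemma galois_K: "galois_over_rat kumK"
 unfolding galois_over_rat_def
proof (intro conjI ballI allI impI)
 show "subfield kumK complex_ring" by (rule subfield_K)
 show "algebraic x" if "x \<in> kumK" for x using that by (rule K_algebraic)
 fix p :: "rat poly" and z :: complex
 assume p: "Factorial_Ring.irreducible p" "\<exists>x\<in>kumK. poly (map_poly of_rat p) x = 0"
  and z: "poly (map_poly of_rat p) z = 0"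
 then obtain x where x: "x \<in> kumK" "poly (map_poly of_rat p) x = 0" by blast
 have nd: "\<not> l dvd a" if "a \<in> {1..<l}" for a using that by (auto dest: dvd_imp_le)
 define Y where "Y = (\<lambda>(a, b). sig a b x) ` ({1..<l} \<times> {..<l})"
 have fin: "finite Y" by (simp add: Y_def)
 have YK: "Y \<subseteq> kumK" using sig_K[OF nd x(1)] by (auto simp: Y_def)
 \<comment> \<open>The identity is a ring homomorphism, hence one of the
   \<open>sig a b\<close>.\<close>
 have xY: "x \<in> Y"
 proof -
  obtain a b where "0 < a" "a < l" "b < l" "\<And>y. y \<in> kumK \<Longrightarrow> (\<lambda>y. y) y = sig a b y"
   by (rule hom_is_sig[of "\<lambda>y. y"]) auto
  hence "x = sig a b x" "(a, b) \<in> {1..<l} \<times> {..<l}" using x(1) by auto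
  thus ?thesis unfolding Y_def by force
 qed
 have stable: "sig c d ` Y = Y" if cd: "c \<in> {1..<l}" for c d
 proof (rule card_subset_eq[OF fin])
  note n = nd[OF cd]
  show "sig c d ` Y \<subseteq> Y"
  proof
   fix w assume "w \<in> sig c d ` Y"
   then obtain a b where ab: "a \<in> {1..<l}" "w = sig c d (sig a b x)" unfolding Y_def by auto
   obtain a' b' where ab': "0 < a'" "a' < l" "b' < l" "\<And>y. y \<in> kumK \<Longrightarrow> (\<lambda>y. sig c d (sig a b y)) y = sig a' b' y"
    by (rule hom_is_sig[of "\<lambda>y. sig c d (sig a b y)"])
     (use sig_add[OF n] sig_add[OF nd[OF ab(1)]] sig_mult[OF n] sig_mult[OF nd[OF ab(1)]]
       sig_K[OF nd[OF ab(1)]] sig_int[OF n, of _ 1] sig_int[OF nd[OF ab(1)], of _ 1] in auto)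
   hence "w = sig a' b' x" "(a', b') \<in> {1..<l} \<times> {..<l}" using ab x(1) by auto
   thus "w \<in> Y" unfolding Y_def by force
  qed
  show "card (sig c d ` Y) = card Y"
   using card_image[OF inj_on_subset[OF sig_inj[OF n] YK]] by simp
 qed
 define P where "P = (\<Prod>y\<in>Y. [:- y, 1:])"
 have rat: "poly.coeff P i \<in> \<rat>" for i
 proof (rule fixed_rational)
  show "poly.coeff P i \<in> kumK" using prod_linear_coeff[OF fin YK not_dvd_1] by (simp add: P_def)
  fix a b assume a: "a \<in> {1..<l}" "b < l"
  have "(\<Prod>y\<in>Y. [:- sig a b y, 1:]) = (\<Prod>y\<in>sig a b ` Y. [:- y, 1:])"
   using inj_on_subset[OF sig_inj[OF nd[OF a(1)]] YK] by (simp add: prod.reindex)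
  thus "sig a b (poly.coeff P i) = poly.coeff P i"
   using prod_linear_coeff[OF fin YK nd[OF a(1)]] stable[OF a(1)] by (simp add: P_def)
 qed
 define g where "g = the_inv (of_rat :: rat \<Rightarrow> complex)"
 have inv: "g (of_rat c) = c" for c
  unfolding g_def by (rule the_inv_f_f) (simp add: inj_def)
 define r where "r = map_poly g P"
 have rP: "map_poly of_rat r = P"
 proof (rule poly_eqI)
  fix i
  obtain c where "poly.coeff P i = of_rat c" using rat[of i] by (auto simp: Rats_def)
  thus "poly.coeff (map_poly of_rat r) i = poly.coeff P i"
   using inv[of 0] inv[of c] by (simp add: r_def coeff_map_poly)
 qed
 have "poly (map_poly of_rat r) x = 0" unfolding rP P_def poly_prod using xY fin by (auto simp: prod_zero_iff)
 hence "p dvd r" using irreducible_rat_dvd[OF p(1) x(2)] by blast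
 then obtain s where "r = p * s" by (auto simp: dvd_def)
 hence "poly P z = 0" using z rP[symmetric] by (simp add: of_rat_poly_mult)
 hence "z \<in> Y" unfolding P_def poly_prod using fin by (auto simp: prod_zero_iff)
 thus "z \<in> kumK" using YK by blast
qed

text \<open>Normality provides the conjugate \<zeta> \<alpha> of \<alpha>; dividing by \<alpha>
  provides \<zeta>.\<close>

lemma galois_contains_K:
 assumes M: "galois_over_rat M" "\<alpha> \<in> M"
 shows "kumK \<subseteq> M"
proof -
 have sf: "subfield M complex_ring" using M(1) unfolding galois_over_rat_def by blast
 note c = subfield_complexD[OF sf]
 obtain p :: "rat poly" where p: "Factorial_Ring.irreducible p" "poly (map_poly of_rat p) \<alpha> = 0"
  using irreducible_rat_poly_exists[OF K_algebraic[OF K_alpha]] by blast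
 have s: "sig 1 1 \<alpha> = \<zeta> * \<alpha>" using sig_alpha[OF not_dvd_1, of 1] by (simp only: power_one_right)
 have "poly (map_poly of_rat p) (\<zeta> * \<alpha>) = 0"
  using sig_root[OF not_dvd_1 K_alpha p(2), of 1] unfolding s .
 moreover have ex: "\<exists>x\<in>M. poly (map_poly of_rat p) x = 0" using p(2) M(2) by blast
 ultimately have "\<zeta> * \<alpha> \<in> M"
  using M(1)[unfolded galois_over_rat_def, THEN conjunct2, THEN conjunct2, rule_format, OF p(1) ex] by simp
 hence "\<zeta> * \<alpha> * inverse \<alpha> \<in> M" by (rule c(3)[OF _ c(5)[OF M(2)]])
 hence zM: "\<zeta> \<in> M" using alpha_nz by (simp add: mult.assoc)
 have pow: "x ^ n \<in> M" if "x \<in> M" for x n by (induction n) (use that c in auto)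
 have "of_rat q \<in> M" for q by (rule subfield_complex_of_rat[OF sf])
 hence tm: "of_rat q * (\<zeta> ^ i * \<alpha> ^ j) \<in> M" for q i j using c(3) pow zM M(2) by simp
 have zero: "0 \<in> M" using subfield_complex_of_rat[OF sf, of 0] by simp
 have sum: "(\<Sum>i\<in>I. f i) \<in> M" if "\<And>i. i \<in> I \<Longrightarrow> f i \<in> M" for I :: "(nat \<times> nat) set" and f
  using that by (induction I rule: infinite_finite_induct) (auto intro: c(2) zero)
 show ?thesis unfolding K_ratspan ratspan_def using tm by (auto intro!: sum)
qed

lemma galois_closure_K:
 assumes "\<alpha> \<in> M" "M \<subseteq> kumK"
 shows "is_galois_closure M kumK"
 unfolding is_galois_closure_def using galois_K assms galois_contains_K by blast

lemma pure_field_alpha: "pure_field l (generate_field complex_ring {\<alpha>})"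
proof -
 let ?L = "generate_field complex_ring {\<alpha>}"
 \<comment> \<open>Without the root of unity (m = 1, z = 1) the relation describes the pure field,
   and its closure properties make the span of the powers of \<alpha> a field.\<close>
 interpret q: conj_pair 1 l "of_int D" 1 \<alpha> 1 \<alpha>
  by standard (use l_pos alpha in auto)
 let ?S = "ratspan {..<l} (\<lambda>j. \<alpha> ^ j)"
 have S: "x \<in> ?S \<longleftrightarrow> q.conjrel x x" for x
 proof
  assume "x \<in> ?S"
  then obtain c where "x = (\<Sum>j<l. of_rat (c j) * \<alpha> ^ j)" unfolding ratspan_def by blast
  hence "x = bsum 1 l (\<lambda>_ j. c j) 1 \<alpha>" by (simp add: bsum_def)
  thus "q.conjrel x x" using q.conjrelI by simp
 next
  assume "q.conjrel x x"
  then obtain c where "x = bsum 1 l c 1 \<alpha>" by (rule q.conjrelE)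
  thus "x \<in> ?S" unfolding ratspan_def mem_Collect_eq by (intro exI[of _ "c 0"]) (simp add: bsum_def)
 qed
 have alg: "algebraic x" if "x \<in> ?S" for x
  using q.conjrel_algebraic[of x x] that algebraic_int_alpha unfolding S by auto
 have rat: "of_rat c \<in> ?S" for c unfolding S by (rule q.conjrel_rat)
 have add: "x + y \<in> ?S" if "x \<in> ?S" "y \<in> ?S" for x y using that q.conjrel_add unfolding S by blast
 have mult: "x * y \<in> ?S" if "x \<in> ?S" "y \<in> ?S" for x y using that q.conjrel_mult unfolding S by blast
 have sub: "subfield ?S complex_ring"
 proof (rule subfield_complexI)
  show "1 \<in> ?S" using rat[of 1] by simp
  show "x \<in> ?S \<Longrightarrow> - x \<in> ?S" for x using mult[OF rat[of "-1"], of x] by simp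
  show "inverse x \<in> ?S" if "x \<in> ?S" for x by (rule subring_inverse_closed[OF add mult rat that alg[OF that]])
 qed (use add mult in auto)
 have aS: "\<alpha> \<in> ?S" unfolding S using q.conjrel_monom[of 0 1] by simp
 have L: "subfield ?L complex_ring" by (rule field.generate_field_is_subfield[OF field_C]) simp
 have aL: "\<alpha> \<in> ?L" by (rule generate_field.incl) simp
 have "?L = ?S"
 proof
  show "?L \<subseteq> ?S" by (rule field.generate_field_min_subfield1[OF field_C _ sub]) (use aS in auto)
  note c = subfield_complexD[OF L]
  have pow: "x ^ n \<in> ?L" if "x \<in> ?L" for x n by (induction n) (use that c in auto)
  have zero: "0 \<in> ?L" using subfield_complex_of_rat[OF L, of 0] by simp
  have sum: "(\<Sum>i\<in>I. f i) \<in> ?L" if "\<And>i. i \<in> I \<Longrightarrow> f i \<in> ?L" for I :: "nat set" and f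
   using that by (induction I rule: infinite_finite_induct) (auto intro: c(2) zero)
  show "?S \<subseteq> ?L" unfolding ratspan_def
   by (auto intro!: sum c(3) pow aL subfield_complex_of_rat[OF L])
 qed
 moreover have "C.dim \<rat> ?S = card {..<l}"
 proof (rule dim_ratspan)
  fix c j assume "(\<Sum>j<l. of_rat (c j) * \<alpha> ^ j) = 0" "j \<in> {..<l}"
  thus "c j = 0" using alpha_F_independent[of "\<lambda>j. of_rat (c j)" j] F_rat by simp
 qed simp
 ultimately have "field_degree ?L = l" unfolding field_degree_def by simp
 thus ?thesis unfolding pure_field_def using alpha by blast
qed

lemma metacyclic_K: "metacyclic_field l kumK"
proof -
 let ?L = "generate_field complex_ring {\<alpha>}"
 have "\<alpha> \<in> ?L" by (rule generate_field.incl) simp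
 moreover have "?L \<subseteq> kumK" by (rule field.generate_field_min_subfield1[OF field_C _ subfield_K]) (use K_alpha in auto)
 ultimately show ?thesis
  unfolding metacyclic_field_def using number_field_K pure_field_alpha galois_closure_K by blast
qed

end

subsection \<open>Determinants\<close>

lemma det_reindex_rows:
 assumes "bij_betw p {..<n} {..<n}"
 shows "norm (mdet n (\<lambda>i j. f (p i) j)) = norm (mdet n (\<lambda>i j. f i j))"
proof -
 define p' where "p' i = (if i < n then p i else i)" for i
 have "bij_betw p' {..<n} {..<n}" using assms by (subst bij_betw_cong[of _ _ p]) (auto simp: p'_def)
 hence pp: "p' permutes {0..<n}" by (intro bij_imp_permutes) (auto simp: p'_def atLeast0LessThan)
 define A where "A = mat n n (\<lambda>(i, j). f i j)"
 have "mat n n (\<lambda>(i, j). f (p i) j) = mat n n (\<lambda>(i, j). A $$ (p' i, j))"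
 proof (rule eq_matI)
  fix i j assume "i < dim_row (mat n n (\<lambda>(i, j). A $$ (p' i, j)))" "j < dim_col (mat n n (\<lambda>(i, j). A $$ (p' i, j)))"
  hence ij: "i < n" "j < n" by auto
  have "p i < n" using assms ij unfolding bij_betw_def by auto
  thus "mat n n (\<lambda>(i, j). f (p i) j) $$ (i, j) = mat n n (\<lambda>(i, j). A $$ (p' i, j)) $$ (i, j)"
   using ij by (simp add: A_def p'_def)
 qed simp_all
 hence "mdet n (\<lambda>i j. f (p i) j) = signof p' * det A"
  using det_permute_rows[OF _ pp, of A] by (simp add: A_def)
 moreover have "norm (signof p' :: complex) = 1" by (simp add: sign_def)
 ultimately show ?thesis by (simp add: norm_mult A_def)
qed

lemma det_block_diagonal:
 fixes B :: "nat \<Rightarrow> nat \<Rightarrow> nat \<Rightarrow> complex"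
 shows "mdet (m * n) (\<lambda>r s. if r div n = s div n then B (r div n) (r mod n) (s mod n) else 0)
   = (\<Prod>k<m. mdet n (\<lambda>i j. B k i j))"
proof (induction m)
 case 0
 show ?case by (simp add: det_dim_zero)
next
 case (Suc m)
 define F where "F = (\<lambda>(r, s). if r div n = s div n then B (r div n) (r mod n) (s mod n) else 0)"
 have "mat (Suc m * n) (Suc m * n) F
  = four_block_mat (mat (m * n) (m * n) F) (0\<^sub>m (m * n) n) (0\<^sub>m n (m * n)) (mat n n (\<lambda>(i, j). B m i j))"
 proof (rule eq_matI)
  fix i j assume "i < dim_row (four_block_mat (mat (m * n) (m * n) F) (0\<^sub>m (m * n) n) (0\<^sub>m n (m * n)) (mat n n (\<lambda>(i, j). B m i j)))"
   "j < dim_col (four_block_mat (mat (m * n) (m * n) F) (0\<^sub>m (m * n) n) (0\<^sub>m n (m * n)) (mat n n (\<lambda>(i, j). B m i j)))"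
  hence ij: "i < m * n + n" "j < m * n + n" by auto
  have small: "k div n < m" if "k < m * n" for k using that by (simp add: less_mult_imp_div_less)
  have large: "k div n = m \<and> k mod n = k - m * n" if "\<not> k < m * n" "k < m * n + n" for k
  proof -
   have k: "k = m * n + (k - m * n)" "k - m * n < n" using that by auto
   have "k div n = m" by (subst k(1)) (use k(2) in simp)
   moreover have "k mod n = k - m * n" by (subst k(1)) (use k(2) in simp)
   ultimately show ?thesis by simp
  qed
  show "mat (Suc m * n) (Suc m * n) F $$ (i, j)
   = four_block_mat (mat (m * n) (m * n) F) (0\<^sub>m (m * n) n) (0\<^sub>m n (m * n)) (mat n n (\<lambda>(i, j). B m i j)) $$ (i, j)"
   using ij small[of i] small[of j] large[of i] large[of j]
   by (cases "i < m * n"; cases "j < m * n") (auto simp: F_def)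
 qed auto
 moreover have "det (four_block_mat (mat (m * n) (m * n) F) (0\<^sub>m (m * n) n) (0\<^sub>m n (m * n)) (mat n n (\<lambda>(i, j). B m i j)))
   = det (mat (m * n) (m * n) F) * mdet n (\<lambda>i j. B m i j)"
  by (rule det_four_block_mat_upper_right_zero) auto
 ultimately show ?case using Suc unfolding F_def by simp
qed

lemma mdet_cong: "(\<And>i j. i < n \<Longrightarrow> j < n \<Longrightarrow> f i j = g i j) \<Longrightarrow> mdet n f = mdet n g"
 by (rule arg_cong[of _ _ det]) (auto intro!: eq_matI)

lemma mdet_mult: "mdet n f * mdet n g = mdet n (\<lambda>i j. \<Sum>k<n. f i k * g k j)"
proof -
 have "mat n n (\<lambda>(i, j). f i j) * mat n n (\<lambda>(i, j). g i j) = mat n n (\<lambda>(i, j). \<Sum>k<n. f i k * g k j)"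
  by (rule eq_matI) (auto simp: scalar_prod_def atLeast0LessThan)
 thus ?thesis using det_mult[of "mat n n (\<lambda>(i, j). f i j)" n "mat n n (\<lambda>(i, j). g i j)"] by simp
qed

text \<open>A matrix with entries \<open>C a b j * A j a i\<close> is the product of a matrix that is block diagonal in \<open>a\<close>
 and one that is block diagonal in \<open>j\<close>.\<close>

lemma det_twisted_kronecker:
 fixes A C :: "nat \<Rightarrow> nat \<Rightarrow> nat \<Rightarrow> complex"
 assumes "m > 0" "n > 0"
 shows "norm (mdet (m * n) (\<lambda>r s. C (r div n) (r mod n) (s div m) * A (s div m) (r div n) (s mod m)))
  = (\<Prod>a<m. norm (mdet n (\<lambda>b j. C a b j))) * (\<Prod>j<n. norm (mdet m (\<lambda>a i. A j a i)))"
proof -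
 define P where "P r s = (if r div n = s div n then C (r div n) (r mod n) (s mod n) else 0)" for r s
 define g where "g r s = (if r div m = s div m then A (r div m) (r mod m) (s mod m) else 0)" for r s
 \<comment> \<open>Passes between the two encodings of a pair (a, j), as a n + j and as j m +
   a.\<close>
 define p where "p t = (t mod n) * m + t div n" for t
 have dm: "t div n < m" "t mod n < n" if "t < m * n" for t
  using that assms by (auto simp: less_mult_imp_div_less)
 have enc: "a * n + j < m * n" if "a < m" "j < n" for a j
 proof -
  have "a * n + j < (a + 1) * n" using that by simp
  also have "\<dots> \<le> m * n" using that by (intro mult_le_mono) auto
  finally show ?thesis .
 qed
 have enc': "j * m + a < n * m" if "a < m" "j < n" for a j
 proof -
  have "j * m + a < (j + 1) * m" using that by simp
  also have "\<dots> \<le> n * m" using that by (intro mult_le_mono) auto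
  finally show ?thesis .
 qed
 have p: "bij_betw p {..<m * n} {..<m * n}"
 proof (rule bij_betwI[where g = "\<lambda>t. (t mod m) * n + t div m"])
  show "p \<in> {..<m * n} \<rightarrow> {..<m * n}" using dm enc' by (auto simp: p_def mult.commute[of m n])
  show "(\<lambda>t. (t mod m) * n + t div m) \<in> {..<m * n} \<rightarrow> {..<m * n}"
  proof
   fix t assume "t \<in> {..<m * n}"
   hence "t div m < n" "t mod m < m" using assms by (auto simp: less_mult_imp_div_less mult.commute)
   thus "(t mod m) * n + t div m \<in> {..<m * n}" using enc by simp
  qed
  show "p t mod m * n + p t div m = t" if "t \<in> {..<m * n}" for t
   using dm[of t] that assms by (simp add: p_def)
  show "p (t mod m * n + t div m) = t" if "t \<in> {..<m * n}" for t
  proof -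
   have "t div m < n" using that by (simp add: less_mult_imp_div_less mult.commute)
   thus ?thesis using assms by (simp add: p_def)
  qed
 qed
 have "mdet (m * n) (\<lambda>r s. C (r div n) (r mod n) (s div m) * A (s div m) (r div n) (s mod m))
   = mdet (m * n) P * mdet (m * n) (\<lambda>r s. g (p r) s)"
  unfolding mdet_mult
 proof (rule mdet_cong)
  fix r s assume rs: "r < m * n" "s < m * n"
  define j where "j = s div m"
  have j: "j < n" using rs by (simp add: j_def less_mult_imp_div_less mult.commute)
  \<comment> \<open>The only index that meets row block r div n of the first factor and column block
    s div m of the second.\<close>
  define t0 where "t0 = (r div n) * n + j"
  have t0: "t0 < m * n" "t0 div n = r div n" "t0 mod n = j" using enc dm(1)[OF rs(1)] j by (auto simp: t0_def)
  have z: "P r t * g (p t) s = 0"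
   if "t \<in> {..<m * n} - {t0}" for t
  proof (rule ccontr)
   assume *: "P r t * g (p t) s \<noteq> 0"
   hence 1: "r div n = t div n" by (auto simp: P_def split: if_splits)
   have "p t div m = s div m" using * by (auto simp: g_def split: if_splits)
   moreover have "p t div m = t mod n" using dm[of t] that by (simp add: p_def)
   ultimately have "t = t0" using 1 unfolding t0_def j_def by (metis div_mult_mod_eq)
   thus False using that by simp
  qed
  have "(\<Sum>t<m * n. P r t * g (p t) s) = (\<Sum>t\<in>{t0}. P r t * g (p t) s)"
   using z t0(1) by (intro sum.mono_neutral_right) auto
  also have "\<dots> = C (r div n) (r mod n) j * g (p t0) s" using t0 by (simp add: P_def)
  also have "g (p t0) s = A j (r div n) (s mod m)"
   using dm(1)[OF rs(1)] t0 by (simp add: p_def g_def j_def)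
  finally show "C (r div n) (r mod n) (s div m) * A (s div m) (r div n) (s mod m) = (\<Sum>t<m * n. P r t * g (p t) s)"
   by (simp add: j_def)
 qed
 moreover have "mdet (m * n) P = (\<Prod>a<m. mdet n (\<lambda>b j. C a b j))"
  unfolding P_def by (rule det_block_diagonal)
 moreover have "norm (mdet (m * n) (\<lambda>r s. g (p r) s)) = norm (mdet (m * n) g)" by (rule det_reindex_rows[OF p])
 moreover have "mdet (m * n) g = (\<Prod>j<n. mdet m (\<lambda>a i. A j a i))"
  unfolding g_def using det_block_diagonal[of n m A] by (simp add: mult.commute)
 ultimately show ?thesis by (simp add: norm_mult prod_norm[symmetric])
qed

lemma det_scale_columns:
 shows "mdet n (\<lambda>i j. f i j * c j) = mdet n (\<lambda>i j. f i j) * (\<Prod>j<n. c j)"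
proof -
 define E where "E = mat n n (\<lambda>(i, j). if i = j then c j else 0)"
 have "mat n n (\<lambda>(i, j). f i j * c j) = mat n n (\<lambda>(i, j). f i j) * E"
  by (rule eq_matI) (auto simp: E_def scalar_prod_def if_distrib[of "\<lambda>x. _ * x"] sum.delta cong: if_cong)
 moreover have "det E = (\<Prod>j<n. c j)"
  using det_upper_triangular[of E n] by (simp add: E_def upper_triangular_def diag_mat_def prod_list_diag_prod
   prod.list_conv_set_nth atLeast0LessThan)
 moreover have "det (mat n n (\<lambda>(i, j). f i j) * E) = mdet n (\<lambda>i j. f i j) * det E"
  by (rule det_mult[of _ n]) (auto simp: E_def)
 ultimately show ?thesis by simp
qed

lemma mdet_transpose: "mdet n f = mdet n (\<lambda>i j. f j i)"
proof -
 have "transpose_mat (mat n n (\<lambda>(i, j). f i j)) = mat n n (\<lambda>(i, j). f j i)" by (rule eq_matI) auto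
 thus ?thesis using det_transpose[of "mat n n (\<lambda>(i, j). f i j)" n] by simp
qed

lemma det_scale_rows: "mdet n (\<lambda>i j. c i * f i j) = (\<Prod>i<n. c i) * mdet n f"
 using det_scale_columns[of n "\<lambda>i j. f j i" c] mdet_transpose[of n "\<lambda>i j. c i * f i j"] mdet_transpose[of n f]
 by (simp add: mult.commute)

text \<open>By the binomial theorem the shifted matrix is the unshifted one times an upper
  triangular matrix with ones on the diagonal.\<close>

lemma det_vandermonde_shift:
 shows "mdet n (\<lambda>b j. (x b - s) ^ j) = mdet n (\<lambda>b j. x b ^ j)"
proof -
 define U where "U k j = of_nat (j choose k) * (- s) ^ (j - k)" for k j
 have "mdet n (\<lambda>b j. (x b - s) ^ j) = mdet n (\<lambda>b j. x b ^ j) * mdet n U" unfolding mdet_mult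
 proof (rule mdet_cong)
  fix b j assume "j < n"
  have "(x b - s) ^ j = (x b + - s) ^ j" by simp
  also have "\<dots> = (\<Sum>k\<le>j. of_nat (j choose k) * x b ^ k * (- s) ^ (j - k))" by (rule binomial_ring)
  also have "\<dots> = (\<Sum>k<n. x b ^ k * U k j)"
   using \<open>j < n\<close> by (intro sum.mono_neutral_cong_left) (auto simp: U_def)
  finally show "(x b - s) ^ j = (\<Sum>k<n. x b ^ k * U k j)" .
 qed
 moreover have "mdet n U = 1"
  using det_upper_triangular[of "mat n n (\<lambda>(i, j). U i j)" n] by (simp add: U_def upper_triangular_def diag_mat_def prod_list_diag_prod
   prod.list_conv_set_nth)
 ultimately show ?thesis by simp
qed

text \<open>\<open>|det W|\<^sup>2 = det (W W*)\<close>\<close>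

lemma det_norm_orthogonal:
 assumes "\<And>i j. i < n \<Longrightarrow> j < n \<Longrightarrow> (\<Sum>k<n. f i k * cnj (f j k)) = (if i = j then c else 0)"
 shows "of_real ((norm (mdet n (\<lambda>i j. f i j)))\<^sup>2) = c ^ n"
proof -
 interpret cnj: comm_ring_hom cnj by unfold_locales auto
 have "cnj (mdet n f) = mdet n (\<lambda>i j. cnj (f i j))"
  unfolding cnj.hom_det[symmetric] by (rule arg_cong[of _ _ det]) (auto intro!: eq_matI)
 hence "mdet n f * cnj (mdet n f) = mdet n f * mdet n (\<lambda>i j. cnj (f j i))" by (simp add: mdet_transpose[of n "\<lambda>i j. cnj (f i j)"])
 also have "\<dots> = mdet n (\<lambda>i j. if i = j then c else 0)" unfolding mdet_mult by (rule mdet_cong) (rule assms)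
 also have "mat n n (\<lambda>(i, j). if i = j then c else 0) = c \<cdot>\<^sub>m 1\<^sub>m n" by (rule eq_matI) auto
 finally show ?thesis unfolding complex_norm_square by simp
qed

subsection \<open>Bases and discriminants\<close>

lemma int_subgroup_generator:
 fixes S :: "int set"
 assumes "a \<in> S" "a \<noteq> 0" and diff: "\<And>x y. x \<in> S \<Longrightarrow> y \<in> S \<Longrightarrow> x - y \<in> S"
 obtains g where "g \<in> S" "g > 0" "\<And>x. x \<in> S \<Longrightarrow> g dvd x"
proof -
 have zero: "0 \<in> S" using diff[OF assms(1,1)] by simp
 have neg: "- x \<in> S" if "x \<in> S" for x using diff[OF zero that] by simp
 have add: "x + y \<in> S" if "x \<in> S" "y \<in> S" for x y using diff[OF that(1) neg[OF that(2)]] by simp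
 have mul: "of_nat n * x \<in> S" if "x \<in> S" for n :: nat and x
  by (induction n) (use that zero add in \<open>auto simp: distrib_right\<close>)
 have mult: "k * x \<in> S" if "x \<in> S" for k x
  using mul[OF that] neg[OF mul[OF that]] by (cases k rule: int_cases2) auto
 have "\<bar>a\<bar> \<in> S" using assms(1) neg by (simp add: abs_if)
 hence "\<exists>n. n > 0 \<and> int n \<in> S" using assms(2) by (intro exI[of _ "nat \<bar>a\<bar>"]) auto
 then obtain n where n: "n > 0" "int n \<in> S" "\<And>m. m > 0 \<and> int m \<in> S \<Longrightarrow> n \<le> m"
  using exists_least_iff[of "\<lambda>n. n > 0 \<and> int n \<in> S"] by (metis not_le)
 have "int n dvd x" if x: "x \<in> S" for x
 proof -
  have "x mod int n = x - (x div int n) * int n" by (simp add: minus_div_mult_eq_mod)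
  hence m: "x mod int n \<in> S" using diff[OF x mult[OF n(2)]] by simp
  have "x mod int n = 0"
  proof (rule ccontr)
   assume ne: "x mod int n \<noteq> 0"
   have b: "0 \<le> x mod int n" "x mod int n < int n" using n(1) by auto
   hence "n \<le> nat (x mod int n)" using n(3)[of "nat (x mod int n)"] m ne by simp
   thus False using b n(1) by (simp add: le_nat_iff)
  qed
  thus ?thesis by auto
 qed
 thus ?thesis using that[of "int n"] n by simp
qed

text \<open>A subgroup that embeds additively into \<open>\<int>\<^sup>n\<close> is free.\<close>

lemma integral_basis_exists:
 fixes H :: "complex set" and co :: "complex \<Rightarrow> nat \<Rightarrow> int"
 assumes "\<And>x y. x \<in> H \<Longrightarrow> y \<in> H \<Longrightarrow> x - y \<in> H" "0 \<in> H"
  and "\<And>x y i. x \<in> H \<Longrightarrow> y \<in> H \<Longrightarrow> i < n \<Longrightarrow> co (x - y) i = co x i - co y i"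
  and "\<And>x. x \<in> H \<Longrightarrow> (\<And>i. i < n \<Longrightarrow> co x i = 0) \<Longrightarrow> x = 0"
 shows "\<exists>bs. set bs \<subseteq> H \<and>
   (\<forall>x\<in>H. \<exists>!cs :: int list. length cs = length bs \<and> x = (\<Sum>i<length bs. of_int (cs ! i) * bs ! i))"
 using assms
proof (induction n arbitrary: H)
 case 0
 hence "H = {0}" by auto
 thus ?case by (intro exI[of _ "[]"]) auto
next
 case (Suc n)
 note diff = Suc.prems(1) and zero = Suc.prems(2) and cdiff = Suc.prems(3) and inj = Suc.prems(4)
 have neg: "- x \<in> H" if "x \<in> H" for x using diff[OF zero that] by simp
 have add: "x + y \<in> H" if "x \<in> H" "y \<in> H" for x y using diff[OF that(1) neg[OF that(2)]] by simp
 have c0: "co 0 i = 0" if "i < Suc n" for i using cdiff[OF zero zero that] by simp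
 have cneg: "co (- x) i = - co x i" if "x \<in> H" "i < Suc n" for x i using cdiff[OF zero that] c0[OF that(2)] by simp
 have cadd: "co (x + y) i = co x i + co y i" if "x \<in> H" "y \<in> H" "i < Suc n" for x y i
  using cdiff[OF that(1) neg[OF that(2)] that(3)] cneg[OF that(2,3)] by simp
 have nat: "of_nat k * x \<in> H \<and> co (of_nat k * x) n = int k * co x n" if "x \<in> H" for x and k :: nat
  by (induction k) (use that zero c0 add cadd in \<open>auto simp: distrib_right\<close>)
 have scale: "of_int k * x \<in> H \<and> co (of_int k * x) n = k * co x n" if "x \<in> H" for x k
  using nat[OF that] neg cneg by (cases k rule: int_cases2) auto
 \<comment> \<open>The kernel of the last coordinate. Its basis is extended by a preimage of a
   generator of the image, which is a subgroup of the integers.\<close>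
 define H' where "H' = {x \<in> H. co x n = 0}"
 have "\<exists>bs. set bs \<subseteq> H' \<and>
   (\<forall>x\<in>H'. \<exists>!cs :: int list. length cs = length bs \<and> x = (\<Sum>i<length bs. of_int (cs ! i) * bs ! i))"
 proof (rule Suc.IH)
  fix x assume x: "x \<in> H'" "\<And>i. i < n \<Longrightarrow> co x i = 0"
  hence "co x i = 0" if "i < Suc n" for i using that by (cases "i = n") (auto simp: H'_def)
  thus "x = 0" using inj x(1) by (auto simp: H'_def)
 qed (auto simp: H'_def diff zero cdiff c0)
 then obtain bs where bs0: "set bs \<subseteq> H' \<and>
   (\<forall>x\<in>H'. \<exists>!cs :: int list. length cs = length bs \<and> x = (\<Sum>i<length bs. of_int (cs ! i) * bs ! i))"
  by (rule exE)
 note bs = conjunct1[OF bs0] bspec[OF conjunct2[OF bs0]]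
 show ?case
 proof (cases "\<forall>x\<in>H. co x n = 0")
  case True
  hence "H' = H" by (auto simp: H'_def)
  thus ?thesis using bs by blast
 next
  case False
  then obtain a where a: "a \<in> H" "co a n \<noteq> 0" by blast
  obtain g where g: "g \<in> (\<lambda>x. co x n) ` H" "g > 0" "\<And>x. x \<in> (\<lambda>x. co x n) ` H \<Longrightarrow> g dvd x"
  proof (rule int_subgroup_generator[of "co a n" "(\<lambda>x. co x n) ` H"])
   fix u v assume "u \<in> (\<lambda>x. co x n) ` H" "v \<in> (\<lambda>x. co x n) ` H"
   then obtain x y where "x \<in> H" "y \<in> H" "u = co x n" "v = co y n" by auto
   thus "u - v \<in> (\<lambda>x. co x n) ` H" using diff cdiff[of x y n] by (intro image_eqI[of _ _ "x - y"]) auto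
  qed (use a in auto)
  obtain z where z: "z \<in> H" "co z n = g" using g(1) by auto
  define m where "m = length bs"
  have snoc: "(\<Sum>i<length (bs @ [z]). of_int ((cs @ [k]) ! i) * (bs @ [z]) ! i)
    = (\<Sum>i<m. of_int (cs ! i) * bs ! i) + of_int k * z" if "length cs = m" for cs k
   using that by (simp add: m_def nth_append)
  have H': "(\<Sum>i<m. of_int (cs ! i) * bs ! i) \<in> H'" for cs :: "int list"
  proof -
   have "bs ! i \<in> H'" if "i < m" for i using bs(1) that by (auto simp: m_def)
   hence "of_int (cs ! i) * bs ! i \<in> H'" if "i < m" for i using scale that by (auto simp: H'_def)
   moreover have "x + y \<in> H'" if "x \<in> H'" "y \<in> H'" for x y using that add cadd by (auto simp: H'_def)
   moreover have "0 \<in> H'" using zero c0 by (auto simp: H'_def)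
   ultimately have "(\<Sum>i<k. of_int (cs ! i) * bs ! i) \<in> H'" if "k \<le> m" for k
    using that by (induction k) auto
   thus ?thesis by simp
  qed
  have "\<exists>!cs :: int list. length cs = length (bs @ [z]) \<and> x = (\<Sum>i<length (bs @ [z]). of_int (cs ! i) * (bs @ [z]) ! i)"
   if x: "x \<in> H" for x
  proof -
   obtain k where k: "co x n = g * k" using g(3)[of "co x n"] x by (auto simp: dvd_def)
   have x': "x - of_int k * z \<in> H'"
    using diff[OF x] scale[OF z(1)] cdiff[OF x, of "of_int k * z" n] z(2) k by (auto simp: H'_def)
   obtain cs where cs: "length cs = m" "x - of_int k * z = (\<Sum>i<m. of_int (cs ! i) * bs ! i)"
    and un: "\<And>ds. length ds = m \<Longrightarrow> x - of_int k * z = (\<Sum>i<m. of_int (ds ! i) * bs ! i) \<Longrightarrow> ds = cs"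
    using bs(2)[OF x'] unfolding m_def by auto
   show ?thesis
   proof (rule ex1I[of _ "cs @ [k]"])
    show "length (cs @ [k]) = length (bs @ [z]) \<and> x = (\<Sum>i<length (bs @ [z]). of_int ((cs @ [k]) ! i) * (bs @ [z]) ! i)"
     unfolding snoc[OF cs(1)] cs(2)[symmetric] using cs(1) by (simp add: m_def)
    fix es :: "int list"
    assume es: "length es = length (bs @ [z]) \<and> x = (\<Sum>i<length (bs @ [z]). of_int (es ! i) * (bs @ [z]) ! i)"
    hence "es \<noteq> []" by auto
    then obtain ds k' where ds: "es = ds @ [k']" by (metis rev_exhaust)
    have ld: "length ds = m" using es ds by (simp add: m_def)
    have e: "x = (\<Sum>i<m. of_int (ds ! i) * bs ! i) + of_int k' * z" using es unfolding ds snoc[OF ld] by simp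
    have "co x n = k' * g" unfolding e using cadd[of "\<Sum>i<m. of_int (ds ! i) * bs ! i" "of_int k' * z" n] H'[of ds] scale[OF z(1)] z(2)
     by (auto simp: H'_def)
    hence kk: "k' = k" using k g(2) by auto
    have "ds = cs" by (rule un[OF ld]) (use e kk in simp)
    thus "es = cs @ [k]" using ds kk by simp
   qed
  qed
  moreover have "set (bs @ [z]) \<subseteq> H" using bs(1) z(1) by (auto simp: H'_def)
  ultimately show ?thesis by blast
 qed
qed

text \<open>Through the Leibniz formula. It serves for the integers, the rationals, the p-integral
  numbers and the abstract ring in \<open>cramer_coordinates\<close>.\<close>

lemma det_in_subring:
 fixes f :: "nat \<Rightarrow> nat \<Rightarrow> complex"
 assumes add: "\<And>x y. x \<in> S \<Longrightarrow> y \<in> S \<Longrightarrow> x + y \<in> S" and mult: "\<And>x y. x \<in> S \<Longrightarrow> y \<in> S \<Longrightarrow> x * y \<in> S"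
  and one: "1 \<in> S" "-1 \<in> S"
  and f: "\<And>i j. i < n \<Longrightarrow> j < n \<Longrightarrow> f i j \<in> S"
 shows "mdet n (\<lambda>i j. f i j) \<in> S"
proof -
 have zero: "0 \<in> S" using add[OF one] by simp
 have prod: "(\<Prod>i\<in>I. g i) \<in> S" if "\<And>i. i \<in> I \<Longrightarrow> g i \<in> S" for I :: "nat set" and g
  using that by (induction I rule: infinite_finite_induct) (auto intro: mult one)
 have sum: "(\<Sum>i\<in>I. g i) \<in> S" if "\<And>i. i \<in> I \<Longrightarrow> g i \<in> S" for I :: "(nat \<Rightarrow> nat) set" and g
  using that by (induction I rule: infinite_finite_induct) (auto intro: add zero)
 have "mdet n (\<lambda>i j. f i j)
  = (\<Sum>p\<in>{p. p permutes {0..<n}}. signof p * (\<Prod>i = 0..<n. mat n n (\<lambda>(i, j). f i j) $$ (i, p i)))"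
  by (rule det_def') simp
 also have "\<dots> \<in> S"
 proof (intro sum mult prod)
  fix p assume p: "p \<in> {p. p permutes {0..<n}}"
  show "signof p \<in> S" using one by (auto simp: sign_def)
  fix i assume i: "i \<in> {0..<n}"
  hence "p i < n" using p permutes_in_image[of p "{0..<n}" i] by auto
  thus "mat n n (\<lambda>(i, j). f i j) $$ (i, p i) \<in> S" using f i by simp
 qed
 finally show ?thesis .
qed

section \<open>Matrices of embeddings and traces\<close>

context kummer
begin

lemma nd_Suc: "r < (l - 1) * l \<Longrightarrow> \<not> l dvd r div l + 1"
proof -
 assume "r < (l - 1) * l"
 hence "r div l < l - 1" by (simp add: less_mult_imp_div_less)
 thus ?thesis by (auto dest: dvd_imp_le)
qed

text \<open>A linear numbering of the embeddings: r = (a - 1) l + b stands for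
  \<open>sig a b\<close>, so that a runs through 1, ..., l - 1.\<close>

definition emb :: "nat \<Rightarrow> complex \<Rightarrow> complex"
 where "emb r = sig (r div l + 1) (r mod l)"

definition trm :: "nat \<Rightarrow> (nat \<Rightarrow> complex) \<Rightarrow> complex mat"
 where "trm n c = mat n n (\<lambda>(i, j). field_trace kumK (c i * c j))"

definition embm :: "(nat \<Rightarrow> complex) \<Rightarrow> complex mat"
 where "embm c = mat ((l - 1) * l) ((l - 1) * l) (\<lambda>(r, s). emb r (c s))"

lemma field_trace_emb:
 assumes "x \<in> kumK"
 shows "field_trace kumK x = (\<Sum>r<(l-1)*l. emb r x)"
proof -
 have "(\<Sum>r<(l-1)*l. emb r x) = (\<Sum>a<l-1. \<Sum>r\<in>{a*l..<a*l+l}. emb r x)"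
  by (rule sum.nat_group[symmetric])
 also have "\<dots> = (\<Sum>a<l-1. \<Sum>b<l. sig (Suc a) b x)"
 proof (rule sum.cong[OF refl])
  fix a
  show "(\<Sum>r\<in>{a*l..<a*l+l}. emb r x) = (\<Sum>b<l. sig (Suc a) b x)"
   by (rule sym, rule sum.reindex_bij_witness[where i = "\<lambda>v. v - a * l" and j = "\<lambda>j. a * l + j"])
    (use l_pos in \<open>auto simp: emb_def\<close>)
 qed
 also have "\<dots> = (\<Sum>a\<in>{1..<l}. \<Sum>b<l. sig a b x)"
  by (rule sum.reindex_bij_witness[where j = Suc and i = "\<lambda>a. a - 1"]) auto
 finally show ?thesis using field_trace_K[OF assms] by simp
qed

lemma emb_mult: "r < (l-1)*l \<Longrightarrow> x \<in> kumK \<Longrightarrow> y \<in> kumK \<Longrightarrow> emb r (x * y) = emb r x * emb r y"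
 unfolding emb_def by (rule sig_mult[OF nd_Suc])
lemma emb_rat: "r < (l-1)*l \<Longrightarrow> emb r (of_rat q) = of_rat q"
 unfolding emb_def by (rule sig_rat[OF nd_Suc])
lemma emb_sum: "r < (l-1)*l \<Longrightarrow> (\<And>i. i \<in> I \<Longrightarrow> f i \<in> kumK) \<Longrightarrow> emb r (\<Sum>i\<in>I. f i) = (\<Sum>i\<in>I. emb r (f i))"
 unfolding emb_def by (rule sig_sum[OF nd_Suc])
lemma emb_pint: "r < (l-1)*l \<Longrightarrow> x \<in> kumK \<Longrightarrow> x \<in> pint p \<Longrightarrow> emb r x \<in> pint p"
 unfolding emb_def by (rule sig_pint[OF nd_Suc])
lemma emb_algebraic_int: "r < (l-1)*l \<Longrightarrow> x \<in> kumK \<Longrightarrow> algebraic_int x \<Longrightarrow> algebraic_int (emb r x)"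
 unfolding emb_def by (rule sig_algebraic_int[OF nd_Suc])

lemma emb_ratcomb:
 assumes "r < (l-1)*l" "\<And>s. s < n \<Longrightarrow> c s \<in> kumK"
 shows "emb r (\<Sum>s<n. of_rat (q s) * c s) = (\<Sum>s<n. of_rat (q s) * emb r (c s))"
 using assms by (subst emb_sum) (auto simp: emb_mult emb_rat K_mult K_rat)

lemma field_trace_ratcomb:
 assumes "\<And>s. s < n \<Longrightarrow> c s \<in> kumK" "x \<in> kumK"
 shows "field_trace kumK ((\<Sum>s<n. of_rat (q s) * c s) * x) = (\<Sum>s<n. of_rat (q s) * field_trace kumK (c s * x))"
proof -
 have "(\<Sum>s<n. of_rat (q s) * c s) * x = (\<Sum>s<n. of_rat (q s) * (c s * x))"
  by (simp add: sum_distrib_right mult.assoc)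
 moreover have "(\<Sum>s<n. of_rat (q s) * (c s * x)) \<in> kumK"
  using assms by (intro K_sum K_mult K_rat) auto
 ultimately have "field_trace kumK ((\<Sum>s<n. of_rat (q s) * c s) * x)
   = (\<Sum>r<(l-1)*l. \<Sum>s<n. of_rat (q s) * emb r (c s * x))"
  using emb_ratcomb[of _ n "\<lambda>s. c s * x" q] assms by (simp add: field_trace_emb K_mult)
 also have "\<dots> = (\<Sum>s<n. \<Sum>r<(l-1)*l. of_rat (q s) * emb r (c s * x))" by (rule sum.swap)
 finally show ?thesis using assms by (simp add: field_trace_emb K_mult sum_distrib_left)
qed

lemma det_trm_change:
 assumes c: "\<And>s. s < n \<Longrightarrow> c s \<in> kumK" and c': "\<And>i. i < n \<Longrightarrow> c' i = (\<Sum>s<n. of_rat (A i s) * c s)"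
 shows "det (trm n c') = (mdet n (\<lambda>i j. of_rat (A i j)))\<^sup>2 * det (trm n c)"
proof -
 let ?a = "\<lambda>i j. of_rat (A i j) :: complex"
 have c'K: "c' i \<in> kumK" if "i < n" for i
  unfolding c'[OF that] using c by (intro K_sum K_mult K_rat) auto
 have 1: "field_trace kumK (c' i * x) = (\<Sum>s<n. of_rat (A i s) * field_trace kumK (c s * x))" if "i < n" "x \<in> kumK" for i x
  unfolding c'[OF that(1)] by (rule field_trace_ratcomb) (use c that in auto)
 have "det (trm n c') = mdet n ?a * (mdet n (\<lambda>s t. field_trace kumK (c s * c t)) * mdet n (\<lambda>i j. ?a j i))"
  unfolding mdet_mult trm_def
 proof (rule mdet_cong)
  fix i j assume ij: "i < n" "j < n"
  have "field_trace kumK (c' i * c' j) = (\<Sum>s<n. of_rat (A i s) * field_trace kumK (c' j * c s))"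
   using 1[OF ij(1) c'K[OF ij(2)]] by (simp add: mult.commute)
  also have "\<dots> = (\<Sum>s<n. of_rat (A i s) * (\<Sum>t<n. field_trace kumK (c s * c t) * of_rat (A j t)))"
   using 1[OF ij(2)] c by (intro sum.cong refl) (simp add: mult.commute)
  finally show "field_trace kumK (c' i * c' j) = (\<Sum>s<n. of_rat (A i s) * (\<Sum>t<n. field_trace kumK (c s * c t) * of_rat (A j t)))" .
 qed
 thus ?thesis unfolding mdet_transpose[of n ?a, symmetric] trm_def by (simp add: power2_eq_square mult_ac)
qed

lemma det_trm_embm:
 assumes c: "\<And>s. s < (l-1)*l \<Longrightarrow> c s \<in> kumK"
 shows "det (trm ((l-1)*l) c) = (det (embm c))\<^sup>2"
proof -
 have "trm ((l-1)*l) c = transpose_mat (embm c) * embm c"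
 proof (rule eq_matI)
  fix i j assume "i < dim_row (transpose_mat (embm c) * embm c)" "j < dim_col (transpose_mat (embm c) * embm c)"
  hence ij: "i < (l-1)*l" "j < (l-1)*l" by (auto simp: embm_def)
  have "field_trace kumK (c i * c j) = (\<Sum>r<(l-1)*l. emb r (c i) * emb r (c j))"
   using c ij by (simp add: field_trace_emb K_mult emb_mult)
  thus "trm ((l-1)*l) c $$ (i, j) = (transpose_mat (embm c) * embm c) $$ (i, j)"
   using ij by (simp add: trm_def embm_def scalar_prod_def atLeast0LessThan)
 qed (auto simp: trm_def embm_def)
 moreover have "det (transpose_mat (embm c) * embm c) = det (transpose_mat (embm c)) * det (embm c)"
  by (rule det_mult[of _ "(l-1)*l"]) (auto simp: embm_def)
 moreover have "det (transpose_mat (embm c)) = det (embm c)"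
  by (rule det_transpose[of _ "(l-1)*l"]) (simp add: embm_def)
 ultimately show ?thesis by (simp add: power2_eq_square)
qed

text \<open>Cramer's rule bounds the denominators of the coordinates by the discriminant.\<close>

lemma cramer_coordinates:
 assumes add: "\<And>x y. x \<in> S \<Longrightarrow> y \<in> S \<Longrightarrow> x + y \<in> S" and mult: "\<And>x y. x \<in> S \<Longrightarrow> y \<in> S \<Longrightarrow> x * y \<in> S"
  and one: "1 \<in> S" "-1 \<in> S" and emb: "\<And>r x. r < (l-1)*l \<Longrightarrow> x \<in> kumK \<Longrightarrow> x \<in> S \<Longrightarrow> emb r x \<in> S"
  and c: "\<And>s. s < (l-1)*l \<Longrightarrow> c s \<in> kumK" "\<And>s. s < (l-1)*l \<Longrightarrow> c s \<in> S"
  and x: "(\<Sum>s<(l-1)*l. of_rat (q s) * c s) \<in> S" and s: "s < (l-1)*l"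
 shows "(det (embm c))\<^sup>2 * of_rat (q s) \<in> S"
proof -
 define N where "N = (l-1)*l"
 define x where "x = (\<Sum>s<N. of_rat (q s) * c s)"
 have xK: "x \<in> kumK" unfolding x_def N_def using c by (intro K_sum K_mult K_rat) auto
 have xS: "x \<in> S" using x by (simp add: x_def N_def)
 define M where "M = embm c"
 have M: "M \<in> carrier_mat N N" by (simp add: M_def embm_def N_def)
 define v where "v = vec N (\<lambda>r. emb r x)"
 define w where "w = vec N (\<lambda>s. of_rat (q s) :: complex)"
 define Rm where "Rm = mat N N (\<lambda>(r, t). if t = s then emb r x else emb r (c t))"
 have zero: "0 \<in> S" using add[OF one] by simp
 have Mdef: "M = mat N N (\<lambda>(r, s). emb r (c s))" unfolding M_def embm_def N_def ..
 have sN: "s < N" using s by (simp only: N_def)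
 have Mw: "M *\<^sub>v w = v"
 proof (rule eq_vecI)
  fix r assume "r < dim_vec v"
  hence r: "r < N" by (simp add: v_def)
  have "emb r x = (\<Sum>s<N. of_rat (q s) * emb r (c s))"
   unfolding x_def by (rule emb_ratcomb) (use r c in \<open>auto simp: N_def\<close>)
  thus "(M *\<^sub>v w) $ r = v $ r" using r
   by (simp add: Mdef v_def w_def scalar_prod_def atLeast0LessThan mult.commute)
 qed (simp add: Mdef v_def)
 \<comment> \<open>Multiplying M w = v by the adjugate yields det M times w without leaving S. A
   second factor det M is added at the end, since the square is the discriminant of the family and
   hence rational.\<close>
 have "adj_mat M * M = det M \<cdot>\<^sub>m 1\<^sub>m N" by (rule adj_mat(3)[OF M])
 hence "(adj_mat M * M) *\<^sub>v w = det M \<cdot>\<^sub>v w"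
  by (intro eq_vecI) (auto simp: w_def scalar_prod_def if_distrib[of "\<lambda>x. x * _"] if_distrib[of "\<lambda>x. _ * x"] sum.delta' cong: if_cong)
 moreover have "(adj_mat M * M) *\<^sub>v w = adj_mat M *\<^sub>v v"
  using assoc_mult_mat_vec[OF adj_mat(1)[OF M] M, of w] Mw by (simp add: w_def)
 ultimately have e: "det M \<cdot>\<^sub>v w = adj_mat M *\<^sub>v v" by simp
 have cof: "adj_mat M $$ (s, r) \<in> S" if r: "r < N" for r
 proof -
  have "adj_mat M $$ (s, r) = cofactor M r s" using s r M by (simp add: adj_mat_def N_def)
  also have "\<dots> = (-1) ^ (r + s) * det (mat_delete M r s)" by (simp add: cofactor_def)
  also have "mat_delete M r s = mat (N - 1) (N - 1) (\<lambda>(i, j). emb (if i < r then i else Suc i) (c (if j < s then j else Suc j)))"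
   using r s by (intro eq_matI) (auto simp: mat_delete_def M_def embm_def N_def)
  finally have e: "adj_mat M $$ (s, r) = (-1) ^ (r + s) * mdet (N - 1) (\<lambda>i j. emb (if i < r then i else Suc i) (c (if j < s then j else Suc j)))" .
  have "(-1) ^ k \<in> S" for k :: nat by (induction k) (use one mult[OF one(2)] in auto)
  moreover have "mdet (N - 1) (\<lambda>i j. emb (if i < r then i else Suc i) (c (if j < s then j else Suc j))) \<in> S"
  proof (rule det_in_subring[OF add mult one])
   fix i j assume "i < N - 1" "j < N - 1"
   hence "(if i < r then i else Suc i) < N" "(if j < s then j else Suc j) < N" by auto
   thus "emb (if i < r then i else Suc i) (c (if j < s then j else Suc j)) \<in> S"
    using emb c by (auto simp: N_def)
  qed
  ultimately show ?thesis unfolding e by (rule mult)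
 qed
 have "(det M \<cdot>\<^sub>v w) $ s = (\<Sum>r<N. adj_mat M $$ (s, r) * emb r x)"
  unfolding e using sN carrier_matD[OF adj_mat(1)[OF M]] by (simp add: v_def scalar_prod_def atLeast0LessThan)
 also have "\<dots> \<in> S"
 proof -
  have "adj_mat M $$ (s, r) * emb r x \<in> S" if "r < N" for r
   using cof[OF that] emb[OF _ xK xS, of r] that by (intro mult) (auto simp: N_def)
  hence "(\<Sum>r<k. adj_mat M $$ (s, r) * emb r x) \<in> S" if "k \<le> N" for k
   using that by (induction k) (auto intro: zero add)
  thus ?thesis by simp
 qed
 finally have "det M * of_rat (q s) \<in> S" using s by (simp add: w_def N_def)
 moreover have "det M \<in> S" unfolding M_def embm_def
  by (rule det_in_subring[OF add mult one]) (use emb c in auto)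
 ultimately have "det M * (det M * of_rat (q s)) \<in> S" by (rule mult[rotated])
 thus ?thesis by (simp add: M_def power2_eq_square mult.assoc)
qed

lemma independent_if_det:
 assumes c: "\<And>s. s < (l-1)*l \<Longrightarrow> c s \<in> kumK" and d: "det (embm c) \<noteq> 0"
  and z: "(\<Sum>s<(l-1)*l. of_rat (q s) * c s) = 0" and s: "s < (l-1)*l"
 shows "q s = 0"
proof -
 define N where "N = (l-1)*l"
 define w where "w = vec N (\<lambda>s. of_rat (q s) :: complex)"
 have Mdef: "embm c = mat N N (\<lambda>(r, s). emb r (c s))" unfolding embm_def N_def ..
 hence M: "embm c \<in> carrier_mat N N" by simp
 have "embm c *\<^sub>v w = 0\<^sub>v N"
 proof (rule eq_vecI)
  fix r assume "r < dim_vec (0\<^sub>v N)"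
  hence r: "r < N" by simp
  have "emb r (of_rat 0) = (\<Sum>s<N. of_rat (q s) * emb r (c s))"
   using emb_ratcomb[of r N c q] r c z by (simp add: N_def)
  hence "(\<Sum>s<N. of_rat (q s) * emb r (c s)) = 0" using emb_rat[of r 0] r by (simp add: N_def)
  thus "(embm c *\<^sub>v w) $ r = 0\<^sub>v N $ r" using r
   by (simp add: Mdef w_def scalar_prod_def atLeast0LessThan mult.commute)
 qed (simp add: Mdef)
 hence "w = 0\<^sub>v N" using det_0_iff_vec_prod_zero_field[OF M] d by (metis w_def vec_carrier)
 hence "w $ s = 0" using s by (simp add: N_def)
 thus ?thesis using s by (simp add: w_def N_def)
qed

end

text \<open>Comparing the traces of the two products of base changes shows that the families have the same size.\<close>

lemma base_change_inverse:
 fixes c c' :: "nat \<Rightarrow> complex" and A B :: "nat \<Rightarrow> nat \<Rightarrow> rat"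
 assumes c': "\<And>i. i < n' \<Longrightarrow> c' i = (\<Sum>s<n. of_rat (A i s) * c s)"
  and c: "\<And>s. s < n \<Longrightarrow> c s = (\<Sum>i<n'. of_rat (B s i) * c' i)"
  and ind': "\<And>q i. (\<Sum>i<n'. of_rat (q i) * c' i) = 0 \<Longrightarrow> i < n' \<Longrightarrow> q i = 0"
  and ind: "\<And>q i. (\<Sum>i<n. of_rat (q i) * c i) = 0 \<Longrightarrow> i < n \<Longrightarrow> q i = 0"
 shows "n = n'" "mdet n (\<lambda>i j. of_rat (A i j)) * mdet n (\<lambda>i j. of_rat (B i j)) = (1 :: complex)"
proof -
 have prod: "(\<Sum>s<m. Ua i s * Ub s j) = (if i = j then 1 else 0)"
  if d': "\<And>i. i < m' \<Longrightarrow> d' i = (\<Sum>s<m. of_rat (Ua i s) * d s)"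
   and d: "\<And>s. s < m \<Longrightarrow> d s = (\<Sum>i<m'. of_rat (Ub s i) * d' i)"
   and ind: "\<And>q i. (\<Sum>i<m'. of_rat (q i) * d' i) = 0 \<Longrightarrow> i < m' \<Longrightarrow> q i = 0"
   and ij: "i < m'" "j < m'"
  for d d' :: "nat \<Rightarrow> complex" and Ua Ub :: "nat \<Rightarrow> nat \<Rightarrow> rat" and m m' i j
 proof -
  have "d' i = (\<Sum>s<m. \<Sum>j<m'. of_rat (Ua i s) * (of_rat (Ub s j) * d' j))"
   using d'[OF ij(1)] d by (simp add: sum_distrib_left)
  also have "\<dots> = (\<Sum>j<m'. \<Sum>s<m. of_rat (Ua i s) * (of_rat (Ub s j) * d' j))" by (rule sum.swap)
  also have "\<dots> = (\<Sum>j<m'. of_rat (\<Sum>s<m. Ua i s * Ub s j) * d' j)"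
   by (simp add: of_rat_sum of_rat_mult sum_distrib_right mult.assoc)
  finally have 1: "d' i = (\<Sum>j<m'. of_rat (\<Sum>s<m. Ua i s * Ub s j) * d' j)" .
  have "(\<Sum>j<m'. of_rat ((\<Sum>s<m. Ua i s * Ub s j) - (if i = j then 1 else 0)) * d' j)
    = (\<Sum>j<m'. of_rat (\<Sum>s<m. Ua i s * Ub s j) * d' j) - (\<Sum>j<m'. if j = i then d' j else 0)"
   unfolding sum_subtractf[symmetric] by (intro sum.cong refl) (auto simp: of_rat_diff left_diff_distrib)
  also have "\<dots> = 0" using 1 ij by (simp add: sum.delta')
  finally show ?thesis using ind[of "\<lambda>j. (\<Sum>s<m. Ua i s * Ub s j) - (if i = j then 1 else 0)" j] ij by simp
 qed
 have AB: "(\<Sum>s<n. A i s * B s j) = (if i = j then 1 else 0)" if "i < n'" "j < n'" for i j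
  by (rule prod[where d' = c' and d = c and Ua = A and Ub = B and m = n and m' = n'],
   fact c', fact c, fact ind', fact that(1), fact that(2))
 have BA: "(\<Sum>i<n'. B s i * A i t) = (if s = t then 1 else 0)" if "s < n" "t < n" for s t
  by (rule prod[where d' = c and d = c' and Ua = B and Ub = A and m = n' and m' = n],
   fact c, fact c', fact ind, fact that(1), fact that(2))
 have "(of_nat n' :: rat) = (\<Sum>i<n'. \<Sum>s<n. A i s * B s i)" using AB by simp
 also have "\<dots> = (\<Sum>s<n. \<Sum>i<n'. A i s * B s i)" by (rule sum.swap)
 also have "\<dots> = (\<Sum>s<n. \<Sum>i<n'. B s i * A i s)" by (simp add: mult.commute)
 also have "\<dots> = of_nat n" using BA by simp
 finally show n: "n = n'" by simp
 have "mdet n (\<lambda>i j. of_rat (A i j)) * mdet n (\<lambda>i j. of_rat (B i j)) = mdet n (\<lambda>i j. if i = j then 1 else 0)"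
  unfolding mdet_mult
 proof (rule mdet_cong)
  fix i j assume ij: "i < n" "j < n"
  have "(\<Sum>k<n. of_rat (A i k) * of_rat (B k j)) = (of_rat (\<Sum>s<n. A i s * B s j) :: complex)"
   by (simp add: of_rat_sum of_rat_mult)
  thus "(\<Sum>k<n. of_rat (A i k) * of_rat (B k j)) = (if i = j then 1 else 0 :: complex)" using AB[of i j] ij n by simp
 qed
 also have "mat n n (\<lambda>(i, j). if i = j then 1 else 0 :: complex) = 1\<^sub>m n" by (rule eq_matI) auto
 finally show "mdet n (\<lambda>i j. of_rat (A i j)) * mdet n (\<lambda>i j. of_rat (B i j)) = 1" by simp
qed

lemma (in prime_place) multiplicity_eq_if_punit:
 assumes x: "punit p x" and e: "of_int d = of_nat p ^ e * x"
 shows "multiplicity (int p) d = e"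
proof -
 have p0: "of_nat p \<noteq> (0 :: complex)" using prime_p by auto
 have d0: "d \<noteq> 0" using e x p0 by (auto simp: punit_def)
 have "\<not> is_unit (int p)" using prime_p by (metis not_prime_unit prime_nat_int_transfer)
 then obtain u where u: "d = int p ^ multiplicity (int p) d * u" "\<not> int p dvd u"
  using multiplicity_decompose'[OF d0] by blast
 define v where "v = multiplicity (int p) d"
 have eq: "of_nat p ^ v * of_int u = of_nat p ^ e * x" using e u(1) unfolding v_def by (metis of_int_mult of_int_of_nat_eq of_int_power)
 have False if "v < e"
 proof -
  have "e = v + Suc (e - Suc v)" using that by simp
  hence "of_nat p ^ e = of_nat p ^ v * (of_nat p * of_nat p ^ (e - Suc v) :: complex)" by (metis power_Suc power_add)
  hence "of_int u / of_nat p = of_nat p ^ (e - Suc v) * x" using eq p0 by (simp add: field_simps)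
  also have "\<dots> \<in> pint p" using x by (intro pint_mult pint_power pint_of_nat) (simp add: punit_def)
  finally show False using int_dvd_if_pint u(2) by blast
 qed
 moreover have False if "e < v"
 proof -
  have "v = e + Suc (v - Suc e)" using that by simp
  hence "of_nat p ^ v = of_nat p ^ e * (of_nat p * of_nat p ^ (v - Suc e) :: complex)" by (metis power_Suc power_add)
  hence "x = of_nat p * (of_nat p ^ (v - Suc e) * of_int u)" using eq p0 by simp
  hence "of_int 1 / of_nat p = of_nat p ^ (v - Suc e) * of_int u * inverse x"
   using p0 x by (simp add: punit_def field_simps)
  also have "\<dots> \<in> pint p" using x by (intro pint_mult pint_power pint_of_nat pint_of_int) (simp add: punit_def)
  finally show False using int_dvd_if_pint not_dvd_one by blast
 qed
 ultimately show ?thesis unfolding v_def by (metis linorder_neqE_nat)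
qed

section \<open>Determinants of families built from relative bases\<close>

context kummer
begin

definition N :: nat where "N = (l - 1) * l"

text \<open>The exponent of \<open>lam\<close> is the fast digit of s, while in \<open>emb\<close>
  the exponent b is the fast digit of r. This mixed ordering is the one for which
  \<open>det_twisted_kronecker\<close> is stated.\<close>

definition fam :: "(nat \<Rightarrow> complex) \<Rightarrow> nat \<Rightarrow> complex"
 where "fam g s = lam ^ (s mod (l - 1)) * g (s div (l - 1))"

abbreviation "fdet g \<equiv> (norm (det (embm (fam g))))\<^sup>2"

abbreviation "lamdet \<equiv> norm (mdet (l - 1) (\<lambda>a i. (1 - \<zeta> ^ Suc a) ^ i))"

lemma sum_fam:
 "(\<Sum>s<N. of_rat (q (s div (l - 1)) (s mod (l - 1))) * fam g s)
   = (\<Sum>j<l. (\<Sum>i<l-1. of_rat (q j i) * lam ^ i) * g j)"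
proof -
 have l1: "l - 1 > 0" using l_ge_3 by simp
 have "(\<Sum>j<l. (\<Sum>i<l-1. of_rat (q j i) * lam ^ i) * g j)
   = (\<Sum>j<l. \<Sum>s\<in>{j*(l-1)..<j*(l-1)+(l-1)}. of_rat (q (s div (l - 1)) (s mod (l - 1))) * fam g s)"
 proof (rule sum.cong[OF refl])
  fix j
  have "(\<Sum>i<l-1. of_rat (q j i) * lam ^ i) * g j = (\<Sum>i<l-1. of_rat (q j i) * (lam ^ i * g j))"
   by (simp add: sum_distrib_right mult.assoc)
  also have "\<dots> = (\<Sum>s\<in>{j*(l-1)..<j*(l-1)+(l-1)}. of_rat (q (s div (l - 1)) (s mod (l - 1))) * fam g s)"
   by (rule sum.reindex_bij_witness[where i = "\<lambda>v. v - j * (l - 1)" and j = "\<lambda>i. j * (l - 1) + i"])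
    (use l1 in \<open>auto simp: fam_def\<close>)
  finally show "(\<Sum>i<l-1. of_rat (q j i) * lam ^ i) * g j
   = (\<Sum>s\<in>{j*(l-1)..<j*(l-1)+(l-1)}. of_rat (q (s div (l - 1)) (s mod (l - 1))) * fam g s)" .
 qed
 also have "\<dots> = (\<Sum>s<l*(l-1). of_rat (q (s div (l - 1)) (s mod (l - 1))) * fam g s)"
  by (rule sum.nat_group)
 finally show ?thesis by (simp only: N_def mult.commute)
qed

lemma F_lam_coords:
 assumes "x \<in> cycF"
 obtains q where "x = (\<Sum>i<l-1. of_rat (q i) * lam ^ i)"
proof -
 obtain r where r: "x = (\<Sum>i<l-1. of_rat (r i) * \<zeta> ^ i)" using assms unfolding cycF_def by blast
 show ?thesis by (rule that) (unfold r lam_def, rule binomial_basis_change)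
qed

lemma lam_pint: "algebraic_int lam"
 using algebraic_int_plus_complex[of 1 "- \<zeta>"] algebraic_int_zeta by (simp add: lam_def)

lemma fam_alpha_span:
 assumes "x \<in> kumK"
 obtains q where "x = (\<Sum>s<N. of_rat (q s) * fam (\<lambda>j. \<alpha> ^ j) s)"
proof -
 obtain y where y: "\<forall>j<l. y j \<in> cycF" "x = (\<Sum>j<l. y j * \<alpha> ^ j)" using assms unfolding kumK_def by blast
 have "\<forall>j\<in>{..<l}. \<exists>q. y j = (\<Sum>i<l-1. of_rat (q i) * lam ^ i)" using y(1) F_lam_coords by (metis lessThan_iff)
 then obtain q where q: "\<And>j. j < l \<Longrightarrow> y j = (\<Sum>i<l-1. of_rat (q j i) * lam ^ i)" by (auto dest!: bchoice)
 show ?thesis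
  by (rule that[of "\<lambda>s. q (s div (l - 1)) (s mod (l - 1))"], unfold sum_fam y(2))
   (intro sum.cong refl, simp add: q)
qed

lemma fam_K:
 assumes "\<And>j. j < l \<Longrightarrow> g j \<in> kumK" "s < N"
 shows "fam g s \<in> kumK"
proof -
 have "s div (l - 1) < l" using assms(2) by (simp add: N_def less_mult_imp_div_less mult.commute)
 thus ?thesis unfolding fam_def by (intro K_mult[OF K_power[OF K_F[OF F_lam]]] assms(1))
qed

lemma fam_alpha_algebraic_int: "algebraic_int (fam (\<lambda>j. \<alpha> ^ j) s)"
 unfolding fam_def by (intro algebraic_int_times_complex algebraic_int_power_complex lam_pint algebraic_int_alpha)

lemma lam_conj: "sig (Suc a) b lam = 1 - \<zeta> ^ Suc a" if "\<not> l dvd Suc a"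
 using sig_diff[OF that K_1 K_zeta[of 1], of b] sig_int[OF that, of b 1] sig_zeta[OF that, of b 1] by (simp add: lam_def)

text \<open>The Galois-conjugate matrix of a family \<open>fam g\<close> factors through the conjugates over \<open>cycF\<close>.\<close>

lemma det_fam:
 assumes g: "\<And>j. j < l \<Longrightarrow> g j \<in> kumK"
 shows "norm (det (embm (fam g)))
  = (\<Prod>a<l-1. norm (mdet l (\<lambda>b j. sig (Suc a) b (g j))))
   * lamdet ^ l"
proof -
 have "embm (fam g) = mat ((l - 1) * l) ((l - 1) * l)
   (\<lambda>(r, s). sig (Suc (r div l)) (r mod l) (g (s div (l - 1))) * (1 - \<zeta> ^ Suc (r div l)) ^ (s mod (l - 1)))"
  unfolding embm_def
 proof (intro eq_matI; simp only: dim_row_mat dim_col_mat index_mat prod.case)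
  fix r s assume rs: "r < (l - 1) * l" "s < (l - 1) * l"
  have sj: "s div (l - 1) < l" using rs(2) by (simp add: less_mult_imp_div_less mult.commute)
  have nd: "\<not> l dvd Suc (r div l)" using nd_Suc[OF rs(1)] by simp
  have "emb r (fam g s) = sig (Suc (r div l)) (r mod l) (lam ^ (s mod (l - 1))) * sig (Suc (r div l)) (r mod l) (g (s div (l - 1)))"
   unfolding emb_def fam_def using sig_mult[OF nd K_power[OF K_F[OF F_lam]] g[OF sj]] by simp
  also have "sig (Suc (r div l)) (r mod l) (lam ^ (s mod (l - 1))) = (1 - \<zeta> ^ Suc (r div l)) ^ (s mod (l - 1))"
   using sig_power[OF nd K_F[OF F_lam]] lam_conj[OF nd] by simp
  finally show "emb r (fam g s) = sig (Suc (r div l)) (r mod l) (g (s div (l - 1))) * (1 - \<zeta> ^ Suc (r div l)) ^ (s mod (l - 1))"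
   by (simp only: mult.commute)
 qed
 thus ?thesis
  using det_twisted_kronecker[of "l - 1" l "\<lambda>a b j. sig (Suc a) b (g j)" "\<lambda>_ a i. (1 - \<zeta> ^ Suc a) ^ i"] l_ge_3
  by simp
qed

lemma cnj_zeta_power: "cnj (\<zeta> ^ j) = \<zeta> ^ ((l - 1) * j)"
proof -
 have "norm \<zeta> = 1" by (simp add: zeta)
 hence "\<zeta> * cnj \<zeta> = 1" using complex_norm_square[of \<zeta>] by simp
 moreover have "\<zeta> * \<zeta> ^ (l - 1) = 1" using zeta_l l_pos by (cases l) auto
 ultimately have "cnj \<zeta> = \<zeta> ^ (l - 1)" using zeta_nz by (metis mult_left_cancel)
 thus ?thesis by (simp add: power_mult)
qed

text \<open>The rows are the characters of the cyclic group of order l, so the matrix times its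
  adjoint is l times the identity.\<close>

lemma det_fourier:
 "(norm (mdet l (\<lambda>b j. (\<zeta> ^ (a * b)) ^ j)))\<^sup>2 = real l ^ l" if a: "\<not> l dvd a"
proof -
 have "(\<Sum>k<l. (\<zeta> ^ (a * i)) ^ k * cnj ((\<zeta> ^ (a * j)) ^ k)) = (if i = j then of_nat l else 0)"
  if ij: "i < l" "j < l" for i j
 proof -
  have "(\<Sum>k<l. (\<zeta> ^ (a * i)) ^ k * cnj ((\<zeta> ^ (a * j)) ^ k)) = (\<Sum>k<l. (\<zeta> ^ (a * (i + (l - 1) * j))) ^ k)"
   by (intro sum.cong refl)
    (simp add: cnj_zeta_power power_mult[symmetric] power_add[symmetric] algebra_simps del: complex_cnj_power)
  also have "\<dots> = (if l dvd a * (i + (l - 1) * j) then of_nat l else 0)" by (rule sum_zeta_power)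
  also have "l dvd a * (i + (l - 1) * j) \<longleftrightarrow> l dvd i + (l - 1) * j"
   using a prime_l prime_dvd_mult_iff by blast
  also have "l dvd i + (l - 1) * j \<longleftrightarrow> i = j"
  proof -
   have "i + (l - 1) * j + j = i + l * j" using l_pos by (cases l) auto
   hence e: "int (i + (l - 1) * j) = int i - int j + int l * int j"
    by (metis add_diff_cancel_right' add_diff_eq diff_add_eq of_nat_add of_nat_mult)
   have "l dvd i + (l - 1) * j \<longleftrightarrow> int l dvd int (i + (l - 1) * j)" by (simp only: int_dvd_int_iff)
   also have "\<dots> \<longleftrightarrow> int l dvd int i - int j" unfolding e by (simp add: dvd_add_left_iff)
   also have "\<dots> \<longleftrightarrow> int i - int j = 0"
   proof
    assume "int l dvd int i - int j"
    hence "int l dvd \<bar>int i - int j\<bar>" by simp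
    moreover have "\<not> int l \<le> \<bar>int i - int j\<bar>" using ij by auto
    ultimately show "int i - int j = 0" using zdvd_imp_le[of "int l" "\<bar>int i - int j\<bar>"] by auto
   qed simp
   finally show ?thesis by simp
  qed
  finally show ?thesis .
 qed
 from det_norm_orthogonal[of l "\<lambda>i k. (\<zeta> ^ (a * i)) ^ k", OF this]
 have "of_real ((norm (mdet l (\<lambda>b j. (\<zeta> ^ (a * b)) ^ j)))\<^sup>2) = (of_real (real l ^ l) :: complex)"
  by simp
 thus ?thesis by (simp only: of_real_eq_iff)
qed

text \<open>Up to sign the discriminant of Q(\<zeta>). The determinant is found inside the full
  Vandermonde matrix of the numbers 1 - \<zeta>^b: the row b = 0 is (1, 0, ..., 0), and taking a
  factor 1 - \<zeta>^a out of each other row costs a factor l in total.\<close>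

lemma det_lam: "(lamdet)\<^sup>2 = real l ^ (l - 2)"
proof -
 define V where "V = mat l l (\<lambda>(b, j). (1 - \<zeta> ^ b) ^ j)"
 have V: "V \<in> carrier_mat l l" by (simp add: V_def)
 define L where "L = mdet (l - 1) (\<lambda>a i. (1 - \<zeta> ^ Suc a) ^ i)"
 have "det V = mdet l (\<lambda>b j. (\<zeta> ^ b - 1) ^ j * (-1) ^ j)"
 proof -
  have "(1 - \<zeta> ^ b) ^ j = (\<zeta> ^ b - 1) ^ j * (-1) ^ j" for b j
   by (metis minus_diff_eq mult_minus1_right power_mult_distrib)
  thus ?thesis by (simp add: V_def)
 qed
 also have "\<dots> = mdet l (\<lambda>b j. (\<zeta> ^ b - 1) ^ j) * (\<Prod>j<l. (-1) ^ j)"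
  by (rule det_scale_columns)
 also have "mdet l (\<lambda>b j. (\<zeta> ^ b - 1) ^ j) = mdet l (\<lambda>b j. (\<zeta> ^ b) ^ j)"
  by (rule det_vandermonde_shift)
 finally have "norm (det V) = norm (mdet l (\<lambda>b j. (\<zeta> ^ b) ^ j))"
  by (simp add: norm_mult prod_norm[symmetric] norm_power)
 hence 1: "(norm (det V))\<^sup>2 = real l ^ l" using det_fourier[OF not_dvd_1] by simp
 have "det V = (\<Sum>j<l. V $$ (0, j) * cofactor V 0 j)"
  by (rule laplace_expansion_row[OF V]) (rule l_pos)
 also have "\<dots> = (\<Sum>j\<in>{0}. V $$ (0, j) * cofactor V 0 j)"
  by (rule sum.mono_neutral_right) (use l_pos in \<open>auto simp: V_def\<close>)
 also have "\<dots> = det (mat_delete V 0 0)" using l_pos by (simp add: V_def cofactor_def)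
 also have "mat_delete V 0 0 = mat (l - 1) (l - 1) (\<lambda>(a, i). (1 - \<zeta> ^ Suc a) * (1 - \<zeta> ^ Suc a) ^ i)"
  by (rule eq_matI) (auto simp: mat_delete_def V_def)
 also have "det \<dots> = (\<Prod>a<l-1. (1 - \<zeta> ^ Suc a)) * L"
  unfolding L_def by (rule det_scale_rows)
 also have "(\<Prod>a<l-1. (1 - \<zeta> ^ Suc a)) = (\<Prod>a\<in>{1..<l}. (1 - \<zeta> ^ a))"
  by (rule prod.reindex_bij_witness[where j = Suc and i = "\<lambda>a. a - 1"]) auto
 finally have "det V = of_nat l * L" unfolding prod_one_minus_zeta .
 hence "real l ^ 2 * (norm L)\<^sup>2 = real l ^ l" using 1 by (simp add: norm_mult power_mult_distrib)
 also have "real l ^ l = real l ^ (2 + (l - 2))"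
  using l_ge_3 by (intro arg_cong[of _ _ "\<lambda>k. real l ^ k"]) simp
 also have "\<dots> = real l ^ 2 * real l ^ (l - 2)" by (rule power_add)
 finally show ?thesis using l_pos by (simp add: L_def)
qed

lemma norm_det_alpha: "(norm (mdet l (\<lambda>b j. (\<zeta> ^ b * \<alpha>) ^ j)))\<^sup>2 = real l ^ l * \<bar>real_of_int D\<bar> ^ (l - 1)"
proof -
 have "mdet l (\<lambda>b j. (\<zeta> ^ b * \<alpha>) ^ j) = mdet l (\<lambda>b j. (\<zeta> ^ b) ^ j) * (\<Prod>j<l. \<alpha> ^ j)"
  by (simp only: power_mult_distrib det_scale_columns)
 also have "(\<Prod>j<l. \<alpha> ^ j) = \<alpha> ^ (\<Sum>j<l. j)" by (rule power_sum[symmetric])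
 finally have "(norm (mdet l (\<lambda>b j. (\<zeta> ^ b * \<alpha>) ^ j)))\<^sup>2 = real l ^ l * (norm \<alpha> ^ (\<Sum>j<l. j))\<^sup>2"
  using det_fourier[OF not_dvd_1] by (simp add: norm_mult norm_power power_mult_distrib)
 also have "(norm \<alpha> ^ (\<Sum>j<l. j))\<^sup>2 = norm \<alpha> ^ (2 * (\<Sum>j<l. j))" by (simp add: power_mult[symmetric] mult.commute)
 also have "2 * (\<Sum>j<l. j) = l * (l - 1)"
 proof -
  have "(\<Sum>j<l. j) = (\<Sum>j\<in>{0..l-1}. j)" using l_pos by (intro sum.cong) auto
  also have "2 * \<dots> = (l - 1) * (l - 1 + 1)" using gauss_sum[of "l - 1", where ?'a = nat] by simp
  finally show ?thesis using l_pos by (simp add: mult.commute)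
 qed
 also have "norm \<alpha> ^ (l * (l - 1)) = norm (\<alpha> ^ l) ^ (l - 1)" by (simp add: power_mult norm_power)
 also have "norm (\<alpha> ^ l) = \<bar>real_of_int D\<bar>" unfolding alpha by simp
 finally show ?thesis .
qed

text \<open>The absolute discriminant of the lattice spanned by the products lam^i \<alpha>^j. It
  gives the exact contribution at primes other than l where these products form a basis, and its
  nonvanishing gives independence everywhere.\<close>

lemma det_fam_alpha:
 "fdet (\<lambda>j. \<alpha> ^ j) = real l ^ (l * (l - 1) + (l - 2) * l) * \<bar>real_of_int D\<bar> ^ ((l - 1)\<^sup>2)"
proof -
 have nd: "\<not> l dvd Suc a" if "a < l - 1" for a using that by (auto dest: dvd_imp_le)
 have "sig (Suc a) b (\<alpha> ^ j) = (\<zeta> ^ b * \<alpha>) ^ j" if "a < l - 1" for a b j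
  using sig_power[OF nd[OF that] K_alpha] sig_alpha[OF nd[OF that]] by simp
 hence "norm (det (embm (fam (\<lambda>j. \<alpha> ^ j)))) = norm (mdet l (\<lambda>b j. (\<zeta> ^ b * \<alpha>) ^ j)) ^ (l - 1)
   * lamdet ^ l"
  using det_fam[of "\<lambda>j. \<alpha> ^ j"] by (simp add: K_power K_alpha)
 hence "fdet (\<lambda>j. \<alpha> ^ j) = ((norm (mdet l (\<lambda>b j. (\<zeta> ^ b * \<alpha>) ^ j)))\<^sup>2) ^ (l - 1)
   * ((lamdet)\<^sup>2) ^ l"
  by (simp add: power_mult_distrib power_mult[symmetric] mult.commute)
 also have "\<dots> = (real l ^ l * \<bar>real_of_int D\<bar> ^ (l - 1)) ^ (l - 1) * (real l ^ (l - 2)) ^ l"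
  unfolding norm_det_alpha det_lam ..
 also have "\<dots> = real l ^ (l * (l - 1) + (l - 2) * l) * \<bar>real_of_int D\<bar> ^ ((l - 1)\<^sup>2)"
  by (simp add: power_mult_distrib power_mult[symmetric] power_add power2_eq_square)
 finally show ?thesis .
qed

lemma det_fam_alpha_nz: "det (embm (fam (\<lambda>j. \<alpha> ^ j))) \<noteq> 0"
proof
 assume "det (embm (fam (\<lambda>j. \<alpha> ^ j))) = 0"
 hence "real l ^ (l * (l - 1) + (l - 2) * l) * \<bar>real_of_int D\<bar> ^ ((l - 1)\<^sup>2) = 0"
  using det_fam_alpha by simp
 thus False using l_pos D_nz by simp
qed

end

section \<open>Integral bases and the local determination of the discriminant\<close>

context kummer
begin

lemma field_trace_Ints:
 assumes "x \<in> kumK" "algebraic_int x"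
 shows "field_trace kumK x \<in> \<int>"
proof (rule rational_algebraic_int_is_int)
 show "field_trace kumK x \<in> \<rat>" unfolding field_trace_K[OF assms(1)] by (rule trace_rational[OF assms(1)])
 show "algebraic_int (field_trace kumK x)"
  unfolding field_trace_emb[OF assms(1)] using emb_algebraic_int assms by (intro algebraic_int_sum_complex) auto
qed

lemma det_trm_Ints:
 assumes "\<And>i. i < n \<Longrightarrow> c i \<in> ring_of_integers kumK"
 shows "det (trm n c) \<in> \<int>"
 unfolding trm_def
proof (rule det_in_subring)
 fix i j assume "i < n" "j < n"
 thus "field_trace kumK (c i * c j) \<in> \<int>"
  using assms unfolding ring_of_integers_def by (intro field_trace_Ints K_mult algebraic_int_times_complex) auto
qed auto

abbreviation c0 :: "nat \<Rightarrow> complex" where "c0 \<equiv> fam (\<lambda>j. \<alpha> ^ j)"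

lemma c0_K: "s < N \<Longrightarrow> c0 s \<in> kumK"
 by (rule fam_K) (auto intro: K_power K_alpha)

lemma c0_integers: "s < N \<Longrightarrow> c0 s \<in> ring_of_integers kumK"
 unfolding ring_of_integers_def using c0_K fam_alpha_algebraic_int by simp

lemma det_c0_int: obtains d :: int where "(det (embm c0))\<^sup>2 = of_int d" "d \<noteq> 0"
proof -
 have "det (trm N c0) \<in> \<int>" by (rule det_trm_Ints) (rule c0_integers)
 moreover have "det (trm N c0) = (det (embm c0))\<^sup>2"
  unfolding N_def by (rule det_trm_embm) (use c0_K in \<open>simp add: N_def\<close>)
 ultimately obtain d where d: "(det (embm c0))\<^sup>2 = of_int d" by (auto elim: Ints_cases)
 moreover have "d \<noteq> 0" using d det_fam_alpha_nz by auto
 ultimately show ?thesis by (rule that)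
qed

lemma c0_independent: "(\<Sum>s<N. of_rat (q s) * c0 s) = 0 \<Longrightarrow> s < N \<Longrightarrow> q s = 0"
 unfolding N_def by (rule independent_if_det[OF _ det_fam_alpha_nz]) (auto intro: c0_K simp: N_def)

lemma ring_of_integers_diff:
 "x \<in> ring_of_integers kumK \<Longrightarrow> y \<in> ring_of_integers kumK \<Longrightarrow> x - y \<in> ring_of_integers kumK"
 using algebraic_int_plus_complex[of x "- y"] by (simp add: ring_of_integers_def K_diff)

text \<open>By Cramer's rule the discriminant d of the family \<open>c0\<close> clears the
  denominators of all integral elements. Their multiples by d have integer coordinates, unique by
  independence, and this embeds the ring of integers additively into Z^N.\<close>

lemma integral_basis_K: obtains bs where "integral_basis kumK bs"
proof -
 obtain d where d: "(det (embm c0))\<^sup>2 = of_int d" "d \<noteq> 0" by (rule det_c0_int)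
 have ex: "\<exists>f :: nat \<Rightarrow> int. of_int d * x = (\<Sum>s<N. of_int (f s) * c0 s)" if x: "x \<in> ring_of_integers kumK" for x
 proof -
  have xK: "x \<in> kumK" "algebraic_int x" using x by (auto simp: ring_of_integers_def)
  obtain q where q: "x = (\<Sum>s<N. of_rat (q s) * c0 s)" using fam_alpha_span[OF xK(1)] by blast
  have "\<exists>k :: int. of_int d * of_rat (q s) = (of_int k :: complex)" if s: "s < N" for s
  proof -
   have "(det (embm c0))\<^sup>2 * of_rat (q s) \<in> {x. algebraic_int x}"
   proof (rule cramer_coordinates[where c = c0])
    show "(\<Sum>s<(l-1)*l. of_rat (q s) * c0 s) \<in> {x. algebraic_int x}" using xK(2) q by (simp add: N_def)
   qed (use s c0_K fam_alpha_algebraic_int emb_algebraic_int in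
     \<open>auto simp: N_def intro: algebraic_int_plus_complex algebraic_int_times_complex\<close>)
   hence "algebraic_int (of_int d * of_rat (q s) :: complex)" using d by simp
   moreover have "of_int d * of_rat (q s) \<in> (\<rat> :: complex set)" by (intro Rats_mult) auto
   ultimately have "of_int d * of_rat (q s) \<in> (\<int> :: complex set)" using rational_algebraic_int_is_int by blast
   thus ?thesis by (auto elim: Ints_cases)
  qed
  hence "\<forall>s\<in>{..<N}. \<exists>k :: int. of_int d * of_rat (q s) = (of_int k :: complex)" by simp
  then obtain f :: "nat \<Rightarrow> int" where f: "\<And>s. s < N \<Longrightarrow> of_int d * of_rat (q s) = (of_int (f s) :: complex)"
   by (auto dest!: bchoice)
  have "of_int d * x = (\<Sum>s<N. of_int d * of_rat (q s) * c0 s)" unfolding q by (simp add: sum_distrib_left mult.assoc)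
  also have "\<dots> = (\<Sum>s<N. of_int (f s) * c0 s)" by (intro sum.cong refl) (simp add: f)
  finally show ?thesis by blast
 qed
 define co where "co x = (SOME f :: nat \<Rightarrow> int. of_int d * x = (\<Sum>s<N. of_int (f s) * c0 s))" for x
 have co: "of_int d * x = (\<Sum>s<N. of_int (co x s) * c0 s)" if "x \<in> ring_of_integers kumK" for x
  unfolding co_def by (rule someI_ex[OF ex[OF that]])
 have "\<exists>bs. set bs \<subseteq> ring_of_integers kumK \<and>
   (\<forall>x\<in>ring_of_integers kumK. \<exists>!cs :: int list. length cs = length bs \<and> x = (\<Sum>i<length bs. of_int (cs ! i) * bs ! i))"
 proof (rule integral_basis_exists[where co = co and n = N])
  show "0 \<in> ring_of_integers kumK" by (simp add: ring_of_integers_def K_0)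
  fix x y i assume x: "x \<in> ring_of_integers kumK" "y \<in> ring_of_integers kumK" "i < N"
  have "(\<Sum>s<N. of_rat (of_int (co (x - y) s - (co x s - co y s))) * c0 s)
    = (\<Sum>s<N. of_int (co (x - y) s) * c0 s) - ((\<Sum>s<N. of_int (co x s) * c0 s) - (\<Sum>s<N. of_int (co y s) * c0 s))"
   unfolding sum_subtractf[symmetric]
   by (intro sum.cong refl) (simp only: of_rat_of_int_eq of_int_diff of_rat_diff left_diff_distrib)
  also have "\<dots> = 0"
   unfolding co[OF x(1), symmetric] co[OF x(2), symmetric] co[OF ring_of_integers_diff[OF x(1,2)], symmetric]
   by (simp add: algebra_simps)
  finally have "(of_int (co (x - y) i - (co x i - co y i)) :: rat) = 0"
   by (rule c0_independent) (rule x)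
  thus "co (x - y) i = co x i - co y i" by (simp only: of_int_eq_0_iff)
 next
  fix x assume x: "x \<in> ring_of_integers kumK" "\<And>i. i < N \<Longrightarrow> co x i = 0"
  thus "x = 0" using co[OF x(1)] d(2) by simp
 qed (rule ring_of_integers_diff)
 thus ?thesis using that unfolding integral_basis_def by blast
qed

lemma integral_basis_coords:
 assumes "integral_basis kumK bs" "x \<in> ring_of_integers kumK"
 obtains f :: "nat \<Rightarrow> int" where "x = (\<Sum>i<length bs. of_int (f i) * bs ! i)"
 using assms unfolding integral_basis_def by blast

text \<open>Uniqueness of the expansion of 0 gives independence over the integers; a common
  denominator extends it to rational coefficients.\<close>

lemma integral_basis_independent:
 assumes bs: "integral_basis kumK bs" and q: "(\<Sum>i<length bs. of_rat (q i) * bs ! i) = 0" and i: "i < length bs"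
 shows "q i = 0"
proof -
 obtain d f where d: "d > (0::int)" "\<And>i. i \<in> {..<length bs} \<Longrightarrow> of_int d * q i = of_int (f i)"
  using common_denominator[of "{..<length bs}" q] by blast
 have f: "of_int (f i) = of_int d * (of_rat (q i) :: complex)" if "i < length bs" for i
  using arg_cong[OF d(2), of i "of_rat :: rat \<Rightarrow> complex"] that by (simp add: of_rat_mult)
 have "(\<Sum>i<length bs. of_int (f i) * bs ! i) = (\<Sum>i<length bs. of_int d * (of_rat (q i) * bs ! i))"
  by (intro sum.cong refl) (simp add: f)
 also have "\<dots> = 0" unfolding sum_distrib_left[symmetric] q by simp
 finally have z: "0 = (\<Sum>i<length bs. of_int (map f [0..<length bs] ! i) * bs ! i)" by simp
 have "0 \<in> ring_of_integers kumK" by (simp add: ring_of_integers_def K_0)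
 hence "\<exists>!cs :: int list. length cs = length bs \<and> 0 = (\<Sum>i<length bs. of_int (cs ! i) * bs ! i)"
  using bs unfolding integral_basis_def by blast
 moreover have "length (replicate (length bs) (0::int)) = length bs \<and>
   0 = (\<Sum>i<length bs. of_int (replicate (length bs) (0::int) ! i) * bs ! i)" by simp
 moreover have "length (map f [0..<length bs]) = length bs \<and>
   0 = (\<Sum>i<length bs. of_int (map f [0..<length bs] ! i) * bs ! i)" using z by simp
 moreover have un: "\<exists>!x. P x \<Longrightarrow> P a \<Longrightarrow> P b \<Longrightarrow> a = b" for P :: "int list \<Rightarrow> bool" and a b by blast
 ultimately have "replicate (length bs) 0 = map f [0..<length bs]" by - (rule un)
 hence "map f [0..<length bs] = replicate (length bs) 0" by (rule sym)
 hence "map f [0..<length bs] ! i = replicate (length bs) 0 ! i" by (rule arg_cong)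
 hence "f i = 0" using i by simp
 thus ?thesis using d(1) d(2)[of i] i by simp
qed

lemma integral_basis_nth:
 "integral_basis kumK bs \<Longrightarrow> i < length bs \<Longrightarrow> bs ! i \<in> ring_of_integers kumK"
 unfolding integral_basis_def using nth_mem by blast

lemma integral_basis_length:
 assumes bs: "integral_basis kumK bs"
 shows "length bs = N"
proof -
 have "\<exists>q. bs ! i = (\<Sum>s<N. of_rat (q s) * c0 s)" if "i < length bs" for i
 proof -
  have "bs ! i \<in> kumK" using integral_basis_nth[OF bs that] by (simp add: ring_of_integers_def)
  then obtain q where "bs ! i = (\<Sum>s<N. of_rat (q s) * c0 s)" by (rule fam_alpha_span)
  thus ?thesis by (intro exI[of _ q])
 qed
 hence "\<forall>i\<in>{..<length bs}. \<exists>q. bs ! i = (\<Sum>s<N. of_rat (q s) * c0 s)" by simp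
 then obtain A where A: "\<And>i. i < length bs \<Longrightarrow> bs ! i = (\<Sum>s<N. of_rat (A i s) * c0 s)" by (auto dest!: bchoice)
 have "\<forall>s\<in>{..<N}. \<exists>f :: nat \<Rightarrow> int. c0 s = (\<Sum>i<length bs. of_int (f i) * bs ! i)"
  using integral_basis_coords[OF bs c0_integers] by (metis lessThan_iff)
 then obtain B :: "nat \<Rightarrow> nat \<Rightarrow> int" where B: "\<And>s. s < N \<Longrightarrow> c0 s = (\<Sum>i<length bs. of_int (B s i) * bs ! i)"
  by (auto dest!: bchoice)
 have "N = length bs"
  by (rule base_change_inverse(1)[where c = c0 and c' = "\<lambda>i. bs ! i" and A = A and B = "\<lambda>s i. of_int (B s i)"],
   fact A, unfold of_rat_of_int_eq, fact B, fact integral_basis_independent[OF bs], fact c0_independent)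
 thus ?thesis by simp
qed

text \<open>Both transition matrices are integral and inverse to each other, so their determinants
  are 1 or -1 and disappear on squaring. The definite description in \<open>discriminant\<close>
  relies on this.\<close>

lemma integral_basis_det_unique:
 assumes bs: "integral_basis kumK bs" and bs': "integral_basis kumK bs'"
 shows "det (trm N (\<lambda>i. bs' ! i)) = det (trm N (\<lambda>i. bs ! i))"
proof -
 note len = integral_basis_length[OF bs] integral_basis_length[OF bs']
 have "\<forall>i\<in>{..<N}. \<exists>f :: nat \<Rightarrow> int. bs' ! i = (\<Sum>s<N. of_int (f s) * bs ! s)"
  using integral_basis_coords[OF bs integral_basis_nth[OF bs']] len by (metis lessThan_iff)
 then obtain A :: "nat \<Rightarrow> nat \<Rightarrow> int" where A: "\<And>i. i < N \<Longrightarrow> bs' ! i = (\<Sum>s<N. of_int (A i s) * bs ! s)"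
  by (auto dest!: bchoice)
 have "\<forall>i\<in>{..<N}. \<exists>f :: nat \<Rightarrow> int. bs ! i = (\<Sum>s<N. of_int (f s) * bs' ! s)"
  using integral_basis_coords[OF bs' integral_basis_nth[OF bs]] len by (metis lessThan_iff)
 then obtain B :: "nat \<Rightarrow> nat \<Rightarrow> int" where B: "\<And>i. i < N \<Longrightarrow> bs ! i = (\<Sum>s<N. of_int (B i s) * bs' ! s)"
  by (auto dest!: bchoice)
 define a where "a = mdet N (\<lambda>i j. of_int (A i j) :: complex)"
 define b where "b = mdet N (\<lambda>i j. of_int (B i j) :: complex)"
 have "mdet N (\<lambda>i j. of_rat (of_int (A i j))) * mdet N (\<lambda>i j. of_rat (of_int (B i j))) = (1 :: complex)"
  by (rule base_change_inverse(2)[where c = "\<lambda>i. bs ! i" and c' = "\<lambda>i. bs' ! i" and n' = N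
    and A = "\<lambda>i s. of_int (A i s)" and B = "\<lambda>i s. of_int (B i s)"],
   unfold of_rat_of_int_eq, fact A, fact B, fact integral_basis_independent[OF bs', unfolded len],
   fact integral_basis_independent[OF bs, unfolded len])
 hence ab: "a * b = 1" by (simp add: a_def b_def)
 have "a \<in> \<int>" "b \<in> \<int>" unfolding a_def b_def by (rule det_in_subring; simp)+
 then obtain u v where uv: "a = of_int u" "b = of_int v" by (auto elim!: Ints_cases)
 hence "of_int (u * v) = (1 :: complex)" using ab by simp
 hence "u * v = 1" by (simp only: of_int_eq_1_iff)
 hence "u = 1 \<or> u = -1" by (auto simp: zmult_eq_1_iff)
 hence a2: "a\<^sup>2 = 1" using uv by auto
 have "det (trm N (\<lambda>i. bs' ! i)) = (mdet N (\<lambda>i j. of_rat (of_int (A i j))))\<^sup>2 * det (trm N (\<lambda>i. bs ! i))"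
  by (rule det_trm_change)
   (use A integral_basis_nth[OF bs] len in \<open>auto simp: ring_of_integers_def\<close>)
 thus ?thesis using a2 by (simp add: a_def)
qed

lemma discriminant_K:
 assumes bs: "integral_basis kumK bs"
 shows "of_int (discriminant kumK) = det (trm N (\<lambda>i. bs ! i))"
proof -
 have "det (trm N (\<lambda>i. bs ! i)) \<in> \<int>"
  by (rule det_trm_Ints) (use integral_basis_nth[OF bs] integral_basis_length[OF bs] in simp)
 then obtain d where d: "det (trm N (\<lambda>i. bs ! i)) = of_int d" by (rule Ints_cases)
 have "discriminant kumK = d" unfolding discriminant_def
 proof (rule the_equality)
  show "\<exists>bs. integral_basis kumK bs \<and> of_int d = det
   (mat (length bs) (length bs) (\<lambda>(i, j). field_trace kumK (bs ! i * bs ! j)))"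
   using bs d integral_basis_length[OF bs] by (intro exI[of _ bs]) (simp add: trm_def)
  fix d' assume "\<exists>bs. integral_basis kumK bs \<and> of_int d' = det
   (mat (length bs) (length bs) (\<lambda>(i, j). field_trace kumK (bs ! i * bs ! j)))"
  then obtain bs' where bs': "integral_basis kumK bs'"
   "of_int d' = mdet (length bs') (\<lambda>i j. field_trace kumK (bs' ! i * bs' ! j))" by blast
  hence "of_int d' = det (trm N (\<lambda>i. bs' ! i))"
   using integral_basis_length[OF bs'(1)] by (simp add: trm_def)
  hence "(of_int d' :: complex) = of_int d" using integral_basis_det_unique[OF bs bs'(1)] d by simp
  thus "d' = d" by simp
 qed
 thus ?thesis using d by simp
qed

text \<open>A basis of the p-integral elements over the localised integers. Independence is encoded
  by the nonvanishing determinant, the form in which it is computed.\<close>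

definition p_basis :: "nat \<Rightarrow> (nat \<Rightarrow> complex) \<Rightarrow> bool"
 where "p_basis p g \<longleftrightarrow> (\<forall>j<l. g j \<in> kumK \<and> g j \<in> pint p) \<and> det (embm (fam g)) \<noteq> 0 \<and>
  (\<forall>x\<in>kumK. x \<in> pint p \<longrightarrow> (\<exists>q. (\<forall>s<N. q s \<in> zloc p) \<and> x = (\<Sum>s<N. of_rat (q s) * fam g s)))"

text \<open>The transition matrices between an integral basis and the family have p-integral entries
  in both directions, so the determinant is a p-unit.\<close>

lemma discriminant_p_basis:
 assumes p: "prime p" and g: "p_basis p g"
 obtains u where "punit p (of_rat u)" "of_int (discriminant kumK) = (of_rat u)\<^sup>2 * (det (embm (fam g)))\<^sup>2"
proof -
 interpret P: prime_place p by standard (rule p)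
 obtain bs where bs: "integral_basis kumK bs" by (rule integral_basis_K)
 note len = integral_basis_length[OF bs]
 have gK: "g j \<in> kumK" "g j \<in> pint p" if "j < l" for j using g that unfolding p_basis_def by auto
 have fK: "fam g s \<in> kumK" if "s < N" for s by (rule fam_K[OF gK(1) that])
 have fp: "fam g s \<in> pint p" if "s < N" for s
 proof -
  have "s div (l - 1) < l" using that by (simp add: N_def less_mult_imp_div_less mult.commute)
  thus ?thesis unfolding fam_def by (intro P.pint_mult P.pint_power P.pint_algebraic_int lam_pint gK(2))
 qed
 have "\<forall>i\<in>{..<N}. \<exists>q. (\<forall>s<N. q s \<in> zloc p) \<and> bs ! i = (\<Sum>s<N. of_rat (q s) * fam g s)"
  using g integral_basis_nth[OF bs] P.pint_algebraic_int len unfolding p_basis_def ring_of_integers_def by auto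
 then obtain A where A: "\<And>i s. i < N \<Longrightarrow> s < N \<Longrightarrow> A i s \<in> zloc p"
  "\<And>i. i < N \<Longrightarrow> bs ! i = (\<Sum>s<N. of_rat (A i s) * fam g s)" by (auto dest!: bchoice)
 have "\<exists>q. (\<forall>i<N. q i \<in> zloc p) \<and> fam g s = (\<Sum>i<N. of_rat (q i) * bs ! i)" if s: "s < N" for s
 proof -
  obtain t :: int where t: "\<not> int p dvd t" "algebraic_int (of_int t * fam g s)" using fp[OF s] unfolding pint_def by blast
  have "of_int t * fam g s \<in> ring_of_integers kumK"
   using t(2) fK[OF s] by (simp add: ring_of_integers_def K_mult K_int)
  then obtain f :: "nat \<Rightarrow> int" where f: "of_int t * fam g s = (\<Sum>i<N. of_int (f i) * bs ! i)"
   using integral_basis_coords[OF bs] len by metis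
  have t0: "t \<noteq> 0" using t(1) by auto
  have "fam g s = (of_int t * fam g s) / of_int t" using t0 by simp
  also have "\<dots> = (\<Sum>i<N. of_rat (of_int (f i) / of_int t) * bs ! i)"
   unfolding f sum_divide_distrib by (simp add: of_rat_divide)
  finally have "fam g s = (\<Sum>i<N. of_rat (of_int (f i) / of_int t) * bs ! i)" .
  moreover have "of_int (f i) / of_int t \<in> zloc p" for i using t(1) unfolding zloc_def by blast
  ultimately show ?thesis by (intro exI[of _ "\<lambda>i. of_int (f i) / of_int t"]) simp
 qed
 hence "\<forall>s\<in>{..<N}. \<exists>q. (\<forall>i<N. q i \<in> zloc p) \<and> fam g s = (\<Sum>i<N. of_rat (q i) * bs ! i)" by simp
 then obtain B where B: "\<And>s i. s < N \<Longrightarrow> i < N \<Longrightarrow> B s i \<in> zloc p"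
  "\<And>s. s < N \<Longrightarrow> fam g s = (\<Sum>i<N. of_rat (B s i) * bs ! i)" by (auto dest!: bchoice)
 define a where "a = mdet N (\<lambda>i j. of_rat (A i j) :: complex)"
 define b where "b = mdet N (\<lambda>i j. of_rat (B i j) :: complex)"
 have ind: "q s = 0" if "(\<Sum>s<N. of_rat (q s) * fam g s) = 0" "s < N" for q s
  using that g unfolding N_def p_basis_def
  by (intro independent_if_det[where c = "fam g" and q = q and s = s]) (use fK in \<open>auto simp: N_def\<close>)
 have ab: "a * b = 1" unfolding a_def b_def
  by (rule base_change_inverse(2)[where c = "fam g" and c' = "\<lambda>i. bs ! i" and n' = N],
   fact A(2), fact B(2), fact integral_basis_independent[OF bs, unfolded len], fact ind)
 have "a \<in> pint p" "b \<in> pint p" unfolding a_def b_def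
  using A(1) B(1) P.pint_of_int[of "-1"]
  by (auto intro!: det_in_subring P.pint_add P.pint_mult P.pint_1 P.pint_if_zloc)
 moreover have "inverse a = b" using ab by (rule inverse_unique)
 ultimately have "punit p a" using ab unfolding punit_def by auto
 moreover have "a \<in> \<rat>" unfolding a_def by (rule det_in_subring) auto
 then obtain u where u: "a = of_rat u" by (auto simp: Rats_def)
 moreover have "det (trm N (\<lambda>i. bs ! i)) = a\<^sup>2 * det (trm N (fam g))"
  unfolding a_def by (rule det_trm_change) (use A(2) fK in auto)
 moreover have "det (trm N (fam g)) = (det (embm (fam g)))\<^sup>2"
  unfolding N_def by (rule det_trm_embm) (use fK in \<open>simp add: N_def\<close>)
 ultimately show ?thesis using that[of u] discriminant_K[OF bs] by simp
qed

lemma discriminant_multiplicity: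
 assumes p: "prime p" and g: "p_basis p g"
  and e: "of_real (fdet g) = of_nat p ^ e * x" "punit p x"
 shows "multiplicity (int p) (discriminant kumK) = e" "discriminant kumK \<noteq> 0"
proof -
 interpret P: prime_place p by standard (rule p)
 obtain u where u: "punit p (of_rat u)" "of_int (discriminant kumK) = (of_rat u)\<^sup>2 * (det (embm (fam g)))\<^sup>2"
  by (rule discriminant_p_basis[OF p g])
 define M where "M = (det (embm (fam g)))\<^sup>2"
 have "u \<noteq> 0" using u(1) by (auto simp: punit_def)
 hence "M = of_rat (of_int (discriminant kumK) / u\<^sup>2)" using u(2) by (simp add: M_def of_rat_divide of_rat_power)
 hence "M = of_int (discriminant kumK) / (of_rat u)\<^sup>2" by (simp add: of_rat_divide of_rat_power)
 moreover obtain a b where ab: "quotient_of u = (a, b)" by fastforce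
 hence "of_rat u = (of_int a / of_int b :: complex)" by (simp add: quotient_of_div[OF ab] of_rat_divide)
 ultimately have "M = of_real (real_of_int (discriminant kumK) / (real_of_int a / real_of_int b)\<^sup>2)" by simp
 then obtain r where r: "M = of_real r" by blast
 have "norm M = fdet g" by (simp add: M_def norm_power)
 hence "fdet g = \<bar>r\<bar>" using r by simp
 \<comment> \<open>The determinant is known only in absolute value. Its square M is real, being
   rational, so only a sign is lost, and a sign is a p-unit.\<close>
 hence "M = of_real (fdet g) \<or> M = - of_real (fdet g)"
  using r by (auto simp: abs_if)
 hence "M = of_int 1 * (of_nat p ^ e * x) \<or> M = of_int (-1) * (of_nat p ^ e * x)" unfolding e(1) by simp
 then obtain s :: int where s: "s = 1 \<or> s = -1" "M = of_int s * (of_nat p ^ e * x)" by blast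
 have "\<not> int p dvd s" using s(1) P.not_dvd_one by auto
 hence pu: "punit p ((of_rat u)\<^sup>2 * (of_int s * x))"
  by (intro P.punit_mult P.punit_power u(1) P.punit_of_int e(2))
 have d: "of_int (discriminant kumK) = of_nat p ^ e * ((of_rat u)\<^sup>2 * (of_int s * x))"
  using u(2) s(2) unfolding M_def by (simp add: mult_ac)
 show "multiplicity (int p) (discriminant kumK) = e" by (rule P.multiplicity_eq_if_punit[OF pu d])
 show "discriminant kumK \<noteq> 0"
 proof
  assume "discriminant kumK = 0"
  hence "of_nat p ^ e * ((of_rat u)\<^sup>2 * (of_int s * x)) = 0" using d by simp
  thus False using pu prime_gt_0_nat[OF p] by (auto simp: punit_def)
 qed
qed

lemma p_basis_if_F_integral:
 assumes p: "prime p" and g: "\<And>j. j < l \<Longrightarrow> g j \<in> kumK" "\<And>j. j < l \<Longrightarrow> g j \<in> pint p"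
  and F: "F_integral p g" and d: "det (embm (fam g)) \<noteq> 0"
  and span: "\<And>x. x \<in> kumK \<Longrightarrow> \<exists>y. (\<forall>j<l. y j \<in> cycF) \<and> x = (\<Sum>j<l. y j * g j)"
 shows "p_basis p g"
 unfolding p_basis_def
proof (intro conjI ballI impI d)
 show "\<forall>j<l. g j \<in> kumK \<and> g j \<in> pint p" using g by blast
 fix x assume x: "x \<in> kumK" "x \<in> pint p"
 obtain y where y: "\<forall>j<l. y j \<in> cycF" "x = (\<Sum>j<l. y j * g j)" using span[OF x(1)] by blast
 hence yp: "\<forall>j<l. y j \<in> pint p" using F x(2) unfolding F_integral_def by blast
 have "\<forall>j\<in>{..<l}. \<exists>q. y j = (\<Sum>i<l-1. of_rat (q i) * lam ^ i) \<and> (\<forall>i<l-1. q i \<in> zloc p)"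
  using y(1) yp F_coords[OF p] by (metis lessThan_iff)
 then obtain q where q: "\<And>j. j < l \<Longrightarrow> y j = (\<Sum>i<l-1. of_rat (q j i) * lam ^ i)"
  "\<And>j i. j < l \<Longrightarrow> i < l - 1 \<Longrightarrow> q j i \<in> zloc p" by (auto dest!: bchoice)
 have l1: "l - 1 > 0" using l_ge_3 by simp
 have "x = (\<Sum>s<N. of_rat (q (s div (l - 1)) (s mod (l - 1))) * fam g s)"
  unfolding sum_fam y(2) by (intro sum.cong refl) (simp add: q(1))
 moreover have "q (s div (l - 1)) (s mod (l - 1)) \<in> zloc p" if "s < N" for s
  using that l1 by (intro q(2)) (auto simp: N_def less_mult_imp_div_less mult.commute)
 ultimately show "\<exists>q. (\<forall>s<N. q s \<in> zloc p) \<and> x = (\<Sum>s<N. of_rat (q s) * fam g s)"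
  by (intro exI[of _ "\<lambda>s. q (s div (l - 1)) (s mod (l - 1))"]) simp
qed

end

lemma sum_double_lessThan: "2 * (\<Sum>j<n. j) = n * (n - 1 :: nat)"
proof (cases n)
 case (Suc m)
 have "(\<Sum>j<n. j) = (\<Sum>j\<in>{0..m}. j)" unfolding Suc by (intro sum.cong) auto
 thus ?thesis using gauss_sum[of m, where ?'a = nat] Suc by simp
qed simp

lemma of_real_abs_of_int: "complex_of_real \<bar>real_of_int d\<bar> = of_int \<bar>d\<bar>"
 by (simp add: abs_if)

context prime_place
begin

lemma not_dvd_power: "\<not> int p dvd t \<Longrightarrow> \<not> int p dvd t ^ n"
proof (induction n)
 case 0 show ?case unfolding power_0 by (rule not_dvd_one)
next
 case (Suc n) thus ?case unfolding power_Suc by (intro not_dvd_mult) auto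
qed

lemma multiplicity_one_decomp:
 assumes "multiplicity (int p) x = 1"
 obtains d where "x = int p * d" "\<not> int p dvd d"
proof -
 have "x \<noteq> 0" using assms by (intro notI) simp
 moreover have "\<not> is_unit (int p)" using prime_p by (metis not_prime_unit prime_nat_int_transfer)
 ultimately obtain d where "x = int p ^ multiplicity (int p) x * d" "\<not> int p dvd d"
  using multiplicity_decompose'[of x "int p"] by blast
 hence "x = int p * d" "\<not> int p dvd d" using assms by simp_all
 thus ?thesis by (rule that)
qed

end

section \<open>The discriminant at primes other than l\<close>

context kummer
begin

lemma det_embm_nz_if:
 assumes "(norm (det (embm c)))\<^sup>2 \<noteq> 0"
 shows "det (embm c) \<noteq> 0"
 using assms by auto

lemma span_alpha: "x \<in> kumK \<Longrightarrow> \<exists>y. (\<forall>j<l. y j \<in> cycF) \<and> x = (\<Sum>j<l. y j * \<alpha> ^ j)"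
 unfolding kumK_def by blast

lemma alpha_pint: "prime p \<Longrightarrow> \<alpha> ^ j \<in> pint p"
 by (intro prime_place.pint_algebraic_int algebraic_int_power_complex algebraic_int_alpha) (unfold_locales)

text \<open>If p divides D exactly once, the descent applies with \<pi> = \<alpha>. If p divides
  neither l nor D, it does not divide the discriminant of \<open>c0\<close>, and Cramer's rule
  leaves no denominator at p.\<close>

lemma p_basis_alpha:
 assumes p: "prime p" "p \<noteq> l" "multiplicity (int p) D = 1 \<or> \<not> int p dvd D"
 shows "p_basis p (\<lambda>j. \<alpha> ^ j)"
proof (cases "multiplicity (int p) D = 1")
 case True
 show ?thesis
  by (rule p_basis_if_F_integral[OF p(1)])
   (use alpha_pint[OF p(1)] F_integral_alpha[OF p(1,2) True] det_fam_alpha_nz span_alpha K_power[OF K_alpha] in auto)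
next
 case False
 interpret P: prime_place p by standard (rule p(1))
 obtain d where d: "(det (embm c0))\<^sup>2 = of_int d" "d \<noteq> 0" by (rule det_c0_int)
 define d' where "d' = int l ^ (l * (l - 1) + (l - 2) * l) * \<bar>D\<bar> ^ ((l - 1)\<^sup>2)"
 have "real_of_int \<bar>d\<bar> = norm ((det (embm c0))\<^sup>2)" unfolding d by simp
 also have "\<dots> = real_of_int d'" unfolding norm_power det_fam_alpha d'_def by simp
 finally have dd: "\<bar>d\<bar> = d'" by (simp only: of_int_eq_iff)
 have "\<not> int p dvd int l" using p prime_l primes_dvd_imp_eq by auto
 moreover have "\<not> int p dvd \<bar>D\<bar>" using False p(3) by simp
 ultimately have "\<not> int p dvd d'" unfolding d'_def by (intro P.not_dvd_mult P.not_dvd_power)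
 hence nd: "\<not> int p dvd d" using dd by (metis dvd_abs_iff)
 show ?thesis unfolding p_basis_def
 proof (intro conjI ballI impI)
  show "\<forall>j<l. \<alpha> ^ j \<in> kumK \<and> \<alpha> ^ j \<in> pint p" using K_power[OF K_alpha] alpha_pint[OF p(1)] by blast
  show "det (embm c0) \<noteq> 0" by (rule det_fam_alpha_nz)
  fix x assume x: "x \<in> kumK" "x \<in> pint p"
  obtain q where q: "x = (\<Sum>s<N. of_rat (q s) * c0 s)" using fam_alpha_span[OF x(1)] by blast
  have "q s \<in> zloc p" if s: "s < N" for s
  proof -
   have "(det (embm c0))\<^sup>2 * of_rat (q s) \<in> pint p"
   proof (rule cramer_coordinates[where c = c0])
    show "(\<Sum>s<(l-1)*l. of_rat (q s) * c0 s) \<in> pint p" using x(2) q by (simp add: N_def)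
   qed (use s c0_K P.pint_algebraic_int[OF fam_alpha_algebraic_int] emb_pint P.pint_1 P.pint_of_int[of "-1"] in
     \<open>auto simp: N_def intro: P.pint_add P.pint_mult\<close>)
   hence "inverse (of_int d) * (of_int d * of_rat (q s)) \<in> pint p"
    using P.pint_mult[OF P.pint_inverse_int[OF nd]] d by simp
   hence "of_rat (q s) \<in> pint p" using d(2) by (simp add: mult.assoc[symmetric])
   thus ?thesis by (rule P.zloc_if_pint)
  qed
  thus "\<exists>q. (\<forall>s<N. q s \<in> zloc p) \<and> x = (\<Sum>s<N. of_rat (q s) * c0 s)" using q by blast
 qed
qed

lemma multiplicity_unramified:
 assumes p: "prime p" "p \<noteq> l" "\<not> int p dvd D"
 shows "multiplicity (int p) (discriminant kumK) = 0" "discriminant kumK \<noteq> 0"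
proof -
 interpret P: prime_place p by standard (rule p(1))
 have "\<not> int p dvd int l" using p prime_l primes_dvd_imp_eq by auto
 hence u: "punit p (of_int (int l ^ (l * (l - 1) + (l - 2) * l) * \<bar>D\<bar> ^ ((l - 1)\<^sup>2)))"
  using p by (intro P.punit_of_int P.not_dvd_mult P.not_dvd_power) auto
 have pb: "p_basis p (\<lambda>j. \<alpha> ^ j)" using p by (intro p_basis_alpha) auto
 have e: "complex_of_real (fdet (\<lambda>j. \<alpha> ^ j)) = of_nat p ^ 0 * of_int (int l ^ (l * (l - 1) + (l - 2) * l) * \<bar>D\<bar> ^ ((l - 1)\<^sup>2))"
  by (simp add: det_fam_alpha of_real_abs_of_int)
 show "multiplicity (int p) (discriminant kumK) = 0" "discriminant kumK \<noteq> 0"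
  using discriminant_multiplicity[OF p(1) pb e u] by auto
qed

lemma multiplicity_ramified:
 assumes p: "prime p" "p \<noteq> l" "multiplicity (int p) D = 1"
 shows "multiplicity (int p) (discriminant kumK) = (l - 1)\<^sup>2"
proof -
 interpret P: prime_place p by standard (rule p(1))
 obtain d where d: "D = int p * d" "\<not> int p dvd d" using D_decomp p by blast
 have "\<not> int p dvd int l" using p prime_l primes_dvd_imp_eq by auto
 hence u: "punit p (of_int (int l ^ (l * (l - 1) + (l - 2) * l) * \<bar>d\<bar> ^ ((l - 1)\<^sup>2)))"
  using d(2) by (intro P.punit_of_int P.not_dvd_mult P.not_dvd_power) auto
 have "p_basis p (\<lambda>j. \<alpha> ^ j)" using p by (intro p_basis_alpha) auto
 thus ?thesis by (rule discriminant_multiplicity(1)[OF p(1) _ _ u])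
  (simp add: det_fam_alpha d abs_mult power_mult_distrib mult_ac of_real_abs_of_int)
qed

subsection \<open>The prime \<open>l\<close>, ramified case\<close>

text \<open>Expanding (x - D)^l gives x^l - D^l + l w(x). Putting x = D shows that w vanishes at D,
  so w(\<alpha>) is a multiple \<beta> z of \<beta> = \<alpha> - D. Hence \<beta>^l is l times m' +
  \<beta> z, where l m' = D - D^l. This factor is a unit because m' is one and \<beta> has positive
  valuation, which is made explicit by a cofactor.\<close>

lemma beta_power:
 assumes m: "multiplicity (int l) (D - D ^ l) = 1"
 obtains u where "(\<alpha> - of_int D) ^ l = of_nat l * u" "punit l u"
proof -
 define \<beta> where "\<beta> = \<alpha> - of_int D"
 obtain m' where m': "D - D ^ l = int l * m'" "\<not> int l dvd m'"
  by (rule L.multiplicity_one_decomp[OF m])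
 define w where "w x = (\<Sum>k\<in>{1..<l}. of_nat ((l choose k) div l) * x ^ k * (- of_int D) ^ (l - k))" for x :: complex
 have expand: "(x - of_int D) ^ l = x ^ l - of_int D ^ l + of_nat l * w x" for x
 proof -
  have "{..l} = insert 0 (insert l {1..<l})" using l_pos by auto
  hence "(x + - of_int D) ^ l = x ^ l + (- of_int D) ^ l + (\<Sum>k\<in>{1..<l}. of_nat (l choose k) * x ^ k * (- of_int D) ^ (l - k))"
   unfolding binomial_ring using l_pos by simp
  also have "(\<Sum>k\<in>{1..<l}. of_nat (l choose k) * x ^ k * (- of_int D) ^ (l - k)) = of_nat l * w x"
   unfolding w_def sum_distrib_left
  proof (intro sum.cong refl)
   fix k assume k: "k \<in> {1..<l}"
   have "l dvd (l choose k)" using k prime_l by (intro dvd_choose_prime) auto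
   then obtain d where "l choose k = l * d" by (auto simp: dvd_def)
   thus "of_nat (l choose k) * x ^ k * (- of_int D) ^ (l - k)
     = of_nat l * (of_nat ((l choose k) div l) * x ^ k * (- of_int D) ^ (l - k))" using l_pos by simp
  qed
  also have "(- of_int D :: complex) ^ l = - (of_int D ^ l)" using odd_l by (rule power_minus_odd)
  finally show ?thesis by simp
 qed
 have "of_nat l * w (of_int D) = 0" using expand[of "of_int D"] l_pos by (simp add: power_0_left)
 hence wD: "w (of_int D) = 0" using l_pos by simp
 define z where "z = (\<Sum>k\<in>{1..<l}. of_nat ((l choose k) div l) * (\<Sum>i<k. of_int D ^ (k - Suc i) * \<alpha> ^ i) * (- of_int D) ^ (l - k))"
 have "w \<alpha> = w \<alpha> - w (of_int D)" using wD by simp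
 also have "\<dots> = (\<Sum>k\<in>{1..<l}. of_nat ((l choose k) div l) * (\<alpha> ^ k - of_int D ^ k) * (- of_int D) ^ (l - k))"
  unfolding w_def sum_subtractf[symmetric] by (intro sum.cong refl) (simp add: algebra_simps)
 also have "\<dots> = (\<Sum>k\<in>{1..<l}. \<beta> * (of_nat ((l choose k) div l) * (\<Sum>i<k. of_int D ^ (k - Suc i) * \<alpha> ^ i) * (- of_int D) ^ (l - k)))"
  unfolding \<beta>_def power_diff_sumr2 by (intro sum.cong refl) (simp only: mult_ac)
 also have "\<dots> = \<beta> * z" unfolding z_def by (rule sum_distrib_left[symmetric])
 finally have wz: "w \<alpha> = \<beta> * z" .
 have zp: "z \<in> pint l" unfolding z_def
  by (intro L.pint_sum L.pint_mult L.pint_of_nat L.pint_power L.pint_minus L.pint_of_int L.pint_algebraic_int algebraic_int_alpha)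
 define u where "u = of_int m' + \<beta> * z"
 have bl: "\<beta> ^ l = of_nat l * u"
 proof -
  have "\<beta> ^ l = of_int (D - D ^ l) + of_nat l * (\<beta> * z)" unfolding \<beta>_def expand alpha wz by (simp add: \<beta>_def)
  thus ?thesis unfolding u_def m' by (simp add: distrib_left)
 qed
 have bp: "\<beta> \<in> pint l" unfolding \<beta>_def by (intro L.pint_diff L.pint_of_int L.pint_algebraic_int algebraic_int_alpha)
 have up: "u \<in> pint l" unfolding u_def by (intro L.pint_add L.pint_of_int L.pint_mult bp zp)
 \<comment> \<open>The cofactor: u divides m'^l - (-\<beta> z)^l as a factor of a difference of l-th
   powers, and it divides \<beta>^l = l u. So it divides m'^l, a unit at l.\<close>
 define y where "y = (\<Sum>i<l. (- (\<beta> * z)) ^ (l - Suc i) * of_int m' ^ i) + of_nat l * (- z) ^ l"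
 have yp: "y \<in> pint l" unfolding y_def
  by (intro L.pint_add L.pint_sum L.pint_mult L.pint_power L.pint_minus L.pint_of_int L.pint_of_nat bp zp)
 have "of_int m' ^ l = (of_int m' ^ l - (- (\<beta> * z)) ^ l) + (- (\<beta> * z)) ^ l" by simp
 also have "of_int m' ^ l - (- (\<beta> * z)) ^ l = (of_int m' - - (\<beta> * z)) * (\<Sum>i<l. (- (\<beta> * z)) ^ (l - Suc i) * of_int m' ^ i)"
  by (rule power_diff_sumr2)
 also have "(- (\<beta> * z)) ^ l = \<beta> ^ l * (- z) ^ l" by (simp add: power_mult_distrib[symmetric])
 finally have my: "of_int m' ^ l = u * y" unfolding bl y_def u_def by (simp add: algebra_simps)
 have nm: "\<not> int l dvd m' ^ l" using m'(2) prime_l by (metis prime_dvd_power prime_nat_int_transfer)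
 hence m0: "of_int m' ^ l \<noteq> (0 :: complex)" by (metis dvd_0_right of_int_eq_0_iff of_int_power)
 hence u0: "u \<noteq> 0" using my by auto
 have uy: "u * y \<noteq> 0" using my m0 by simp
 have "u * (y * inverse (of_int (m' ^ l))) = (u * y) * inverse (u * y)"
  using my by (simp only: of_int_power mult.assoc)
 also have "\<dots> = 1" using uy by (rule right_inverse)
 finally have "u * (y * inverse (of_int (m' ^ l))) = 1" .
 hence "inverse u = y * inverse (of_int (m' ^ l))" by (rule inverse_unique)
 also have "\<dots> \<in> pint l" by (intro L.pint_mult yp L.pint_inverse_int nm)
 finally have "punit l u" unfolding punit_def using u0 up by simp
 thus ?thesis using that bl unfolding \<beta>_def by blast
qed

text \<open>With v(l) = 1 one has v(\<alpha> - D) = 1/l by \<open>beta_power\<close> and v(lam) =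
  1/(l-1). So \<pi> has value 1/(l(l-1)), and its l-th power is \<open>lam\<close> times a
  unit.\<close>

lemma ramified_case:
 assumes m: "multiplicity (int l) (D - D ^ l) = 1"
 defines "\<pi> \<equiv> lam / (\<alpha> - of_int D)"
 shows "p_basis l (\<lambda>j. \<pi> ^ j)"
  "fdet (\<lambda>j. \<pi> ^ j)
   = (real l ^ l * \<bar>real_of_int D\<bar> ^ (l - 1) / \<bar>real_of_int (D - D ^ l)\<bar> ^ (2 * (l - 1))) ^ (l - 1)
    * real l ^ (l * (l - 1)) * real l ^ ((l - 2) * l)"
proof -
 define \<beta> where "\<beta> = \<alpha> - of_int D"
 obtain u where u: "\<beta> ^ l = of_nat l * u" "punit l u" using beta_power[OF m] unfolding \<beta>_def by blast
 obtain v where v: "lam ^ (l - 1) = of_nat l * v" "punit l v" by (rule lam_power)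
 have b0: "\<beta> \<noteq> 0" using u l_pos by (intro notI) (auto simp: punit_def power_0_left)
 have bK: "\<beta> \<in> kumK" unfolding \<beta>_def by (intro K_diff K_alpha K_int)
 have pi: "\<pi> = lam / \<beta>" by (simp add: \<pi>_def \<beta>_def)
 have piK: "\<pi> \<in> kumK" unfolding pi by (intro K_divide bK K_F F_lam)
 have "lam ^ l = lam * lam ^ (l - 1)" using l_pos by (cases l) auto
 hence "\<pi> ^ l = lam * (of_nat l * v) / (of_nat l * u)" unfolding pi power_divide u v by simp
 hence pil: "\<pi> ^ l = lam * (v / u)" using l_pos by simp
 have vu: "punit l (v / u)" by (intro L.punit_divide u v)
 have pip: "\<pi> \<in> pint l"
 proof (rule L.pint_root)
  show "\<pi> ^ l \<in> pint l" unfolding pil using vu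
   by (intro L.pint_mult[OF L.pint_algebraic_int[OF lam_pint]]) (simp add: punit_def)
 qed (rule l_pos)
 have nd: "\<not> l dvd Suc a" if "a < l - 1" for a using that by (auto dest: dvd_imp_le)
 define lc where "lc a = 1 - \<zeta> ^ Suc a" for a
 define bc where "bc b = \<zeta> ^ b * \<alpha> - of_int D" for b
 have prodb: "(\<Prod>b<l. norm (bc b)) = \<bar>real_of_int (D - D ^ l)\<bar>"
 proof -
  have "(\<Prod>b<l. norm (bc b)) = norm (\<Prod>b<l. (of_int D - \<zeta> ^ b * \<alpha>))"
   unfolding prod_norm[symmetric] bc_def by (intro prod.cong refl) (simp add: norm_minus_commute)
  also have "\<dots> = norm (of_int D ^ l - \<alpha> ^ l)" unfolding prod_zeta ..
  also have "\<dots> = norm (complex_of_int (D ^ l - D))" unfolding alpha by simp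
  also have "\<dots> = \<bar>real_of_int (D - D ^ l)\<bar>" by (simp only: norm_of_int)
  finally show ?thesis .
 qed
 have dn: "D - D ^ l \<noteq> 0" using m by (intro notI) simp
 have bc0: "bc b \<noteq> 0" if "b < l" for b
 proof
  assume "bc b = 0"
  hence "(\<Prod>b<l. norm (bc b)) = 0" using that by (intro prod_zero) auto
  thus False unfolding prodb using dn by simp
 qed
 define R where "R = norm (mdet l (\<lambda>b j. (\<zeta> ^ b * \<alpha>) ^ j))"
 \<comment> \<open>Clearing the denominator bc^(l-1) from each row turns negative powers into
   positive ones in reversed column order. The reversal and the shift by D change the determinant by
   a sign at most.\<close>
 have rev: "norm (mdet l (\<lambda>b j. bc b ^ (l - Suc j))) = R"
 proof -
  have bij: "bij_betw (\<lambda>j. l - Suc j) {..<l} {..<l}"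
   by (rule bij_betwI[where g = "\<lambda>j. l - Suc j"]) auto
  have "norm (mdet l (\<lambda>b j. bc b ^ (l - Suc j))) = norm (mdet l (\<lambda>j b. bc b ^ (l - Suc j)))"
   by (rule arg_cong[OF mdet_transpose])
  also have "\<dots> = norm (mdet l (\<lambda>j b. bc b ^ j))"
   by (rule det_reindex_rows[OF bij, of "\<lambda>j b. bc b ^ j"])
  also have "\<dots> = norm (mdet l (\<lambda>b j. bc b ^ j))" by (rule arg_cong[OF mdet_transpose])
  also have "\<dots> = R" unfolding R_def bc_def by (simp only: det_vandermonde_shift)
  finally show ?thesis .
 qed
 have C: "norm (mdet l (\<lambda>b j. sig (Suc a) b (\<pi> ^ j)))
   = R / \<bar>real_of_int (D - D ^ l)\<bar> ^ (l - 1) * norm (lc a) ^ (\<Sum>j<l. j)" if a: "a < l - 1" for a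
 proof -
  have s: "sig (Suc a) b \<pi> = lc a / bc b" for b
   unfolding pi divide_inverse
   using sig_mult[OF nd[OF a] K_F[OF F_lam] K_inverse[OF bK]] sig_inverse[OF nd[OF a] bK] lam_conj[OF nd[OF a]]
    sig_diff[OF nd[OF a] K_alpha K_int] sig_alpha[OF nd[OF a]] sig_int[OF nd[OF a]]
   by (simp add: lc_def bc_def \<beta>_def)
  have "mat l l (\<lambda>(b, j). sig (Suc a) b (\<pi> ^ j))
    = mat l l (\<lambda>(b, j). (inverse (bc b) ^ (l - 1) * bc b ^ (l - Suc j)) * lc a ^ j)"
  proof (intro eq_matI; simp only: dim_row_mat dim_col_mat index_mat prod.case)
   fix b j assume bj: "b < l" "j < l"
   have "bc b ^ (l - 1) = bc b ^ (l - Suc j + j)" using bj by simp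
   hence "bc b ^ (l - 1) = bc b ^ (l - Suc j) * bc b ^ j" by (simp only: power_add)
   hence "inverse (bc b) ^ (l - 1) * bc b ^ (l - Suc j) = inverse (bc b) ^ j"
    using bc0[OF bj(1)] by (simp add: power_inverse field_simps)
   thus "sig (Suc a) b (\<pi> ^ j) = (inverse (bc b) ^ (l - 1) * bc b ^ (l - Suc j)) * lc a ^ j"
    using sig_power[OF nd[OF a] piK] s by (simp add: divide_inverse power_mult_distrib mult.commute)
  qed
  hence "mdet l (\<lambda>b j. sig (Suc a) b (\<pi> ^ j))
    = (\<Prod>b<l. inverse (bc b) ^ (l - 1)) * mdet l (\<lambda>b j. bc b ^ (l - Suc j)) * (\<Prod>j<l. lc a ^ j)"
   by (simp only: det_scale_columns det_scale_rows)
  hence "norm (mdet l (\<lambda>b j. sig (Suc a) b (\<pi> ^ j)))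
    = (\<Prod>b<l. norm (inverse (bc b) ^ (l - 1))) * R * norm (lc a) ^ (\<Sum>j<l. j)"
   by (simp only: norm_mult rev prod_norm[symmetric] norm_power power_sum)
  also have "(\<Prod>b<l. norm (inverse (bc b) ^ (l - 1))) = inverse (\<Prod>b<l. norm (bc b)) ^ (l - 1)"
  proof -
   have "(\<Prod>b<l. norm (inverse (bc b) ^ (l - 1))) = (\<Prod>b<l. inverse (norm (bc b))) ^ (l - 1)"
    by (simp only: norm_power norm_inverse prod_power_distrib)
   also have "(\<Prod>b<l. inverse (norm (bc b))) = inverse (\<Prod>b<l. norm (bc b))"
    using prod_inversef[of "\<lambda>b. norm (bc b)" "{..<l}"] by (simp add: o_def)
   finally show ?thesis .
  qed
  finally show ?thesis unfolding prodb by (simp add: divide_inverse power_inverse)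
 qed
 have prodlc: "(\<Prod>a<l-1. norm (lc a)) = real l"
 proof -
  have "(\<Prod>a<l-1. lc a) = (\<Prod>a\<in>{1..<l}. (1 - \<zeta> ^ a))" unfolding lc_def
   by (rule prod.reindex_bij_witness[where j = Suc and i = "\<lambda>a. a - 1"]) auto
  hence "(\<Prod>a<l-1. lc a) = of_nat l" unfolding prod_one_minus_zeta .
  thus ?thesis unfolding prod_norm by simp
 qed
 have "norm (det (embm (fam (\<lambda>j. \<pi> ^ j))))
  = (\<Prod>a<l-1. R / \<bar>real_of_int (D - D ^ l)\<bar> ^ (l - 1) * norm (lc a) ^ (\<Sum>j<l. j))
   * lamdet ^ l"
  using det_fam[of "\<lambda>j. \<pi> ^ j"] K_power[OF piK] C by simp
 also have "(\<Prod>a<l-1. R / \<bar>real_of_int (D - D ^ l)\<bar> ^ (l - 1) * norm (lc a) ^ (\<Sum>j<l. j))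
   = (R / \<bar>real_of_int (D - D ^ l)\<bar> ^ (l - 1)) ^ (l - 1) * real l ^ (\<Sum>j<l. j)"
  unfolding prod.distrib prod_power_distrib[symmetric] prodlc by simp
 finally have *: "fdet (\<lambda>j. \<pi> ^ j)
  = (R\<^sup>2 / (\<bar>real_of_int (D - D ^ l)\<bar> ^ (l - 1))\<^sup>2) ^ (l - 1) * real l ^ (2 * (\<Sum>j<l. j))
   * ((lamdet)\<^sup>2) ^ l"
  by (simp only: power_mult_distrib power_divide power_mult[symmetric] mult_ac)
 have "R\<^sup>2 = real l ^ l * \<bar>real_of_int D\<bar> ^ (l - 1)" unfolding R_def by (rule norm_det_alpha)
 with * show D2: "fdet (\<lambda>j. \<pi> ^ j)
   = (real l ^ l * \<bar>real_of_int D\<bar> ^ (l - 1) / \<bar>real_of_int (D - D ^ l)\<bar> ^ (2 * (l - 1))) ^ (l - 1)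
    * real l ^ (l * (l - 1)) * real l ^ ((l - 2) * l)"
  unfolding sum_double_lessThan det_lam by (simp only: power_mult[symmetric] mult.commute)
 show "p_basis l (\<lambda>j. \<pi> ^ j)"
 proof (rule p_basis_if_F_integral[OF prime_l])
  show "\<pi> ^ j \<in> kumK" for j by (rule K_power[OF piK])
  show "\<pi> ^ j \<in> pint l" for j by (rule L.pint_power[OF pip])
  show "F_integral l (\<lambda>j. \<pi> ^ j)" by (rule F_integral_ramified[OF pil vu])
  have "\<bar>real_of_int (D - D ^ l)\<bar> \<noteq> 0" using dn by simp
  hence "fdet (\<lambda>j. \<pi> ^ j) \<noteq> 0" unfolding D2 using l_pos D_nz by simp
  thus "det (embm (fam (\<lambda>j. \<pi> ^ j))) \<noteq> 0" by (rule det_embm_nz_if)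
  fix x assume x: "x \<in> kumK"
  \<comment> \<open>Powers of \<pi> carry negative powers of \<beta>. So x \<beta>^(l-1) is expanded
    in powers of \<alpha>, then of \<beta>, and the order is reversed.\<close>
  have "x * \<beta> ^ (l - 1) \<in> kumK" by (intro K_mult x K_power bK)
  then obtain y where y: "\<forall>j<l. y j \<in> cycF" "x * \<beta> ^ (l - 1) = (\<Sum>j<l. y j * \<alpha> ^ j)" using span_alpha by blast
  define z where "z k = (\<Sum>j<l. y j * (of_nat (j choose k) * of_int D ^ (j - k)))" for k
  have zF: "z k \<in> cycF" for k unfolding z_def
   using y(1) F_int[of "int _"] by (intro F_sum F_mult F_power F_int) auto
  have "\<alpha> ^ j = (\<Sum>k<l. of_nat (j choose k) * \<beta> ^ k * of_int D ^ (j - k))" if "j < l" for j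
  proof -
   have "\<alpha> ^ j = (\<beta> + of_int D) ^ j" by (simp add: \<beta>_def)
   also have "\<dots> = (\<Sum>k\<le>j. of_nat (j choose k) * \<beta> ^ k * of_int D ^ (j - k))" by (rule binomial_ring)
   also have "\<dots> = (\<Sum>k<l. of_nat (j choose k) * \<beta> ^ k * of_int D ^ (j - k))"
    using that by (intro sum.mono_neutral_left) auto
   finally show ?thesis .
  qed
  hence "x * \<beta> ^ (l - 1) = (\<Sum>j<l. \<Sum>k<l. y j * (of_nat (j choose k) * of_int D ^ (j - k)) * \<beta> ^ k)"
   unfolding y(2) by (intro sum.cong refl) (simp add: sum_distrib_left mult_ac)
  also have "\<dots> = (\<Sum>k<l. z k * \<beta> ^ k)" unfolding z_def sum_distrib_right by (rule sum.swap)
  also have "\<dots> = (\<Sum>k<l. z (l - Suc k) * \<beta> ^ (l - Suc k))" by (rule sum.nat_diff_reindex[symmetric])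
  finally have xb: "x * \<beta> ^ (l - 1) = (\<Sum>k<l. z (l - Suc k) * \<beta> ^ (l - Suc k))" .
  have "x = x * \<beta> ^ (l - 1) * inverse \<beta> ^ (l - 1)" using b0 by (simp add: power_inverse)
  also have "\<dots> = (\<Sum>k<l. (z (l - Suc k) * inverse lam ^ k) * \<pi> ^ k)"
   unfolding xb sum_distrib_right
  proof (intro sum.cong refl)
   fix k assume k: "k \<in> {..<l}"
   have "\<beta> ^ (l - 1) = \<beta> ^ (l - Suc k + k)" using k by simp
   hence "\<beta> ^ (l - 1) = \<beta> ^ (l - Suc k) * \<beta> ^ k" by (simp only: power_add)
   hence "\<beta> ^ (l - Suc k) * inverse \<beta> ^ (l - 1) = inverse \<beta> ^ k"
    using b0 by (simp add: power_inverse field_simps)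
   moreover have "inverse lam ^ k * \<pi> ^ k = inverse \<beta> ^ k"
    unfolding pi using lam_nz by (simp add: power_divide power_inverse field_simps)
   ultimately show "z (l - Suc k) * \<beta> ^ (l - Suc k) * inverse \<beta> ^ (l - 1) = (z (l - Suc k) * inverse lam ^ k) * \<pi> ^ k"
    by (simp only: mult.assoc)
  qed
  finally have "x = (\<Sum>k<l. (z (l - Suc k) * inverse lam ^ k) * \<pi> ^ k)" .
  moreover have "z (l - Suc k) * inverse lam ^ k \<in> cycF" for k by (intro F_mult zF F_power F_inverse F_lam)
  ultimately show "\<exists>y. (\<forall>j<l. y j \<in> cycF) \<and> x = (\<Sum>j<l. y j * \<pi> ^ j)"
   by (intro exI[of _ "\<lambda>k. z (l - Suc k) * inverse lam ^ k"]) simp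
 qed
qed

lemma multiplicity_l_ramified:
 assumes m: "multiplicity (int l) (D - D ^ l) = 1" and v: "D = int l ^ v * d" "\<not> int l dvd d"
 shows "multiplicity (int l) (discriminant kumK) = l\<^sup>2 - 2 + v * (l - 1)\<^sup>2"
proof -
 define \<pi> where "\<pi> = lam / (\<alpha> - of_int D)"
 note rc = ramified_case[OF m, folded \<pi>_def]
 obtain m' where m': "D - D ^ l = int l * m'" "\<not> int l dvd m'"
  by (rule L.multiplicity_one_decomp[OF m])
 define n where "n = l - 1"
 have ln: "l = Suc n" "n \<ge> 2" using l_ge_3 by (auto simp: n_def)
 define x where "x = \<bar>real_of_int d\<bar> ^ (n * n) / \<bar>real_of_int m'\<bar> ^ (2 * n * n)"
 have l0: "real l > 0" and m0: "\<bar>real_of_int m'\<bar> > 0" using l_pos m'(2) by auto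
 have "fdet (\<lambda>j. \<pi> ^ j)
   = (real l ^ l * (real l ^ v * \<bar>real_of_int d\<bar>) ^ n / (real l * \<bar>real_of_int m'\<bar>) ^ (2 * n)) ^ n * real l ^ (l * n) * real l ^ ((l - 2) * l)"
  unfolding rc(2) m'(1) by (simp add: v(1) abs_mult n_def)
 also have "\<dots> * real l ^ (2 * n * n) = real l ^ (l * n) * real l ^ (v * n * n) * real l ^ (l * n) * real l ^ ((l - 2) * l) * x"
  unfolding x_def using l0 m0
  by (simp add: power_mult_distrib power_divide power_mult[symmetric] field_simps)
 also have "\<dots> = real l ^ (l\<^sup>2 - 2 + v * n\<^sup>2) * x * real l ^ (2 * n * n)"
 proof -
  \<comment> \<open>The two summands l n and the summand (l-2) l come from the Fourier matrix, the
    conjugates of \<open>lam\<close> and the cyclotomic discriminant; v n^2 comes from D, and 2 n^2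
    is lost to the denominator D - D^l.\<close>
  have "l * n + v * n * n + l * n + (l - 2) * l = (l\<^sup>2 - 2 + v * n\<^sup>2) + 2 * n * n"
  proof -
   obtain k where k: "n = Suc k" using ln(2) by (cases n) auto
   have "l - 2 = k" "l\<^sup>2 - 2 = k * k + 4 * k + 2" using ln(1) k by (simp_all add: power2_eq_square)
   thus ?thesis using ln(1) k by (simp add: power2_eq_square algebra_simps)
  qed
  hence "real l ^ (l * n + v * n * n + l * n + (l - 2) * l) = real l ^ ((l\<^sup>2 - 2 + v * n\<^sup>2) + 2 * n * n)" by (rule arg_cong)
  thus ?thesis by (simp only: power_add mult_ac)
 qed
 finally have "fdet (\<lambda>j. \<pi> ^ j) = real l ^ (l\<^sup>2 - 2 + v * n\<^sup>2) * x"
  using l0 by simp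
 hence e: "complex_of_real (fdet (\<lambda>j. \<pi> ^ j)) = of_nat l ^ (l\<^sup>2 - 2 + v * n\<^sup>2) * of_real x"
  by simp
 have "of_real x = (of_int (\<bar>d\<bar> ^ (n * n)) / of_int (\<bar>m'\<bar> ^ (2 * n * n)) :: complex)" by (simp add: x_def of_real_abs_of_int)
 moreover have "\<not> int l dvd \<bar>d\<bar> ^ (n * n)" "\<not> int l dvd \<bar>m'\<bar> ^ (2 * n * n)"
  using v(2) m'(2) by (auto intro!: L.not_dvd_power simp del: power_abs)
 ultimately have "punit l (of_real x)" by (simp only:) (intro L.punit_divide L.punit_of_int)
 from discriminant_multiplicity(1)[OF prime_l rc(1) e this] show ?thesis by (simp add: n_def)
qed

end

subsection \<open>The prime \<open>l\<close>, split case\<close>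

context prime_place
begin

text \<open>t y is a root of the monic polynomial X^2 - t X - t^2 (y^2 - y).\<close>

lemma pint_quadratic: assumes "y * y - y \<in> pint p" shows "y \<in> pint p"
proof -
 obtain t :: int where t: "\<not> int p dvd t" "algebraic_int (of_int t * (y * y - y))"
  using assms unfolding pint_def by blast
 have "algebraic_int (of_int t * (of_int t * (y * y - y)))" by (rule algebraic_int_times_complex[OF _ t(2)]) simp
 hence "algebraic_int (of_int t * y)"
  by (rule algebraic_int_root[where p = "[:0, - of_int t, 1:]"])
   (auto simp: algebra_simps coeff_pCons split: nat.splits)
 thus ?thesis using t(1) unfolding pint_def by blast
qed

text \<open>Let y be the mean. From (u - 1) y = p e one gets u^j y = y + p e (1 + ... + u^(j-1)).
  Averaging over j gives y^2 - y = e s with an integral s, so y satisfies a monic quadratic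
  equation.\<close>

lemma pint_root_mean:
 assumes u: "u \<in> pint p" "u ^ p = 1 + of_nat p * of_nat p * e" and e: "e \<in> pint p"
 shows "(\<Sum>j<p. u ^ j) / of_nat p \<in> pint p"
proof -
 define y where "y = (\<Sum>j<p. u ^ j) / of_nat p"
 have p0: "of_nat p \<noteq> (0 :: complex)" using prime_p prime_gt_0_nat by simp
 have "(u - 1) * (\<Sum>j<p. u ^ j) = of_nat p * of_nat p * e" using u(2) power_diff_1_eq[of u p] by simp
 hence uy: "(u - 1) * y = of_nat p * e" unfolding y_def using p0 by (simp add: field_simps)
 have uj: "u ^ j * y = y + of_nat p * e * (\<Sum>i<j. u ^ i)" for j
 proof -
  have "(u ^ j - 1) * y = ((u - 1) * y) * (\<Sum>i<j. u ^ i)" using power_diff_1_eq[of u j] by (simp only: mult_ac)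
  thus ?thesis unfolding uy by (simp add: algebra_simps)
 qed
 have "of_nat p * (y * y) = (\<Sum>j<p. u ^ j * y)" unfolding sum_distrib_right[symmetric] using p0 by (simp add: y_def)
 also have "\<dots> = (\<Sum>j<p. y) + (\<Sum>j<p. of_nat p * e * (\<Sum>i<j. u ^ i))" unfolding uj by (rule sum.distrib)
 also have "(\<Sum>j<p. of_nat p * e * (\<Sum>i<j. u ^ i)) = of_nat p * e * (\<Sum>j<p. \<Sum>i<j. u ^ i)" by (rule sum_distrib_left[symmetric])
 also have "(\<Sum>j<p. y) + of_nat p * e * (\<Sum>j<p. \<Sum>i<j. u ^ i) = of_nat p * (y + e * (\<Sum>j<p. \<Sum>i<j. u ^ i))"
  by (simp only: sum_constant card_lessThan distrib_left mult.assoc)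
 finally have "y * y - y = e * (\<Sum>j<p. \<Sum>i<j. u ^ i)" using p0 by simp
 also have "\<dots> \<in> pint p" by (intro pint_mult e pint_sum pint_power u)
 finally show ?thesis unfolding y_def by (rule pint_quadratic)
qed

end

context cyclotomic
begin

lemma sum_zeta_quotient:
 assumes "i < l" "j < l"
 shows "(\<Sum>b<l. (\<zeta> ^ i / \<zeta> ^ j) ^ b) = (if i = j then of_nat l else 0)"
proof (cases "i = j")
 case True thus ?thesis using zeta_nz by simp
next
 case False
 define x where "x = \<zeta> ^ i / \<zeta> ^ j"
 have "x \<noteq> 1" using False assms zeta_power_eq[of i j] zeta_nz by (auto simp: x_def)
 moreover have "x ^ l = 1"
  unfolding x_def power_divide power_mult[symmetric] mult.commute[of _ l] unfolding power_mult zeta_l by simp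
 hence "(x - 1) * (\<Sum>b<l. x ^ b) = 0" using power_diff_1_eq[of x l] by simp
 ultimately have "(\<Sum>b<l. x ^ b) = 0" by simp
 thus ?thesis using False unfolding x_def by simp
qed

end

context kummer
begin

lemma sig_1_F: assumes "x \<in> cycF" shows "sig 1 b x = x"
proof -
 obtain q where q: "x = (\<Sum>i<l-1. of_rat (q i) * \<zeta> ^ i)" using assms unfolding cycF_def by blast
 show ?thesis unfolding q
  by (subst sig_sum[OF not_dvd_1 K_mult[OF K_rat K_zeta]])
   (simp only: sig_mult[OF not_dvd_1 K_rat K_zeta] sig_rat[OF not_dvd_1] sig_zeta[OF not_dvd_1] power_one_right)
qed

text \<open>Integrality of coordinates comes from duality here, not from a prime element. With
  \<open>\<phi>\<close> the means of the inverse powers, the sums over b of the products of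
  conjugates of \<open>\<theta>\<close> and \<open>\<phi>\<close> form the identity matrix, so each
  coordinate is a sum of conjugates of x times l-integral numbers.\<close>

lemma multiplicity_l_split:
 assumes h: "int l ^ 2 dvd D ^ (l - 1) - 1"
 shows "multiplicity (int l) (discriminant kumK) = l * (l - 2)"
proof -
 obtain e0 where e0: "D ^ (l - 1) - 1 = int l ^ 2 * e0" using h by (auto simp: dvd_def)
 have nd: "\<not> int l dvd D"
 proof
  assume "int l dvd D"
  hence "int l dvd D ^ (l - 1)" by (rule dvd_trans) (use l_ge_3 in \<open>simp add: dvd_power\<close>)
  moreover have "int l dvd D ^ (l - 1) - 1" unfolding e0 by (simp add: power2_eq_square)
  ultimately have "int l dvd D ^ (l - 1) - (D ^ (l - 1) - 1)" by (rule dvd_diff)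
  hence "int l dvd 1" by simp
  thus False using L.not_dvd_one by simp
 qed
 have ndE: "\<not> int l dvd D ^ (l - 1)" using nd by (rule L.not_dvd_power)
 have l0: "of_nat l \<noteq> (0 :: complex)" using l_pos by simp
 \<comment> \<open>Dividing \<alpha> by D makes the l-th power the inverse of D^(l-1), which is 1
   modulo l^2 as the mean criterion requires.\<close>
 define c where "c = \<alpha> / of_int D"
 define u where "u k = \<zeta> ^ k * c" for k
 have c0: "c \<noteq> 0" using alpha_nz D_nz by (simp add: c_def)
 have Dl: "(of_int D :: complex) ^ l = of_int D * of_int (D ^ (l - 1))" using l_pos by (cases l) auto
 have "c ^ l = inverse (of_int (D ^ (l - 1)))" unfolding c_def power_divide alpha Dl using D_nz by (simp add: field_simps)
 moreover have "(\<zeta> ^ k) ^ l = 1" for k by (metis mult.commute power_mult power_one zeta_l)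
 ultimately have ul: "u k ^ l = inverse (of_int (D ^ (l - 1)))" for k by (simp add: u_def power_mult_distrib)
 have iul: "inverse (u k) ^ l = of_int (D ^ (l - 1))" for k using ul[of k] by (metis inverse_inverse_eq power_inverse)
 have up: "u k \<in> pint l" for k by (rule L.pint_root[OF _ l_pos]) (use ul L.pint_inverse_int[OF ndE] in simp)
 have ip: "inverse (u k) \<in> pint l" for k by (rule L.pint_root[OF _ l_pos]) (use iul L.pint_of_int[of "D ^ (l - 1)"] in simp)
 have E: "of_int (D ^ (l - 1)) = (1 + of_nat l * of_nat l * of_int e0 :: complex)"
 proof -
  have "D ^ (l - 1) = 1 + int l * int l * e0" using e0 by (simp add: power2_eq_square)
  thus ?thesis by (simp only: of_int_add of_int_mult of_int_of_nat_eq of_int_1)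
 qed
 define \<theta> where "\<theta> k = (\<Sum>j<l. u k ^ j) / of_nat l" for k
 define \<phi> where "\<phi> k = (\<Sum>j<l. inverse (u k) ^ j) / of_nat l" for k
 have \<phi>p: "\<phi> k \<in> pint l" for k unfolding \<phi>_def
  by (rule L.pint_root_mean[OF ip, of _ "of_int e0"]) (use iul E L.pint_of_int in auto)
 have \<theta>p: "\<theta> k \<in> pint l" for k unfolding \<theta>_def
 proof (rule L.pint_root_mean[OF up, of _ "- of_int e0 * inverse (of_int (D ^ (l - 1)))"])
  have "of_int (D ^ (l - 1)) \<noteq> (0 :: complex)" using D_nz by simp
  thus "u k ^ l = 1 + of_nat l * of_nat l * (- of_int e0 * inverse (of_int (D ^ (l - 1))))"
   unfolding ul E by (simp add: field_simps)
  show "- of_int e0 * inverse (of_int (D ^ (l - 1))) \<in> pint l"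
   by (intro L.pint_mult L.pint_minus L.pint_of_int L.pint_inverse_int ndE)
 qed
 have shift: "u (k + b) ^ j = u k ^ j * (\<zeta> ^ j) ^ b" for k b j
  by (simp add: u_def power_add power_mult_distrib power_mult[symmetric] mult.commute)
 have orth: "(\<Sum>b<l. \<theta> (k + b) * \<phi> (m + b)) = (if k = m then 1 else 0)" if km: "k < l" "m < l" for k m
 proof -
  have "\<theta> (k + b) * \<phi> (m + b) = (\<Sum>j<l. \<Sum>i<l. u k ^ j * inverse (u m ^ i) * (\<zeta> ^ j / \<zeta> ^ i) ^ b) / (of_nat l * of_nat l)" for b
   unfolding \<theta>_def \<phi>_def times_divide_times_eq sum_product power_inverse shift
   by (simp add: field_simps power_divide)
  hence "(\<Sum>b<l. \<theta> (k + b) * \<phi> (m + b))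
    = (\<Sum>b<l. \<Sum>j<l. \<Sum>i<l. u k ^ j * inverse (u m ^ i) * (\<zeta> ^ j / \<zeta> ^ i) ^ b) / (of_nat l * of_nat l)"
   by (simp only: sum_divide_distrib)
  also have "(\<Sum>b<l. \<Sum>j<l. \<Sum>i<l. u k ^ j * inverse (u m ^ i) * (\<zeta> ^ j / \<zeta> ^ i) ^ b)
    = (\<Sum>j<l. \<Sum>i<l. u k ^ j * inverse (u m ^ i) * (\<Sum>b<l. (\<zeta> ^ j / \<zeta> ^ i) ^ b))"
   unfolding sum_distrib_left by (subst sum.swap, rule sum.cong[OF refl], rule sum.swap)
  also have "\<dots> = (\<Sum>j<l. u k ^ j * inverse (u m ^ j) * of_nat l)"
   by (rule sum.cong[OF refl]) (simp add: sum_zeta_quotient if_distrib[of "\<lambda>x. _ * x"] sum.delta' cong: if_cong)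
  also have "\<dots> = (\<Sum>j<l. (\<zeta> ^ k / \<zeta> ^ m) ^ j) * of_nat l"
   unfolding sum_distrib_right by (rule sum.cong[OF refl]) (simp add: u_def power_mult_distrib power_divide c0 field_simps)
  finally show ?thesis using sum_zeta_quotient[OF km] l0 by simp
 qed
 have cK: "c \<in> kumK" unfolding c_def by (intro K_divide K_alpha K_int)
 have uK: "u k \<in> kumK" for k unfolding u_def by (intro K_mult K_zeta cK)
 have lK: "of_nat l \<in> kumK" using K_int[of "int l"] by simp
 have \<theta>K: "\<theta> k \<in> kumK" for k unfolding \<theta>_def by (intro K_divide K_sum K_power uK lK)
 have sig: "sig a b (\<theta> k) = (\<Sum>j<l. (\<zeta> ^ (a * k + b) * c) ^ j) / of_nat l" if a: "\<not> l dvd a" for a b k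
 proof -
  have cc: "sig a b c = \<zeta> ^ b * c" unfolding c_def divide_inverse
   using sig_mult[OF a K_alpha K_inverse[OF K_int]] sig_inverse[OF a K_int] sig_alpha[OF a] sig_int[OF a] by simp
  have "sig a b (u k) = \<zeta> ^ (a * k + b) * c" unfolding u_def
   using sig_mult[OF a K_zeta cK] sig_zeta[OF a] cc by (simp add: power_add power_mult)
  moreover have "sig a b (\<Sum>j<l. u k ^ j) = (\<Sum>j<l. sig a b (u k) ^ j)"
   by (subst sig_sum[OF a K_power[OF uK]]) (simp only: sig_power[OF a uK])
  moreover have "sig a b (\<theta> k) = sig a b (\<Sum>j<l. u k ^ j) * sig a b (inverse (of_nat l))"
   unfolding \<theta>_def divide_inverse by (intro sig_mult[OF a] K_sum K_power uK K_inverse lK)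
  moreover have "sig a b (inverse (of_nat l)) = inverse (of_nat l)"
   using sig_inverse[OF a lK] sig_int[OF a, of b "int l"] by simp
  ultimately show ?thesis by (simp only: divide_inverse)
 qed
 have nda: "\<not> l dvd Suc a" if "a < l - 1" for a using that by (auto dest: dvd_imp_le)
 have D0: "\<bar>real_of_int D\<bar> > 0" using D_nz by simp
 \<comment> \<open>The conjugate matrix is the Vandermonde matrix of the \<zeta>^b \<alpha> times a
   row-scaled Fourier matrix. The powers of l cancel, and a unit at l remains.\<close>
 have det: "(norm (mdet l (\<lambda>b k. sig (Suc a) b (\<theta> k))))\<^sup>2 = inverse (\<bar>real_of_int D\<bar> ^ ((l - 1)\<^sup>2))"
  if a: "a < l - 1" for a
 proof -
  define W1 where "W1 = mdet l (\<lambda>b j. (\<zeta> ^ b * \<alpha>) ^ j)"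
  have "mdet l (\<lambda>b k. sig (Suc a) b (\<theta> k)) = W1 * mdet l (\<lambda>j k. inverse (of_nat l * of_int D ^ j) * (\<zeta> ^ (Suc a * j)) ^ k)"
   unfolding W1_def mdet_mult
  proof (rule mdet_cong)
   fix b k
   have "(\<zeta> ^ (Suc a * k + b) * c) ^ j / of_nat l = (\<zeta> ^ b * \<alpha>) ^ j * (inverse (of_nat l * of_int D ^ j) * (\<zeta> ^ (Suc a * j)) ^ k)" for j
   proof -
    have "(\<zeta> ^ (Suc a * j)) ^ k = (\<zeta> ^ (Suc a * k)) ^ j" by (simp only: power_mult[symmetric] mult_ac)
    thus ?thesis by (simp only: c_def power_add power_mult_distrib power_divide) (simp add: field_simps)
   qed
   thus "sig (Suc a) b (\<theta> k) = (\<Sum>j<l. (\<zeta> ^ b * \<alpha>) ^ j * (inverse (of_nat l * of_int D ^ j) * (\<zeta> ^ (Suc a * j)) ^ k))"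
    unfolding sig[OF nda[OF a]] sum_divide_distrib by (simp only:)
  qed
  also have "mdet l (\<lambda>j k. inverse (of_nat l * of_int D ^ j) * (\<zeta> ^ (Suc a * j)) ^ k)
   = (\<Prod>j<l. inverse (of_nat l * of_int D ^ j)) * mdet l (\<lambda>j k. (\<zeta> ^ (Suc a * j)) ^ k)"
   by (rule det_scale_rows)
  finally have "(norm (mdet l (\<lambda>b k. sig (Suc a) b (\<theta> k))))\<^sup>2
   = (norm W1)\<^sup>2 * (norm (\<Prod>j<l. inverse (of_nat l * (of_int D) ^ j :: complex)))\<^sup>2
    * (norm (mdet l (\<lambda>j k. (\<zeta> ^ (Suc a * j)) ^ k)))\<^sup>2"
   by (simp only: norm_mult power_mult_distrib mult_ac)
  also have "(norm (\<Prod>j<l. inverse (of_nat l * (of_int D) ^ j :: complex)))\<^sup>2 = inverse (real l ^ l * real l ^ l * \<bar>real_of_int D\<bar> ^ (2 * (\<Sum>j<l. j)))"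
  proof -
   have "(\<Prod>j<l. inverse (of_nat l * (of_int D) ^ j :: complex)) = inverse (\<Prod>j<l. of_nat l * (of_int D) ^ j)"
    using prod_inversef[of "\<lambda>j. of_nat l * (of_int D) ^ j :: complex" "{..<l}"] by (simp add: o_def)
   hence "norm (\<Prod>j<l. inverse (of_nat l * (of_int D) ^ j :: complex)) = inverse (real l ^ l * \<bar>real_of_int D\<bar> ^ (\<Sum>j<l. j))"
    by (simp add: prod_norm[symmetric] prod.distrib norm_inverse norm_mult norm_power power_sum)
   thus ?thesis by (simp add: power2_eq_square power_add mult_2 mult_ac)
  qed
  finally have "(norm (mdet l (\<lambda>b k. sig (Suc a) b (\<theta> k))))\<^sup>2
   = real l ^ l * \<bar>real_of_int D\<bar> ^ (l - 1) * inverse (real l ^ l * real l ^ l * \<bar>real_of_int D\<bar> ^ (l * (l - 1))) * real l ^ l"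
   unfolding W1_def norm_det_alpha det_fourier[OF nda[OF a]] sum_double_lessThan .
  also have "l * (l - 1) = (l - 1) + (l - 1)\<^sup>2" using l_pos by (cases l) (auto simp: power2_eq_square)
  also have "real l ^ l * \<bar>real_of_int D\<bar> ^ (l - 1) * inverse (real l ^ l * real l ^ l * \<bar>real_of_int D\<bar> ^ ((l - 1) + (l - 1)\<^sup>2)) * real l ^ l
    = inverse (\<bar>real_of_int D\<bar> ^ ((l - 1)\<^sup>2))"
   unfolding power_add using l_pos D0 by (simp add: field_simps)
  finally show ?thesis .
 qed
 have "fdet \<theta>
  = (\<Prod>a<l-1. (norm (mdet l (\<lambda>b j. sig (Suc a) b (\<theta> j))))\<^sup>2)
   * ((lamdet)\<^sup>2) ^ l"
  unfolding det_fam[OF \<theta>K] power_mult_distrib prod_power_distrib by (simp only: power_mult[symmetric] mult.commute)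
 hence d2: "fdet \<theta> = real l ^ (l * (l - 2)) * inverse (\<bar>real_of_int D\<bar> ^ ((l - 1)\<^sup>2 * (l - 1)))"
  unfolding det_lam using det by (simp add: power_mult power_inverse mult_ac) (simp only: power_mult[symmetric] mult.commute)
 have pb: "p_basis l \<theta>"
 proof (rule p_basis_if_F_integral[OF prime_l \<theta>K \<theta>p])
  show "F_integral l \<theta>" unfolding F_integral_def
  proof (intro allI impI)
   fix y m assume y: "\<forall>j<l. y j \<in> cycF" "(\<Sum>j<l. y j * \<theta> j) \<in> pint l" and m: "m < l"
   define x where "x = (\<Sum>j<l. y j * \<theta> j)"
   have yK: "y j * \<theta> j \<in> kumK" if "j \<in> {..<l}" for j using that y(1) \<theta>K K_F by (intro K_mult) auto
   have xK: "x \<in> kumK" unfolding x_def by (rule K_sum[OF yK])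
   have "sig 1 b x = (\<Sum>k<l. sig 1 b (y k * \<theta> k))" for b
    unfolding x_def by (rule sig_sum[OF not_dvd_1]) (rule yK)
   moreover have "(\<Sum>k<l. sig 1 b (y k * \<theta> k)) = (\<Sum>k<l. y k * \<theta> (k + b))" for b
   proof (rule sum.cong[OF refl])
    fix k assume "k \<in> {..<l}"
    hence yk: "y k \<in> cycF" using y(1) by blast
    show "sig 1 b (y k * \<theta> k) = y k * \<theta> (k + b)"
     unfolding sig_mult[OF not_dvd_1 K_F[OF yk] \<theta>K] sig_1_F[OF yk] sig[OF not_dvd_1] by (simp add: \<theta>_def u_def)
   qed
   ultimately have sx: "sig 1 b x = (\<Sum>k<l. y k * \<theta> (k + b))" for b by simp
   have "(\<Sum>b<l. sig 1 b x * \<phi> (m + b)) = (\<Sum>k<l. y k * (\<Sum>b<l. \<theta> (k + b) * \<phi> (m + b)))"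
    unfolding sx sum_distrib_right sum_distrib_left by (subst sum.swap) (simp only: mult.assoc)
   also have "\<dots> = y m" using m by (simp add: orth if_distrib[of "\<lambda>x. _ * x"] sum.delta cong: if_cong)
   finally have "y m = (\<Sum>b<l. sig 1 b x * \<phi> (m + b))" ..
   also have "\<dots> \<in> pint l" using sig_pint[OF not_dvd_1 xK] y(2) by (intro L.pint_sum L.pint_mult \<phi>p) (simp add: x_def)
   finally show "y m \<in> pint l" .
  qed
  have "fdet \<theta> \<noteq> 0" unfolding d2 using l_pos D_nz by simp
  thus "det (embm (fam \<theta>)) \<noteq> 0" by (rule det_embm_nz_if)
  fix x assume "x \<in> kumK"
  then obtain y where y: "\<forall>j<l. y j \<in> cycF" "x = (\<Sum>j<l. y j * \<alpha> ^ j)" using span_alpha by blast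
  \<comment> \<open>Fourier inversion recovers the powers of c, so the means span the field over
    \<open>cycF\<close>.\<close>
  have cj: "c ^ j = (\<Sum>k<l. inverse ((\<zeta> ^ k) ^ j) * \<theta> k)" if j: "j < l" for j
  proof -
   have "(\<Sum>k<l. inverse ((\<zeta> ^ k) ^ j) * \<theta> k) = (\<Sum>k<l. \<Sum>i<l. (\<zeta> ^ i / \<zeta> ^ j) ^ k * c ^ i / of_nat l)"
    unfolding \<theta>_def sum_divide_distrib sum_distrib_left
   proof (rule sum.cong[OF refl], rule sum.cong[OF refl])
    fix k i
    have "(\<zeta> ^ k) ^ i = (\<zeta> ^ i) ^ k" "(\<zeta> ^ k) ^ j = (\<zeta> ^ j) ^ k" by (simp_all only: power_mult[symmetric] mult.commute)
    thus "inverse ((\<zeta> ^ k) ^ j) * (u k ^ i / of_nat l) = (\<zeta> ^ i / \<zeta> ^ j) ^ k * c ^ i / of_nat l"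
     by (simp only: u_def power_mult_distrib power_divide) (simp add: field_simps)
   qed
   also have "\<dots> = (\<Sum>i<l. (\<Sum>k<l. (\<zeta> ^ i / \<zeta> ^ j) ^ k) * c ^ i / of_nat l)"
    unfolding sum_distrib_right sum_divide_distrib by (rule sum.swap)
   also have "\<dots> = c ^ j" using j l0 by (simp add: sum_zeta_quotient if_distrib[of "\<lambda>x. x * _"] if_distrib[of "\<lambda>x. x / _"] sum.delta cong: if_cong)
   finally show ?thesis ..
  qed
  have "x = (\<Sum>j<l. \<Sum>k<l. y j * of_int D ^ j * inverse ((\<zeta> ^ k) ^ j) * \<theta> k)"
   unfolding y(2)
  proof (rule sum.cong[OF refl])
   fix j assume "j \<in> {..<l}"
   have "\<alpha> = of_int D * c" using D_nz by (simp add: c_def)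
   hence "\<alpha> ^ j = of_int D ^ j * c ^ j" by (simp add: power_mult_distrib)
   thus "y j * \<alpha> ^ j = (\<Sum>k<l. y j * of_int D ^ j * inverse ((\<zeta> ^ k) ^ j) * \<theta> k)"
    using cj \<open>j \<in> {..<l}\<close> by (simp add: sum_distrib_left mult_ac)
  qed
  also have "\<dots> = (\<Sum>k<l. (\<Sum>j<l. y j * of_int D ^ j * inverse ((\<zeta> ^ k) ^ j)) * \<theta> k)"
   unfolding sum_distrib_right by (rule sum.swap)
  finally have "x = (\<Sum>k<l. (\<Sum>j<l. y j * of_int D ^ j * inverse ((\<zeta> ^ k) ^ j)) * \<theta> k)" .
  moreover have "(\<Sum>j<l. y j * of_int D ^ j * inverse ((\<zeta> ^ k) ^ j)) \<in> cycF" for k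
   using y(1) by (intro F_sum F_mult F_power F_int F_inverse F_zeta) auto
  ultimately show "\<exists>y. (\<forall>j<l. y j \<in> cycF) \<and> x = (\<Sum>j<l. y j * \<theta> j)"
   by (intro exI[of _ "\<lambda>k. \<Sum>j<l. y j * of_int D ^ j * inverse ((\<zeta> ^ k) ^ j)"]) simp
 qed
 have pu: "punit l (inverse (of_int (\<bar>D\<bar> ^ ((l - 1)\<^sup>2 * (l - 1)))))"
 proof -
  have "\<not> int l dvd \<bar>D\<bar>" using nd by simp
  hence "\<not> int l dvd \<bar>D\<bar> ^ ((l - 1)\<^sup>2 * (l - 1))" by (rule L.not_dvd_power)
  thus ?thesis by (intro L.punit_inverse L.punit_of_int)
 qed
 show ?thesis
  by (rule discriminant_multiplicity(1)[OF prime_l pb _ pu]) (simp add: d2 of_real_abs_of_int)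
qed

end

subsection \<open>Kummer theory\<close>

context cyclotomic
begin

text \<open>For \<alpha>^l in \<open>cycF\<close> the field obtained by adjoining \<alpha>,
  available before a normalised radicand is chosen; for a normalised one it is
  \<open>kumK\<close>.\<close>

definition Fspan :: "complex \<Rightarrow> complex set"
 where "Fspan \<alpha> = {x. \<exists>y. (\<forall>j<l. y j \<in> cycF) \<and> x = (\<Sum>j<l. y j * \<alpha> ^ j)}"

lemma Fspan_subset:
 assumes a: "\<alpha> ^ l \<in> cycF" and f: "f \<in> cycF"
 shows "Fspan (f * \<alpha> ^ k) \<subseteq> Fspan \<alpha>"
proof
 fix x assume "x \<in> Fspan (f * \<alpha> ^ k)"
 then obtain y where y: "\<forall>j<l. y j \<in> cycF" "x = (\<Sum>j<l. y j * (f * \<alpha> ^ k) ^ j)" unfolding Fspan_def by blast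
 define c where "c j = y j * f ^ j * (\<alpha> ^ l) ^ (k * j div l)" for j
 define z where "z i = (\<Sum>j<l. if k * j mod l = i then c j else 0)" for i
 have zF: "z i \<in> cycF" for i unfolding z_def c_def
  using y(1) by (intro F_sum) (auto intro!: F_mult F_power f a F_0)
 have c: "y j * (f * \<alpha> ^ k) ^ j = c j * \<alpha> ^ (k * j mod l)" for j
 proof -
  have "(\<alpha> ^ k) ^ j = \<alpha> ^ (l * (k * j div l) + k * j mod l)" unfolding mult_div_mod_eq by (simp add: power_mult)
  thus ?thesis unfolding c_def power_mult_distrib power_add power_mult by (simp only: mult.assoc)
 qed
 have "(\<Sum>i<l. z i * \<alpha> ^ i) = (\<Sum>j<l. \<Sum>i<l. (if k * j mod l = i then c j else 0) * \<alpha> ^ i)"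
  unfolding z_def sum_distrib_right by (rule sum.swap)
 also have "\<dots> = x" unfolding y(2) c
  using l_pos by (intro sum.cong[OF refl]) (simp add: if_distrib[of "\<lambda>x. x * _"] sum.delta cong: if_cong)
 finally have "x = (\<Sum>i<l. z i * \<alpha> ^ i)" ..
 thus "x \<in> Fspan \<alpha>" unfolding Fspan_def mem_Collect_eq using zF by (intro exI[of _ z]) simp
qed

lemma Fspan_self: "\<alpha> \<in> Fspan \<alpha>"
 unfolding Fspan_def mem_Collect_eq
proof (intro exI[of _ "\<lambda>j. if j = 1 then 1 else 0"] conjI allI impI)
 show "(if j = 1 then 1 else 0) \<in> cycF" for j :: nat using F_0 F_1 by simp
 show "\<alpha> = (\<Sum>j<l. (if j = 1 then 1 else 0) * \<alpha> ^ j)"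
  using l_ge_3 by (simp add: if_distrib[of "\<lambda>x. x * _"] sum.delta cong: if_cong)
qed

lemma inverse_mod_l_Suc:
 assumes "\<not> l dvd a" obtains b t where "a * b = Suc (l * t)"
proof -
 obtain b where b: "[a * b = 1] (mod l)" using inverse_mod_l[OF assms] by blast
 have "a * b \<noteq> 0" using b l_ge_3 by (intro notI) (simp add: Cong.cong_def)
 moreover have "l dvd a * b - 1" using b cong_to_1_nat by blast
 then obtain t where "a * b - 1 = l * t" by (auto simp: dvd_def)
 ultimately have "a * b = Suc (l * t)" by linarith
 thus ?thesis by (rule that)
qed

text \<open>If p has multiplicity v in D and v k = 1 + l m, then D^k / p^(l m) is an integer
  divisible by p exactly once, and \<alpha>^k / p^m is an l-th root of it. Since k is invertible
  modulo l, a power of the new root recovers \<alpha> up to a factor in \<open>cycF\<close>.\<close>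

lemma kummer_normalize:
 assumes D: "D \<noteq> 0" "\<alpha> ^ l = of_int D" and p: "prime p" "\<not> l dvd multiplicity (int p) D"
 obtains \<beta> D' k m where "kummer l \<zeta> D' \<beta> p" "kummer.kumK l \<zeta> \<beta> = Fspan \<alpha>" "D ^ k = D' * int p ^ (m * l)" "\<not> l dvd k"
  "\<beta> = \<alpha> ^ k * of_rat (1 / of_nat p ^ m)"
proof -
 interpret P: prime_place p by standard (rule p(1))
 define v where "v = multiplicity (int p) D"
 obtain k m where "v * k = Suc (l * m)" using inverse_mod_l_Suc[of v] p(2) unfolding v_def by blast
 hence vk: "v * k = Suc (m * l)" by (simp only: mult.commute)
 have ndk: "\<not> l dvd k"
 proof
  assume "l dvd k"
  hence "l dvd Suc (m * l)" using vk dvd_mult by metis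
  hence "l dvd 1" using dvd_add_right_iff[of l "m * l" 1] by simp
  thus False using l_ge_3 by simp
 qed
 have "\<not> is_unit (int p)" using p(1) by (metis not_prime_unit prime_nat_int_transfer)
 then obtain d where d: "D = int p ^ v * d" "\<not> int p dvd d"
  unfolding v_def using multiplicity_decompose'[OF D(1)] by blast
 define D' where "D' = int p * d ^ k"
 have Dk: "D ^ k = D' * int p ^ (m * l)"
  unfolding d(1) power_mult_distrib power_mult[symmetric] vk D'_def by (simp add: mult_ac)
 have p0: "of_nat p \<noteq> (0 :: complex)" using p(1) prime_gt_0_nat by auto
 define \<beta> where "\<beta> = \<alpha> ^ k * of_rat (1 / of_nat p ^ m)"
 have \<beta>: "\<beta> = \<alpha> ^ k / of_nat p ^ m" by (simp add: \<beta>_def of_rat_divide of_rat_power)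
 have "\<beta> ^ l = of_int (D ^ k) / of_int (int p ^ (m * l))"
  unfolding \<beta> power_divide power_mult[symmetric] mult.commute[of k] unfolding power_mult D(2) by simp
 also have "\<dots> = of_int D'" unfolding Dk using p0 by simp
 finally have bl: "\<beta> ^ l = of_int D'" .
 have "multiplicity (int p) D' = 1"
 proof -
  have "\<not> int p dvd d ^ k" using d(2) by (rule P.not_dvd_power)
  moreover have "D' \<noteq> 0" unfolding D'_def using p0 d D(1) by auto
  ultimately show ?thesis unfolding D'_def using \<open>\<not> is_unit (int p)\<close> p0 d D(1)
   by (subst multiplicity_times_same) (auto simp: not_dvd_imp_multiplicity_0)
 qed
 hence K: "kummer l \<zeta> D' \<beta> p" by unfold_locales (use bl p(1) in auto)
 obtain k' t where kk: "k * k' = Suc (l * t)" using inverse_mod_l_Suc[OF ndk] by blast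
 have D0: "of_int D \<noteq> (0 :: complex)" using D(1) by simp
 have "\<beta> ^ k' * of_nat p ^ (m * k') = \<alpha> * of_int D ^ t"
  unfolding \<beta> power_divide power_mult[symmetric] kk unfolding power_Suc power_mult D(2) using p0 by simp
 hence "\<alpha> = of_nat p ^ (m * k') / of_int D ^ t * \<beta> ^ k'" using D0 by (simp add: field_simps)
 moreover have "of_nat p ^ (m * k') / of_int D ^ t \<in> cycF"
  using F_int[of "int p"] by (intro F_divide F_power F_int) simp
 ultimately have "Fspan \<alpha> \<subseteq> Fspan \<beta>" using Fspan_subset[of \<beta>] F_int[of D'] bl by metis
 moreover have "Fspan \<beta> \<subseteq> Fspan \<alpha>" unfolding \<beta>_def mult.commute[of "\<alpha> ^ k"]
  by (rule Fspan_subset) (use D(2) F_int F_rat in auto)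
 ultimately have "kummer.kumK l \<zeta> \<beta> = Fspan \<alpha>" unfolding kummer.kumK_def[OF K] Fspan_def[symmetric] by blast
 thus ?thesis using that[OF K _ Dk ndk \<beta>_def] by blast
qed

text \<open>Otherwise normalisation produces a root \<beta> inside \<open>cycF\<close>. Then \<beta>
  - \<beta> = 0, read with coefficients \<beta> and -1 on the powers 0 and 1, is a relation
  forbidden by \<open>alpha_F_independent\<close>.\<close>

lemma power_in_F_multiplicity:
 assumes "\<gamma> \<in> cycF" "\<gamma> ^ l = of_int D" "D \<noteq> 0" and p: "prime p"
 shows "l dvd multiplicity (int p) D"
proof (rule ccontr)
 assume "\<not> l dvd multiplicity (int p) D"
 then obtain \<beta> D' k m where K: "kummer l \<zeta> D' \<beta> p" and b: "\<beta> = \<gamma> ^ k * of_rat (1 / of_nat p ^ m)"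
  using kummer_normalize[OF assms(3,2) p] by metis
 interpret K: kummer l \<zeta> D' \<beta> p by (rule K)
 have bF: "\<beta> \<in> cycF" unfolding b by (intro F_mult F_power F_rat assms)
 define y where "y j = (if j = 0 then \<beta> else if j = 1 then - 1 else 0)" for j :: nat
 have "(\<Sum>j<l. y j * \<beta> ^ j) = (\<Sum>j\<in>{0, 1}. y j * \<beta> ^ j)"
  using l_ge_3 by (intro sum.mono_neutral_right) (auto simp: y_def)
 also have "\<dots> = 0" by (simp add: y_def)
 finally have "y 1 = 0"
  by (rule K.alpha_F_independent[rotated]) (use bF F_0 F_minus[OF F_1] l_ge_3 in \<open>auto simp: y_def\<close>)
 thus False by (simp add: y_def)
qed

end

context kummer
begin

lemma fixed_in_F:
 assumes x: "x \<in> kumK" "sig 1 1 x = x"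
 shows "x \<in> cycF"
proof -
 obtain y where y: "\<forall>j<l. y j \<in> cycF" "x = (\<Sum>j<l. y j * \<alpha> ^ j)" using span_alpha[OF x(1)] by blast
 have "sig 1 1 x = (\<Sum>j<l. sig 1 1 (y j * \<alpha> ^ j))"
  unfolding y(2) by (rule sig_sum[OF not_dvd_1]) (use y(1) K_F in \<open>auto intro!: K_mult K_power K_alpha\<close>)
 also have "\<dots> = (\<Sum>j<l. y j * \<zeta> ^ j * \<alpha> ^ j)"
 proof (rule sum.cong[OF refl])
  fix j assume "j \<in> {..<l}"
  hence "y j \<in> cycF" using y(1) by simp
  thus "sig 1 1 (y j * \<alpha> ^ j) = y j * \<zeta> ^ j * \<alpha> ^ j"
   using sig_mult[OF not_dvd_1 K_F K_power[OF K_alpha]] sig_1_F sig_power[OF not_dvd_1 K_alpha] sig_alpha[OF not_dvd_1]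
   by (simp add: power_mult_distrib)
 qed
 finally have "(\<Sum>j<l. (y j * \<zeta> ^ j - y j) * \<alpha> ^ j) = 0" using x(2) y(2)
  by (simp add: left_diff_distrib sum_subtractf)
 hence e: "y j * \<zeta> ^ j - y j = 0" if "j < l" for j
  by (rule alpha_F_independent[of "\<lambda>j. y j * \<zeta> ^ j - y j", rotated]) (use that y(1) in \<open>auto intro!: F_diff F_mult F_zeta\<close>)
 have "y j = 0" if j: "j \<in> {..<l} - {0}" for j
 proof -
  have "\<zeta> ^ j \<noteq> 1" using j zeta_power_eq_1[of j] by (auto dest: dvd_imp_le)
  moreover have "y j * (\<zeta> ^ j - 1) = 0" using e[of j] j by (simp add: algebra_simps)
  ultimately show ?thesis by simp
 qed
 hence "x = y 0" unfolding y(2) using l_pos by (subst sum.remove[of _ 0]) auto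
 thus ?thesis using y(1) l_pos by simp
qed

text \<open>The automorphism \<open>sig 1 1\<close> multiplies \<beta> by some \<zeta>^k, just as it
  does \<alpha>^k, so their quotient \<gamma> is fixed and lies in \<open>cycF\<close>. As
  \<gamma>^l = E / D^k, multiplying \<gamma> by D^k gives the integral radicand E D^(k(l-1)) for
  \<open>power_in_F_multiplicity\<close>.\<close>

lemma kummer_power:
 assumes b: "\<beta> \<in> kumK" "\<beta> ^ l = of_int E" "E \<noteq> 0"
 obtains k where "k < l" "\<And>p. prime p \<Longrightarrow> l dvd multiplicity (int p) E + k * (l - 1) * multiplicity (int p) D"
proof -
 have b0: "\<beta> \<noteq> 0" using b(2,3) l_pos by (intro notI) (simp add: power_0_left)
 have "sig 1 1 \<beta> ^ l = \<beta> ^ l" using sig_power[OF not_dvd_1 b(1), of 1 l] sig_int[OF not_dvd_1] b(2) by simp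
 then obtain k where k: "k < l" "sig 1 1 \<beta> = \<zeta> ^ k * \<beta>" using b0 by (rule root_cases)
 define \<gamma> where "\<gamma> = \<beta> * inverse (\<alpha> ^ k)"
 have aK: "\<alpha> ^ k \<in> kumK" by (intro K_power K_alpha)
 have gK: "\<gamma> \<in> kumK" unfolding \<gamma>_def by (intro K_mult b K_inverse aK)
 have "sig 1 1 \<gamma> = \<zeta> ^ k * \<beta> * inverse ((\<zeta> * \<alpha>) ^ k)"
  unfolding \<gamma>_def using sig_mult[OF not_dvd_1 b(1) K_inverse[OF aK]] sig_inverse[OF not_dvd_1 aK]
   sig_power[OF not_dvd_1 K_alpha] sig_alpha[OF not_dvd_1, of 1] k(2) by simp
 also have "\<dots> = \<gamma>" unfolding \<gamma>_def using zeta_nz by (simp add: power_mult_distrib)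
 finally have gF: "\<gamma> \<in> cycF" by (rule fixed_in_F[OF gK])
 have "(\<gamma> * of_int (D ^ k)) ^ l = of_int (E * D ^ (k * (l - 1)))"
 proof -
  have "(\<alpha> ^ k) ^ l = of_int D ^ k" by (metis alpha mult.commute power_mult)
  moreover have "(of_int D ^ k :: complex) ^ l = of_int D ^ (k * (l - 1)) * of_int D ^ k"
   using l_pos by (cases l) (simp_all add: power_mult[symmetric] power_add mult.commute)
  ultimately show ?thesis using D_nz by (simp add: \<gamma>_def power_mult_distrib power_inverse b(2))
 qed
 moreover have "E * D ^ (k * (l - 1)) \<noteq> 0" using D_nz b(3) by simp
 ultimately have "l dvd multiplicity (int p) (E * D ^ (k * (l - 1)))" if "prime p" for p
  using power_in_F_multiplicity that gF F_mult F_int by metis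
 moreover have "multiplicity (int p) (E * D ^ (k * (l - 1))) = multiplicity (int p) E + k * (l - 1) * multiplicity (int p) D"
  if "prime p" for p
  using that b(3) D_nz by (simp add: prime_elem_multiplicity_mult_distrib prime_elem_multiplicity_power_distrib)
 ultimately show ?thesis using that[OF k(1)] by metis
qed

text \<open>An isomorphism onto M is in particular an embedding of \<open>kumK\<close>, hence some
  \<open>sig a b\<close>, and these map \<open>kumK\<close> into itself.\<close>

lemma iso_subset:
 assumes "field_ring kumK \<simeq> field_ring M"
 shows "M \<subseteq> kumK"
proof -
 obtain h where h: "h \<in> ring_iso (field_ring kumK) (field_ring M)" using assms unfolding is_ring_iso_def by blast
 have hh: "h \<in> Ring.ring_hom (field_ring kumK) (field_ring M)" and bij: "bij_betw h kumK M"
  using h by (auto simp: ring_iso_def)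
 have hm: "h (x + y) = h x + h y" "h (x * y) = h x * h y" if "x \<in> kumK" "y \<in> kumK" for x y
  using ring_hom_add[OF hh] ring_hom_mult[OF hh] that by (simp_all)
 have h1: "h 1 = 1" using ring_hom_one[OF hh] by simp
 show ?thesis
 proof (rule hom_is_sig[of h])
  fix a b assume ab: "0 < a" "a < l" "\<And>x. x \<in> kumK \<Longrightarrow> h x = sig a b x"
  have "\<not> l dvd a" using ab by (auto dest: dvd_imp_le)
  hence "h ` kumK \<subseteq> kumK" using ab(3) sig_K by auto
  thus ?thesis using bij by (simp add: bij_betw_def)
 qed (use hm h1 in simp_all)
qed

lemma discriminant_nz: "discriminant kumK \<noteq> 0"
proof -
 obtain p where p: "prime p" "p > nat \<bar>D\<bar> + l" using bigger_prime by blast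
 have "\<not> int p dvd D" using p(2) D_nz by (auto dest!: dvd_imp_le_int)
 thus ?thesis using multiplicity_unramified(2)[OF p(1)] p(2) by simp
qed

end

subsection \<open>Discriminants of the fields of radicands\<close>

lemma multiplicity_int_nat: "multiplicity (int p) (int n) = multiplicity p n" if p: "prime p"
proof (cases "n = 0")
 case False
 have "p ^ k dvd n \<longleftrightarrow> k \<le> multiplicity p n" for k
  using False p by (intro power_dvd_iff_le_multiplicity) (auto dest: not_prime_unit)
 hence "int p ^ k dvd int n \<longleftrightarrow> k \<le> multiplicity p n" for k
  by (metis of_nat_dvd_iff of_nat_power)
 thus ?thesis by (intro multiplicity_eqI) (simp_all del: power_Suc)
qed simp

context cyclotomic
begin

definition lfree :: "nat set"
 where "lfree = {n. n > 0 \<and> (\<forall>p. prime p \<longrightarrow> multiplicity p n < l)}"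

definition rt :: "nat \<Rightarrow> complex" where "rt n = of_real (root l (real n))"

definition KF :: "nat \<Rightarrow> complex set" where "KF n = Fspan (rt n)"

lemma rt_power: "rt n ^ l = of_nat n" unfolding rt_def of_real_power[symmetric] using l_pos by simp

lemma prime_dvd_iff_multiplicity: "prime p \<Longrightarrow> n > 0 \<Longrightarrow> p dvd n \<longleftrightarrow> multiplicity p (n :: nat) > 0"
 by (subst prime_multiplicity_gt_zero_iff) auto

lemma KF_kummer:
 assumes n: "n \<in> lfree" and p: "prime p" "p dvd n"
 obtains \<beta> d k m where "kummer l \<zeta> (int d) \<beta> p" "kummer.kumK l \<zeta> \<beta> = KF n" "n ^ k = d * p ^ (m * l)" "\<not> l dvd k"
proof -
 have n0: "n > 0" "multiplicity p n < l" using n p by (auto simp: lfree_def)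
 moreover have "multiplicity p n > 0" using prime_dvd_iff_multiplicity p n0 by blast
 ultimately have "\<not> l dvd multiplicity (int p) (int n)" using multiplicity_int_nat[OF p(1)] by (auto dest: dvd_imp_le)
 show ?thesis
 proof (rule kummer_normalize[of "int n" "rt n" p])
  show "int n \<noteq> 0" "rt n ^ l = of_int (int n)" using n0 by (simp_all add: rt_power)
  fix \<beta> D k m
  assume K: "kummer l \<zeta> D \<beta> p" "kummer.kumK l \<zeta> \<beta> = Fspan (rt n)" "int n ^ k = D * int p ^ (m * l)" "\<not> l dvd k"
  have "D \<ge> 0"
  proof (rule ccontr)
   assume "\<not> D \<ge> 0"
   hence "D * int p ^ (m * l) < 0" using p(1) prime_gt_0_nat by (intro mult_neg_pos) auto
   thus False using K(3) zero_le_power[of "int n" k] by simp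
  qed
  then obtain d where d: "D = int d" using nonneg_int_cases by blast
  have "n ^ k = d * p ^ (m * l)" using K(3) unfolding d by (metis of_nat_eq_iff of_nat_mult of_nat_power)
  thus ?thesis using that[OF K(1)[unfolded d]] K(2,4) by (simp add: KF_def)
 qed fact+
qed

text \<open>For l dividing n the value is (l^2 - 2) + (l - 1)^2: the ramified exponent plus the
  contribution of one factor l in the normalised radicand.\<close>

definition expo :: "nat \<Rightarrow> nat"
 where "expo n = (if l dvd n then 2 * l\<^sup>2 - 2 * l - 1 else if [n ^ (l - 1) = 1] (mod l\<^sup>2) then l * (l - 2) else l\<^sup>2 - 2)"

definition rad :: "nat \<Rightarrow> nat" where "rad n = (\<Prod>p\<in>prime_factors n - {l}. p)"

lemma euler_l: "\<not> l dvd a \<Longrightarrow> [a ^ (l * (l - 1)) = 1] (mod l\<^sup>2)"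
proof -
 assume "\<not> l dvd a"
 hence "coprime a (l ^ 2)" using prime_l by (metis coprime_commute coprime_power_left_iff prime_imp_coprime)
 from euler_theorem[OF this] show ?thesis using prime_l by (simp add: totient_prime_power)
qed

text \<open>d arises from n^k by dividing out the l-th power of p^m, and l-th powers of numbers
  prime to l satisfy the congruence by Euler's theorem. So the splitting condition does not depend
  on the generator.\<close>

lemma cong_power_l_iff:
 assumes "n ^ k = d * p ^ (m * l)" "\<not> l dvd n" "\<not> l dvd p" "\<not> l dvd k"
 shows "[d ^ (l - 1) = 1] (mod l\<^sup>2) \<longleftrightarrow> [n ^ (l - 1) = 1] (mod l\<^sup>2)"
proof -
 have "\<not> l dvd p ^ m" using assms(3) prime_l prime_dvd_power by blast
 hence "[d ^ (l - 1) * (p ^ m) ^ (l * (l - 1)) = d ^ (l - 1) * 1] (mod l\<^sup>2)" by (intro cong_scalar_left euler_l)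
 moreover have "d ^ (l - 1) * (p ^ m) ^ (l * (l - 1)) = (n ^ k) ^ (l - 1)"
  unfolding assms(1) power_mult_distrib by (simp only: power_mult[symmetric] mult.assoc)
 ultimately have c: "[(n ^ (l - 1)) ^ k = d ^ (l - 1)] (mod l\<^sup>2)" by (simp add: power_mult[symmetric] mult.commute)
 show ?thesis
 proof
  assume "[n ^ (l - 1) = 1] (mod l\<^sup>2)"
  hence "[(n ^ (l - 1)) ^ k = 1 ^ k] (mod l\<^sup>2)" by (rule cong_pow)
  thus "[d ^ (l - 1) = 1] (mod l\<^sup>2)" using c by (metis cong_sym cong_trans power_one)
 next
  assume d1: "[d ^ (l - 1) = 1] (mod l\<^sup>2)"
  obtain k' t where kk: "k * k' = Suc (l * t)" using inverse_mod_l_Suc[OF assms(4)] by blast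
  have "[((n ^ (l - 1)) ^ k) ^ k' = 1 ^ k'] (mod l\<^sup>2)" using cong_trans[OF c d1] by (rule cong_pow)
  moreover have "((n ^ (l - 1)) ^ k) ^ k' = n ^ (l - 1) * (n ^ (l * (l - 1))) ^ t"
  proof -
   have "((n ^ (l - 1)) ^ k) ^ k' = n ^ (l - 1) * ((n ^ (l - 1)) ^ (l * t))"
    unfolding power_mult[symmetric, of "n ^ (l - 1)"] kk by simp
   thus ?thesis by (simp only: power_mult[symmetric] mult_ac)
  qed
  moreover have "[n ^ (l - 1) * (n ^ (l * (l - 1))) ^ t = n ^ (l - 1) * 1 ^ t] (mod l\<^sup>2)"
   by (intro cong_scalar_left cong_pow euler_l assms)
  ultimately show "[n ^ (l - 1) = 1] (mod l\<^sup>2)" by (metis cong_sym cong_trans mult_1_right power_one)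
 qed
qed

text \<open>Multiplicities are compared at every prime q. If q divides n, a generator normalised at
  q is taken; otherwise one normalised at a fixed prime factor of n, whose radicand is still prime
  to q.\<close>

lemma discriminant_KF:
 assumes n: "n \<in> lfree" "n \<noteq> 1"
 shows "\<bar>discriminant (KF n)\<bar> = int (l ^ expo n * rad n ^ ((l - 1)\<^sup>2))"
proof -
 define M where "M = nat \<bar>discriminant (KF n)\<bar>"
 define R where "R = (\<Prod>p\<in>insert l (prime_factors n). p ^ (if p = l then expo n else (l - 1)\<^sup>2))"
 have n0: "n > 0" using n by (simp add: lfree_def)
 obtain p0 where p0: "prime p0" "p0 dvd n" using prime_factor_nat n by blast
 have M0: "M > 0"
 proof -
  obtain \<beta> d k m where K: "kummer l \<zeta> (int d) \<beta> p0" "kummer.kumK l \<zeta> \<beta> = KF n" using KF_kummer[OF n(1) p0] by metis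
  show ?thesis using kummer.discriminant_nz[OF K(1)] unfolding K(2) M_def by simp
 qed
 have MM: "multiplicity q M = multiplicity (int q) (discriminant (KF n))" if "prime q" for q
  using multiplicity_int_nat[OF that, of M] multiplicity_normalize_right[of "int q" "discriminant (KF n)"]
  by (simp only: M_def normalize_int_def int_nat_eq abs_ge_zero if_True)
 have "multiplicity q M = multiplicity q R" if q: "prime q" for q
 proof -
  have R: "multiplicity q R = (if q = l then expo n else if q dvd n then (l - 1)\<^sup>2 else 0)"
   unfolding R_def using q n0 prime_l
   by (subst multiplicity_prod_prime_powers) (auto simp: prime_factors_dvd)
  show ?thesis
  proof (cases "q = l")
   case False
   show ?thesis
   proof (cases "q dvd n")
    case True
    obtain \<beta> d k m where K: "kummer l \<zeta> (int d) \<beta> q" "kummer.kumK l \<zeta> \<beta> = KF n" using KF_kummer[OF n(1) q True] by metis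
    interpret K: kummer l \<zeta> "int d" \<beta> q by (rule K)
    show ?thesis unfolding R MM[OF q] using K.multiplicity_ramified[OF q False K.mult_p0] K(2) False True by simp
   next
    case nq: False
    obtain \<beta> d k m where K: "kummer l \<zeta> (int d) \<beta> p0" "kummer.kumK l \<zeta> \<beta> = KF n" "n ^ k = d * p0 ^ (m * l)"
     using KF_kummer[OF n(1) p0] by metis
    interpret K: kummer l \<zeta> "int d" \<beta> p0 by (rule K)
    have "\<not> q dvd d" using K(3) nq q by (metis dvd_mult2 prime_dvd_power)
    hence "\<not> int q dvd int d" by simp
    thus ?thesis unfolding R MM[OF q] using K.multiplicity_unramified[OF q False] K(2) False nq by simp
   qed
  next
   case ql: True
   show ?thesis
   proof (cases "l dvd n")
    case True
    obtain \<beta> D k m where K: "kummer l \<zeta> (int D) \<beta> l" "kummer.kumK l \<zeta> \<beta> = KF n" using KF_kummer[OF n(1) prime_l True] by metis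
    interpret K: kummer l \<zeta> "int D" \<beta> l by (rule K)
    obtain d where d: "int D = int l * d" "\<not> int l dvd d" by (rule L.multiplicity_one_decomp[OF K.mult_p0])
    have "int D - int D ^ l = int l * (d - int l ^ (l - 1) * d ^ l)"
     unfolding d(1) power_mult_distrib using l_pos by (cases l) (auto simp: algebra_simps)
    moreover have "\<not> int l dvd d - int l ^ (l - 1) * d ^ l"
    proof
     assume "int l dvd d - int l ^ (l - 1) * d ^ l"
     moreover have "int l dvd int l ^ (l - 1) * d ^ l" using l_ge_3 by (intro dvd_mult2 dvd_power) simp
     ultimately have "int l dvd (d - int l ^ (l - 1) * d ^ l) + int l ^ (l - 1) * d ^ l" by (rule dvd_add)
     thus False using d(2) by simp
    qed
    ultimately have "multiplicity (int l) (int D - int D ^ l) = 1" using l_pos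
     by (intro multiplicity_eqI) (auto simp: power2_eq_square)
    from K.multiplicity_l_ramified[OF this, of 1 d] d
    have "multiplicity (int l) (discriminant (KF n)) = l\<^sup>2 - 2 + (l - 1)\<^sup>2" using K(2) by simp
    moreover have "l\<^sup>2 - 2 + (l - 1)\<^sup>2 = 2 * l\<^sup>2 - 2 * l - 1"
    proof -
     obtain j where "l = Suc (Suc j)" using l_ge_3 by (metis Suc_le_D numeral_3_eq_3 Suc_le_mono)
     thus ?thesis by (simp add: power2_eq_square)
    qed
    ultimately show ?thesis unfolding R unfolding MM[OF q] unfolding ql using True by (simp add: expo_def)
   next
    case nl: False
    obtain \<beta> d k m where K: "kummer l \<zeta> (int d) \<beta> p0" "kummer.kumK l \<zeta> \<beta> = KF n" "n ^ k = d * p0 ^ (m * l)" "\<not> l dvd k"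
     using KF_kummer[OF n(1) p0] by metis
    interpret K: kummer l \<zeta> "int d" \<beta> p0 by (rule K)
    have nd: "\<not> l dvd d" using K(3) nl prime_l by (metis dvd_mult2 prime_dvd_power)
    have "\<not> l dvd p0" using nl p0 prime_l primes_dvd_imp_eq by blast
    hence iff: "[d ^ (l - 1) = 1] (mod l\<^sup>2) \<longleftrightarrow> [n ^ (l - 1) = 1] (mod l\<^sup>2)" by (rule cong_power_l_iff[OF K(3) nl _ K(4)])
    have dvd: "int l ^ j dvd int d ^ (l - 1) - 1 \<longleftrightarrow> [d ^ (l - 1) = 1] (mod l ^ j)" for j
     using cong_int_iff[of "d ^ (l - 1)" 1 "l ^ j"] by (simp add: cong_iff_dvd_diff)
    show ?thesis
    proof (cases "[n ^ (l - 1) = 1] (mod l\<^sup>2)")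
     case True
     hence "int l ^ 2 dvd int d ^ (l - 1) - 1" using iff dvd[of 2] by simp
     from K.multiplicity_l_split[OF this] show ?thesis unfolding R unfolding MM[OF q] unfolding ql using K(2) True nl by (simp add: expo_def)
    next
     case False
     have e: "int d - int d ^ l = - int d * (int d ^ (l - 1) - 1)" using l_pos by (cases l) (auto simp: algebra_simps)
     \<comment> \<open>Fermat gives one factor l in d^(l-1) - 1, and the failure of the congruence
       modulo l^2 excludes a second.\<close>
     have "multiplicity (int l) (int d - int d ^ l) = 1"
     proof (rule multiplicity_eqI)
      have "int l ^ 1 dvd int d ^ (l - 1) - 1" unfolding dvd using fermat_theorem[OF prime_l nd] by simp
      thus "int l ^ 1 dvd int d - int d ^ l" unfolding e by (rule dvd_mult)
      show "\<not> int l ^ Suc 1 dvd int d - int d ^ l"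
      proof
       assume *: "int l ^ Suc 1 dvd int d - int d ^ l"
       have "coprime (l ^ 2) d" using prime_l nd by (simp add: prime_imp_coprime)
       hence "coprime (int (l ^ 2)) (int d)" by (simp only: coprime_int_iff)
       hence "coprime (int l ^ Suc 1) (- int d)" by (simp add: numeral_2_eq_2)
       with * have "int l ^ Suc 1 dvd int d ^ (l - 1) - 1" unfolding e by (simp only: coprime_dvd_mult_right_iff)
       hence "int l ^ 2 dvd int d ^ (l - 1) - 1" by (simp add: numeral_2_eq_2)
       thus False using dvd[of 2] iff False by simp
      qed
     qed
     from K.multiplicity_l_ramified[OF this, of 0 "int d"] nd show ?thesis
      unfolding R unfolding MM[OF q] unfolding ql using K(2) False nl by (simp add: expo_def)
    qed
   qed
  qed
 qed
 moreover have "R > 0" unfolding R_def using prime_l by (intro prod_pos) (auto dest!: in_prime_factors_imp_prime intro: prime_gt_0_nat)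
 ultimately have "M = R" using multiplicity_eq_nat[OF M0] by blast
 also have "R = l ^ expo n * rad n ^ ((l - 1)\<^sup>2)"
 proof -
  have "insert l (prime_factors n) = insert l (prime_factors n - {l})" by auto
  hence "R = (\<Prod>p\<in>insert l (prime_factors n - {l}). p ^ (if p = l then expo n else (l - 1)\<^sup>2))" by (simp add: R_def)
  also have "\<dots> = l ^ expo n * (\<Prod>p\<in>prime_factors n - {l}. p ^ (l - 1)\<^sup>2)" by (subst prod.insert) auto
  finally show ?thesis by (simp add: rad_def prod_power_distrib)
 qed
 finally have "int M = int (l ^ expo n * rad n ^ ((l - 1)\<^sup>2))" by (rule arg_cong)
 moreover have "int M = \<bar>discriminant (KF n)\<bar>" by (simp add: M_def)
 ultimately show ?thesis by (rule trans[OF sym, rotated])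
qed

end

section \<open>Radicands that generate the same field\<close>

context cyclotomic
begin

lemma rt_nz: "n > 0 \<Longrightarrow> rt n \<noteq> 0" using l_pos by (simp add: rt_def)

text \<open>The l-th-power-free part of n^k; on exponents it is multiplication by k modulo
  l.\<close>

definition pw :: "nat \<Rightarrow> nat \<Rightarrow> nat"
 where "pw n k = (\<Prod>p\<in>prime_factors n. p ^ (k * multiplicity p n mod l))"

lemma prod_prime_factors_pos: "(\<Prod>p\<in>prime_factors n. p ^ f p) > (0 :: nat)"
 by (intro prod_pos) (auto dest!: in_prime_factors_imp_prime intro: prime_gt_0_nat)

lemma multiplicity_prime_factors_prod:
 assumes "n > 0" "prime p" "multiplicity p n = 0 \<Longrightarrow> f p = 0"
 shows "multiplicity p (\<Prod>p\<in>prime_factors n. p ^ f p) = (f p :: nat)"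
 using assms by (subst multiplicity_prod_prime_powers) (auto simp: in_prime_factors_iff dest: not_dvd_imp_multiplicity_0)

lemma multiplicity_pw: "n > 0 \<Longrightarrow> prime p \<Longrightarrow> multiplicity p (pw n k) = k * multiplicity p n mod l"
 unfolding pw_def by (rule multiplicity_prime_factors_prod) auto

lemma pw_pos: "pw n k > 0" unfolding pw_def by (rule prod_prime_factors_pos)

lemma lfree_pos: "n \<in> lfree \<Longrightarrow> n > 0" by (simp add: lfree_def)

lemma lfree_multiplicity: "n \<in> lfree \<Longrightarrow> prime p \<Longrightarrow> multiplicity p n < l" by (simp add: lfree_def)

lemma pw_lfree: "n > 0 \<Longrightarrow> pw n k \<in> lfree"
 unfolding lfree_def using pw_pos l_pos by (auto simp: multiplicity_pw)

lemma lfree_eqI: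
 assumes "m \<in> lfree" "n \<in> lfree" "\<And>p. prime p \<Longrightarrow> multiplicity p m = multiplicity p n"
 shows "m = n"
 by (rule multiplicity_eq_nat[OF lfree_pos[OF assms(1)] lfree_pos[OF assms(2)] assms(3)])

lemma power_decomposition:
 assumes n: "n > 0"
 obtains r where "r > 0" "n ^ k = pw n k * r ^ l"
proof -
 define r where "r = (\<Prod>p\<in>prime_factors n. p ^ (k * multiplicity p n div l))"
 have r0: "r > 0" unfolding r_def by (rule prod_prime_factors_pos)
 have mr: "multiplicity p r = k * multiplicity p n div l" if "prime p" for p
  unfolding r_def by (rule multiplicity_prime_factors_prod[OF n that]) simp
 have "n ^ k = pw n k * r ^ l"
 proof (rule multiplicity_eq_nat)
  fix p :: nat assume p: "prime p"
  have "multiplicity p (pw n k * r ^ l) = k * multiplicity p n mod l + l * (k * multiplicity p n div l)"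
   using p pw_pos[of n k] r0 mr[OF p] multiplicity_pw[OF n p]
   by (simp add: prime_elem_multiplicity_mult_distrib prime_elem_multiplicity_power_distrib)
  thus "multiplicity p (n ^ k) = multiplicity p (pw n k * r ^ l)"
   using p n by (simp add: prime_elem_multiplicity_power_distrib)
 qed (use n r0 pw_pos in auto)
 thus ?thesis using that r0 by blast
qed

lemma rt_mult: "rt (a * b) = rt a * rt b" by (simp add: rt_def real_root_mult)

lemma rt_pow: "rt (a ^ k) = rt a ^ k" using l_pos by (simp add: rt_def real_root_power)

lemma rt_lth_power: "rt (r ^ l) = of_nat r"
 using l_pos by (simp add: rt_def real_root_power_cancel)

lemma rt_pw: assumes "n > 0" obtains f where "f \<in> cycF" "rt (pw n k) = f * rt n ^ k"
proof -
 obtain r where r: "r > 0" "n ^ k = pw n k * r ^ l" using power_decomposition[OF assms] .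
 have "rt n ^ k = rt (pw n k) * of_nat r" unfolding rt_pow[symmetric] r(2) rt_mult rt_lth_power ..
 hence "rt (pw n k) = inverse (of_nat r) * rt n ^ k" using r(1) by (simp add: field_simps)
 moreover have "inverse (of_nat r) \<in> cycF" using F_int[of "int r"] by (intro F_inverse) simp
 ultimately show ?thesis using that by blast
qed

lemma KF_pw_subset: assumes "n > 0" shows "KF (pw n k) \<subseteq> KF n"
proof -
 obtain f where "f \<in> cycF" "rt (pw n k) = f * rt n ^ k" using rt_pw[OF assms] .
 thus ?thesis unfolding KF_def using Fspan_subset[of "rt n" f k] F_int[of "int n"] rt_power[of n] by simp
qed

lemma pw_pw: assumes "n \<in> lfree" "[k * k' = 1] (mod l)" shows "pw (pw n k) k' = n"
proof (rule lfree_eqI)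
 have n0: "n > 0" by (rule lfree_pos) fact
 show "pw (pw n k) k' \<in> lfree" using pw_lfree pw_pos by blast
 fix p :: nat assume p: "prime p"
 have "multiplicity p (pw (pw n k) k') = k' * (k * multiplicity p n mod l) mod l"
  using multiplicity_pw[OF pw_pos p] multiplicity_pw[OF n0 p] by simp
 also have "\<dots> = (k * k') * multiplicity p n mod l" unfolding mod_mult_right_eq by (simp only: mult_ac)
 also have "\<dots> = 1 * multiplicity p n mod l" using assms(2) cong_scalar_right[of "k * k'" 1 l] unfolding Cong.cong_def by blast
 also have "\<dots> = multiplicity p n" using lfree_multiplicity[OF assms(1) p] by simp
 finally show "multiplicity p (pw (pw n k) k') = multiplicity p n" .
qed fact

lemma KF_pw: assumes "n \<in> lfree" "\<not> l dvd k" shows "KF (pw n k) = KF n"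
proof -
 obtain k' where "[k * k' = 1] (mod l)" using inverse_mod_l[OF assms(2)] .
 hence "pw (pw n k) k' = n" by (rule pw_pw[OF assms(1)])
 thus ?thesis using KF_pw_subset[OF lfree_pos[OF assms(1)], of k] KF_pw_subset[OF pw_pos, of n k k'] by auto
qed

text \<open>\<open>kummer_power\<close> compares m with a normalised radicand d: modulo l the
  exponents of m are i times those of d, and those are k times the exponents of n. So i k modulo l
  is the required power.\<close>

lemma KF_eq_imp_pw:
 assumes n: "n \<in> lfree" "n \<noteq> 1" and m: "m \<in> lfree" "m \<noteq> 1" "KF m = KF n"
 obtains k where "0 < k" "k < l" "m = pw n k"
proof -
 have n0: "n > 0" and m0: "m > 0" using n m by (auto simp: lfree_def)
 obtain p0 where p0: "prime p0" "p0 dvd n" using prime_factor_nat n by blast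
 obtain \<beta> d k j where K: "kummer l \<zeta> (int d) \<beta> p0" "kummer.kumK l \<zeta> \<beta> = KF n" "n ^ k = d * p0 ^ (j * l)"
  using KF_kummer[OF n(1) p0] by metis
 interpret K: kummer l \<zeta> "int d" \<beta> p0 by (rule K)
 have "rt m \<in> K.kumK" using Fspan_self[of "rt m"] m(3) K(2) by (simp add: KF_def)
 moreover have "rt m ^ l = of_int (int m)" by (simp add: rt_power)
 ultimately obtain i where i: "\<And>p. prime p \<Longrightarrow> l dvd multiplicity (int p) (int m) + i * (l - 1) * multiplicity (int p) (int d)"
  using K.kummer_power m0 by (metis of_nat_eq_0_iff neq0_conv)
 have d0: "d > 0" using K.D_nz by simp
 define k' where "k' = (i * k) mod l"
 have eq: "multiplicity p m = k' * multiplicity p n mod l" if p: "prime p" for p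
 proof -
  have "k * multiplicity p n = multiplicity p (n ^ k)" using p n0 by (simp add: prime_elem_multiplicity_power_distrib)
  also have "\<dots> = multiplicity p d + j * l * multiplicity p p0" unfolding K(3)
   using p d0 p0(1) prime_gt_0_nat[of p0] by (simp add: prime_elem_multiplicity_mult_distrib prime_elem_multiplicity_power_distrib)
  finally have e: "k * multiplicity p n = multiplicity p d + l * (j * multiplicity p p0)" by (simp add: mult_ac)
  have "l dvd multiplicity p m + i * (l - 1) * multiplicity p d" using i[OF p] multiplicity_int_nat[OF p] by simp
  \<comment> \<open>Adding i times the multiplicity in d turns the factor i (l - 1) into a multiple
    of l.\<close>
  hence "[multiplicity p m + i * (l - 1) * multiplicity p d + i * multiplicity p d = 0 + i * multiplicity p d] (mod l)"
   by (intro cong_add) (simp_all add: cong_0_iff)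
  moreover have "multiplicity p m + i * (l - 1) * multiplicity p d + i * multiplicity p d = multiplicity p m + l * (i * multiplicity p d)"
   using l_pos by (cases l) (auto simp: algebra_simps)
  ultimately have "[multiplicity p m + l * (i * multiplicity p d) = i * multiplicity p d] (mod l)" by (simp only: add_0)
  hence "[multiplicity p m = i * multiplicity p d] (mod l)" by (simp add: Cong.cong_def)
  moreover have "i * (k * multiplicity p n) = i * multiplicity p d + l * (i * (j * multiplicity p p0))" unfolding e by (simp add: algebra_simps)
  hence "[i * (k * multiplicity p n) = i * multiplicity p d] (mod l)" by (simp add: Cong.cong_def)
  ultimately have "[multiplicity p m = i * k * multiplicity p n] (mod l)" using cong_trans cong_sym by (metis mult.assoc)
  moreover have "multiplicity p m < l" by (rule lfree_multiplicity[OF m(1) p])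
  ultimately have "multiplicity p m = i * k * multiplicity p n mod l" by (simp add: Cong.cong_def)
  thus ?thesis unfolding k'_def by (simp only: mod_mult_left_eq)
 qed
 have me: "m = pw n k'" by (rule lfree_eqI[OF m(1) pw_lfree[OF n0]]) (simp add: eq multiplicity_pw[OF n0])
 have "k' \<noteq> 0"
 proof
  assume "k' = 0"
  hence "m = 1" unfolding me pw_def by simp
  thus False using m(2) by simp
 qed
 moreover have "k' < l" unfolding k'_def using l_pos by simp
 ultimately show ?thesis using that me by blast
qed

text \<open>A prime factor of n has multiplicity prime to l, so the different k are told apart at
  that prime; k = 0 would give the excluded radicand 1.\<close>

lemma card_KF_fibre:
 assumes n: "n \<in> lfree" "n \<noteq> 1"
 shows "{m \<in> lfree - {1}. KF m = KF n} = pw n ` {1..<l}" "card (pw n ` {1..<l}) = l - 1"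
proof -
 have n0: "n > 0" using n by (auto simp: lfree_def)
 obtain p0 where p0: "prime p0" "p0 dvd n" using prime_factor_nat n by blast
 define v where "v = multiplicity p0 n"
 have "v > 0" "v < l" using prime_dvd_iff_multiplicity[OF p0(1) n0] p0 lfree_multiplicity[OF n(1) p0(1)] by (auto simp: v_def)
 hence "\<not> l dvd v" by (auto dest: dvd_imp_le)
 hence cv: "coprime v l" using prime_l by (metis coprime_commute prime_imp_coprime)
 have inj: "i = j" if "i < l" "j < l" "pw n i = pw n j" for i j
 proof -
  have "[i * v = j * v] (mod l)" using that(3) multiplicity_pw[OF n0 p0(1), folded v_def] by (metis Cong.cong_def)
  hence "[i = j] (mod l)" using cv by (simp add: cong_mult_rcancel_nat)
  thus ?thesis using that by (simp add: Cong.cong_def)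
 qed
 hence "inj_on (pw n) {1..<l}" by (auto intro: inj_onI)
 thus "card (pw n ` {1..<l}) = l - 1" by (simp add: card_image)
 have "pw n k \<noteq> 1" if "0 < k" "k < l" for k
  using inj[of k 0] that l_pos by (auto simp: pw_def)
 moreover have "KF (pw n k) = KF n" if "0 < k" "k < l" for k using that by (intro KF_pw n) (auto dest: dvd_imp_le)
 ultimately have "pw n ` {1..<l} \<subseteq> {m \<in> lfree - {1}. KF m = KF n}" using pw_lfree[OF n0] by auto
 moreover have "m \<in> pw n ` {1..<l}" if "m \<in> lfree" "m \<noteq> 1" "KF m = KF n" for m
 proof (rule KF_eq_imp_pw[OF n that])
  fix k assume "0 < k" "k < l" "m = pw n k"
  thus ?thesis by simp
 qed
 ultimately show "{m \<in> lfree - {1}. KF m = KF n} = pw n ` {1..<l}" by blast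
qed

lemma card_KF_image:
 assumes "\<And>m n. KF m = KF n \<Longrightarrow> P m = P n"
 shows "(l - 1) * card (KF ` {n \<in> lfree - {1}. P n}) = card {n \<in> lfree - {1}. P n}"
proof -
 define R where "R = {n \<in> lfree - {1}. P n}"
 have fib: "{n \<in> R. KF n = M} = pw m ` {1..<l} \<and> card (pw m ` {1..<l}) = l - 1" if "m \<in> R" "KF m = M" for m M
 proof -
  have m: "m \<in> lfree" "m \<noteq> 1" "P m" using that by (auto simp: R_def)
  have "{n \<in> R. KF n = M} = {n \<in> lfree - {1}. KF n = KF m}" 
  proof -
   have "P n" if "KF n = KF m" for n using assms[OF that] m(3) by simp
   thus ?thesis unfolding R_def that(2)[symmetric] by blast
  qed
  thus ?thesis using card_KF_fibre[OF m(1,2)] by simp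
 qed
 show ?thesis
 proof (cases "finite (KF ` R)")
  case True
  have "R = (\<Union>M\<in>KF ` R. {n \<in> R. KF n = M})" by auto
  moreover have "finite (\<Union>M\<in>KF ` R. {n \<in> R. KF n = M})" using True fib by (intro finite_UN_I) auto
  ultimately have "finite R" by simp
  hence "card R = (\<Sum>M\<in>KF ` R. card {n \<in> R. KF n = M})" using sum.image_gen[of R "\<lambda>_. 1 :: nat" KF] by simp
  also have "\<dots> = (\<Sum>M\<in>KF ` R. l - 1)" using fib by (intro sum.cong[OF refl]) auto
  finally show ?thesis unfolding R_def[symmetric] by simp
 next
  \<comment> \<open>For infinitely many fields both cardinalities are 0 by convention.\<close>
  case False
  hence "infinite R" by auto
  thus ?thesis unfolding R_def[symmetric] using False by simp
 qed
qed

end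

subsection \<open>Classification of metacyclic fields\<close>

context cyclotomic
begin

lemma subfield_F: "subfield cycF complex_ring"
 by (rule subfield_complexI) (auto intro: F_1 F_add F_mult F_minus F_inverse)

lemma cycF_subset_subfield:
 assumes M: "subfield M complex_ring" "\<zeta> \<in> M"
 shows "cycF \<subseteq> M"
proof
 note c = subfield_complexD[OF M(1)]
 have 0: "0 \<in> M" using subfield_complex_of_rat[OF M(1), of 0] by simp
 have pow: "\<zeta> ^ i \<in> M" for i by (induction i) (auto intro: c M(2))
 have sum: "(\<Sum>i\<in>A. f i) \<in> M" if "\<And>i. i \<in> A \<Longrightarrow> f i \<in> M" for f :: "nat \<Rightarrow> complex" and A
  using that by (induction A rule: infinite_finite_induct) (auto intro: c 0)
 fix x assume "x \<in> cycF"
 thus "x \<in> M" unfolding cycF_def using subfield_complex_of_rat[OF M(1)] pow by (auto intro!: sum c(3))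
qed

text \<open>Such a number generates Q or the cyclotomic field, of degree 1 or l - 1 and never l.
  This disposes of D = 0 and of radicands whose absolute value is an l-th power.\<close>

lemma not_pure_cyclotomic:
 assumes "field_degree (generate_field complex_ring {\<zeta> ^ b * of_int r}) = l"
 shows False
proof (cases "\<zeta> ^ b * of_int r \<in> \<rat>")
 case True
 have sf: "subfield (generate_field complex_ring {\<zeta> ^ b * of_int r}) complex_ring"
  by (rule field.generate_field_is_subfield[OF field_C]) simp
 have "\<rat> \<subseteq> generate_field complex_ring {\<zeta> ^ b * of_int r}" using subfield_complex_of_rat[OF sf] by (auto elim: Rats_cases)
 moreover have "generate_field complex_ring {\<zeta> ^ b * of_int r} \<subseteq> \<rat>"
  by (rule field.generate_field_min_subfield1[OF field_C _ subfield_Rats]) (use True in auto)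
 moreover have "ratspan {0 :: nat} (\<lambda>_. 1) = \<rat>" by (auto simp: ratspan_def elim: Rats_cases)
 ultimately have "generate_field complex_ring {\<zeta> ^ b * of_int r} = ratspan {0 :: nat} (\<lambda>_. 1)" by simp
 moreover have "C.dim \<rat> (ratspan {0 :: nat} (\<lambda>_. 1)) = 1" by (subst dim_ratspan) auto
 ultimately show False using assms l_ge_3 by (simp add: field_degree_def)
next
 case False
 define L where "L = generate_field complex_ring {\<zeta> ^ b * of_int r}"
 have sf: "subfield L complex_ring" unfolding L_def by (rule field.generate_field_is_subfield[OF field_C]) simp
 have r0: "r \<noteq> 0" using False by (intro notI) simp
 have nb: "\<not> l dvd b" using False zeta_power_eq_1[of b] by auto
 have in_L: "\<zeta> ^ b * of_int r \<in> L" unfolding L_def by (rule generate_field.incl) simp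
 have "\<zeta> ^ b * of_int r * inverse (of_int r) \<in> L"
  using subfield_complexD(3,5)[OF sf] in_L subfield_complex_of_rat[OF sf, of "of_int r"] by simp
 hence zb: "\<zeta> ^ b \<in> L" using r0 by (simp add: mult.assoc)
 obtain b' where b': "[b * b' = 1] (mod l)" using inverse_mod_l[OF nb] .
 have "(\<zeta> ^ b) ^ i \<in> L" for i by (induction i) (use subfield_complexD(1,3)[OF sf] zb in auto)
 hence "(\<zeta> ^ b) ^ b' \<in> L" .
 moreover have "(\<zeta> ^ b) ^ b' = \<zeta> ^ 1" unfolding power_mult[symmetric] zeta_power_eq using b' by (simp add: Cong.cong_def)
 ultimately have "\<zeta> \<in> L" by simp
 hence "cycF \<subseteq> L" by (rule cycF_subset_subfield[OF sf])
 moreover have "L \<subseteq> cycF" unfolding L_def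
  by (rule field.generate_field_min_subfield1[OF field_C _ subfield_F]) (auto intro: F_mult F_zeta F_int)
 moreover have "cycF = ratspan {..<l-1} (\<lambda>i. \<zeta> ^ i)" unfolding cycF_def ratspan_def ..
 ultimately have "L = ratspan {..<l-1} (\<lambda>i. \<zeta> ^ i)" by simp
 moreover have "C.dim \<rat> (ratspan {..<l-1} (\<lambda>i. \<zeta> ^ i)) = card {..<l-1}"
  by (rule dim_ratspan) (use zeta_independent in auto)
 ultimately show False using assms l_ge_3 by (simp add: field_degree_def L_def)
qed

text \<open>Since l is odd, the sign of D is its own l-th power. It is absorbed into r together with
  the l-th-power part of the absolute value.\<close>

lemma root_of_int_decomposition:
 assumes a: "\<alpha> ^ l = of_int D" "D \<noteq> 0"
 obtains b r where "r \<noteq> 0" "\<alpha> = \<zeta> ^ b * of_int r * rt (pw (nat \<bar>D\<bar>) 1)"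
proof -
 define n where "n = nat \<bar>D\<bar>"
 have n0: "n > 0" using a(2) by (simp add: n_def)
 obtain r where r: "r > 0" "n ^ 1 = pw n 1 * r ^ l" using power_decomposition[OF n0] .
 have "int n = int (pw n 1) * int r ^ l" using r(2) by (metis of_nat_mult of_nat_power power_one_right)
 moreover have "sgn D ^ l = sgn D" using odd_l a(2) by (cases "D > 0") (auto simp: sgn_if)
 moreover have "D = sgn D * int n" by (simp add: n_def mult_sgn_abs)
 ultimately have "D = sgn D ^ l * int r ^ l * int (pw n 1)" by (simp only: mult_ac)
 hence "complex_of_int D = of_int (sgn D ^ l * int r ^ l * int (pw n 1))" by (rule arg_cong)
 also have "\<dots> = (of_int (sgn D * int r) * rt (pw n 1)) ^ l"
  by (simp add: power_mult_distrib rt_power)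
 finally have "\<alpha> ^ l = (of_int (sgn D * int r) * rt (pw n 1)) ^ l" unfolding a(1) .
 moreover have nz: "sgn D * int r \<noteq> 0" using a(2) r(1) by (simp add: sgn_eq_0_iff)
 moreover have "of_int (sgn D * int r) * rt (pw n 1) \<noteq> 0" using nz rt_nz[OF pw_pos] by simp
 ultimately obtain b where "\<alpha> = \<zeta> ^ b * (of_int (sgn D * int r) * rt (pw n 1))" using root_cases by metis
 thus ?thesis using that[OF nz, of b] by (simp add: n_def mult.assoc)
qed

lemma metacyclic_imp_KF:
 assumes K: "metacyclic_field l K"
 obtains n where "n \<in> lfree - {1}" "K = KF n"
proof -
 obtain L where L: "pure_field l L" "is_galois_closure L K" using K unfolding metacyclic_field_def by blast
 obtain D \<alpha> where D: "\<alpha> ^ l = of_int D" "L = generate_field complex_ring {\<alpha>}" "field_degree L = l"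
  using L(1) unfolding pure_field_def by blast
 have D0: "D \<noteq> 0"
 proof
  assume "D = 0"
  hence "\<alpha> = \<zeta> ^ 0 * of_int 0" using D(1) l_pos by simp
  thus False using not_pure_cyclotomic[of 0 0] D by simp
 qed
 define n where "n = pw (nat \<bar>D\<bar>) 1"
 obtain b r where br: "r \<noteq> 0" "\<alpha> = \<zeta> ^ b * of_int r * rt n" using root_of_int_decomposition[OF D(1) D0, folded n_def] .
 have n1: "n \<noteq> 1"
 proof
  assume "n = 1"
  hence "\<alpha> = \<zeta> ^ b * of_int r" using br(2) l_pos by (simp add: rt_def)
  thus False using not_pure_cyclotomic[of b r] D by simp
 qed
 have nl: "n \<in> lfree" unfolding n_def using D0 by (intro pw_lfree) simp
 obtain p where p: "prime p" "p dvd n" using prime_factor_nat n1 by blast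
 have "multiplicity p n > 0" using prime_dvd_iff_multiplicity p lfree_pos[OF nl] by blast
 moreover have "multiplicity p n = multiplicity (int p) D mod l"
 proof -
  have "multiplicity (int p) (int (nat \<bar>D\<bar>)) = multiplicity (int p) D"
   using multiplicity_normalize_right[of "int p" D] by (simp only: normalize_int_def int_nat_eq abs_ge_zero if_True)
  thus ?thesis unfolding n_def using multiplicity_int_nat[OF p(1), of "nat \<bar>D\<bar>"] multiplicity_pw[of "nat \<bar>D\<bar>" p 1] D0 p(1) by simp
 qed
 ultimately have "\<not> l dvd multiplicity (int p) D" by auto
 then obtain \<beta> D' k m where B: "kummer l \<zeta> D' \<beta> p" "kummer.kumK l \<zeta> \<beta> = Fspan \<alpha>" "\<beta> = \<alpha> ^ k * of_rat (1 / of_nat p ^ m)"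
  using kummer_normalize[OF D0 D(1) p(1)] by metis
 interpret B: kummer l \<zeta> D' \<beta> p by (rule B)
 have gK: "galois_over_rat K" "L \<subseteq> K" using L(2) unfolding is_galois_closure_def by auto
 have sK: "subfield K complex_ring" using gK unfolding galois_over_rat_def by blast
 have "\<alpha> \<in> L" unfolding D(2) by (rule generate_field.incl) simp
 hence aK: "\<alpha> \<in> K" using gK by blast
 have "\<alpha> ^ i \<in> K" for i by (induction i) (use subfield_complexD(1,3)[OF sK] aK in auto)
 hence "\<beta> \<in> K" unfolding B(3) by (intro subfield_complexD(3)[OF sK] subfield_complex_of_rat[OF sK])
 hence "B.kumK \<subseteq> K" by (rule B.galois_contains_K[OF gK(1)])
 moreover have "L \<subseteq> B.kumK" unfolding D(2)
  by (rule field.generate_field_min_subfield1[OF field_C _ B.subfield_K]) (use B(2) Fspan_self in auto)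
 hence "K \<subseteq> B.kumK" using L(2) B.galois_K unfolding is_galois_closure_def by blast
 ultimately have "K = Fspan \<alpha>" using B(2) by simp
 moreover have "Fspan \<alpha> \<subseteq> Fspan (rt n)"
  using Fspan_subset[of "rt n" "\<zeta> ^ b * of_int r" 1] F_mult[OF F_zeta F_int] F_int[of "int n"] by (simp add: rt_power br(2))
 moreover have "Fspan (rt n) \<subseteq> Fspan \<alpha>"
 proof -
  have "\<zeta> ^ b * of_int r \<noteq> 0" using br(1) zeta_nz by simp
  hence "inverse (\<zeta> ^ b * of_int r) * (\<zeta> ^ b * of_int r) = 1" by (rule left_inverse)
  hence "rt n = inverse (\<zeta> ^ b * of_int r) * \<alpha> ^ 1" unfolding br(2) power_one_right mult.assoc[symmetric, of "inverse _"] by (simp only: mult_1_left)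
  moreover have "inverse (\<zeta> ^ b * of_int r) \<in> cycF" by (intro F_inverse F_mult F_zeta F_int)
  ultimately show ?thesis using Fspan_subset[of \<alpha> "inverse (\<zeta> ^ b * of_int r)" 1] D(1) F_int by simp
 qed
 ultimately have "K = KF n" by (simp add: KF_def)
 thus ?thesis using that nl n1 by blast
qed

lemma KF_is_kumK:
 assumes "n \<in> lfree - {1}"
 obtains D \<beta> p where "kummer l \<zeta> D \<beta> p" "KF n = kummer.kumK l \<zeta> \<beta>"
proof -
 obtain p where p: "prime p" "p dvd n" using prime_factor_nat assms by blast
 show ?thesis using KF_kummer[of n p] assms p that by (metis DiffD1)
qed

lemma metacyclic_iff_KF: "metacyclic_field l K \<longleftrightarrow> K \<in> KF ` (lfree - {1})"
proof
 assume "metacyclic_field l K"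
 thus "K \<in> KF ` (lfree - {1})" using metacyclic_imp_KF by blast
next
 assume "K \<in> KF ` (lfree - {1})"
 then obtain n where n: "n \<in> lfree - {1}" "K = KF n" by blast
 obtain D \<beta> p where K: "kummer l \<zeta> D \<beta> p" "KF n = kummer.kumK l \<zeta> \<beta>" using KF_is_kumK[OF n(1)] .
 show "metacyclic_field l K" unfolding n(2) K(2) by (rule kummer.metacyclic_K[OF K(1)])
qed

lemma metacyclic_iso_subset:
 assumes "metacyclic_field l K" "field_ring K \<simeq> field_ring M"
 shows "M \<subseteq> K"
proof -
 obtain n where n: "n \<in> lfree - {1}" "K = KF n" using assms(1) unfolding metacyclic_iff_KF by blast
 obtain D \<beta> p where K: "kummer l \<zeta> D \<beta> p" "KF n = kummer.kumK l \<zeta> \<beta>" using KF_is_kumK[OF n(1)] .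
 show ?thesis using kummer.iso_subset[OF K(1)] assms(2) unfolding n(2) K(2) by blast
qed

text \<open>Every embedding of a Galois field into the complex numbers has its image inside that
  field, so isomorphism classes may be counted as subfields.\<close>

lemma metacyclic_iso_iff:
 assumes K: "metacyclic_field l K" and M: "metacyclic_field l M"
 shows "(K, M) \<in> number_field_iso \<longleftrightarrow> K = M"
proof
 assume "(K, M) \<in> number_field_iso"
 hence i: "field_ring K \<simeq> field_ring M" "number_field K" unfolding number_field_iso_def by auto
 have "ring (field_ring K)"
  using i(2) unfolding number_field_def by (intro C.subring_is_ring subcring.axioms(1) subfieldE(1)) simp
 hence "field_ring M \<simeq> field_ring K" using i(1) by (rule ring_iso_sym)
 thus "K = M" using metacyclic_iso_subset[OF K i(1)] metacyclic_iso_subset[OF M] by blast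
next
 assume "K = M"
 moreover have "id \<in> ring_iso (field_ring K) (field_ring K)" by (rule ring_iso_set_refl)
 ultimately show "(K, M) \<in> number_field_iso"
  using K unfolding number_field_iso_def metacyclic_field_def is_ring_iso_def by auto
qed

lemma metacyclic_count_lfree:
 "(l - 1) * metacyclic_count l x = card {n \<in> lfree - {1}. real (l ^ expo n * rad n ^ ((l - 1)\<^sup>2)) \<le> x}"
proof -
 define S where "S = {K. metacyclic_field l K \<and> real_of_int \<bar>discriminant K\<bar> \<le> x}"
 have "S // number_field_iso = (\<lambda>K. number_field_iso `` {K}) ` S" unfolding quotient_def by auto
 moreover have "inj_on (\<lambda>K. number_field_iso `` {K}) S"
 proof (rule inj_onI)
  fix K M assume KM: "K \<in> S" "M \<in> S" "number_field_iso `` {K} = number_field_iso `` {M}"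
  have "(M, M) \<in> number_field_iso" using metacyclic_iso_iff[of M M] KM by (simp add: S_def)
  hence "(K, M) \<in> number_field_iso" using KM(3) by blast
  thus "K = M" using metacyclic_iso_iff[of K M] KM by (simp add: S_def)
 qed
 ultimately have "metacyclic_count l x = card S" unfolding metacyclic_count_def S_def[symmetric] by (simp add: card_image)
 also have "S = KF ` {n \<in> lfree - {1}. real_of_int \<bar>discriminant (KF n)\<bar> \<le> x}" unfolding S_def metacyclic_iff_KF by auto
 finally have "(l - 1) * metacyclic_count l x = card {n \<in> lfree - {1}. real_of_int \<bar>discriminant (KF n)\<bar> \<le> x}"
  using card_KF_image[of "\<lambda>n. real_of_int \<bar>discriminant (KF n)\<bar> \<le> x"] by simp
 also have "{n \<in> lfree - {1}. real_of_int \<bar>discriminant (KF n)\<bar> \<le> x} = {n \<in> lfree - {1}. real (l ^ expo n * rad n ^ ((l - 1)\<^sup>2)) \<le> x}"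
 proof (intro Collect_cong conj_cong refl)
  fix n assume "n \<in> lfree - {1}"
  hence "real_of_int \<bar>discriminant (KF n)\<bar> = real (l ^ expo n * rad n ^ ((l - 1)\<^sup>2))"
   using discriminant_KF[of n] by (simp only: of_int_of_nat_eq Diff_iff singleton_iff not_False_eq_True)
  thus "real_of_int \<bar>discriminant (KF n)\<bar> \<le> x \<longleftrightarrow> real (l ^ expo n * rad n ^ ((l - 1)\<^sup>2)) \<le> x" by (simp only:)
 qed
 finally show ?thesis .
qed

end

lemma le_nat_floor_iff: "n > 0 \<Longrightarrow> n \<le> nat \<lfloor>x\<rfloor> \<longleftrightarrow> real n \<le> x"
 by (cases "x \<ge> 0") (auto simp: le_nat_iff le_floor_iff)

subsection \<open>Tuples of positive integers\<close>

text \<open>Tuples are functions with the fixed value 1 beyond their length, so that equal tuples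
  are equal functions and a longer tuple arises by a single update.\<close>

definition Tup :: "nat \<Rightarrow> (nat \<Rightarrow> nat) set"
 where "Tup k = {t. (\<forall>j<k. t j > 0) \<and> (\<forall>j\<ge>k. t j = 1)}"

definition tp :: "nat \<Rightarrow> (nat \<Rightarrow> nat) \<Rightarrow> nat" where "tp k t = (\<Prod>j<k. t j)"

definition TupY :: "nat \<Rightarrow> real \<Rightarrow> (nat \<Rightarrow> nat) set"
 where "TupY k Y = {t \<in> Tup k. real (tp k t) \<le> Y}"

lemma tp_pos: "t \<in> Tup k \<Longrightarrow> tp k t > 0" unfolding Tup_def tp_def by (auto intro: prod_pos)

lemma tp_ge_1: "t \<in> Tup k \<Longrightarrow> real (tp k t) \<ge> 1" using tp_pos[of t k] by simp

lemma tp_Suc_upd: "tp (Suc k) (t(k := n)) = tp k t * n" unfolding tp_def by (simp add: lessThan_Suc mult.commute)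

lemma bij_Tup_Suc:
 "bij_betw (\<lambda>(n, t). t(k := n)) {(n, t). n > 0 \<and> t \<in> Tup k \<and> real (n * tp k t) \<le> Y} (TupY (Suc k) Y)"
proof (rule bij_betw_byWitness[where f' = "\<lambda>t. (t k, t(k := 1))"])
 have *: "real (t k) * real (tp k (t(k := Suc 0))) = real (tp (Suc k) t)" for t
  using tp_Suc_upd[of k "t(k := 1)" "t k"] by (simp add: mult.commute)
 show "\<forall>a\<in>{(n, t). n > 0 \<and> t \<in> Tup k \<and> real (n * tp k t) \<le> Y}.
   (\<lambda>t. (t k, t(k := 1))) ((\<lambda>(n, t). t(k := n)) a) = a"
  by (auto simp: Tup_def fun_eq_iff)
 show "\<forall>a'\<in>TupY (Suc k) Y. (\<lambda>(n, t). t(k := n)) ((\<lambda>t. (t k, t(k := 1))) a') = a'"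
  by simp
 show "(\<lambda>t. (t k, t(k := 1))) ` TupY (Suc k) Y \<subseteq> {(n, t). n > 0 \<and> t \<in> Tup k \<and> real (n * tp k t) \<le> Y}"
  using * by (auto simp: TupY_def Tup_def)
qed (auto simp: TupY_def Tup_def tp_Suc_upd mult.commute fun_eq_iff)

lemma pairs_n: "{(n, t). n > 0 \<and> t \<in> Tup k \<and> real (n * tp k t) \<le> Y} = (SIGMA n:{1..nat \<lfloor>Y\<rfloor>}. TupY k (Y / real n))"
proof -
 have "real n \<le> Y" if "t \<in> Tup k" "real (n * tp k t) \<le> Y" for n t
  using tp_ge_1[OF that(1)] that(2) mult_left_mono[of 1 "real (tp k t)" "real n"] by simp
 thus ?thesis using le_nat_floor_iff by (auto simp: TupY_def field_simps Suc_le_eq)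
qed

lemma pairs_t: "prod.swap ` {(n, t). n > 0 \<and> t \<in> Tup k \<and> real (n * tp k t) \<le> Y} = (SIGMA t:TupY k Y. {1..nat \<lfloor>Y / real (tp k t)\<rfloor>})"
proof -
 have "real (tp k t) \<le> Y" if "n > 0" "real (n * tp k t) \<le> Y" for n t
  using that mult_right_mono[of 1 "real n" "real (tp k t)"] by simp
 moreover have "n \<le> nat \<lfloor>Y / real (tp k t)\<rfloor> \<longleftrightarrow> real (n * tp k t) \<le> Y" if "n > 0" "t \<in> Tup k" for n t
  using le_nat_floor_iff[OF that(1)] tp_pos[OF that(2)] by (simp add: field_simps)
 ultimately show ?thesis by (force simp: TupY_def Suc_le_eq)
qed

lemma finite_TupY: "finite (TupY k Y)"
proof (induction k arbitrary: Y)
 case 0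
 have "TupY 0 Y \<subseteq> {\<lambda>_. 1}" by (auto simp: TupY_def Tup_def)
 thus ?case by (rule finite_subset) simp
next
 case (Suc k)
 thus ?case using bij_betw_finite[OF bij_Tup_Suc[of k Y]] unfolding pairs_n by simp
qed

lemma sum_TupY_Suc_n:
 "(\<Sum>t\<in>TupY (Suc k) Y. f t) = (\<Sum>n\<in>{1..nat \<lfloor>Y\<rfloor>}. \<Sum>t\<in>TupY k (Y / real n). f (t(k := n)))"
proof -
 have "(\<Sum>t\<in>TupY (Suc k) Y. f t) = (\<Sum>(n, t)\<in>(SIGMA n:{1..nat \<lfloor>Y\<rfloor>}. TupY k (Y / real n)). f (t(k := n)))"
  using sum.reindex_bij_betw[OF bij_Tup_Suc, of f k Y] unfolding pairs_n by (simp add: case_prod_unfold)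
 thus ?thesis by (simp add: sum.Sigma finite_TupY)
qed

lemma sum_TupY_Suc_t:
 "(\<Sum>t\<in>TupY (Suc k) Y. f t) = (\<Sum>t\<in>TupY k Y. \<Sum>n\<in>{1..nat \<lfloor>Y / real (tp k t)\<rfloor>}. f (t(k := n)))"
proof -
 have "(\<Sum>t\<in>TupY (Suc k) Y. f t) = (\<Sum>(n, t)\<in>{(n, t). n > 0 \<and> t \<in> Tup k \<and> real (n * tp k t) \<le> Y}. f (t(k := n)))"
  using sum.reindex_bij_betw[OF bij_Tup_Suc, of f k Y] by (simp add: case_prod_unfold)
 also have "\<dots> = (\<Sum>(t, n)\<in>prod.swap ` {(n, t). n > 0 \<and> t \<in> Tup k \<and> real (n * tp k t) \<le> Y}. f (t(k := n)))"
  by (subst sum.reindex) (auto simp: case_prod_unfold)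
 finally show ?thesis unfolding pairs_t by (simp add: sum.Sigma finite_TupY)
qed

subsection \<open>Logarithmic sums\<close>

lemma power_diff_bounds:
 fixes u v :: real
 assumes "0 \<le> v" "v \<le> u"
 shows "u ^ Suc m - v ^ Suc m \<le> real (Suc m) * (u ^ m * (u - v))" "real (Suc m) * (v ^ m * (u - v)) \<le> u ^ Suc m - v ^ Suc m"
proof -
 have e: "u ^ Suc m - v ^ Suc m = (u - v) * (\<Sum>i<Suc m. v ^ (Suc m - Suc i) * u ^ i)" by (rule power_diff_sumr2)
 have b: "v ^ m \<le> v ^ (Suc m - Suc i) * u ^ i \<and> v ^ (Suc m - Suc i) * u ^ i \<le> u ^ m" if "i < Suc m" for i
 proof -
  have "v ^ m = v ^ (m - i) * v ^ i" "u ^ m = u ^ (m - i) * u ^ i" using that by (simp_all add: power_add[symmetric])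
  thus ?thesis using assms by (auto intro!: mult_left_mono mult_right_mono power_mono)
 qed
 have "(\<Sum>i<Suc m. v ^ (Suc m - Suc i) * u ^ i) \<le> (\<Sum>i<Suc m. u ^ m)" using b by (intro sum_mono) auto
 hence "u ^ Suc m - v ^ Suc m \<le> (u - v) * (\<Sum>i<Suc m. u ^ m)" unfolding e using assms by (intro mult_left_mono) auto
 thus "u ^ Suc m - v ^ Suc m \<le> real (Suc m) * (u ^ m * (u - v))" by (simp only: sum_constant card_lessThan mult_ac)
 have "(\<Sum>i<Suc m. v ^ m) \<le> (\<Sum>i<Suc m. v ^ (Suc m - Suc i) * u ^ i)" using b by (intro sum_mono) auto
 hence "(u - v) * (\<Sum>i<Suc m. v ^ m) \<le> u ^ Suc m - v ^ Suc m" unfolding e using assms by (intro mult_left_mono) auto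
 thus "real (Suc m) * (v ^ m * (u - v)) \<le> u ^ Suc m - v ^ Suc m" by (simp only: sum_constant card_lessThan mult_ac)
qed

text \<open>A discrete form of integrating ln(Y/x)^m / x: the increments of ln(Y/n)^(m+1) are
  bounded termwise and telescoped.\<close>

lemma sum_log_power_lower:
 assumes "Y \<ge> 1"
 shows "ln Y ^ Suc m \<le> real (Suc m) * (\<Sum>n\<in>{1..nat \<lfloor>Y\<rfloor>}. (1 / real n) * ln (Y / real n) ^ m)"
proof -
 \<comment> \<open>Truncation at 0 makes the last term of the telescope, just beyond Y,
   vanish.\<close>
 define w where "w n = max 0 (ln (Y / real n))" for n :: nat
 have step: "w n ^ Suc m - w (Suc n) ^ Suc m \<le> real (Suc m) * ((1 / real n) * ln (Y / real n) ^ m)" if n: "1 \<le> n" "real n \<le> Y" for n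
 proof -
  have u: "w n = ln (Y / real n)" using n by (simp add: w_def)
  have "1 + 1 / real n = real (Suc n) / real n" using n by (simp add: field_simps)
  hence "ln (Y / real n) - ln (Y / real (Suc n)) = ln (1 + 1 / real n)" using n assms by (simp add: ln_div)
  also have "\<dots> \<le> 1 / real n" using n by (intro ln_add_one_self_le_self) simp
  finally have d: "w n - w (Suc n) \<le> 1 / real n" unfolding u by (simp add: w_def)
  have "ln (Y / real (Suc n)) \<le> ln (Y / real n)" using n assms by (intro ln_mono divide_left_mono) auto
  hence wle: "0 \<le> w (Suc n)" "w (Suc n) \<le> w n" by (auto simp: w_def)
  have "w n ^ m * (w n - w (Suc n)) \<le> w n ^ m * (1 / real n)" using d wle by (intro mult_left_mono) auto
  hence "real (Suc m) * (w n ^ m * (w n - w (Suc n))) \<le> real (Suc m) * ((1 / real n) * w n ^ m)"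
   by (intro mult_left_mono) (auto simp: mult.commute)
  thus ?thesis using power_diff_bounds(1)[OF wle, of m] unfolding u by linarith
 qed
 define K where "K = nat \<lfloor>Y\<rfloor>"
 have K: "1 \<le> K" "real K \<le> Y" "Y < real (Suc K)" using assms unfolding K_def by linarith+
 have "ln Y ^ Suc m = w 1 ^ Suc m - w (Suc K) ^ Suc m" using K assms by (auto simp: w_def max_def)
 also have "\<dots> = (\<Sum>n\<in>{1..K}. w n ^ Suc m - w (Suc n) ^ Suc m)"
  using sum_Suc_diff[of 1 K "\<lambda>n. - (w n ^ Suc m)"] K by simp
 also have "\<dots> \<le> (\<Sum>n\<in>{1..K}. real (Suc m) * ((1 / real n) * ln (Y / real n) ^ m))"
  using K by (intro sum_mono step) (auto intro: order.trans[of _ "real K"])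
 finally show ?thesis unfolding K_def sum_distrib_left .
qed

text \<open>Telescoping bounds the terms from n = 2 on; the term n = 1 is kept and accounts for the
  extra summand.\<close>

lemma sum_log_power_upper:
 assumes "Y \<ge> 1" "c \<ge> 0"
 shows "real (Suc m) * (\<Sum>n\<in>{1..nat \<lfloor>Y\<rfloor>}. (1 / real n) * (ln (Y / real n) + c) ^ m)
  \<le> real (Suc m) * (ln Y + c) ^ m + (ln Y + c) ^ Suc m"
proof -
 define w where "w n = ln (Y / real n) + c" for n :: nat
 have step: "real (Suc m) * ((1 / real (Suc n)) * w (Suc n) ^ m) \<le> w n ^ Suc m - w (Suc n) ^ Suc m" if n: "1 \<le> n" "real (Suc n) \<le> Y" for n
 proof -
  have "ln (1 + - (1 / real (Suc n))) \<le> - (1 / real (Suc n))" using n by (intro ln_add_one_self_le_self2) simp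
  moreover have "ln (Y / real n) - ln (Y / real (Suc n)) = - ln (1 + - (1 / real (Suc n)))"
  proof -
   have "1 + - (1 / real (Suc n)) = real n / real (Suc n)" by (simp add: field_simps)
   thus ?thesis using n assms by (simp add: ln_div)
  qed
  ultimately have d: "1 / real (Suc n) \<le> w n - w (Suc n)" by (simp add: w_def)
  have "0 \<le> 1 / real (Suc n)" by simp
  hence wle: "0 \<le> w (Suc n)" "w (Suc n) \<le> w n" using n assms order.trans[OF _ d, of 0] by (auto simp: w_def simp del: of_nat_Suc)
  have "w (Suc n) ^ m * (1 / real (Suc n)) \<le> w (Suc n) ^ m * (w n - w (Suc n))" using d wle by (intro mult_left_mono) auto
  hence "real (Suc m) * ((1 / real (Suc n)) * w (Suc n) ^ m) \<le> real (Suc m) * (w (Suc n) ^ m * (w n - w (Suc n)))"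
   by (intro mult_left_mono) (auto simp: mult.commute)
  thus ?thesis using power_diff_bounds(2)[OF wle, of m] by linarith
 qed
 define K where "K = nat \<lfloor>Y\<rfloor>"
 have K: "1 \<le> K" "real K \<le> Y" using assms unfolding K_def by linarith+
 have "(\<Sum>n\<in>{1..K}. real (Suc m) * ((1 / real n) * w n ^ m)) \<le> real (Suc m) * w 1 ^ m + (w 1 ^ Suc m - w K ^ Suc m)"
  using K
 proof (induction K rule: nat_induct_at_least)
  case (Suc n)
  have "(\<Sum>n\<in>{1..Suc n}. real (Suc m) * ((1 / real n) * w n ^ m))
    = (\<Sum>n\<in>{1..n}. real (Suc m) * ((1 / real n) * w n ^ m)) + real (Suc m) * ((1 / real (Suc n)) * w (Suc n) ^ m)"
   using Suc.hyps by simp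
  thus ?case using Suc step[of n] by fastforce
 qed simp
 moreover have "w K \<ge> 0" using K assms by (simp add: w_def)
 hence "w K ^ Suc m \<ge> 0" by simp
 ultimately show ?thesis unfolding K_def sum_distrib_left w_def by simp
qed

definition gsum :: "nat \<Rightarrow> real \<Rightarrow> real" where "gsum m Y = (\<Sum>t\<in>TupY m Y. 1 / real (tp m t))"

lemma gsum_Suc: "gsum (Suc m) Y = (\<Sum>n\<in>{1..nat \<lfloor>Y\<rfloor>}. (1 / real n) * gsum m (Y / real n))"
 unfolding gsum_def sum_TupY_Suc_n tp_Suc_upd sum_distrib_left by (simp add: mult.commute)

text \<open>The shift by m in the upper bound is made for the induction: the boundary term of
  \<open>sum_log_power_upper\<close> is absorbed by (m+1) c^m + c^(m+1) \<le> (c+1)^(m+1).\<close>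

lemma gsum_bounds:
 assumes "Y \<ge> 1"
 shows "ln Y ^ m / fact m \<le> gsum m Y \<and> gsum m Y \<le> (ln Y + real m) ^ m / fact m"
 using assms
proof (induction m arbitrary: Y)
 case 0
 have "TupY 0 Y = {\<lambda>_. 1}" using 0 by (auto simp: TupY_def Tup_def tp_def)
 thus ?case by (simp add: gsum_def tp_def)
next
 case (Suc m)
 have n: "n > 0" "Y / real n \<ge> 1" if "n \<in> {1..nat \<lfloor>Y\<rfloor>}" for n
  using that le_nat_floor_iff[of n Y] by auto
 have lo: "ln Y ^ Suc m / fact (Suc m) \<le> gsum (Suc m) Y"
 proof -
  have "ln Y ^ Suc m / fact (Suc m) \<le> real (Suc m) * (\<Sum>n\<in>{1..nat \<lfloor>Y\<rfloor>}. (1 / real n) * ln (Y / real n) ^ m) / fact (Suc m)"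
   using sum_log_power_lower[OF Suc.prems] by (intro divide_right_mono) auto
  also have "\<dots> = (\<Sum>n\<in>{1..nat \<lfloor>Y\<rfloor>}. (1 / real n) * (ln (Y / real n) ^ m / fact m))"
   by (simp add: sum_divide_distrib del: of_nat_Suc)
  also have "\<dots> \<le> gsum (Suc m) Y" unfolding gsum_Suc using Suc.IH n by (intro sum_mono mult_left_mono) auto
  finally show ?thesis .
 qed
 define c where "c = ln Y + real m"
 have c: "c \<ge> 0" using Suc.prems by (simp add: c_def)
 have "gsum (Suc m) Y \<le> (\<Sum>n\<in>{1..nat \<lfloor>Y\<rfloor>}. (1 / real n) * ((ln (Y / real n) + real m) ^ m / fact m))"
  unfolding gsum_Suc using Suc.IH n by (intro sum_mono mult_left_mono) auto
 also have "\<dots> = real (Suc m) * (\<Sum>n\<in>{1..nat \<lfloor>Y\<rfloor>}. (1 / real n) * (ln (Y / real n) + real m) ^ m) / fact (Suc m)"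
  by (simp add: sum_divide_distrib del: of_nat_Suc)
 also have "\<dots> \<le> (real (Suc m) * c ^ m + c ^ Suc m) / fact (Suc m)"
  using sum_log_power_upper[OF Suc.prems, of "real m" m] unfolding c_def by (intro divide_right_mono) auto
 also have "\<dots> \<le> (c + 1) ^ Suc m / fact (Suc m)"
 proof (rule divide_right_mono)
  show "real (Suc m) * c ^ m + c ^ Suc m \<le> (c + 1) ^ Suc m"
   using power_diff_bounds(2)[of c "c + 1" m] c by simp
 qed simp
 also have "c + 1 = ln Y + real (Suc m)" by (simp add: c_def)
 finally show ?case using lo by blast
qed

lemma card_TupY_Suc:
 assumes "Y \<ge> 1"
 shows "real (card (TupY (Suc m) Y)) \<le> Y * ((ln Y + real m) ^ m / fact m)"
proof -
 have "real (card (TupY (Suc m) Y)) = (\<Sum>t\<in>TupY m Y. \<Sum>n\<in>{1..nat \<lfloor>Y / real (tp m t)\<rfloor>}. 1)"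
  using sum_TupY_Suc_t[of "\<lambda>_. 1 :: real" m Y] by simp
 also have "\<dots> \<le> (\<Sum>t\<in>TupY m Y. Y * (1 / real (tp m t)))"
  using assms by (intro sum_mono) simp
 also have "\<dots> = Y * gsum m Y" unfolding gsum_def by (rule sum_distrib_left[symmetric])
 also have "\<dots> \<le> Y * ((ln Y + real m) ^ m / fact m)" using gsum_bounds[OF assms, of m] assms by (intro mult_left_mono) auto
 finally show ?thesis .
qed

lemma TupY_empty: "Y < 1 \<Longrightarrow> TupY k Y = {}" unfolding TupY_def using tp_ge_1 by fastforce

subsection \<open>Sieving tuples\<close>

definition asy :: "nat \<Rightarrow> (real \<Rightarrow> real) \<Rightarrow> real \<Rightarrow> bool"
 where "asy m F c \<longleftrightarrow> ((\<lambda>Y. F Y / (Y * ln Y ^ m)) \<longlongrightarrow> c) at_top"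

lemma asy_add: "asy m F a \<Longrightarrow> asy m G b \<Longrightarrow> asy m (\<lambda>Y. F Y + G Y) (a + b)"
 unfolding asy_def add_divide_distrib by (rule tendsto_add)

lemma asy_diff: "asy m F a \<Longrightarrow> asy m G b \<Longrightarrow> asy m (\<lambda>Y. F Y - G Y) (a - b)"
 unfolding asy_def diff_divide_distrib by (rule tendsto_diff)

lemma asy_sum: "(\<And>i. i \<in> I \<Longrightarrow> asy m (F i) (a i)) \<Longrightarrow> asy m (\<lambda>Y. \<Sum>i\<in>I. F i Y) (\<Sum>i\<in>I. a i)"
 unfolding asy_def sum_divide_distrib by (rule tendsto_sum)

lemma asy_cmult: "asy m F a \<Longrightarrow> asy m (\<lambda>Y. b * F Y) (b * a)"
 unfolding asy_def times_divide_eq_right[symmetric] by (rule tendsto_mult_left)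

text \<open>The logarithms of Y/p and Y have ratio tending to 1, so only the factor 1/p
  remains.\<close>

lemma asy_scale:
 assumes "asy m F c" and p: "p > 0"
 shows "asy m (\<lambda>Y. F (Y / p)) (c / p)"
proof -
 have "filterlim (\<lambda>Y. Y / p) at_top at_top" using p by real_asymp
 hence "((\<lambda>Y. F (Y / p) / (Y / p * ln (Y / p) ^ m)) \<longlongrightarrow> c) at_top"
  using assms(1) unfolding asy_def by (rule filterlim_compose[rotated])
 moreover have "((\<lambda>Y. (ln (Y / p) / ln Y) ^ m / p) \<longlongrightarrow> 1 ^ m / p) at_top"
 proof (intro tendsto_divide tendsto_power tendsto_const)
  show "((\<lambda>Y. ln (Y / p) / ln Y) \<longlongrightarrow> 1) at_top" using p by real_asymp
 qed (use p in simp)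
 ultimately have "((\<lambda>Y. F (Y / p) / (Y / p * ln (Y / p) ^ m) * ((ln (Y / p) / ln Y) ^ m / p)) \<longlongrightarrow> c * (1 ^ m / p)) at_top"
  by (rule tendsto_mult)
 moreover have "\<forall>\<^sub>F Y in at_top. F (Y / p) / (Y / p * ln (Y / p) ^ m) * ((ln (Y / p) / ln Y) ^ m / p) = F (Y / p) / (Y * ln Y ^ m)"
  using eventually_gt_at_top[of "max 1 p"]
 proof eventually_elim
  case (elim Y)
  have "ln (Y / p) > 0" using elim p by (intro ln_gt_zero) (simp add: field_simps)
  thus ?case using elim p by (simp add: power_divide field_simps)
 qed
 ultimately show ?thesis unfolding asy_def by (simp cong: filterlim_cong add: tendsto_cong)
qed

lemma asy_close:
 assumes "asy m F c" and "\<And>Y. Y \<ge> 1 \<Longrightarrow> \<bar>G Y - F Y\<bar> \<le> H Y" and "asy m H 0"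
 shows "asy m G c"
proof -
 have "((\<lambda>Y. (G Y - F Y) / (Y * ln Y ^ m)) \<longlongrightarrow> 0) at_top"
 proof (rule Lim_null_comparison)
  show "\<forall>\<^sub>F Y in at_top. norm ((G Y - F Y) / (Y * ln Y ^ m)) \<le> H Y / (Y * ln Y ^ m)"
   using eventually_ge_at_top[of 1]
  proof eventually_elim
   case (elim Y)
   show ?case using elim assms(2)[OF elim] by (simp add: abs_mult divide_right_mono)
  qed
 qed (use assms(3) in \<open>simp add: asy_def\<close>)
 hence "asy m (\<lambda>Y. F Y + (G Y - F Y)) (c + 0)" using assms(1) by (intro asy_add) (simp_all add: asy_def)
 thus ?thesis by simp
qed

lemma log_shift_limit: "((\<lambda>Y. (ln Y + c) ^ m / ln Y ^ m) \<longlongrightarrow> 1) at_top" for c :: real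
proof -
 have "((\<lambda>Y :: real. (ln Y + c) / ln Y) \<longlongrightarrow> 1) at_top" by real_asymp
 hence "((\<lambda>Y. ((ln Y + c) / ln Y) ^ m) \<longlongrightarrow> 1 ^ m) at_top" by (rule tendsto_power)
 thus ?thesis by (simp add: power_divide)
qed

lemma asy_gsum: "asy m (\<lambda>Y. Y * gsum m Y) (1 / fact m)"
 unfolding asy_def
proof (rule tendsto_sandwich)
 show "\<forall>\<^sub>F Y in at_top. 1 / fact m \<le> Y * gsum m Y / (Y * ln Y ^ m)"
  using eventually_gt_at_top[of 1]
  by eventually_elim (use gsum_bounds[of _ m] in \<open>auto simp: field_simps\<close>)
 show "\<forall>\<^sub>F Y in at_top. Y * gsum m Y / (Y * ln Y ^ m) \<le> (ln Y + real m) ^ m / ln Y ^ m / fact m"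
  using eventually_gt_at_top[of 1]
  by eventually_elim (use gsum_bounds[of _ m] in \<open>auto simp: field_simps\<close>)
 show "((\<lambda>Y. (ln Y + real m) ^ m / ln Y ^ m / fact m) \<longlongrightarrow> 1 / fact m) at_top"
  by (intro tendsto_divide log_shift_limit tendsto_const) simp
qed simp

definition upd :: "nat \<Rightarrow> nat \<Rightarrow> (nat \<Rightarrow> nat) \<Rightarrow> nat \<Rightarrow> nat" where "upd i p s = s(i := p * s i)"

lemma tp_upd: "i < k \<Longrightarrow> tp k (upd i p s) = p * tp k s"
 unfolding tp_def upd_def by (simp add: prod.remove[of "{..<k}" i] if_distrib cong: if_cong)

lemma inj_upd: assumes "p > 0" shows "inj (upd i p)"
proof (rule injI)
 fix s t assume "upd i p s = upd i p t"
 hence "\<And>j. (s(i := p * s i)) j = (t(i := p * t i)) j" unfolding upd_def by simp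
 hence "s j = t j" for j using assms by (metis fun_upd_apply mult_left_cancel nat_neq_iff)
 thus "s = t" by (rule ext)
qed

lemma upd_Tup: "i < k \<Longrightarrow> p > 0 \<Longrightarrow> upd i p s \<in> Tup k \<longleftrightarrow> s \<in> Tup k"
 unfolding Tup_def upd_def by (auto split: if_splits)

lemma upd_div:
 assumes "p dvd t i" shows "upd i p (t(i := t i div p)) = t"
 using assms by (simp add: upd_def)

lemma bij_upd:
 assumes "i < k" "p > 0"
 shows "bij_betw (upd i p) {s \<in> U. real (tp k s) \<le> Y / real p} {t \<in> upd i p ` U. real (tp k t) \<le> Y}"
 unfolding bij_betw_def using inj_upd[OF assms(2), of i] assms
 by (auto simp: tp_upd field_simps intro: inj_on_subset)

lemma dvd_tp_iff: "prime p \<Longrightarrow> p dvd tp k t \<longleftrightarrow> (\<exists>j<k. p dvd t j)"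
 unfolding tp_def by (subst prime_dvd_prod_iff) auto

lemma card_cong_class:
 assumes M: "M > 0"
 shows "\<bar>real (card {n \<in> {1..K}. [n = r] (mod M)}) - real K / real M\<bar> \<le> 1"
proof -
 \<comment> \<open>The representative is taken in 1, ..., M because the counted numbers start at
   1.\<close>
 define r0 where "r0 = (if r mod M = 0 then M else r mod M)"
 have r0: "1 \<le> r0" "r0 \<le> M" "[r0 = r] (mod M)" using M by (auto simp: r0_def Cong.cong_def)
 define c where "c = (K + M - r0) div M"
 have bnd: "q < c \<longleftrightarrow> r0 + q * M \<le> K" for q
 proof -
  have "q < c \<longleftrightarrow> Suc q * M \<le> K + M - r0" unfolding c_def using M by (simp add: less_eq_div_iff_mult_less_eq Suc_le_eq[symmetric])
  thus ?thesis using r0 by auto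
 qed
 have "{n \<in> {1..K}. [n = r] (mod M)} = (\<lambda>q. r0 + q * M) ` {..<c}"
 proof (intro subset_antisym subsetI)
  fix n assume n: "n \<in> {n \<in> {1..K}. [n = r] (mod M)}"
  hence c: "[n = r0] (mod M)" using r0(3) cong_trans cong_sym by blast
  have "n \<ge> r0"
  proof (rule ccontr)
   assume "\<not> r0 \<le> n"
   hence "n < M" "n < r0" using r0 by auto
   thus False using c n r0 by (cases "r0 = M") (auto simp: Cong.cong_def)
  qed
  hence "M dvd n - r0" using c by (simp add: cong_altdef_nat)
  then obtain q where "n = r0 + q * M" using \<open>n \<ge> r0\<close> by (metis dvd_div_mult_self le_add_diff_inverse)
  thus "n \<in> (\<lambda>q. r0 + q * M) ` {..<c}" using n bnd by auto
 next
  fix n assume "n \<in> (\<lambda>q. r0 + q * M) ` {..<c}"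
  then obtain q where q: "n = r0 + q * M" "q < c" by auto
  have "[r0 + q * M = r0] (mod M)" by (simp add: Cong.cong_def)
  thus "n \<in> {n \<in> {1..K}. [n = r] (mod M)}" using q bnd r0 cong_trans by auto
 qed
 moreover have "inj_on (\<lambda>q. r0 + q * M) {..<c}" using M by (auto intro: inj_onI)
 ultimately have card: "card {n \<in> {1..K}. [n = r] (mod M)} = c" by (simp add: card_image)
 have "c * M \<le> K + M - r0" "K + M - r0 < Suc c * M"
  unfolding c_def using M dividend_less_div_times[of M "K + M - r0"] by (simp_all add: algebra_simps)
 hence "c * M \<le> K + M" "K < Suc c * M" using r0 by auto
 hence "real (c * M) \<le> real (K + M)" "real K < real (Suc c * M)" by (simp_all only: of_nat_le_iff of_nat_less_iff)
 hence "real c \<le> real K / real M + 1" "real K / real M < real c + 1" using M by (simp_all add: field_simps)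
 thus ?thesis unfolding card by linarith
qed

locale tuple_sieve =
 fixes l m :: nat
 assumes prime_l: "prime l" and m_pos: "m > 0"
begin

text \<open>The exponents decrease to 1, so the last entry, the one split off by
  \<open>sum_TupY_Suc_t\<close>, enters linearly and can be solved for modulo l^2.\<close>

definition phi :: "(nat \<Rightarrow> nat) \<Rightarrow> nat" where "phi t = (\<Prod>j<Suc m. t j ^ (Suc m - j))"

definition cnt :: "(nat \<Rightarrow> nat) set \<Rightarrow> nat \<Rightarrow> real \<Rightarrow> real"
 where "cnt U r Y = real (card {t \<in> U. real (tp (Suc m) t) \<le> Y \<and> [phi t = r] (mod l\<^sup>2)})"

definition cop :: "(nat \<Rightarrow> nat) set" where "cop = {t \<in> Tup (Suc m). \<forall>j<Suc m. \<not> l dvd t j}"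

definition hsum :: "nat \<Rightarrow> real \<Rightarrow> real"
 where "hsum i Y = (\<Sum>t\<in>{t \<in> TupY m Y. \<forall>j<i. \<not> l dvd t j}. 1 / real (tp m t))"

lemma l_gt_1: "l > 1" using prime_l by (rule prime_gt_1_nat)

text \<open>The tuples with entry i divisible by l are the images under \<open>upd i l\<close> of
  the tuples subject to the same conditions on the earlier entries.\<close>

lemma hsum_Suc:
 assumes "i < m"
 shows "hsum (Suc i) Y = hsum i Y - 1 / real l * hsum i (Y / real l)"
proof -
 define U where "U = {t \<in> Tup m. \<forall>j<i. \<not> l dvd t j}"
 have U: "{t \<in> TupY m Y. \<forall>j<i. \<not> l dvd t j} = {t \<in> U. real (tp m t) \<le> Y}" for Y unfolding U_def TupY_def by auto
 have split: "{t \<in> U. real (tp m t) \<le> Y} = {t \<in> TupY m Y. \<forall>j<Suc i. \<not> l dvd t j} \<union> {t \<in> upd i l ` U. real (tp m t) \<le> Y}"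
 proof (intro subset_antisym subsetI)
  fix t assume t: "t \<in> {t \<in> U. real (tp m t) \<le> Y}"
  show "t \<in> {t \<in> TupY m Y. \<forall>j<Suc i. \<not> l dvd t j} \<union> {t \<in> upd i l ` U. real (tp m t) \<le> Y}"
  proof (cases "l dvd t i")
   case True
   have u: "upd i l (t(i := t i div l)) = t" by (rule upd_div) fact
   hence "t(i := t i div l) \<in> Tup m" using t upd_Tup[OF assms, of l "t(i := t i div l)"] l_gt_1 by (simp add: U_def)
   hence "t(i := t i div l) \<in> U" using t by (auto simp: U_def)
   thus ?thesis using u t by (metis (mono_tags, lifting) UnI2 image_eqI mem_Collect_eq)
  qed (use t in \<open>auto simp: U_def TupY_def less_Suc_eq\<close>)
 next
  fix t assume "t \<in> {t \<in> TupY m Y. \<forall>j<Suc i. \<not> l dvd t j} \<union> {t \<in> upd i l ` U. real (tp m t) \<le> Y}"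
  moreover have "upd i l s \<in> U" if "s \<in> U" for s using that upd_Tup[OF assms] l_gt_1 by (auto simp: U_def) (auto simp: upd_def)
  ultimately show "t \<in> {t \<in> U. real (tp m t) \<le> Y}" by (auto simp: U_def TupY_def)
 qed
 have fin: "finite {t \<in> U. real (tp m t) \<le> Y}" for Y unfolding U[symmetric] using finite_TupY by simp
 have "hsum i Y = hsum (Suc i) Y + (\<Sum>t\<in>{t \<in> upd i l ` U. real (tp m t) \<le> Y}. 1 / real (tp m t))"
  unfolding hsum_def U split
 proof (rule sum.union_disjoint)
  show "{t \<in> TupY m Y. \<forall>j<Suc i. \<not> l dvd t j} \<inter> {t \<in> upd i l ` U. real (tp m t) \<le> Y} = {}" by (auto simp: upd_def)
 qed (use fin[of Y] split in auto)
 also have "(\<Sum>t\<in>{t \<in> upd i l ` U. real (tp m t) \<le> Y}. 1 / real (tp m t)) = (\<Sum>s\<in>{s \<in> U. real (tp m s) \<le> Y / real l}. 1 / real (tp m (upd i l s)))"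
  using bij_upd[OF assms, of l U Y] l_gt_1 by (intro sum.reindex_bij_betw[symmetric]) auto
 also have "\<dots> = 1 / real l * hsum i (Y / real l)" unfolding hsum_def U sum_distrib_left using assms by (simp add: tp_upd)
 finally show ?thesis by simp
qed

lemma asy_hsum: "i \<le> m \<Longrightarrow> asy m (\<lambda>Y. Y * hsum i Y) ((1 - 1 / real l) ^ i / fact m)"
proof (induction i)
 case 0
 have "hsum 0 = gsum m" by (rule ext) (simp add: hsum_def gsum_def)
 thus ?case using asy_gsum by simp
next
 case (Suc i)
 define F where "F Y = Y * hsum i Y" for Y
 have "asy m (\<lambda>Y. F Y - F (Y / real l)) ((1 - 1 / real l) ^ i / fact m - (1 - 1 / real l) ^ i / fact m / real l)"
  using Suc l_gt_1 unfolding F_def[abs_def] by (intro asy_diff asy_scale) auto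
 moreover have "F Y - F (Y / real l) = Y * hsum (Suc i) Y" for Y
  using Suc.prems by (simp add: F_def hsum_Suc algebra_simps)
 moreover have "(1 - 1 / real l) ^ i / fact m - (1 - 1 / real l) ^ i / fact m / real l = (1 - 1 / real l) ^ Suc i / fact m"
  using l_gt_1 by (simp add: field_simps)
 ultimately show ?case by simp
qed

lemma inverse_mod_l2: assumes "\<not> l dvd a" obtains b where "[a * b = 1] (mod l\<^sup>2)"
proof -
 have "coprime a (l ^ 2)" using assms prime_l by (metis coprime_commute coprime_power_left_iff prime_imp_coprime)
 then obtain b where "[a * b = Suc 0] (mod l\<^sup>2)" using cong_solve_coprime_nat by blast
 thus ?thesis using that by simp
qed

lemma cong_unit_iff: assumes "[w * v = 1] (mod M)" shows "[w * n = r] (mod M) \<longleftrightarrow> [n = r * v] (mod (M :: nat))"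
proof -
 have wv: "[w * v * x = x] (mod M)" for x using cong_scalar_right[OF assms, of x] by simp
 show ?thesis
 proof
  assume "[w * n = r] (mod M)"
  hence "[w * n * v = r * v] (mod M)" by (rule cong_scalar_right)
  thus "[n = r * v] (mod M)" using wv[of n] by (metis cong_sym cong_trans mult.assoc mult.commute)
 next
  assume "[n = r * v] (mod M)"
  hence "[w * n = w * (r * v)] (mod M)" by (rule cong_scalar_left)
  thus "[w * n = r] (mod M)" using wv[of r] by (metis cong_trans mult.assoc mult.commute)
 qed
qed

text \<open>Once the first m entries are fixed and prime to l, the last one is confined to one unit
  class modulo l^2; it is then prime to l by itself and has density 1/l^2. The error is at most 2
  per choice, and there are only O(Y (ln Y)^(m-1)) choices.\<close>

lemma asy_cop:
 assumes r: "\<not> l dvd r"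
 shows "asy m (cnt cop r) ((1 - 1 / real l) ^ m / fact m / real (l\<^sup>2))"
proof (rule asy_close)
 show "asy m (\<lambda>Y. 1 / real (l\<^sup>2) * (Y * hsum m Y)) ((1 - 1 / real l) ^ m / fact m / real (l\<^sup>2))"
  using asy_cmult[OF asy_hsum[of m], of "1 / real (l\<^sup>2)"] by (simp add: mult.commute)
 show "asy m (\<lambda>Y. 2 * real (card (TupY m Y))) 0"
 proof -
  obtain m' where m': "m = Suc m'" using m_pos by (cases m) auto
  have "((\<lambda>Y. (ln Y + real m') ^ m' / ln Y ^ m' * (2 / fact m' * (1 / ln Y))) \<longlongrightarrow> 1 * (2 / fact m' * 0)) at_top"
   by (intro tendsto_mult log_shift_limit tendsto_const) real_asymp
  hence *: "((\<lambda>Y. (ln Y + real m') ^ m' / ln Y ^ m' * (2 / fact m' * (1 / ln Y))) \<longlongrightarrow> 0) at_top" by simp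
  show ?thesis unfolding asy_def
  proof (rule tendsto_sandwich[OF _ _ tendsto_const *])
   show "\<forall>\<^sub>F Y in at_top. 0 \<le> 2 * real (card (TupY m Y)) / (Y * ln Y ^ m)"
    using eventually_gt_at_top[of 1] by eventually_elim simp
   show "\<forall>\<^sub>F Y in at_top. 2 * real (card (TupY m Y)) / (Y * ln Y ^ m) \<le> (ln Y + real m') ^ m' / ln Y ^ m' * (2 / fact m' * (1 / ln Y))"
    using eventually_gt_at_top[of 1]
   proof eventually_elim
    case (elim Y)
    have "2 * real (card (TupY m Y)) / (Y * ln Y ^ m) \<le> 2 * (Y * ((ln Y + real m') ^ m' / fact m')) / (Y * ln Y ^ m)"
     using card_TupY_Suc[of Y m'] elim unfolding m' by (intro divide_right_mono mult_left_mono) auto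
    also have "\<dots> = (ln Y + real m') ^ m' / ln Y ^ m' * (2 / fact m' * (1 / ln Y))" using elim by (simp add: m' mult_ac)
    finally show ?case .
   qed
  qed
 qed
 fix Y :: real assume Y: "Y \<ge> 1"
 define P where "P t \<longleftrightarrow> (\<forall>j<Suc m. \<not> l dvd t j) \<and> [phi t = r] (mod l\<^sup>2)" for t
 define w where "w s = (\<Prod>j<m. s j ^ (Suc m - j))" for s :: "nat \<Rightarrow> nat"
 have ph: "phi (s(m := n)) = w s * n" for s n by (simp add: phi_def w_def lessThan_Suc mult.commute)
 define c where "c s = (\<Sum>n\<in>{1..nat \<lfloor>Y / real (tp m s)\<rfloor>}. if P (s(m := n)) then 1 else 0 :: real)" for s
 define e where "e s = (if \<forall>j<m. \<not> l dvd s j then Y / (real (l\<^sup>2) * real (tp m s)) else 0)" for s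
 have "cnt cop r Y = (\<Sum>t\<in>TupY (Suc m) Y. if P t then 1 else 0)"
 proof -
  have "{t \<in> cop. real (tp (Suc m) t) \<le> Y \<and> [phi t = r] (mod l\<^sup>2)} = {t \<in> TupY (Suc m) Y. P t}"
   unfolding cop_def P_def TupY_def by auto
  thus ?thesis unfolding cnt_def by (simp add: sum.If_cases finite_TupY Int_def conj_commute)
 qed
 hence cnt: "cnt cop r Y = (\<Sum>s\<in>TupY m Y. c s)" unfolding sum_TupY_Suc_t c_def .
 have "1 / real (l\<^sup>2) * (Y * hsum m Y) = (\<Sum>s\<in>TupY m Y. e s)"
  unfolding hsum_def e_def sum_distrib_left
  by (rule sum.mono_neutral_cong_left) (auto simp: finite_TupY)
 hence "\<bar>cnt cop r Y - 1 / real (l\<^sup>2) * (Y * hsum m Y)\<bar> = \<bar>\<Sum>s\<in>TupY m Y. c s - e s\<bar>" by (simp only: cnt sum_subtractf)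
 also have "\<dots> \<le> (\<Sum>s\<in>TupY m Y. \<bar>c s - e s\<bar>)" by (rule sum_abs)
 also have "\<dots> \<le> (\<Sum>s\<in>TupY m Y. 2)"
 proof (rule sum_mono)
  fix s assume s: "s \<in> TupY m Y"
  show "\<bar>c s - e s\<bar> \<le> 2"
  proof (cases "\<forall>j<m. \<not> l dvd s j")
   case False
   hence "\<not> P (s(m := n))" for n unfolding P_def by (metis fun_upd_apply less_Suc_eq nat_neq_iff)
   hence "c s = 0" unfolding c_def by simp
   thus ?thesis using False unfolding e_def by auto
  next
   case True
   have "\<not> l dvd w s"
   proof
    assume "l dvd w s"
    then obtain j where "j < m" "l dvd s j ^ (Suc m - j)" unfolding w_def using prime_l by (auto simp: prime_dvd_prod_iff)
    thus False using True prime_dvd_power[OF prime_l] by blast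
   qed
   then obtain v where v: "[w s * v = 1] (mod l\<^sup>2)" by (rule inverse_mod_l2)
   have P: "P (s(m := n)) \<longleftrightarrow> [n = r * v] (mod l\<^sup>2)" for n
   proof -
    have "\<not> l dvd n" if "[w s * n = r] (mod l\<^sup>2)"
    proof
     assume "l dvd n"
     hence "l dvd w s * n" by simp
     moreover have "[w s * n = r] (mod l)" using that by (rule cong_dvd_modulus_nat) simp
     ultimately show False using r cong_dvd_iff by blast
    qed
    thus ?thesis unfolding P_def ph cong_unit_iff[OF v, symmetric] using True by (auto simp: less_Suc_eq)
   qed
   define K where "K = nat \<lfloor>Y / real (tp m s)\<rfloor>"
   have tp: "real (tp m s) \<ge> 1" using s tp_ge_1 by (auto simp: TupY_def)
   have x0: "Y / real (tp m s) \<ge> 0" using Y by simp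
   have l2: "real (l\<^sup>2) \<ge> 1" using l_gt_1 by simp
   have "c s = real (card {n \<in> {1..K}. [n = r * v] (mod l\<^sup>2)})"
    unfolding c_def P K_def by (simp add: sum.If_cases Int_def)
   hence 1: "\<bar>c s - real K / real (l\<^sup>2)\<bar> \<le> 1" using card_cong_class[of "l\<^sup>2"] l_gt_1 by simp
   have e: "e s = Y / real (tp m s) / real (l\<^sup>2)" using True by (simp add: e_def mult.commute)
   have k: "real K \<le> Y / real (tp m s)" "Y / real (tp m s) \<le> real K + 1" using x0 unfolding K_def by linarith+
   have "real K / real (l\<^sup>2) \<le> e s" unfolding e by (rule divide_right_mono[OF k(1)]) simp
   moreover have "e s \<le> (real K + 1) / real (l\<^sup>2)" unfolding e by (rule divide_right_mono[OF k(2)]) simp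
   hence "e s \<le> real K / real (l\<^sup>2) + 1" using l2 by (simp add: add_divide_distrib) (smt (verit) divide_le_eq_1)
   ultimately show ?thesis using 1 by linarith
  qed
 qed
 finally show "\<bar>cnt cop r Y - 1 / real (l\<^sup>2) * (Y * hsum m Y)\<bar> \<le> 2 * real (card (TupY m Y))" by simp
qed

end

context tuple_sieve
begin

lemma phi_upd: assumes "i < Suc m" shows "phi (upd i p s) = p ^ (Suc m - i) * phi s"
proof -
 have "phi (upd i p s) = (\<Prod>j<Suc m. (if j = i then p ^ (Suc m - i) else 1) * s j ^ (Suc m - j))"
  unfolding phi_def upd_def by (intro prod.cong[OF refl]) (simp add: power_mult_distrib)
 also have "\<dots> = (\<Prod>j<Suc m. if j = i then p ^ (Suc m - i) else 1) * phi s" unfolding phi_def by (rule prod.distrib)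
 also have "(\<Prod>j<Suc m. if j = i then p ^ (Suc m - i) else 1) = p ^ (Suc m - i)"
  using assms prod.delta'[of "{..<Suc m}" i "\<lambda>_. p ^ (Suc m - i)"] by (simp add: eq_commute)
 finally show ?thesis .
qed

text \<open>Multiplying entry i by p multiplies \<open>phi\<close> by p^(Suc m - i); its inverse v
  moves the residue class back.\<close>

lemma cnt_upd:
 assumes i: "i < Suc m" and p: "p > 0" "[p ^ (Suc m - i) * v = 1] (mod l\<^sup>2)"
 shows "cnt (upd i p ` U) r Y = cnt U (r * v) (Y / real p)"
proof -
 have "bij_betw (upd i p) {s \<in> U. real (tp (Suc m) s) \<le> Y / real p \<and> [phi s = r * v] (mod l\<^sup>2)}
   {t \<in> upd i p ` U. real (tp (Suc m) t) \<le> Y \<and> [phi t = r] (mod l\<^sup>2)}"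
  unfolding bij_betw_def
 proof
  show "inj_on (upd i p) {s \<in> U. real (tp (Suc m) s) \<le> Y / real p \<and> [phi s = r * v] (mod l\<^sup>2)}"
   using inj_upd[OF p(1)] by (rule inj_on_subset) simp
  show "upd i p ` {s \<in> U. real (tp (Suc m) s) \<le> Y / real p \<and> [phi s = r * v] (mod l\<^sup>2)}
   = {t \<in> upd i p ` U. real (tp (Suc m) t) \<le> Y \<and> [phi t = r] (mod l\<^sup>2)}"
  proof -
   have "real (p * tp (Suc m) s) \<le> Y \<longleftrightarrow> real (tp (Suc m) s) \<le> Y / real p" for s
    using p(1) by (simp add: pos_le_divide_eq mult.commute)
   thus ?thesis by (auto simp: tp_upd[OF i] phi_upd[OF i] cong_unit_iff[OF p(2)] simp del: of_nat_mult)
  qed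
 qed
 thus ?thesis unfolding cnt_def by (simp add: bij_betw_same_card)
qed

lemma finite_cnt: "U \<subseteq> Tup (Suc m) \<Longrightarrow> finite {t \<in> U. real (tp (Suc m) t) \<le> Y \<and> [phi t = r] (mod l\<^sup>2)}"
 by (rule finite_subset[OF _ finite_TupY[of "Suc m" Y]]) (auto simp: TupY_def)

lemma cnt_union:
 assumes "A \<subseteq> Tup (Suc m)" "B \<subseteq> Tup (Suc m)" "A \<inter> B = {}"
 shows "cnt (A \<union> B) r Y = cnt A r Y + cnt B r Y"
proof -
 have "{t \<in> A \<union> B. real (tp (Suc m) t) \<le> Y \<and> [phi t = r] (mod l\<^sup>2)}
  = {t \<in> A. real (tp (Suc m) t) \<le> Y \<and> [phi t = r] (mod l\<^sup>2)} \<union> {t \<in> B. real (tp (Suc m) t) \<le> Y \<and> [phi t = r] (mod l\<^sup>2)}" by auto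
 thus ?thesis unfolding cnt_def using assms by (simp, subst card_Un_disjoint) (auto simp: finite_cnt)
qed

lemma cnt_UN:
 assumes "finite I" "\<And>i. i \<in> I \<Longrightarrow> A i \<subseteq> Tup (Suc m)" "\<And>i j. i \<in> I \<Longrightarrow> j \<in> I \<Longrightarrow> i \<noteq> j \<Longrightarrow> A i \<inter> A j = {}"
 shows "cnt (\<Union>i\<in>I. A i) r Y = (\<Sum>i\<in>I. cnt (A i) r Y)"
 using assms
proof (induction I rule: finite_induct)
 case (insert i I)
 have "cnt (A i \<union> (\<Union>i\<in>I. A i)) r Y = cnt (A i) r Y + cnt (\<Union>i\<in>I. A i) r Y"
  using insert.prems insert.hyps by (intro cnt_union) fastforce+
 thus ?case using insert by simp
qed (simp add: cnt_def)

definition good :: "nat set \<Rightarrow> (nat \<Rightarrow> nat) set"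
 where "good A = {t \<in> cop. \<forall>q\<in>A. \<not> q\<^sup>2 dvd tp (Suc m) t}"

lemma good_Tup: "good A \<subseteq> Tup (Suc m)" unfolding good_def cop_def by auto

lemma upd_cop:
 assumes "i < Suc m" "p > 0" "\<not> l dvd p"
 shows "upd i p s \<in> cop \<longleftrightarrow> s \<in> cop"
proof -
 have "l dvd upd i p s j \<longleftrightarrow> l dvd s j" for j
  using assms(3) prime_dvd_mult_iff[OF prime_l] by (simp add: upd_def)
 thus ?thesis unfolding cop_def using upd_Tup[OF assms(1,2)] by simp
qed

lemma prime_square_dvd_mult:
 assumes "prime p" "prime q" "p \<noteq> q"
 shows "q\<^sup>2 dvd p * n \<longleftrightarrow> q\<^sup>2 dvd (n :: nat)"
proof -
 have "coprime (q\<^sup>2) p" using assms by (simp add: primes_coprime)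
 thus ?thesis by (rule coprime_dvd_mult_right_iff)
qed

context
 fixes p :: nat and A :: "nat set"
 assumes p: "prime p" "p \<noteq> l" "p \<notin> A" and A: "\<And>q. q \<in> A \<Longrightarrow> prime q"
begin

lemma p_pos: "p > 0" using p(1) by (rule prime_gt_0_nat)

lemma not_l_dvd_p: "\<not> l dvd p" using p prime_l primes_dvd_imp_eq by blast

lemma upd_good: "i < Suc m \<Longrightarrow> upd i p s \<in> good A \<longleftrightarrow> s \<in> good A"
proof -
 assume i: "i < Suc m"
 have "q\<^sup>2 dvd tp (Suc m) (upd i p s) \<longleftrightarrow> q\<^sup>2 dvd tp (Suc m) s" if "q \<in> A" for q
  using prime_square_dvd_mult[OF p(1) A[OF that]] that p(3) by (auto simp: tp_upd[OF i])
 thus ?thesis unfolding good_def using upd_cop[OF i p_pos not_l_dvd_p] by simp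
qed

text \<open>The intermediate stages of the sieve at p, which removes multiples of p from one entry
  after the other.\<close>

definition part :: "nat \<Rightarrow> (nat \<Rightarrow> nat) set" where "part i = {t \<in> good A. \<forall>j<i. \<not> p dvd t j}"

lemma part_Tup: "part i \<subseteq> Tup (Suc m)" unfolding part_def using good_Tup by auto

lemma upd_part: "i < Suc m \<Longrightarrow> j \<le> i \<Longrightarrow> upd i p s \<in> part j \<longleftrightarrow> s \<in> part j"
 unfolding part_def using upd_good by (auto simp: upd_def)

lemma part_split:
 assumes i: "i < Suc m"
 shows "part i = part (Suc i) \<union> upd i p ` part i" "part (Suc i) \<inter> upd i p ` part i = {}"
proof -
 have "t \<in> part (Suc i) \<union> upd i p ` part i" if t: "t \<in> part i" for t
 proof (cases "p dvd t i")
  case True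
  have u: "upd i p (t(i := t i div p)) = t" by (rule upd_div) fact
  hence "t(i := t i div p) \<in> part i" using t upd_part[OF i, of i "t(i := t i div p)"] by simp
  thus ?thesis using u by (metis UnI2 image_eqI)
 qed (use t in \<open>auto simp: part_def less_Suc_eq\<close>)
 moreover have "part (Suc i) \<subseteq> part i" by (auto simp: part_def)
 moreover have "upd i p ` part i \<subseteq> part i" using upd_part[OF i, of i] by auto
 ultimately show "part i = part (Suc i) \<union> upd i p ` part i" by blast
 show "part (Suc i) \<inter> upd i p ` part i = {}" by (auto simp: part_def upd_def)
qed

lemma class_inverse: obtains v where "[p ^ e * v = 1] (mod l\<^sup>2)" "\<not> l dvd v"
proof -
 have "\<not> l dvd p ^ e" using not_l_dvd_p prime_dvd_power[OF prime_l] by blast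
 then obtain v where v: "[p ^ e * v = 1] (mod l\<^sup>2)" by (rule inverse_mod_l2)
 have "\<not> l dvd v"
 proof
  assume "l dvd v"
  moreover have "[p ^ e * v = 1] (mod l)" using v by (rule cong_dvd_modulus_nat) simp
  ultimately show False using l_gt_1 cong_dvd_iff[of "p ^ e * v" 1 l] by simp
 qed
 thus ?thesis using that v by blast
qed

lemma not_l_dvd_mult: "\<not> l dvd a \<Longrightarrow> \<not> l dvd b \<Longrightarrow> \<not> l dvd a * b"
 using prime_dvd_mult_iff[OF prime_l] by simp

text \<open>The tuples removed at entry i are a copy of the current set, counted up to Y/p in
  another unit class. As the constant is the same for all unit classes, each step contributes a
  factor 1 - 1/p.\<close>

lemma asy_part:
 assumes g: "\<And>r. \<not> l dvd r \<Longrightarrow> asy m (cnt (good A) r) c" and i: "i \<le> Suc m" and r: "\<not> l dvd r"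
 shows "asy m (cnt (part i) r) (c * (1 - 1 / real p) ^ i)"
 using i r
proof (induction i arbitrary: r)
 case 0
 thus ?case using g by (simp add: part_def)
next
 case (Suc i)
 have i: "i < Suc m" using Suc.prems by simp
 obtain v where v: "[p ^ (Suc m - i) * v = 1] (mod l\<^sup>2)" "\<not> l dvd v" by (rule class_inverse)
 have "cnt (part i) r Y = cnt (part (Suc i)) r Y + cnt (upd i p ` part i) r Y" for Y
 proof -
  have "upd i p ` part i \<subseteq> Tup (Suc m)" using part_split(1)[OF i] part_Tup by blast
  thus ?thesis using cnt_union[OF part_Tup _ part_split(2)[OF i]] part_split(1)[OF i] by metis
 qed
 hence e: "cnt (part (Suc i)) r Y = cnt (part i) r Y - cnt (part i) (r * v) (Y / real p)" for Y
  using cnt_upd[OF i p_pos v(1)] by (simp add: algebra_simps)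
 have "asy m (\<lambda>Y. cnt (part i) r Y - cnt (part i) (r * v) (Y / real p)) (c * (1 - 1 / real p) ^ i - c * (1 - 1 / real p) ^ i / real p)"
  using Suc p_pos not_l_dvd_mult[OF _ v(2)] by (intro asy_diff asy_scale) auto
 moreover have "c * (1 - 1 / real p) ^ i - c * (1 - 1 / real p) ^ i / real p = c * (1 - 1 / real p) ^ Suc i"
  by (simp add: algebra_simps)
 ultimately show ?case unfolding e[abs_def] by simp
qed

lemma part_not_dvd: "t \<in> part (Suc m) \<Longrightarrow> \<not> p dvd tp (Suc m) t"
 using dvd_tp_iff[OF p(1)] by (auto simp: part_def)

text \<open>If p^2 does not divide the product, at most one entry is divisible by p, and only once.
  The m + 1 possible positions are the source of the factor 1 + (m+1)/p.\<close>

lemma good_insert: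
 "good (insert p A) = part (Suc m) \<union> (\<Union>i<Suc m. upd i p ` part (Suc m))"
proof (intro subset_antisym subsetI)
 fix t assume t: "t \<in> good (insert p A)"
 hence tA: "t \<in> good A" and p2: "\<not> p\<^sup>2 dvd tp (Suc m) t" by (auto simp: good_def)
 show "t \<in> part (Suc m) \<union> (\<Union>i<Suc m. upd i p ` part (Suc m))"
 proof (cases "p dvd tp (Suc m) t")
  case False
  thus ?thesis using tA dvd_tp_iff[OF p(1)] by (auto simp: part_def)
 next
  case True
  then obtain i where i: "i < Suc m" "p dvd t i" using dvd_tp_iff[OF p(1)] by blast
  define s where "s = t(i := t i div p)"
  have u: "upd i p s = t" unfolding s_def by (rule upd_div) fact
  have "s \<in> good A" using upd_good[OF i(1), of s] tA u by simp
  moreover have "\<not> p dvd tp (Suc m) s"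
   using p2 tp_upd[OF i(1), of p s] p_pos unfolding u by (simp add: power2_eq_square)
  ultimately have "s \<in> part (Suc m)" using dvd_tp_iff[OF p(1)] by (auto simp: part_def)
  hence "t \<in> upd i p ` part (Suc m)" using u by (metis image_eqI)
  thus ?thesis using i(1) by blast
 qed
next
 fix t assume "t \<in> part (Suc m) \<union> (\<Union>i<Suc m. upd i p ` part (Suc m))"
 thus "t \<in> good (insert p A)"
 proof
  assume t: "t \<in> part (Suc m)"
  hence "\<not> p\<^sup>2 dvd tp (Suc m) t" using part_not_dvd by (meson dvd_power dvd_trans pos2)
  thus ?thesis using t by (auto simp: part_def good_def)
 next
  assume "t \<in> (\<Union>i<Suc m. upd i p ` part (Suc m))"
  then obtain i s where i: "i < Suc m" "t = upd i p s" "s \<in> part (Suc m)" by blast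
  have "\<not> p\<^sup>2 dvd tp (Suc m) t" unfolding i(2) tp_upd[OF i(1)]
   using part_not_dvd[OF i(3)] p_pos by (simp add: power2_eq_square)
  moreover have "t \<in> good A" unfolding i(2) using upd_good[OF i(1)] i(3) by (simp add: part_def)
  ultimately show ?thesis by (auto simp: good_def)
 qed
qed

lemma asy_good_insert:
 assumes g: "\<And>r. \<not> l dvd r \<Longrightarrow> asy m (cnt (good A) r) c" and r: "\<not> l dvd r"
 shows "asy m (cnt (good (insert p A)) r) (c * ((1 + real (Suc m) / real p) * (1 - 1 / real p) ^ Suc m))"
proof -
 have "\<exists>v. [p ^ (Suc m - i) * v = 1] (mod l\<^sup>2) \<and> \<not> l dvd v" for i
  by (rule class_inverse[of "Suc m - i"]) blast
 then obtain v where v: "[p ^ (Suc m - i) * v i = 1] (mod l\<^sup>2)" "\<not> l dvd v i" for i by metis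
 have dj: "upd i p ` part (Suc m) \<inter> upd j p ` part (Suc m) = {}" if "i < Suc m" "j < Suc m" "i \<noteq> j" for i j
 proof -
  have "\<not> p dvd upd i p s j" if "s \<in> part (Suc m)" for s using that \<open>i \<noteq> j\<close> \<open>j < Suc m\<close> by (auto simp: part_def upd_def)
  moreover have "p dvd upd j p s j" for s by (simp add: upd_def)
  ultimately show ?thesis by (metis (no_types, lifting) disjoint_iff imageE)
 qed
 have sub: "upd i p ` part (Suc m) \<subseteq> Tup (Suc m)" if "i < Suc m" for i using good_insert good_Tup that by blast
 have "cnt (good (insert p A)) r = (\<lambda>Y. cnt (part (Suc m)) r Y + (\<Sum>i<Suc m. cnt (part (Suc m)) (r * v i) (Y / real p)))"
 proof
  fix Y
  have "cnt (good (insert p A)) r Y = cnt (part (Suc m)) r Y + cnt (\<Union>i<Suc m. upd i p ` part (Suc m)) r Y"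
   unfolding good_insert
  proof (rule cnt_union[OF part_Tup])
   show "(\<Union>i<Suc m. upd i p ` part (Suc m)) \<subseteq> Tup (Suc m)" using sub by blast
   show "part (Suc m) \<inter> (\<Union>i<Suc m. upd i p ` part (Suc m)) = {}" by (auto simp: part_def upd_def)
  qed
  also have "cnt (\<Union>i<Suc m. upd i p ` part (Suc m)) r Y = (\<Sum>i<Suc m. cnt (upd i p ` part (Suc m)) r Y)"
   using sub dj by (intro cnt_UN) auto
  also have "\<dots> = (\<Sum>i<Suc m. cnt (part (Suc m)) (r * v i) (Y / real p))"
   using cnt_upd[OF _ p_pos v(1)] by (intro sum.cong[OF refl]) auto
  finally show "cnt (good (insert p A)) r Y = cnt (part (Suc m)) r Y + (\<Sum>i<Suc m. cnt (part (Suc m)) (r * v i) (Y / real p))" .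
 qed
 moreover have "asy m (\<lambda>Y. cnt (part (Suc m)) r Y + (\<Sum>i<Suc m. cnt (part (Suc m)) (r * v i) (Y / real p)))
   (c * (1 - 1 / real p) ^ Suc m + (\<Sum>i<Suc m. c * (1 - 1 / real p) ^ Suc m / real p))"
  using p_pos by (intro asy_add asy_sum asy_scale asy_part[OF g] not_l_dvd_mult r v(2)) auto
 moreover have "c * (1 - 1 / real p) ^ Suc m + (\<Sum>i<Suc m. c * (1 - 1 / real p) ^ Suc m / real p)
   = c * ((1 + real (Suc m) / real p) * (1 - 1 / real p) ^ Suc m)" 
 proof -
  have "c * x + n * (c * x / real p) = c * ((1 + n / real p) * x)" for x n :: real by (simp add: algebra_simps)
  thus ?thesis by (simp only: sum_constant card_lessThan)
 qed
 ultimately show ?thesis by (simp only:)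
qed

end

definition c0 :: real where "c0 = (1 - 1 / real l) ^ m / fact m / real (l\<^sup>2)"

definition fac :: "nat \<Rightarrow> real" where "fac p = (1 + real (Suc m) / real p) * (1 - 1 / real p) ^ Suc m"

lemma asy_good:
 assumes "finite A" "\<And>q. q \<in> A \<Longrightarrow> prime q \<and> q \<noteq> l" "\<not> l dvd r"
 shows "asy m (cnt (good A) r) (c0 * (\<Prod>q\<in>A. fac q))"
 using assms
proof (induction A arbitrary: r rule: finite_induct)
 case empty
 thus ?case using asy_cop by (simp add: good_def c0_def)
next
 case (insert p A)
 have "asy m (cnt (good (insert p A)) r) (c0 * (\<Prod>q\<in>A. fac q) * ((1 + real (Suc m) / real p) * (1 - 1 / real p) ^ Suc m))"
  by (rule asy_good_insert) (use insert in auto)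
 thus ?case using insert.hyps by (simp add: fac_def mult_ac)
qed

definition primes_upto :: "nat \<Rightarrow> nat set" where "primes_upto z = {p. p \<le> z \<and> prime p \<and> p \<noteq> l}"

definition sqfree_tuples :: "(nat \<Rightarrow> nat) set" where "sqfree_tuples = good {q. prime q}"

text \<open>Removing p twice, from entries i and j that may coincide, leaves a tuple with product at
  most Y/p^2; there are (m+1)^2 pairs of positions.\<close>

lemma card_square_dvd:
 assumes p: "prime p" and Y: "Y \<ge> 1"
 shows "real (card {t \<in> TupY (Suc m) Y. p\<^sup>2 dvd tp (Suc m) t})
  \<le> real ((Suc m)\<^sup>2) * (Y * ((ln Y + real m) ^ m / fact m)) / real p ^ 2"
proof -
 have p0: "p > 0" using p by (rule prime_gt_0_nat)
 have step: "\<exists>i<Suc m. \<exists>s\<in>TupY (Suc m) (Z / real p). t = upd i p s" if t: "t \<in> TupY (Suc m) Z" "p dvd tp (Suc m) t" for t Z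
 proof -
  obtain i where i: "i < Suc m" "p dvd t i" using dvd_tp_iff[OF p] t(2) by blast
  have u: "upd i p (t(i := t i div p)) = t" by (rule upd_div) fact
  have "t(i := t i div p) \<in> TupY (Suc m) (Z / real p)"
   using t(1) upd_Tup[OF i(1) p0, of "t(i := t i div p)"] tp_upd[OF i(1), of p "t(i := t i div p)"] p0
   unfolding u by (simp add: TupY_def field_simps)
  thus ?thesis using u i(1) by metis
 qed
 define I where "I = {..<Suc m} \<times> {..<Suc m}"
 have "{t \<in> TupY (Suc m) Y. p\<^sup>2 dvd tp (Suc m) t} \<subseteq> (\<Union>(i, j)\<in>I. (\<lambda>s. upd i p (upd j p s)) ` TupY (Suc m) (Y / real p / real p))"
 proof
  fix t assume t: "t \<in> {t \<in> TupY (Suc m) Y. p\<^sup>2 dvd tp (Suc m) t}"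
  hence "p dvd tp (Suc m) t" using dvd_trans[of p "p\<^sup>2"] by simp
  then obtain i s where i: "i < Suc m" "s \<in> TupY (Suc m) (Y / real p)" "t = upd i p s" using step[of t Y] t by auto
  have "p dvd tp (Suc m) s" using t p0 tp_upd[OF i(1), of p s] unfolding i(3) by (simp add: power2_eq_square)
  then obtain j s' where "j < Suc m" "s' \<in> TupY (Suc m) (Y / real p / real p)" "s = upd j p s'" using step[OF i(2)] by auto
  thus "t \<in> (\<Union>(i, j)\<in>I. (\<lambda>s. upd i p (upd j p s)) ` TupY (Suc m) (Y / real p / real p))"
   unfolding I_def i(3) using i(1) by (intro UN_I[of "(i, j)"]) auto
 qed
 hence "card {t \<in> TupY (Suc m) Y. p\<^sup>2 dvd tp (Suc m) t} \<le> card (\<Union>(i, j)\<in>I. (\<lambda>s. upd i p (upd j p s)) ` TupY (Suc m) (Y / real p / real p))"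
  by (rule card_mono[rotated]) (auto simp: I_def finite_TupY)
 also have "\<dots> \<le> (\<Sum>x\<in>I. card (case x of (i, j) \<Rightarrow> (\<lambda>s. upd i p (upd j p s)) ` TupY (Suc m) (Y / real p / real p)))"
  by (rule card_UN_le) (simp add: I_def)
 also have "\<dots> \<le> (\<Sum>x\<in>I. card (TupY (Suc m) (Y / real p / real p)))"
  by (intro sum_mono) (auto split: prod.splits intro: card_image_le finite_TupY)
 also have "\<dots> = (Suc m)\<^sup>2 * card (TupY (Suc m) (Y / real p / real p))" by (simp add: I_def power2_eq_square)
 finally have "real (card {t \<in> TupY (Suc m) Y. p\<^sup>2 dvd tp (Suc m) t}) \<le> real ((Suc m)\<^sup>2 * card (TupY (Suc m) (Y / real p / real p)))"
  by (rule of_nat_mono)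
 also have "\<dots> = real ((Suc m)\<^sup>2) * real (card (TupY (Suc m) (Y / real p / real p)))" by (rule of_nat_mult)
 also have "\<dots> \<le> real ((Suc m)\<^sup>2) * (Y / real p / real p * ((ln Y + real m) ^ m / fact m))"
 proof (rule mult_left_mono)
  show "real (card (TupY (Suc m) (Y / real p / real p))) \<le> Y / real p / real p * ((ln Y + real m) ^ m / fact m)"
  proof (cases "Y / real p / real p < 1")
   case True
   thus ?thesis using Y TupY_empty by simp
  next
   case False
   have "Y / real p / real p \<le> Y"
   proof -
    have "1 \<le> real p * real p" using p0 mult_mono[of 1 "real p" 1 "real p"] by simp
    hence "Y / (real p * real p) \<le> Y / 1" using Y by (intro divide_left_mono) auto
    thus ?thesis by simp
   qed
   hence "ln (Y / real p / real p) \<le> ln Y" "ln (Y / real p / real p) \<ge> 0" using False by (auto intro: ln_mono)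
   hence "Y / real p / real p * ((ln (Y / real p / real p) + real m) ^ m / fact m) \<le> Y / real p / real p * ((ln Y + real m) ^ m / fact m)"
    using False by (intro mult_left_mono divide_right_mono power_mono) auto
   thus ?thesis using card_TupY_Suc[of "Y / real p / real p" m] False by linarith
  qed
 qed simp
 finally show ?thesis by (simp add: power2_eq_square mult_ac)
qed

end

subsection \<open>The Euler product\<close>

lemma sum_inverse_squares_tail: "(\<Sum>p\<in>{z<..K}. 1 / real p ^ 2) \<le> 1 / real z" if "z > 0"
proof (cases "z \<le> K")
 case True
 have "(\<Sum>p\<in>{z<..K}. 1 / real p ^ 2) \<le> 1 / real z - 1 / real K"
  using True
 proof (induction K rule: nat_induct_at_least)
  case (Suc n)
  have n: "n > 0" using Suc that by simp
  have "1 / real (Suc n) ^ 2 \<le> 1 / (real n * real (Suc n))"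
   using n by (intro divide_left_mono) (auto simp: power2_eq_square)
  also have "\<dots> = 1 / real n - 1 / real (Suc n)" using n by (simp add: field_simps)
  finally have "1 / real (Suc n) ^ 2 \<le> 1 / real n - 1 / real (Suc n)" .
  moreover have "{z<..Suc n} = insert (Suc n) {z<..n}" using Suc.hyps by auto
  ultimately show ?case using Suc.IH by simp
 qed simp
 also have "\<dots> \<le> 1 / real z" by simp
 finally show ?thesis .
qed simp

lemma prodinf_limit:
 fixes f :: "nat \<Rightarrow> real"
 assumes f: "\<And>p. 0 < f p \<and> f p \<le> 1 \<and> 1 - f p \<le> C / real p ^ 2"
 shows "(\<lambda>n. \<Prod>p\<le>n. f p) \<longlonglongrightarrow> prodinf f" "prodinf f > 0"
proof -
 have "summable (\<lambda>p. C * inverse (real p ^ 2))" by (intro summable_mult inverse_power_summable) simp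
 hence "summable (\<lambda>p. norm (f p - 1))"
 proof (rule summable_comparison_test'[of _ 0])
  fix n
  have "norm (f n - 1) = 1 - f n" using f[of n] by (simp add: abs_if)
  thus "norm (norm (f n - 1)) \<le> C * inverse (real n ^ 2)" using f[of n] by (simp add: divide_inverse)
 qed
 hence c: "convergent_prod f" by (intro abs_convergent_prod_imp_convergent_prod summable_imp_abs_convergent_prod)
 thus lim: "(\<lambda>n. \<Prod>p\<le>n. f p) \<longlonglongrightarrow> prodinf f" by (rule convergent_prod_LIMSEQ)
 have "prodinf f \<noteq> 0" by (rule prodinf_nonzero[OF c]) (use f in \<open>simp add: less_imp_neq[symmetric]\<close>)
 moreover have "prodinf f \<ge> 0" by (rule LIMSEQ_le_const[OF lim]) (use f in \<open>auto intro!: prod_pos less_imp_le\<close>)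
 ultimately show "prodinf f > 0" by simp
qed

context tuple_sieve
begin

definition efac :: "nat \<Rightarrow> real" where "efac p = (if prime p then fac p else 1)"

text \<open>Bernoulli's inequality twice, with k = m + 1 and x = 1/p: the product is at most (1 -
  x^2)^k and at least (1 + k x)(1 - k x).\<close>

lemma efac_bounds: "0 < efac p \<and> efac p \<le> 1 \<and> 1 - efac p \<le> (real (Suc m))\<^sup>2 / real p ^ 2"
proof (cases "prime p")
 case True
 define x where "x = 1 / real p"
 define k where "k = Suc m"
 have p: "real p > 1" using prime_gt_1_nat[OF True] by simp
 have x: "0 < x" "x < 1" using p by (auto simp: x_def)
 have e: "efac p = (1 + real k * x) * (1 - x) ^ k" using True by (simp add: efac_def fac_def x_def k_def)
 have "1 + real k * x \<le> (1 + x) ^ k" using x by (intro Bernoulli_inequality) simp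
 hence "efac p \<le> (1 + x) ^ k * (1 - x) ^ k" unfolding e using x by (intro mult_right_mono) auto
 also have "\<dots> = (1 - x * x) ^ k" by (simp add: power_mult_distrib[symmetric] algebra_simps)
 also have "\<dots> \<le> 1" using x by (intro power_le_one) (auto simp: mult_le_one less_imp_le)
 finally have 1: "efac p \<le> 1" .
 have 2: "efac p > 0" unfolding e using x by (intro mult_pos_pos) (auto intro: add_pos_nonneg)
 have "1 + real k * (- x) \<le> (1 + - x) ^ k" using x by (intro Bernoulli_inequality) simp
 hence "(1 + real k * x) * (1 - real k * x) \<le> efac p" unfolding e using x by (intro mult_left_mono) auto
 hence "1 - efac p \<le> (real k * x) ^ 2" by (simp add: power2_eq_square algebra_simps)
 thus ?thesis using 1 2 by (simp add: x_def k_def power_divide power_mult_distrib)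
qed (simp add: efac_def)

definition euler :: real where "euler = prodinf efac"

lemma euler_limit: "(\<lambda>n. \<Prod>p\<le>n. efac p) \<longlonglongrightarrow> euler" and euler_pos: "euler > 0"
 unfolding euler_def using prodinf_limit[of efac] efac_bounds by blast+

lemma efac_nz: "efac p \<noteq> 0" using efac_bounds[of p] by linarith

text \<open>The sieve omits the prime l, whose Euler factor is therefore divided out.\<close>

lemma primes_upto_limit: "(\<lambda>z. \<Prod>q\<in>primes_upto z. fac q) \<longlonglongrightarrow> euler / fac l"
proof -
 have fl: "fac l = efac l" using prime_l by (simp add: efac_def)
 have pe: "(\<Prod>q\<in>primes_upto z. fac q) = (\<Prod>p\<le>z. efac p) / fac l" if "z \<ge> l" for z
 proof -
  have "(\<Prod>p\<le>z. efac p) = efac l * (\<Prod>p\<in>{..z} - {l}. efac p)" using that by (intro prod.remove) auto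
  also have "(\<Prod>p\<in>{..z} - {l}. efac p) = (\<Prod>q\<in>primes_upto z. fac q)"
   by (rule prod.mono_neutral_cong_right) (auto simp: primes_upto_def efac_def)
  finally show ?thesis unfolding fl using efac_nz[of l] by simp
 qed
 have "\<forall>\<^sub>F z in sequentially. (\<Prod>p\<le>z. efac p) / fac l = (\<Prod>q\<in>primes_upto z. fac q)"
  using eventually_ge_at_top[of l] by eventually_elim (rule pe[symmetric])
 moreover have "(\<lambda>z. (\<Prod>p\<le>z. efac p) / fac l) \<longlonglongrightarrow> euler / fac l"
  using euler_limit efac_nz[of l] by (intro tendsto_divide) (auto simp: fl)
 ultimately show ?thesis by (rule Lim_transform_eventually[rotated])
qed

text \<open>A tuple lost beyond z has product divisible by p^2 for some prime p with z < p \<le> Y,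
  and the sum of 1/p^2 over p > z is at most 1/z.\<close>

lemma good_tail:
 assumes z: "z > 0" and Y: "Y \<ge> 1"
 shows "\<bar>cnt sqfree_tuples r Y - cnt (good (primes_upto z)) r Y\<bar>
  \<le> real ((Suc m)\<^sup>2) * (Y * ((ln Y + real m) ^ m / fact m)) / real z"
proof -
 define B where "B = real ((Suc m)\<^sup>2) * (Y * ((ln Y + real m) ^ m / fact m))"
 have B0: "B \<ge> 0" unfolding B_def using Y by (intro mult_nonneg_nonneg divide_nonneg_nonneg) auto
 define K where "K = nat \<lfloor>Y\<rfloor>"
 define S where "S V = {t \<in> V. real (tp (Suc m) t) \<le> Y \<and> [phi t = r] (mod l\<^sup>2)}" for V
 have sub: "sqfree_tuples \<subseteq> good (primes_upto z)" by (auto simp: sqfree_tuples_def good_def primes_upto_def)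
 have fin: "finite (S (good (primes_upto z)))" unfolding S_def by (rule finite_cnt[OF good_Tup])
 have "S (good (primes_upto z)) - S sqfree_tuples \<subseteq> (\<Union>p\<in>{p \<in> {z<..K}. prime p}. {t \<in> TupY (Suc m) Y. p\<^sup>2 dvd tp (Suc m) t})"
 proof
  fix t assume t: "t \<in> S (good (primes_upto z)) - S sqfree_tuples"
  hence tg: "t \<in> good (primes_upto z)" "real (tp (Suc m) t) \<le> Y" "t \<notin> sqfree_tuples" by (auto simp: S_def)
  have tT: "t \<in> TupY (Suc m) Y" using tg good_Tup by (auto simp: TupY_def)
  obtain p where p: "prime p" "p\<^sup>2 dvd tp (Suc m) t" using tg by (auto simp: sqfree_tuples_def good_def)
  have "p dvd p\<^sup>2" by (simp add: power2_eq_square)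
  hence pd: "p dvd tp (Suc m) t" using p(2) by (rule dvd_trans)
  have "p \<noteq> l"
  proof
   assume "p = l"
   then obtain j where "j < Suc m" "l dvd t j" using pd dvd_tp_iff[OF prime_l] by blast
   thus False using tg(1) by (auto simp: good_def cop_def)
  qed
  moreover have "p \<notin> primes_upto z" using tg(1) p(2) by (auto simp: good_def)
  ultimately have "p > z" using p(1) by (auto simp: primes_upto_def)
  moreover have "p \<le> tp (Suc m) t" using pd tp_pos[of t "Suc m"] tT by (intro dvd_imp_le) (auto simp: TupY_def)
  hence "real p \<le> Y" using tg(2) by linarith
  hence "p \<le> K" unfolding K_def using le_nat_floor_iff[of p Y] prime_gt_0_nat[OF p(1)] by simp
  ultimately have "p \<in> {p \<in> {z<..K}. prime p}" using p(1) by simp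
  moreover have "t \<in> {t \<in> TupY (Suc m) Y. p\<^sup>2 dvd tp (Suc m) t}" using p(2) tT by simp
  ultimately show "t \<in> (\<Union>p\<in>{p \<in> {z<..K}. prime p}. {t \<in> TupY (Suc m) Y. p\<^sup>2 dvd tp (Suc m) t})"
   by (rule UN_I)
 qed
 hence "card (S (good (primes_upto z)) - S sqfree_tuples) \<le> card (\<Union>p\<in>{p \<in> {z<..K}. prime p}. {t \<in> TupY (Suc m) Y. p\<^sup>2 dvd tp (Suc m) t})"
  by (rule card_mono[rotated]) (simp add: finite_TupY)
 also have "\<dots> \<le> (\<Sum>p\<in>{p \<in> {z<..K}. prime p}. card {t \<in> TupY (Suc m) Y. p\<^sup>2 dvd tp (Suc m) t})"
  by (rule card_UN_le) simp
 finally have "real (card (S (good (primes_upto z)) - S sqfree_tuples)) \<le> real (\<Sum>p\<in>{p \<in> {z<..K}. prime p}. card {t \<in> TupY (Suc m) Y. p\<^sup>2 dvd tp (Suc m) t})"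
  by (rule of_nat_mono)
 also have "\<dots> = (\<Sum>p\<in>{p \<in> {z<..K}. prime p}. real (card {t \<in> TupY (Suc m) Y. p\<^sup>2 dvd tp (Suc m) t}))" by simp
 also have "\<dots> \<le> (\<Sum>p\<in>{p \<in> {z<..K}. prime p}. B / real p ^ 2)"
  unfolding B_def using card_square_dvd[OF _ Y] by (intro sum_mono) simp
 also have "\<dots> \<le> (\<Sum>p\<in>{z<..K}. B / real p ^ 2)" using B0 by (intro sum_mono2) auto
 also have "\<dots> = B * (\<Sum>p\<in>{z<..K}. 1 / real p ^ 2)" by (simp add: sum_distrib_left)
 also have "\<dots> \<le> B * (1 / real z)" by (rule mult_left_mono[OF sum_inverse_squares_tail[OF z] B0])
 finally have "real (card (S (good (primes_upto z)) - S sqfree_tuples)) \<le> B / real z" by simp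
 moreover have sS: "S sqfree_tuples \<subseteq> S (good (primes_upto z))" using sub by (auto simp: S_def)
 have "card (S (good (primes_upto z)) - S sqfree_tuples) = card (S (good (primes_upto z))) - card (S sqfree_tuples)"
  by (rule card_Diff_subset[OF finite_subset[OF sS fin] sS])
 moreover have "card (S sqfree_tuples) \<le> card (S (good (primes_upto z)))" by (rule card_mono[OF fin sS])
 ultimately show ?thesis unfolding cnt_def S_def[symmetric] B_def by (simp add: of_nat_diff)
qed

text \<open>z is fixed first, large enough for partial product and tail to cost a third of
  \<epsilon> each; only then does Y grow. The factor 2 in the tail bounds the ratio of the shifted
  to the plain power of the logarithm.\<close>

lemma asy_sqfree_tuples:
 assumes r: "\<not> l dvd r"
 shows "asy m (cnt sqfree_tuples r) (c0 * euler / fac l)"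
 unfolding asy_def
proof (rule tendstoI)
 fix \<epsilon> :: real assume \<epsilon>: "\<epsilon> > 0"
 define C where "C = real ((Suc m)\<^sup>2) / fact m"
 have C0: "C > 0" by (simp add: C_def)
 have "(\<lambda>z. c0 * (\<Prod>q\<in>primes_upto z. fac q)) \<longlonglongrightarrow> c0 * (euler / fac l)"
  by (intro tendsto_mult tendsto_const primes_upto_limit)
 hence "\<forall>\<^sub>F z in sequentially. dist (c0 * (\<Prod>q\<in>primes_upto z. fac q)) (c0 * (euler / fac l)) < \<epsilon> / 3"
  using \<epsilon> by (intro tendstoD) auto
 moreover have "((\<lambda>z. 2 * C / real z) \<longlongrightarrow> 0) sequentially" by real_asymp
 hence "\<forall>\<^sub>F z in sequentially. 2 * C / real z < \<epsilon> / 3" using \<epsilon> by (intro order_tendstoD(2)) auto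
 ultimately have "\<forall>\<^sub>F z in sequentially. z > 0 \<and> dist (c0 * (\<Prod>q\<in>primes_upto z. fac q)) (c0 * (euler / fac l)) < \<epsilon> / 3 \<and> 2 * C / real z < \<epsilon> / 3"
  using eventually_gt_at_top[of 0] by eventually_elim auto
 then obtain z where z: "z > 0" "dist (c0 * (\<Prod>q\<in>primes_upto z. fac q)) (c0 * (euler / fac l)) < \<epsilon> / 3" "2 * C / real z < \<epsilon> / 3"
  unfolding eventually_sequentially by blast
 have "asy m (cnt (good (primes_upto z)) r) (c0 * (\<Prod>q\<in>primes_upto z. fac q))"
  by (rule asy_good) (use r in \<open>auto simp: primes_upto_def\<close>)
 hence "\<forall>\<^sub>F Y in at_top. dist (cnt (good (primes_upto z)) r Y / (Y * ln Y ^ m)) (c0 * (\<Prod>q\<in>primes_upto z. fac q)) < \<epsilon> / 3"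
  unfolding asy_def using \<epsilon> by (intro tendstoD) auto
 moreover have "\<forall>\<^sub>F Y in at_top. dist ((ln Y + real m) ^ m / ln Y ^ m) 1 < 1"
  by (intro tendstoD log_shift_limit) simp
 ultimately show "\<forall>\<^sub>F Y in at_top. dist (cnt sqfree_tuples r Y / (Y * ln Y ^ m)) (c0 * euler / fac l) < \<epsilon>"
  using eventually_gt_at_top[of 1]
 proof eventually_elim
  case (elim Y)
  define E where "E = Y * ln Y ^ m"
  have E0: "E > 0" using elim by (simp add: E_def)
  have "\<bar>cnt sqfree_tuples r Y / E - cnt (good (primes_upto z)) r Y / E\<bar> = \<bar>cnt sqfree_tuples r Y - cnt (good (primes_upto z)) r Y\<bar> / E"
   using E0 by (simp add: diff_divide_distrib[symmetric])
  also have "\<dots> \<le> real ((Suc m)\<^sup>2) * (Y * ((ln Y + real m) ^ m / fact m)) / real z / E"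
   using good_tail[OF z(1), of Y r] elim E0 by (intro divide_right_mono) auto
  also have "\<dots> = C / real z * ((ln Y + real m) ^ m / ln Y ^ m)" using elim by (simp add: C_def E_def mult_ac)
  also have "\<dots> \<le> C / real z * 2" using elim(2) C0 by (intro mult_left_mono) (auto simp: dist_real_def)
  finally have "\<bar>cnt sqfree_tuples r Y / E - cnt (good (primes_upto z)) r Y / E\<bar> < \<epsilon> / 3" using z(3) by simp
  thus ?case using elim(1) z(2) \<epsilon> unfolding E_def[symmetric] dist_real_def times_divide_eq_right[symmetric] by linarith
 qed
qed

text \<open>The m-th powers of 1 - 1/l cancel between \<open>c0\<close> and the factor at l, leaving
  1/(l^2 (1 - 1/l)(1 + (m+1)/l)) beside the factorial. With m = l - 2 the last bracket produces the
  2 l - 1 of the theorem.\<close>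

lemma limit_constant: "c0 * euler / fac l = euler / ((real l - 1) * (real l + real (Suc m)) * fact m)"
proof -
 have l: "real l > 1" using l_gt_1 by simp
 define x y where "x = 1 - 1 / real l" and "y = 1 + real (Suc m) / real l"
 have x: "x > 0" using l by (simp add: x_def)
 have y: "y > 0" using l by (simp add: y_def add_pos_nonneg)
 have fl: "fac l = y * (x * x ^ m)" by (simp add: fac_def x_def y_def)
 have "c0 * euler / fac l = euler / (x * real (l\<^sup>2) * y * fact m)"
  unfolding c0_def x_def[symmetric] fl using x y l by (simp add: field_simps)
 also have "x * real (l\<^sup>2) * y = (real l - 1) * (real l + real (Suc m))"
  using l by (simp add: x_def y_def field_simps power2_eq_square)
 finally show ?thesis .
qed

end

subsection \<open>Radicands and tuples\<close>

text \<open>Applied at one prime to the multiplicities in the entries of a tuple: the weights k - j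
  are positive and distinct, so the weighted sum reveals which entry, if any, is divisible by the
  prime.\<close>

lemma one_hot:
 fixes e :: "nat \<Rightarrow> nat"
 assumes "(\<Sum>j<k. e j) \<le> 1"
 defines "v \<equiv> (\<Sum>j<k. (k - j) * e j)"
 shows "v \<le> k" "\<And>j. j < k \<Longrightarrow> e j = (if v = k - j then 1 else 0)"
proof -
 have "v \<le> k \<and> (\<forall>j<k. e j = (if v = k - j then 1 else 0))"
 proof (cases "\<exists>i<k. e i \<noteq> 0")
  case True
  then obtain i where i: "i < k" "e i \<noteq> 0" by blast
  have s: "(\<Sum>j<k. e j) = e i + (\<Sum>j\<in>{..<k} - {i}. e j)" using i by (intro sum.remove) auto
  hence ei: "e i = 1" and "(\<Sum>j\<in>{..<k} - {i}. e j) = 0" using i(2) assms(1) by linarith+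
  hence ej: "e j = 0" if "j < k" "j \<noteq> i" for j using that by (simp add: sum_eq_0_iff)
  have "v = (k - i) * e i + (\<Sum>j\<in>{..<k} - {i}. (k - j) * e j)" unfolding v_def using i by (intro sum.remove) auto
  also have "(\<Sum>j\<in>{..<k} - {i}. (k - j) * e j) = 0" using ej by (intro sum.neutral) auto
  finally have "v = k - i" using ei by simp
  have "e j = (if v = k - j then 1 else 0)" if j: "j < k" for j
  proof (cases "j = i")
   case False
   hence "v \<noteq> k - j" using \<open>v = k - i\<close> i(1) j by linarith
   thus ?thesis using ej[OF j False] by simp
  qed (use ei \<open>v = k - i\<close> in simp)
  thus ?thesis using \<open>v = k - i\<close> by simp
 next
  case False
  hence "v = 0" unfolding v_def by (intro sum.neutral) auto
  thus ?thesis using False by auto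
 qed
 thus "v \<le> k" "\<And>j. j < k \<Longrightarrow> e j = (if v = k - j then 1 else 0)" by auto
qed

text \<open>Both factors of a^l - b^l = (a - b)(a^(l-1) + ... + b^(l-1)) are divisible by l, the
  second because it is congruent to l b^(l-1).\<close>

lemma power_cong_lift:
 assumes "[a = b] (mod l)" shows "[a ^ l = b ^ l] (mod (l :: nat)\<^sup>2)"
proof -
 have "int l dvd int a - int b" using assms by (metis cong_iff_dvd_diff cong_int_iff)
 then obtain c where c: "int a = int b + int l * c" by (metis add_diff_cancel_left' diff_add_cancel dvdE add.commute)
 have "int l dvd (\<Sum>i<l. int a ^ (l - Suc i) * int b ^ i)"
 proof -
  have "[int a = int b] (mod int l)" using assms by (simp add: cong_int_iff)
  hence "[(\<Sum>i<l. int a ^ (l - Suc i) * int b ^ i) = (\<Sum>i<l. int b ^ (l - Suc i) * int b ^ i)] (mod int l)"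
   by (intro cong_sum cong_mult cong_pow cong_refl)
  moreover have "(\<Sum>i<l. int b ^ (l - Suc i) * int b ^ i) = int l * int b ^ (l - 1)"
  proof -
   have "(\<Sum>i<l. int b ^ (l - Suc i) * int b ^ i) = (\<Sum>i<l. int b ^ (l - 1))"
    by (intro sum.cong[OF refl]) (simp add: power_add[symmetric])
   thus ?thesis by simp
  qed
  ultimately show ?thesis using cong_dvd_iff by fastforce
 qed
 hence "int l * int l dvd (int a - int b) * (\<Sum>i<l. int a ^ (l - Suc i) * int b ^ i)"
  using \<open>int l dvd int a - int b\<close> by (rule mult_dvd_mono[rotated])
 also have "(\<Sum>i<l. int a ^ (l - Suc i) * int b ^ i) = (\<Sum>i<l. int b ^ (l - Suc i) * int a ^ i)"
  by (rule sum.reindex_bij_witness[of _ "\<lambda>i. l - Suc i" "\<lambda>i. l - Suc i"]) (auto simp: mult.commute)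
 finally have "int (l\<^sup>2) dvd int (a ^ l) - int (b ^ l)" using power_diff_sumr2[of "int a" l "int b"] by (simp add: power2_eq_square)
 thus ?thesis by (metis cong_iff_dvd_diff cong_int_iff)
qed

context cyclotomic
begin

sublocale T: tuple_sieve l "l - 2" using prime_l l_ge_3 by unfold_locales auto

lemma Suc_m: "Suc (l - 2) = l - 1" using l_ge_3 by simp

definition lfree_coprime :: "nat set" where "lfree_coprime = {n \<in> lfree. \<not> l dvd n}"

lemma T_pos: "t \<in> T.sqfree_tuples \<Longrightarrow> t j > 0"
 unfolding T.sqfree_tuples_def T.good_def T.cop_def Tup_def by (cases "j < Suc (l - 2)") auto

lemma multiplicity_phi:
 assumes t: "t \<in> T.sqfree_tuples" and p: "prime p"
 shows "multiplicity p (T.phi t) \<le> l - 1"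
  "j < l - 1 \<Longrightarrow> multiplicity p (t j) = (if multiplicity p (T.phi t) = l - 1 - j then 1 else 0)"
  "multiplicity p (tp (l - 1) t) = (if p dvd T.phi t then 1 else 0)"
proof -
 define e where "e j = multiplicity p (t j)" for j
 have tz: "t j \<noteq> 0" for j using T_pos[OF t, of j] by simp
 have tp: "multiplicity p (tp (l - 1) t) = (\<Sum>j<l-1. e j)"
  unfolding tp_def e_def using p by (subst prime_elem_multiplicity_prod_distrib) (auto simp: tz)
 have ph: "multiplicity p (T.phi t) = (\<Sum>j<l-1. (l - 1 - j) * e j)"
  unfolding T.phi_def Suc_m e_def using p
  by (subst prime_elem_multiplicity_prod_distrib) (auto simp: prime_elem_multiplicity_power_distrib tz)
 have ph0: "T.phi t > 0" unfolding T.phi_def using T_pos[OF t] by (intro prod_pos) auto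
 have "\<not> p\<^sup>2 dvd tp (l - 1) t" using t p unfolding T.sqfree_tuples_def T.good_def Suc_m by auto
 hence "\<not> 2 \<le> multiplicity p (tp (l - 1) t)" using multiplicity_dvd'[of 2 p "tp (l - 1) t"] by blast
 hence "(\<Sum>j<l-1. e j) \<le> 1" using tp by simp
 from one_hot[OF this, folded ph] show "multiplicity p (T.phi t) \<le> l - 1"
  and hot: "\<And>j. j < l - 1 \<Longrightarrow> multiplicity p (t j) = (if multiplicity p (T.phi t) = l - 1 - j then 1 else 0)"
  unfolding e_def by auto
 show "multiplicity p (tp (l - 1) t) = (if p dvd T.phi t then 1 else 0)"
 proof (cases "p dvd T.phi t")
  case True
  hence "multiplicity p (T.phi t) > 0" using prime_dvd_iff_multiplicity[OF p ph0] by simp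
  then obtain j where j: "j < l - 1" "e j \<noteq> 0" unfolding ph by (metis (no_types, lifting) lessThan_iff mult_0_right neq0_conv sum.neutral)
  have "e j \<le> (\<Sum>j<l-1. e j)" using j by (intro member_le_sum) auto
  thus ?thesis using True j \<open>(\<Sum>j<l-1. e j) \<le> 1\<close> unfolding tp by simp
 next
  case False
  hence "multiplicity p (T.phi t) = 0" using not_dvd_imp_multiplicity_0 by blast
  hence "e j = 0" if "j < l - 1" for j using hot[OF that] that by (simp add: e_def)
  thus ?thesis unfolding tp using False by simp
 qed
qed

lemma phi_pos: "t \<in> T.sqfree_tuples \<Longrightarrow> T.phi t > 0"
 unfolding T.phi_def using T_pos by (intro prod_pos) auto

lemma phi_lfree_coprime: assumes t: "t \<in> T.sqfree_tuples" shows "T.phi t \<in> lfree_coprime"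
proof -
 have "multiplicity p (T.phi t) < l" if "prime p" for p
  using multiplicity_phi(1)[OF t that] l_pos by linarith
 moreover have "\<not> l dvd T.phi t"
 proof
  assume "l dvd T.phi t"
  hence "multiplicity l (tp (l - 1) t) = 1" using multiplicity_phi(3)[OF t prime_l] by simp
  hence "l dvd tp (l - 1) t" using not_dvd_imp_multiplicity_0[of l "tp (l - 1) t"] by auto
  then obtain j where "j < l - 1" "l dvd t j" using dvd_tp_iff[OF prime_l] by blast
  thus False using t unfolding T.sqfree_tuples_def T.good_def T.cop_def Suc_m by auto
 qed
 ultimately show ?thesis using phi_pos[OF t] by (simp add: lfree_coprime_def lfree_def)
qed

lemma rad_phi: assumes t: "t \<in> T.sqfree_tuples" shows "rad (T.phi t) = tp (l - 1) t"
proof (rule multiplicity_eq_nat)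
 show "tp (l - 1) t > 0" unfolding tp_def using T_pos[OF t] by (intro prod_pos) auto
 show "rad (T.phi t) > 0" unfolding rad_def by (intro prod_pos) (auto dest!: in_prime_factors_imp_prime intro: prime_gt_0_nat)
 fix p :: nat assume p: "prime p"
 have "\<not> l dvd T.phi t" using phi_lfree_coprime[OF t] by (simp add: lfree_coprime_def)
 hence "prime_factors (T.phi t) - {l} = prime_factors (T.phi t)" by (auto dest: in_prime_factors_imp_dvd)
 hence "multiplicity p (rad (T.phi t)) = multiplicity p (\<Prod>q\<in>prime_factors (T.phi t). q ^ 1)" by (simp add: rad_def)
 also have "\<dots> = (if p \<in> prime_factors (T.phi t) then 1 else 0)"
  using p by (subst multiplicity_prod_prime_powers) auto
 also have "\<dots> = (if p dvd T.phi t then 1 else 0)" using p phi_pos[OF t] by (simp add: in_prime_factors_iff)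
 finally show "multiplicity p (rad (T.phi t)) = multiplicity p (tp (l - 1) t)" using multiplicity_phi(3)[OF t p] by simp
qed

lemma bij_phi: "bij_betw T.phi T.sqfree_tuples lfree_coprime"
 unfolding bij_betw_def
proof
 show "inj_on T.phi T.sqfree_tuples"
 proof (rule inj_onI)
  fix s t assume st: "s \<in> T.sqfree_tuples" "t \<in> T.sqfree_tuples" "T.phi s = T.phi t"
  have "s j = t j" for j
  proof (cases "j < l - 1")
   case True
   show ?thesis by (rule multiplicity_eq_nat[OF T_pos[OF st(1)] T_pos[OF st(2)]])
     (use multiplicity_phi(2)[OF st(1) _ True] multiplicity_phi(2)[OF st(2) _ True] st(3) in simp)
  next
   case False
   thus ?thesis using st(1,2) unfolding T.sqfree_tuples_def T.good_def T.cop_def Tup_def Suc_m by auto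
  qed
  thus "s = t" by (rule ext)
 qed
 have "n \<in> T.phi ` T.sqfree_tuples" if n: "n \<in> lfree_coprime" for n
 proof -
  have n0: "n > 0" and nl: "n \<in> lfree" "\<not> l dvd n" using n by (auto simp: lfree_coprime_def lfree_def)
  \<comment> \<open>The inverse map: entry j collects the primes whose multiplicity in n equals its
    exponent l - 1 - j in \<open>phi\<close>.\<close>
  define t where "t j = (if j < l - 1 then \<Prod>p\<in>prime_factors n. p ^ (if multiplicity p n = l - 1 - j then 1 else 0) else 1)" for j
  have t0: "t j > 0" for j by (cases "j < l - 1") (simp_all only: t_def if_True if_False prod_prime_factors_pos zero_less_one)
  have tz: "t j \<noteq> 0" for j using t0[of j] by simp
  have t1: "t j = 1" if "j \<ge> l - 1" for j using that by (simp add: t_def)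
  have mt: "multiplicity p (t j) = (if multiplicity p n = l - 1 - j then 1 else 0)" if "j < l - 1" "prime p" for p j
   using that multiplicity_prime_factors_prod[OF n0 that(2), of "\<lambda>p. if multiplicity p n = l - 1 - j then 1 else 0"] by (simp add: t_def)
  have ix: "(\<Sum>j<l-1. f j * (if v = l - 1 - j then 1 else 0)) = (if v = 0 then 0 else f (l - 1 - v))" if "v < l" for f :: "nat \<Rightarrow> nat" and v
  proof -
   have "(\<Sum>j<l-1. f j * (if v = l - 1 - j then 1 else 0)) = (\<Sum>j<l-1. if j = l - 1 - v \<and> v \<noteq> 0 then f j else 0)"
    using that by (intro sum.cong[OF refl]) auto
   also have "\<dots> = (if v = 0 then 0 else f (l - 1 - v))" using that by (cases "v = 0") (auto simp: sum.delta)
   finally show ?thesis .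
  qed
  have ph: "T.phi t = n"
  proof (rule multiplicity_eq_nat)
   show "T.phi t > 0" unfolding T.phi_def using t0 by (intro prod_pos) auto
   fix p :: nat assume p: "prime p"
   have "multiplicity p (T.phi t) = (\<Sum>j<l-1. (l - 1 - j) * multiplicity p (t j))"
    unfolding T.phi_def Suc_m using p
    by (subst prime_elem_multiplicity_prod_distrib) (auto simp: prime_elem_multiplicity_power_distrib tz)
   also have "\<dots> = (\<Sum>j<l-1. (l - 1 - j) * (if multiplicity p n = l - 1 - j then 1 else 0))"
    using mt[OF _ p] by (intro sum.cong[OF refl]) (simp only: lessThan_iff)
   also have "\<dots> = multiplicity p n" using lfree_multiplicity[OF nl(1) p] by (subst ix) auto
   finally show "multiplicity p (T.phi t) = multiplicity p n" .
  qed fact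
  have "\<not> p\<^sup>2 dvd tp (l - 1) t" if p: "prime p" for p
  proof
   assume d: "p\<^sup>2 dvd tp (l - 1) t"
   have "multiplicity p (tp (l - 1) t) = (\<Sum>j<l-1. 1 * (if multiplicity p n = l - 1 - j then 1 else 0))"
    unfolding tp_def using p mt[OF _ p]
    by (subst prime_elem_multiplicity_prod_distrib) (auto intro!: sum.cong simp: tz)
   also have "\<dots> \<le> 1" using ix[of "multiplicity p n" "\<lambda>_. 1"] lfree_multiplicity[OF nl(1) p] by simp
   finally have "multiplicity p (tp (l - 1) t) \<le> 1" .
   moreover have "tp (l - 1) t \<noteq> 0" unfolding tp_def by (simp add: tz)
   moreover have "\<not> is_unit p" using p not_prime_unit by blast
   ultimately show False using multiplicity_geI[OF _ _ d] by force
  qed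
  moreover have "\<not> l dvd t j" if "j < l - 1" for j
  proof -
   have "multiplicity l n = 0" using nl(2) not_dvd_imp_multiplicity_0 by blast
   hence "multiplicity l (t j) = 0" using mt[OF that prime_l] that by simp
   thus ?thesis using prime_dvd_iff_multiplicity[OF prime_l t0] by simp
  qed
  ultimately have "t \<in> T.sqfree_tuples"
   unfolding T.sqfree_tuples_def T.good_def T.cop_def Tup_def Suc_m using t0 t1 by simp
  thus ?thesis using ph by blast
 qed
 thus "T.phi ` T.sqfree_tuples = lfree_coprime" using phi_lfree_coprime by blast
qed

definition Scount :: "(nat \<Rightarrow> bool) \<Rightarrow> real \<Rightarrow> real"
 where "Scount P Y = real (card {n \<in> lfree_coprime. real (rad n) \<le> Y \<and> P n})"

lemma bij_phi_restricted:
 "bij_betw T.phi {t \<in> T.sqfree_tuples. real (tp (l - 1) t) \<le> Y \<and> P (T.phi t)} {n \<in> lfree_coprime. real (rad n) \<le> Y \<and> P n}"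
proof -
 have "T.phi ` {t \<in> T.sqfree_tuples. real (tp (l - 1) t) \<le> Y \<and> P (T.phi t)} = {n \<in> T.phi ` T.sqfree_tuples. real (rad n) \<le> Y \<and> P n}"
  using rad_phi by auto
 thus ?thesis using bij_phi unfolding bij_betw_def by (auto intro: inj_on_subset)
qed

lemma finite_rad_le: "finite {n \<in> lfree_coprime. real (rad n) \<le> Y \<and> P n}"
proof -
 have "finite {t \<in> T.sqfree_tuples. real (tp (l - 1) t) \<le> Y \<and> P (T.phi t)}"
  using T.good_Tup unfolding T.sqfree_tuples_def Suc_m
  by (intro finite_subset[OF _ finite_TupY[of "l - 1" Y]]) (auto simp: TupY_def)
 thus ?thesis using bij_betw_finite[OF bij_phi_restricted] by blast
qed

lemma Scount_residue: "Scount (\<lambda>n. [n = r] (mod l\<^sup>2)) Y = T.cnt T.sqfree_tuples r Y"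
 unfolding Scount_def T.cnt_def Suc_m using bij_betw_same_card[OF bij_phi_restricted, of Y "\<lambda>n. [n = r] (mod l\<^sup>2)"] by simp

text \<open>Scaled so that the l - 1 split classes together have constant \<open>dens\<close>: a
  single unit class modulo l^2 has dens / (l - 1), and all l (l - 1) of them have l dens.\<close>

definition dens :: real where "dens = T.euler / ((2 * real l - 1) * fact (l - 2))"

lemma asy_Scount_residue: "\<not> l dvd r \<Longrightarrow> asy (l - 2) (Scount (\<lambda>n. [n = r] (mod l\<^sup>2))) (dens / (real l - 1))"
proof -
 assume "\<not> l dvd r"
 from T.asy_sqfree_tuples[OF this] show ?thesis
  unfolding Scount_residue[abs_def] T.limit_constant dens_def Suc_m using l_ge_3 by (simp add: of_nat_diff mult_ac)
qed

lemma Scount_classes: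
 assumes R: "R \<subseteq> {..<l\<^sup>2}" and P: "\<And>n. n \<in> lfree_coprime \<Longrightarrow> P n \<longleftrightarrow> n mod l\<^sup>2 \<in> R"
 shows "Scount P Y = (\<Sum>r\<in>R. Scount (\<lambda>n. [n = r] (mod l\<^sup>2)) Y)"
proof -
 define A where "A = {n \<in> lfree_coprime. real (rad n) \<le> Y \<and> P n}"
 have fR: "finite R" using R by (rule finite_subset) simp
 have "card A = (\<Sum>r\<in>R. \<Sum>n\<in>{n \<in> A. n mod l\<^sup>2 = r}. 1)"
  using sum.group[of A R "\<lambda>n. n mod l\<^sup>2" "\<lambda>_. 1 :: nat"] finite_rad_le[of Y P] fR P by (fastforce simp: A_def)
 also have "\<dots> = (\<Sum>r\<in>R. card {n \<in> lfree_coprime. real (rad n) \<le> Y \<and> [n = r] (mod l\<^sup>2)})"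
 proof (rule sum.cong[OF refl])
  fix r assume r: "r \<in> R"
  hence "r < l\<^sup>2" using R by auto
  hence "{n \<in> A. n mod l\<^sup>2 = r} = {n \<in> lfree_coprime. real (rad n) \<le> Y \<and> [n = r] (mod l\<^sup>2)}"
   using r P by (auto simp: A_def Cong.cong_def)
  thus "(\<Sum>n\<in>{n \<in> A. n mod l\<^sup>2 = r}. 1) = card {n \<in> lfree_coprime. real (rad n) \<le> Y \<and> [n = r] (mod l\<^sup>2)}" by simp
 qed
 finally show ?thesis unfolding Scount_def A_def[symmetric] by simp
qed

lemma asy_Scount:
 assumes R: "R \<subseteq> {..<l\<^sup>2}" "\<And>r. r \<in> R \<Longrightarrow> \<not> l dvd r" and P: "\<And>n. n \<in> lfree_coprime \<Longrightarrow> P n \<longleftrightarrow> n mod l\<^sup>2 \<in> R"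
 shows "asy (l - 2) (Scount P) (real (card R) * (dens / (real l - 1)))"
proof -
 have "asy (l - 2) (\<lambda>Y. \<Sum>r\<in>R. Scount (\<lambda>n. [n = r] (mod l\<^sup>2)) Y) (\<Sum>r\<in>R. dens / (real l - 1))"
  using R(2) by (intro asy_sum asy_Scount_residue)
 moreover have "Scount P = (\<lambda>Y. \<Sum>r\<in>R. Scount (\<lambda>n. [n = r] (mod l\<^sup>2)) Y)"
  by (rule ext, rule Scount_classes[OF R(1)]) (rule P)
 ultimately show ?thesis by simp
qed

lemma asy_Scount_all: "asy (l - 2) (Scount (\<lambda>_. True)) (real l * dens)"
proof -
 define R where "R = {r \<in> {..<l\<^sup>2}. \<not> l dvd r}"
 have co: "coprime r l \<longleftrightarrow> \<not> l dvd r" for r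
  using prime_imp_coprime[OF prime_l, of r] coprime_absorb_left[of l r] l_ge_3 by (auto simp: coprime_commute)
 have "R = totatives (l\<^sup>2)"
  unfolding R_def totatives_def using l_pos by (auto simp: co le_less intro: Nat.gr0I)
 hence "card R = l * (l - 1)" using totient_prime_power[OF prime_l, of 2] by (simp add: totient_def)
 moreover have "n mod l\<^sup>2 \<in> R" if "n \<in> lfree_coprime" for n
 proof -
  have "l dvd n mod l\<^sup>2 \<longleftrightarrow> l dvd n" by (rule dvd_mod_iff) simp
  thus ?thesis using that l_pos by (simp add: R_def lfree_coprime_def)
 qed
 hence "asy (l - 2) (Scount (\<lambda>_. True)) (real (card R) * (dens / (real l - 1)))"
  by (intro asy_Scount) (auto simp: R_def)
 ultimately show ?thesis using l_ge_3 by (simp add: of_nat_diff)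
qed

text \<open>The classes with r^(l-1) = 1 are the Teichmueller representatives modulo l^2: the map
  from a to a^l is inverse to reduction modulo l, so there are l - 1 of them.\<close>

lemma asy_Scount_split: "asy (l - 2) (Scount (\<lambda>n. [n ^ (l - 1) = 1] (mod l\<^sup>2))) dens"
proof -
 define R where "R = {r \<in> {..<l\<^sup>2}. \<not> l dvd r \<and> [r ^ (l - 1) = 1] (mod l\<^sup>2)}"
 have "bij_betw (\<lambda>r. r mod l) R {1..<l}"
 proof (rule bij_betwI[where g = "\<lambda>a. a ^ l mod l\<^sup>2"])
  show "(\<lambda>r. r mod l) \<in> R \<rightarrow> {1..<l}" using l_pos by (auto simp: R_def Suc_le_eq dvd_eq_mod_eq_0)
  have ndl: "\<not> l dvd a" if "a \<in> {1..<l}" for a using that by (auto dest: dvd_imp_le)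
  have fl: "[a ^ l = a] (mod l)" if "\<not> l dvd a" for a
  proof -
   have "[a * a ^ (l - 1) = a * 1] (mod l)" using fermat_theorem[OF prime_l that] by (rule cong_scalar_left)
   thus ?thesis using l_pos by (cases l) auto
  qed
  show "(\<lambda>a. a ^ l mod l\<^sup>2) \<in> {1..<l} \<rightarrow> R"
  proof
   fix a assume a: "a \<in> {1..<l}"
   have "l dvd a ^ l mod l\<^sup>2 \<longleftrightarrow> l dvd a ^ l" by (rule dvd_mod_iff) simp
   hence "\<not> l dvd a ^ l mod l\<^sup>2" using ndl[OF a] prime_dvd_power[OF prime_l] by blast
   moreover have "[(a ^ l mod l\<^sup>2) ^ (l - 1) = (a ^ l) ^ (l - 1)] (mod l\<^sup>2)" by (intro cong_pow) (simp add: Cong.cong_def)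
   hence "[(a ^ l mod l\<^sup>2) ^ (l - 1) = 1] (mod l\<^sup>2)" using euler_l[OF ndl[OF a]] unfolding power_mult by (rule cong_trans)
   ultimately show "a ^ l mod l\<^sup>2 \<in> R" using l_pos by (simp add: R_def)
  qed
  fix a assume a: "a \<in> {1..<l}"
  have "a ^ l mod l\<^sup>2 mod l = a ^ l mod l" by (simp add: mod_mod_cancel power2_eq_square)
  also have "\<dots> = a" using fl[OF ndl[OF a]] a by (simp add: Cong.cong_def)
  finally show "a ^ l mod l\<^sup>2 mod l = a" .
 next
  fix r assume r: "r \<in> R"
  have "[(r mod l) ^ l = r ^ l] (mod l\<^sup>2)" by (rule power_cong_lift) (simp add: Cong.cong_def)
  moreover have "[r * r ^ (l - 1) = r * 1] (mod l\<^sup>2)" using r by (intro cong_scalar_left) (simp add: R_def)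
  hence "[r ^ l = r] (mod l\<^sup>2)" using l_pos by (cases l) auto
  ultimately have "[(r mod l) ^ l = r] (mod l\<^sup>2)" by (rule cong_trans)
  thus "(r mod l) ^ l mod l\<^sup>2 = r" using r by (simp add: Cong.cong_def R_def)
 qed
 hence "card R = l - 1" using bij_betw_same_card by fastforce
 moreover have "asy (l - 2) (Scount (\<lambda>n. [n ^ (l - 1) = 1] (mod l\<^sup>2))) (real (card R) * (dens / (real l - 1)))"
 proof (rule asy_Scount)
  fix n assume n: "n \<in> lfree_coprime"
  have "l dvd n mod l\<^sup>2 \<longleftrightarrow> l dvd n" by (rule dvd_mod_iff) simp
  moreover have "[(n mod l\<^sup>2) ^ (l - 1) = n ^ (l - 1)] (mod l\<^sup>2)" by (intro cong_pow) (simp add: Cong.cong_def)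
  hence "[n ^ (l - 1) = 1] (mod l\<^sup>2) \<longleftrightarrow> [(n mod l\<^sup>2) ^ (l - 1) = 1] (mod l\<^sup>2)" using cong_trans cong_sym by blast
  ultimately show "[n ^ (l - 1) = 1] (mod l\<^sup>2) \<longleftrightarrow> n mod l\<^sup>2 \<in> R" using n l_pos by (simp add: R_def lfree_coprime_def)
 qed (auto simp: R_def)
 ultimately show ?thesis using l_ge_3 by (simp add: of_nat_diff)
qed

end

subsection \<open>The asymptotic count\<close>

text \<open>Substitution of Y = (x/a)^b: the power a^(-b) comes from Y and the factor b^m from its
  logarithm.\<close>

lemma asy_root:
 assumes F: "asy m F c" and a: "a > 0" and b: "b > 0"
 shows "((\<lambda>x. F ((x / a) powr b) / (x powr b * ln x ^ m)) \<longlongrightarrow> c * (a powr - b * b ^ m)) at_top"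
proof -
 have "filterlim (\<lambda>x. (x / a) powr b) at_top at_top" using a b by real_asymp
 hence "((\<lambda>x. F ((x / a) powr b) / ((x / a) powr b * ln ((x / a) powr b) ^ m)) \<longlongrightarrow> c) at_top"
  using F unfolding asy_def by (rule filterlim_compose[rotated])
 moreover have "((\<lambda>x. a powr - b * b ^ m * (ln (x / a) / ln x) ^ m) \<longlongrightarrow> a powr - b * b ^ m * 1 ^ m) at_top"
 proof (intro tendsto_mult tendsto_power tendsto_const)
  show "((\<lambda>x. ln (x / a) / ln x) \<longlongrightarrow> 1) at_top" using a by real_asymp
 qed
 ultimately have "((\<lambda>x. F ((x / a) powr b) / ((x / a) powr b * ln ((x / a) powr b) ^ m) * (a powr - b * b ^ m * (ln (x / a) / ln x) ^ m))
   \<longlongrightarrow> c * (a powr - b * b ^ m * 1 ^ m)) at_top"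
  by (rule tendsto_mult)
 moreover have "\<forall>\<^sub>F x in at_top. F ((x / a) powr b) / ((x / a) powr b * ln ((x / a) powr b) ^ m) * (a powr - b * b ^ m * (ln (x / a) / ln x) ^ m)
   = F ((x / a) powr b) / (x powr b * ln x ^ m)"
  using eventually_gt_at_top[of "max 1 a"]
 proof eventually_elim
  case (elim x)
  have l: "ln (x / a) > 0" "ln x > 0" using elim a by (auto intro!: ln_gt_zero simp: field_simps)
  have e: "ln ((x / a) powr b) = b * ln (x / a)" using elim a by (simp add: ln_powr)
  have p: "(x / a) powr b = x powr b / a powr b" using elim a by (simp add: powr_divide)
  show ?case unfolding e unfolding p power_mult_distrib power_divide powr_minus using l a b elim by (simp add: field_simps)
 qed
 ultimately show ?thesis by (simp add: tendsto_cong)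
qed

context cyclotomic
begin

definition bound :: "nat \<Rightarrow> real \<Rightarrow> real"
 where "bound e x = (x / real (l ^ e)) powr (1 / (real l - 1)\<^sup>2)"

lemma le_bound_iff:
 assumes x: "x > 0"
 shows "real (l ^ e * r ^ ((l - 1)\<^sup>2)) \<le> x \<longleftrightarrow> real r \<le> bound e x"
proof -
 define N where "N = (l - 1)\<^sup>2"
 have N: "N > 0" "real N = (real l - 1)\<^sup>2" using l_ge_3 by (auto simp: N_def of_nat_diff)
 define y where "y = x / real (l ^ e)"
 have y: "y > 0" using x l_pos by (simp add: y_def)
 have z: "bound e x > 0" unfolding bound_def y_def[symmetric] using y by simp
 have "bound e x ^ N = bound e x powr real N" using z by (simp add: powr_realpow)
 also have "\<dots> = y" unfolding bound_def y_def[symmetric] powr_powr N(2)[symmetric] using N(1) y by simp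
 finally have "real r \<le> bound e x \<longleftrightarrow> real r ^ N \<le> y"
  using power_mono_iff[of "real r" "bound e x" N] z N(1) by simp
 also have "\<dots> \<longleftrightarrow> real (l ^ e * r ^ N) \<le> x" unfolding y_def using l_pos by (simp add: field_simps)
 finally show ?thesis by (simp add: N_def)
qed

lemma multiplicity_l_power_mult:
 assumes "n > 0" "\<not> l dvd n" and p: "prime p"
 shows "multiplicity p (l ^ j * n) = (if p = l then j else multiplicity p n)"
proof -
 have "multiplicity p (l ^ j * n) = j * multiplicity p l + multiplicity p n"
  using assms l_pos by (simp add: prime_elem_multiplicity_mult_distrib prime_elem_multiplicity_power_distrib)
 thus ?thesis using assms(2) prime_l p prime_multiplicity_other[OF p prime_l]
  by (auto simp: not_dvd_imp_multiplicity_0 multiplicity_self dest: not_prime_unit)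
qed

lemma rad_l_power_mult: "n > 0 \<Longrightarrow> rad (l ^ j * n) = rad n"
proof -
 assume n: "n > 0"
 have "p = l" if "prime p" "p dvd l ^ j" for p
  using that prime_l by (metis prime_dvd_power primes_dvd_imp_eq)
 thus ?thesis unfolding rad_def using l_pos n
  by (intro prod.cong) (auto simp: in_prime_factors_iff prime_dvd_mult_iff)
qed

text \<open>\<open>rad\<close> ignores l, so the exponent of l is free among 1, ..., l - 1 and every
  radicand prime to l gives rise to l - 1 others.\<close>

lemma bij_l_dvd:
 "bij_betw (\<lambda>(j, n). l ^ j * n) ({1..<l} \<times> {n \<in> lfree_coprime. Q (rad n)}) {n \<in> lfree. l dvd n \<and> Q (rad n)}"
  unfolding bij_betw_def
 proof
  have pos: "n > 0" "\<not> l dvd n" if "n \<in> lfree_coprime" for n using that by (auto simp: lfree_coprime_def lfree_def)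
  show "inj_on (\<lambda>(j, n). l ^ j * n) ({1..<l} \<times> {n \<in> lfree_coprime. Q (rad n)})"
  proof (rule inj_onI, clarify)
   fix i j n n' assume *: "n \<in> lfree_coprime" "n' \<in> lfree_coprime" "l ^ i * n = l ^ j * n'"
   have "i = j" using multiplicity_l_power_mult[OF pos[OF *(1)] prime_l, of i] multiplicity_l_power_mult[OF pos[OF *(2)] prime_l, of j] *(3) by simp
   thus "i = j \<and> n = n'" using *(3) l_pos by simp
  qed
  have "l ^ j * n \<in> {n \<in> lfree. l dvd n \<and> Q (rad n)}" if "j \<in> {1..<l}" "n \<in> lfree_coprime" "Q (rad n)" for j n
  proof -
   have "multiplicity p (l ^ j * n) < l" if "prime p" for p
    using multiplicity_l_power_mult[OF pos[OF \<open>n \<in> lfree_coprime\<close>] that] lfree_multiplicity[OF _ that, of n] \<open>j \<in> {1..<l}\<close> \<open>n \<in> lfree_coprime\<close>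
    by (simp add: lfree_coprime_def)
   moreover have "l ^ j * n > 0" using pos[OF that(2)] l_pos by simp
   moreover have "l dvd l ^ j * n" using that(1) by (intro dvd_mult2 dvd_power) auto
   ultimately show ?thesis using rad_l_power_mult[OF pos(1)[OF that(2)]] that(3) by (simp add: lfree_def)
  qed
  moreover have "n \<in> (\<lambda>(j, n). l ^ j * n) ` ({1..<l} \<times> {n \<in> lfree_coprime. Q (rad n)})"
   if n: "n \<in> lfree" "l dvd n" "Q (rad n)" for n
  proof -
   have n0: "n > 0" by (rule lfree_pos) fact
   define j where "j = multiplicity l n"
   have "\<not> is_unit l" using prime_l not_prime_unit by blast
   then obtain d where d: "n = l ^ j * d" "\<not> l dvd d" unfolding j_def using multiplicity_decompose'[of n l] n0 by blast
   have d0: "d > 0" using d n0 by (cases d) auto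
   have j: "0 < j" "j < l" using prime_dvd_iff_multiplicity[OF prime_l n0] n(2) lfree_multiplicity[OF n(1) prime_l] by (auto simp: j_def)
   have "multiplicity p d < l" if "prime p" for p
    using multiplicity_l_power_mult[OF d0 d(2) that, of j] lfree_multiplicity[OF n(1) that] d l_pos
    by (cases "p = l") (auto simp: not_dvd_imp_multiplicity_0)
   hence "d \<in> lfree_coprime" using d0 d(2) by (simp add: lfree_coprime_def lfree_def)
   moreover have "Q (rad d)" using n(3) rad_l_power_mult[OF d0] unfolding d(1) by simp
   ultimately have "(j, d) \<in> {1..<l} \<times> {n \<in> lfree_coprime. Q (rad n)}" using j by simp
   thus ?thesis unfolding d(1) by (rule rev_image_eqI) simp
  qed
  ultimately show "(\<lambda>(j, n). l ^ j * n) ` ({1..<l} \<times> {n \<in> lfree_coprime. Q (rad n)}) = {n \<in> lfree. l dvd n \<and> Q (rad n)}" by auto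
 qed

lemma card_l_dvd: "card {n \<in> lfree. l dvd n \<and> Q (rad n)} = (l - 1) * card {n \<in> lfree_coprime. Q (rad n)}"
 using bij_betw_same_card[OF bij_l_dvd, of Q] by (simp add: card_cartesian_product)

abbreviation "split_class n \<equiv> [n ^ (l - 1) = 1] (mod l\<^sup>2)"

text \<open>The three values of \<open>expo\<close> give three counts. The final -1 removes n = 1,
  which satisfies the split condition and has radical 1; it is counted once x reaches l^(l(l-2)),
  hence the lower bound on x.\<close>

lemma count_decomposition:
 assumes x: "x \<ge> real (l ^ (l * (l - 2)))"
 shows "real ((l - 1) * metacyclic_count l x)
  = real (l - 1) * Scount (\<lambda>_. True) (bound (2 * l\<^sup>2 - 2 * l - 1) x)
   + (Scount (\<lambda>_. True) (bound (l\<^sup>2 - 2) x) - Scount split_class (bound (l\<^sup>2 - 2) x))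
   + (Scount split_class (bound (l * (l - 2)) x) - 1)"
proof -
 have x0: "x > 0" using x l_pos by (meson less_le_trans of_nat_0_less_iff zero_less_power)
 define e1 e2 e3 where "e1 = 2 * l\<^sup>2 - 2 * l - 1" and "e2 = l\<^sup>2 - 2" and "e3 = l * (l - 2)"
 define A1 where "A1 = {n \<in> lfree. l dvd n \<and> real (rad n) \<le> bound e1 x}"
 define A2 where "A2 = {n \<in> lfree_coprime. real (rad n) \<le> bound e2 x \<and> \<not> split_class n}"
 define A3 where "A3 = {n \<in> lfree_coprime. real (rad n) \<le> bound e3 x \<and> split_class n}"
 have finA1: "finite A1"
  using bij_betw_finite[OF bij_l_dvd, of "\<lambda>r. real r \<le> bound e1 x"] finite_rad_le[of "bound e1 x" "\<lambda>_. True"] by (simp add: A1_def)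
 have fin23: "finite A2" "finite A3" unfolding A2_def A3_def by (rule finite_rad_le)+
 have disj: "A1 \<inter> A2 = {}" "(A1 \<union> A2) \<inter> (A3 - {1}) = {}"
  unfolding A1_def A2_def A3_def lfree_coprime_def by blast+
 have one: "1 \<in> A3"
 proof -
  have "rad 1 = 1" by (simp add: rad_def)
  moreover have "real 1 \<le> bound e3 x" using le_bound_iff[OF x0, of e3 1] x by (simp add: e3_def)
  moreover have "multiplicity p 1 = 0" if "prime p" for p :: nat by simp
  ultimately show ?thesis using l_ge_3 by (simp add: A3_def lfree_coprime_def lfree_def)
 qed
 have "{n \<in> lfree - {1}. real (l ^ expo n * rad n ^ ((l - 1)\<^sup>2)) \<le> x} = A1 \<union> A2 \<union> (A3 - {1})"
  unfolding le_bound_iff[OF x0] A1_def A2_def A3_def lfree_coprime_def expo_def e1_def e2_def e3_def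
  using l_ge_3 by auto
 hence "(l - 1) * metacyclic_count l x = card (A1 \<union> A2 \<union> (A3 - {1}))" unfolding metacyclic_count_lfree by simp
 also have "\<dots> = card (A1 \<union> A2) + card (A3 - {1})"
  by (rule card_Un_disjoint) (use finA1 fin23 disj in simp_all)
 also have "card (A1 \<union> A2) = card A1 + card A2"
  by (rule card_Un_disjoint) (use finA1 fin23 disj in simp_all)
 finally have "real ((l - 1) * metacyclic_count l x) = real (card A1) + real (card A2) + real (card (A3 - {1}))" by simp
 moreover have "real (card A1) = real (l - 1) * Scount (\<lambda>_. True) (bound e1 x)"
  using card_l_dvd[of "\<lambda>r. real r \<le> bound e1 x"] by (simp add: A1_def Scount_def)
 moreover have "real (card A2) = Scount (\<lambda>_. True) (bound e2 x) - Scount split_class (bound e2 x)"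
 proof -
  have "{n \<in> lfree_coprime. real (rad n) \<le> bound e2 x \<and> True}
   = A2 \<union> {n \<in> lfree_coprime. real (rad n) \<le> bound e2 x \<and> split_class n}" by (auto simp: A2_def)
  moreover have "card (A2 \<union> {n \<in> lfree_coprime. real (rad n) \<le> bound e2 x \<and> split_class n})
   = card A2 + card {n \<in> lfree_coprime. real (rad n) \<le> bound e2 x \<and> split_class n}"
   unfolding A2_def by (rule card_Un_disjoint) (auto simp: finite_rad_le)
  ultimately show ?thesis unfolding Scount_def by simp
 qed
 moreover have "real (card (A3 - {1})) = Scount split_class (bound e3 x) - 1"
 proof -
  have "card A3 = Suc (card (A3 - {1}))" using card_Suc_Diff1[OF fin23(2) one] by simp
  thus ?thesis unfolding Scount_def A3_def by simp
 qed
 ultimately show ?thesis by (simp only: e1_def e2_def e3_def)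
qed

lemma big_A_euler: "big_A l = small_a l * T.euler"
proof -
 have "real (Suc (l - 2)) = real l - 1" using l_ge_3 by (simp add: of_nat_diff)
 hence "T.efac = (\<lambda>p. if prime p then (1 + (real l - 1) / real p) * (1 - 1 / real p) ^ (l - 1) else 1)"
  unfolding T.efac_def[abs_def] T.fac_def Suc_m by (simp only: Suc_m)
 thus ?thesis unfolding big_A_def T.euler_def by simp
qed

text \<open>Origin of the 2 in \<open>small_a\<close>: for radicands divisible by l the exponent
  grows by (l-1)^2, which costs a factor 1/l, but they come with multiplicity l - 1 over all unit
  classes; this matches exactly the contribution of the nonsplit radicands. The split ones
  contribute only \<open>dens\<close>, hence the inverse of l - 1.\<close>

lemma limit_value:
 defines "b \<equiv> 1 / (real l - 1)\<^sup>2" and "w \<equiv> \<lambda>e. real (l ^ e) powr - (1 / (real l - 1)\<^sup>2) * (1 / (real l - 1)\<^sup>2) ^ (l - 2)"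
 shows "(real (l - 1) * (real l * dens * w (2 * l\<^sup>2 - 2 * l - 1)) + (real l * dens * w (l\<^sup>2 - 2) - dens * w (l\<^sup>2 - 2)) + dens * w (l * (l - 2))) / real (l - 1) = big_A l"
proof -
 have l: "real l \<ge> 3" using l_ge_3 by simp
 have l1: "real l - 1 > 0" using l by simp
 have b: "(real l - 1)\<^sup>2 > 0" using l by simp
 define u where "u = (1 / (real l - 1)\<^sup>2) ^ (l - 2)"
 have u: "(real l - 1) powr (- 2 * (real l - 2)) = u"
 proof -
  have "- 2 * (real l - 2) = - real (2 * (l - 2))" using l_ge_3 by (simp add: of_nat_diff)
  hence "(real l - 1) powr (- 2 * (real l - 2)) = inverse ((real l - 1) ^ (2 * (l - 2)))"
   by (simp only: powr_minus powr_realpow[OF l1])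
  also have "\<dots> = u" unfolding u_def by (simp add: power_mult power_divide inverse_eq_divide)
  finally show ?thesis .
 qed
 have pw: "real (l ^ e) powr - (1 / (real l - 1)\<^sup>2) = real l powr (- real e / (real l - 1)\<^sup>2)" for e
 proof -
  have "real (l ^ e) = real l powr real e" using l by (simp add: powr_realpow)
  thus ?thesis by (simp add: powr_powr)
 qed
 define q2 q3 where "q2 = real l powr (- ((real l)\<^sup>2 - 2) / (real l - 1)\<^sup>2)" and "q3 = real l powr (- (real l * (real l - 2)) / (real l - 1)\<^sup>2)"
 have l4: "l\<^sup>2 \<ge> 2" using l_ge_3 power_mono[of 3 l 2] by simp
 have E2: "real (l\<^sup>2 - 2) = (real l)\<^sup>2 - 2" using l4 by (simp add: of_nat_diff)
 have E3: "real (l * (l - 2)) = real l * (real l - 2)" using l_ge_3 by (simp add: of_nat_diff)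
 have E1: "real (2 * l\<^sup>2 - 2 * l - 1) = (real l)\<^sup>2 - 2 + (real l - 1)\<^sup>2"
 proof -
  obtain j where j: "l = Suc (Suc j)" using l_ge_3 by (metis Suc_le_D numeral_3_eq_3 Suc_le_mono)
  have "2 * l\<^sup>2 - 2 * l - 1 = 2 * (j * j) + 6 * j + 3" unfolding j by (simp add: power2_eq_square)
  hence "real (2 * l\<^sup>2 - 2 * l - 1) = real (2 * (j * j) + 6 * j + 3)" by (rule arg_cong)
  also have "\<dots> = (real l)\<^sup>2 - 2 + (real l - 1)\<^sup>2" by (simp add: j power2_eq_square algebra_simps)
  finally show ?thesis .
 qed
 have w2: "w (l\<^sup>2 - 2) = q2 * u" unfolding w_def pw E2 q2_def u_def ..
 have w3: "w (l * (l - 2)) = q3 * u" unfolding w_def pw E3 q3_def u_def ..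
 have w1: "w (2 * l\<^sup>2 - 2 * l - 1) = q2 / real l * u"
 proof -
  have "- ((real l)\<^sup>2 - 2 + (real l - 1)\<^sup>2) / (real l - 1)\<^sup>2 = - ((real l)\<^sup>2 - 2) / (real l - 1)\<^sup>2 - 1"
   using b by (simp add: field_simps)
  hence "real l powr (- ((real l)\<^sup>2 - 2 + (real l - 1)\<^sup>2) / (real l - 1)\<^sup>2) = q2 / real l"
   using l by (simp add: powr_diff q2_def)
  thus ?thesis unfolding w_def pw E1 u_def by simp
 qed
 have "big_A l = u / ((2 * real l - 1) * fact (l - 2)) * (2 * q2 + q3 * inverse (real l - 1)) * T.euler"
  unfolding big_A_euler small_a_def u q2_def q3_def ..
 also have "\<dots> = u * dens * (2 * q2 + q3 * inverse (real l - 1))" by (simp add: dens_def)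
 finally have A: "big_A l = u * dens * (2 * q2 + q3 * inverse (real l - 1))" .
 have "real (l - 1) = real l - 1" using l_ge_3 by (simp add: of_nat_diff)
 thus ?thesis unfolding w1 w2 w3 A using l by (simp add: field_simps)
qed

lemma big_A_pos: "big_A l > 0"
proof -
 have l: "real l \<ge> 3" using l_ge_3 by simp
 have "small_a l > 0" unfolding small_a_def using l by (intro mult_pos_pos divide_pos_pos add_pos_pos) auto
 thus ?thesis unfolding big_A_euler using T.euler_pos by simp
qed

lemma metacyclic_count_asymp:
 "(\<lambda>x. real (metacyclic_count l x)) \<sim>[at_top] (\<lambda>x. big_A l * x powr (1 / (real l - 1)\<^sup>2) * ln x ^ (l - 2))"
proof (rule asymp_equivI')
 define b where "b = 1 / (real l - 1)\<^sup>2"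
 define w where "w e = real (l ^ e) powr - b * b ^ (l - 2)" for e
 define D where "D x = x powr b * ln x ^ (l - 2)" for x
 have b0: "b > 0" using l_ge_3 by (simp add: b_def)
 have bb: "big_A l / big_A l = 1" using big_A_pos by simp
 have lim: "((\<lambda>x. Scount P (bound e x) / D x) \<longlongrightarrow> c * w e) at_top" if "asy (l - 2) (Scount P) c" for P c e
  unfolding bound_def b_def[symmetric] D_def w_def by (rule asy_root[OF that _ b0]) (use l_pos in simp)
 define L where "L = real (l - 1) * (real l * dens * w (2 * l\<^sup>2 - 2 * l - 1))
  + (real l * dens * w (l\<^sup>2 - 2) - dens * w (l\<^sup>2 - 2)) + dens * w (l * (l - 2))"
 define G where "G x = real (l - 1) * (Scount (\<lambda>_. True) (bound (2 * l\<^sup>2 - 2 * l - 1) x) / D x)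
   + (Scount (\<lambda>_. True) (bound (l\<^sup>2 - 2) x) / D x - Scount split_class (bound (l\<^sup>2 - 2) x) / D x)
   + Scount split_class (bound (l * (l - 2)) x) / D x - 1 / D x" for x
 have "((\<lambda>x. 1 / D x) \<longlongrightarrow> 0) at_top" unfolding D_def using b0 l_ge_3 by real_asymp
 hence "(G \<longlongrightarrow> L - 0) at_top" unfolding G_def[abs_def] L_def
  by (intro tendsto_add tendsto_diff tendsto_mult tendsto_const lim asy_Scount_all asy_Scount_split)
 moreover have "\<forall>\<^sub>F x in at_top. G x = real (l - 1) * (real (metacyclic_count l x) / D x)"
  using eventually_ge_at_top[of "real (l ^ (l * (l - 2)))"]
 proof eventually_elim
  case (elim x)
  have "real (l - 1) * (real (metacyclic_count l x) / D x) = real ((l - 1) * metacyclic_count l x) / D x" by simp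
  thus ?case unfolding count_decomposition[OF elim] G_def by (simp add: add_divide_distrib diff_divide_distrib)
 qed
 ultimately have "((\<lambda>x. real (l - 1) * (real (metacyclic_count l x) / D x)) \<longlongrightarrow> L - 0) at_top"
  by (rule Lim_transform_eventually)
 hence "((\<lambda>x. real (l - 1) * (real (metacyclic_count l x) / D x) / real (l - 1) / big_A l) \<longlongrightarrow> (L - 0) / real (l - 1) / big_A l) at_top"
  using l_ge_3 big_A_pos by (intro tendsto_divide tendsto_const) auto
 moreover have "(L - 0) / real (l - 1) = big_A l"
  unfolding L_def w_def b_def diff_0_right by (rule limit_value)
 ultimately have "((\<lambda>x. real (l - 1) * (real (metacyclic_count l x) / D x) / real (l - 1) / big_A l) \<longlongrightarrow> 1) at_top"
  by (simp only: bb)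
 thus "((\<lambda>x. real (metacyclic_count l x) / (big_A l * x powr (1 / (real l - 1)\<^sup>2) * ln x ^ (l - 2))) \<longlongrightarrow> 1) at_top"
  using l_ge_3 big_A_pos by (simp add: D_def b_def mult_ac)
qed

end

theorem theorem1:
  fixes l :: nat
  assumes "Factorial_Ring.prime l" and "odd l"
  shows "(\<lambda>x. real (metacyclic_count l x)) \<sim>[at_top]
    (\<lambda>x. big_A l * x powr (1 / (real l - 1)\<^sup>2) * ln x ^ (l - 2))"
proof -
  interpret cyclotomic l "cis (2 * pi / real l)" by standard (use assms in auto)
  show ?thesis by (rule metacyclic_count_asymp)
qed

end
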